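(* Let $n\ge 1$, let $B\subset\mathbb{R}^n$ be a ball centered at zero with radius $R$, and let $V$ and $W$ be positive radial $C^1$-functions on $B\setminus\{0\}$ such that $$\int_0^R\frac{1}{r^{n-1}V(r)}\,dr=+\infty\quad\text{and}\quad \int_0^R r^{n-1}V(r)\,dr<+\infty .$$ Consider the following statements. (1) $(V,W)$ is a Bessel pair on $(0,R)$ and $\beta(V,W;R)\ge 1$. (2) $\displaystyle\int_B V(x)|\nabla u|^2dx\ge\int_B W(x)u^2dx$ for all $u\in C_0^\infty(B)$. (3) $\displaystyle\int_B V(x)|\Delta u|^2dx\ge\int_B W(x)|\nabla u|^2dx+(n-1)\int_B\Big(\frac{V(x)}{|x|^2}-\frac{V_r(|x|)}{|x|}\Big)|\nabla u|^2dx$ for all radial $u\in C_0^\infty(B)$. (4) $\displaystyle\int_B V(x)|\Delta u|^2dx\ge\int_B W(x)|\nabla u|^2dx+(n-1)\int_B\Big(\frac{V(x)}{|x|^2}-\frac{V_r(|x|)}{|x|}\Big)|\nabla u|^2dx$ for all $u\in C_0^\infty(B)$. Then: (a) (1) and (2) are equivalent. (b) If $\lim_{r\to0}r^\alpha V(r)=0$ for some $\alpha<n-2$, then (1), (2) and (3) are equivalent. (c) If in addition to the assumption in (b), $V$ is twice differentiable and $$W(r)-\frac{2V(r)}{r^2}+\frac{2V_r(r)}{r}-V_{rr}(r)\ge0\quad\text{on }(0,R),$$ then (1), (2), (3) and (4) are equivalent.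
   Context: Radial functions on $B\setminus\{0\}$ are identified with functions of $r=|x|\in(0,R)$; $V_r,V_{rr}$ denote derivatives in $r$. For $c>0$ let $(\mathrm{B}_{V,cW})$ denote the ordinary differential equation $$y''(r)+\Big(\frac{n-1}{r}+\frac{V_r(r)}{V(r)}\Big)y'(r)+\frac{cW(r)}{V(r)}y(r)=0 .$$ The couple $(V,W)$ is a Bessel pair on $(0,R)$ if for some $c>0$ the equation $(\mathrm{B}_{V,cW})$ has a positive solution on $(0,R)$. The weight of the pair is $\beta(V,W;R)=\sup\{c:\ (\mathrm{B}_{V,cW})\text{ has a positive solution on }(0,R)\}$.
   Formalization: The condition that the integral of 1/(r^{n-1}V) is infinite is required at r=0, since (a) fails otherwise (n=1, R=1, V=1-r, W=(1/r^2+1/r)/4); the last integral in (3),(4), which may not converge absolutely, is read as a limit over B minus small balls at 0. *)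

theory Defs
  imports "HOL-Analysis.Analysis"
begin

definition partial :: "'a::euclidean_space \<Rightarrow> ('a \<Rightarrow> real) \<Rightarrow> 'a \<Rightarrow> real" where
  "partial b u x = frechet_derivative u (at x) b"

definition grad :: "('a::euclidean_space \<Rightarrow> real) \<Rightarrow> 'a \<Rightarrow> 'a" where
  "grad u x = (\<Sum>b\<in>Basis. partial b u x *\<^sub>R b)"

definition laplacian :: "('a::euclidean_space \<Rightarrow> real) \<Rightarrow> 'a \<Rightarrow> real" where
  "laplacian u x = (\<Sum>b\<in>Basis. partial b (partial b u) x)"

primrec Ck :: "nat \<Rightarrow> ('a::euclidean_space \<Rightarrow> real) \<Rightarrow> bool" where
  "Ck 0 u \<longleftrightarrow> continuous_on UNIV u"
| "Ck (Suc k) u \<longleftrightarrow> (\<forall>x. u differentiable at x) \<and> (\<forall>b\<in>Basis. Ck k (partial b u))"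

(* For open B, a test function on B is identified with its extension by zero to the whole space. *)
definition test_functions :: "'a::euclidean_space set \<Rightarrow> ('a \<Rightarrow> real) set" where
  "test_functions B =
     {u. (\<forall>k. Ck k u) \<and> compact (closure {x. u x \<noteq> 0}) \<and> closure {x. u x \<noteq> 0} \<subseteq> B}"

definition radial :: "('a::euclidean_space \<Rightarrow> real) \<Rightarrow> bool" where
  "radial u \<longleftrightarrow> (\<forall>x y. norm x = norm y \<longrightarrow> u x = u y)"

(* Throughout, a radial weight on B - {0} is represented by its profile, a function of r = |x|;
   only its values on {0<..<R} matter. *)

definition bessel_ode :: "nat \<Rightarrow> real \<Rightarrow> (real \<Rightarrow> real) \<Rightarrow> (real \<Rightarrow> real) \<Rightarrow> real \<Rightarrow> (real \<Rightarrow> real) \<Rightarrow> bool" where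
  "bessel_ode n R V W c y \<longleftrightarrow>
     (\<forall>r\<in>{0<..<R}. y differentiable at r \<and> deriv y differentiable at r \<and>
        deriv (deriv y) r + ((real n - 1) / r + deriv V r / V r) * deriv y r
          + c * W r / V r * y r = 0)"

definition has_positive_solution :: "nat \<Rightarrow> real \<Rightarrow> (real \<Rightarrow> real) \<Rightarrow> (real \<Rightarrow> real) \<Rightarrow> real \<Rightarrow> bool" where
  "has_positive_solution n R V W c \<longleftrightarrow>
     (\<exists>y. bessel_ode n R V W c y \<and> (\<forall>r\<in>{0<..<R}. y r > 0))"

definition bessel_pair :: "nat \<Rightarrow> real \<Rightarrow> (real \<Rightarrow> real) \<Rightarrow> (real \<Rightarrow> real) \<Rightarrow> bool" where
  "bessel_pair n R V W \<longleftrightarrow> (\<exists>c>0. has_positive_solution n R V W c)"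

definition bessel_weight :: "nat \<Rightarrow> real \<Rightarrow> (real \<Rightarrow> real) \<Rightarrow> (real \<Rightarrow> real) \<Rightarrow> ereal" where
  "bessel_weight n R V W = Sup (ereal ` {c. c > 0 \<and> has_positive_solution n R V W c})"

(* The integral of a nonnegative f over (0,R) diverges at the singular endpoint 0. For f continuous
   on (0,R] this just says that the integral over (0,R) is infinite. Divergence caused only by the
   endpoint R must be excluded: for n = 1, R = 1, V r = 1 - r, W r = (1/r^2 + 1/r) / 4 the function
   sqrt r solves the equation with c = 1, and 1 / V has infinite integral over (0,1), but Hardy's
   inequality fails for each u with u 0 \<noteq> 0. *)
definition diverges_at_zero :: "real \<Rightarrow> (real \<Rightarrow> real) \<Rightarrow> bool" where
  "diverges_at_zero R f \<longleftrightarrow>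
     (\<forall>\<delta>\<in>{0<..R}. (\<integral>\<^sup>+r\<in>{0<..<\<delta>}. ennreal (f r) \<partial>lborel) = \<infinity>)"

definition hardy :: "'a::euclidean_space set \<Rightarrow> (real \<Rightarrow> real) \<Rightarrow> (real \<Rightarrow> real) \<Rightarrow> ('a \<Rightarrow> real) \<Rightarrow> bool" where
  "hardy B V W u \<longleftrightarrow>
     (\<integral>\<^sup>+x\<in>B. ennreal (V (norm x) * (norm (grad u x))\<^sup>2) \<partial>lborel)
       \<ge> (\<integral>\<^sup>+x\<in>B. ennreal (W (norm x) * (u x)\<^sup>2) \<partial>lborel)"

(* Integral over B of a function that may be singular at 0, as the limit of the Lebesgue integrals
   over B minus small balls. It agrees with the Lebesgue integral whenever that exists. *)
definition has_improper_integral :: "('a::euclidean_space \<Rightarrow> real) \<Rightarrow> real \<Rightarrow> 'a set \<Rightarrow> bool" where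
  "has_improper_integral f I B \<longleftrightarrow>
     (\<forall>\<epsilon>>0. set_integrable lborel (B - cball 0 \<epsilon>) f) \<and>
     ((\<lambda>\<epsilon>. LINT x:B - cball 0 \<epsilon>|lborel. f x) \<longlongrightarrow> I) (at_right 0)"

(* The term with V_r has no sign and, for oscillating V, need not be absolutely integrable at 0
   (n = 3, V r = 2 + sin (1/r^3)), hence the improper integral. It converges for each test function
   if r^\<alpha> V(r) tends to 0 for some \<alpha> < n - 2 and V(|x|) is integrable near 0, by integration
   by parts. *)
definition hardy_rellich :: "'a::euclidean_space set \<Rightarrow> (real \<Rightarrow> real) \<Rightarrow> (real \<Rightarrow> real) \<Rightarrow> ('a \<Rightarrow> real) \<Rightarrow> bool" where
  "hardy_rellich B V W u \<longleftrightarrow>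
     (\<exists>I. has_improper_integral
            (\<lambda>x. (V (norm x) / (norm x)\<^sup>2 - deriv V (norm x) / norm x) * (norm (grad u x))\<^sup>2) I B \<and>
          enn2ereal (\<integral>\<^sup>+x\<in>B. ennreal (V (norm x) * (laplacian u x)\<^sup>2) \<partial>lborel)
            \<ge> enn2ereal (\<integral>\<^sup>+x\<in>B. ennreal (W (norm x) * (norm (grad u x))\<^sup>2) \<partial>lborel)
              + ereal ((real DIM('a) - 1) * I))"

end

theory Submission
  imports Defs
begin

text \<open>A positive solution \<open>y\<close> of the equation with constant \<open>c\<close> yields Hardy's inequality with constant \<open>c\<close> on every
  ray, by completing the square with \<open>h = p y' / y\<close>, \<open>p = r\<^sup>n\<^sup>-\<^sup>1 V\<close>. The divergence of the integral of \<open>1 / p\<close>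
  at the origin forces \<open>h < 0\<close>, so that the boundary term has the right sign. Conversely, Hardy's inequality for
  radial functions is an energy inequality on every compact interval, which for \<open>c < 1\<close> excludes solutions
  with two zeros, and a nonoscillating linear equation has a positive solution.

  For the second-order inequality, let \<open>E = x \<bullet> \<nabla>\<close>, \<open>T\<^sub>b\<^sub>c = x\<^sub>b \<partial>\<^sub>c - x\<^sub>c \<partial>\<^sub>b\<close> and \<open>S = (1/2) \<Sum> T\<^sub>b\<^sub>c\<^sup>2\<close>. An integration by parts along
  rays removes \<open>V\<^sub>r\<close>. The difference of the terms with \<open>V\<close> then splits into the integral of \<open>V (E\<^sup>2u - Eu)\<^sup>2 / r\<^sup>4\<close>,
  which is the Hardy term of \<open>u\<^sub>r\<close>, and a tangential part that vanishes for radial \<open>u\<close>. The spectral gap of the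
  sphere, \<open>\<integral> (S u)\<^sup>2 \<ge> (n - 1) \<integral> (1/2) \<Sum> (T\<^sub>b\<^sub>c u)\<^sup>2\<close>, bounds the tangential part below by one-dimensional integrals
  of \<open>g = T\<^sub>b\<^sub>c u / r\<close>. These dominate the integral of \<open>W g\<^sup>2\<close>: the hypothesis of (c) is \<open>(V / r)'' \<le> W / r\<close>.\<close>

section \<open>Smooth functions, Euler operator and rotation fields\<close>

text \<open>No pointwise bounds on V and W hold at either end of (0, R). Near R the compact support
  of u helps; at the origin every identity is proved on r > \<epsilon>, and each boundary term needs
  its own reason to vanish or to have a sign. Statement (1) speaks of a supremum that may not be
  attained, so Hardy's inequality is reached from constants above any b < 1, and the converse
  produces solutions only for c < 1. The sphere never appears as a manifold. E and T_bc have linear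
  coefficients, preserve smooth functions and vanish at the origin, and the rays are indexed by the
  points of the punctured unit ball. The spectral gap is proved without spherical harmonics, by an
  integrated Bochner formula; this carries a factor n - 2 and therefore leaves n = 2 to Wirtinger's
  inequality on circles. In the tangential part, the product of S u with the radial operator is
  integrated by parts in T_bc, and the gap is just what is needed to leave half the sum of the
  one-dimensional integrals. The functions T_bc u / r occur because half the sum of their squares is
  the tangential part of the squared gradient.\<close>

lemma partial_eq:
  assumes "(u has_derivative u') (at x)"
  shows "partial b u x = u' b"
  unfolding partial_def using frechet_derivative_at[OF assms] by simp

lemma Ck_SucD: "Ck (Suc k) u \<Longrightarrow> Ck k u"
proof (induction k arbitrary: u)
  case 0
  then show ?case
    by (auto simp: continuous_on_eq_continuous_at intro: differentiable_imp_continuous_within)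
next
  case (Suc k)
  then show ?case by auto
qed

lemma has_derivative_partial:
  assumes "u differentiable at x"
  shows "(u has_derivative (\<lambda>h. \<Sum>b\<in>Basis. (h \<bullet> b) * partial b u x)) (at x)"
proof -
  obtain D where D: "(u has_derivative D) (at x)"
    using assms by (auto simp: differentiable_def)
  have "D h = (\<Sum>b\<in>Basis. (h \<bullet> b) * partial b u x)" for h
  proof -
    interpret bounded_linear D using D by (rule has_derivative_bounded_linear)
    have "D h = D (\<Sum>b\<in>Basis. (h \<bullet> b) *\<^sub>R b)" by (simp add: euclidean_representation)
    also have "\<dots> = (\<Sum>b\<in>Basis. (h \<bullet> b) * D b)" by (simp add: sum scaleR)
    finally show ?thesis using partial_eq[OF D] by simp
  qed
  then have "D = (\<lambda>h. \<Sum>b\<in>Basis. (h \<bullet> b) * partial b u x)" by auto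
  with D show ?thesis by simp
qed

lemma partial_const [simp]: "partial b (\<lambda>x. c) = (\<lambda>x. 0)"
  by (rule ext) (simp add: partial_eq[OF has_derivative_const])

lemma partial_inner: "partial b (\<lambda>x. x \<bullet> c) = (\<lambda>x. b \<bullet> c)"
proof (rule ext)
  fix x :: 'a
  have "((\<lambda>x. x \<bullet> c) has_derivative (\<lambda>h. h \<bullet> c)) (at x)" by (auto intro!: derivative_eq_intros)
  from partial_eq[OF this] show "partial b (\<lambda>x. x \<bullet> c) x = b \<bullet> c" .
qed

lemma partial_add:
  assumes "u differentiable at x" "v differentiable at x"
  shows "partial b (\<lambda>x. u x + v x) x = partial b u x + partial b v x"
proof -
  obtain D D' where D: "(u has_derivative D) (at x)" "(v has_derivative D') (at x)"
    using assms by (auto simp: differentiable_def)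
  show ?thesis
    using partial_eq[OF has_derivative_add[OF D]] partial_eq[OF D(1)] partial_eq[OF D(2)] by simp
qed

lemma partial_mult:
  assumes "u differentiable at x" "v differentiable at x"
  shows "partial b (\<lambda>x. u x * v x) x = partial b u x * v x + u x * partial b v x"
proof -
  obtain D D' where D: "(u has_derivative D) (at x)" "(v has_derivative D') (at x)"
    using assms by (auto simp: differentiable_def)
  show ?thesis
    using partial_eq[OF has_derivative_mult[OF D]] partial_eq[OF D(1)] partial_eq[OF D(2)] by simp
qed

lemma partial_compose:
  fixes h :: "real \<Rightarrow> real"
  assumes "u differentiable at x" "h differentiable at (u x)"
  shows "partial b (\<lambda>x. h (u x)) x = partial 1 h (u x) * partial b u x"
proof -
  obtain D where D: "(u has_derivative D) (at x)"
    using assms by (auto simp: differentiable_def)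
  have h: "(h has_derivative (\<lambda>t. \<Sum>b\<in>Basis. (t \<bullet> b) * partial b h (u x))) (at (u x))"
    by (rule has_derivative_partial[OF assms(2)])
  show ?thesis
    using partial_eq[OF has_derivative_compose[OF D h]] partial_eq[OF D] by simp
qed

lemma Ck_const [simp]: "Ck k (\<lambda>x. c)"
  by (induction k arbitrary: c) auto

lemma Ck_inner: "Ck k (\<lambda>x. x \<bullet> c)"
  by (cases k) (auto simp: partial_inner intro!: continuous_intros derivative_intros)

lemma Ck_add: "Ck k u \<Longrightarrow> Ck k v \<Longrightarrow> Ck k (\<lambda>x. u x + v x)"
proof (induction k arbitrary: u v)
  case 0
  then show ?case by (auto intro: continuous_intros)
next
  case (Suc k)
  then have "partial b (\<lambda>x. u x + v x) = (\<lambda>x. partial b u x + partial b v x)" for b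
    by (intro ext partial_add) auto
  with Suc show ?case by auto
qed

lemma Ck_mult: "Ck k u \<Longrightarrow> Ck k v \<Longrightarrow> Ck k (\<lambda>x. u x * v x)"
proof (induction k arbitrary: u v)
  case 0
  then show ?case by (auto intro: continuous_intros)
next
  case (Suc k)
  then have "partial b (\<lambda>x. u x * v x) = (\<lambda>x. partial b u x * v x + u x * partial b v x)" for b
    by (intro ext partial_mult) auto
  with Suc Ck_SucD[OF Suc.prems(1)] Ck_SucD[OF Suc.prems(2)] show ?case
    by (auto intro!: Ck_add)
qed

definition smooth :: "('a::euclidean_space \<Rightarrow> real) \<Rightarrow> bool" where
  "smooth u \<longleftrightarrow> (\<forall>k. Ck k u)"

lemma smooth_Ck: "smooth u \<Longrightarrow> Ck k u"
  by (simp add: smooth_def)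

lemma smooth_differentiable: "smooth u \<Longrightarrow> u differentiable at x"
  using smooth_Ck[of u "Suc 0"] by simp

lemma smooth_continuous_on: "smooth u \<Longrightarrow> continuous_on S u"
  using smooth_Ck[of u 0] continuous_on_subset by auto

lemma smooth_measurable: "smooth u \<Longrightarrow> u \<in> borel_measurable borel"
  by (rule borel_measurable_continuous_onI[OF smooth_continuous_on])

lemma smooth_partial: "smooth u \<Longrightarrow> b \<in> Basis \<Longrightarrow> smooth (partial b u)"
  unfolding smooth_def by (metis Ck.simps(2))

lemma smooth_const [intro, simp]: "smooth (\<lambda>x. c)"
  by (simp add: smooth_def)

lemma smooth_inner [intro, simp]: "smooth (\<lambda>x. x \<bullet> c)"
  by (simp add: smooth_def Ck_inner)

lemma smooth_add: "smooth u \<Longrightarrow> smooth v \<Longrightarrow> smooth (\<lambda>x. u x + v x)"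
  by (simp add: smooth_def Ck_add)

lemma smooth_mult: "smooth u \<Longrightarrow> smooth v \<Longrightarrow> smooth (\<lambda>x. u x * v x)"
  by (simp add: smooth_def Ck_mult)

lemma smooth_diff: "smooth u \<Longrightarrow> smooth v \<Longrightarrow> smooth (\<lambda>x. u x - v x)"
  using smooth_add[of u "\<lambda>x. (-1) * v x"] smooth_mult[OF smooth_const, of v "-1"] by simp

lemma smooth_sum: "(\<And>i. i \<in> I \<Longrightarrow> smooth (f i)) \<Longrightarrow> smooth (\<lambda>x. \<Sum>i\<in>I. f i x)"
  by (induction I rule: infinite_finite_induct) (auto intro: smooth_add)

lemma smooth_inner_self: "smooth (\<lambda>x::'a::euclidean_space. x \<bullet> x)"
proof -
  have "smooth (\<lambda>x::'a. \<Sum>b\<in>Basis. (x \<bullet> b) * (x \<bullet> b))"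
    by (intro smooth_sum smooth_mult smooth_inner)
  then show ?thesis by (simp add: euclidean_inner[symmetric])
qed

lemmas smooth_intros = smooth_const smooth_inner smooth_add smooth_mult smooth_diff smooth_sum
  smooth_inner_self

lemma smooth_compose:
  fixes h :: "real \<Rightarrow> real"
  assumes "smooth h" "smooth u"
  shows "smooth (\<lambda>x. h (u x))"
proof -
  \<comment> \<open>The outer function is generalised because the chain rule replaces
    \<open>h\<close> by \<open>partial 1 h\<close> at each induction step.\<close>
  have "Ck k (\<lambda>x. h (u x))" if "smooth h" for k and h :: "real \<Rightarrow> real"
    using that
  proof (induction k arbitrary: h)
    case 0
    have "continuous_on UNIV (h \<circ> u)"
      using 0 assms by (intro continuous_on_compose) (auto intro: smooth_continuous_on)
    then show ?case by (simp add: o_def)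
  next
    case (Suc k)
    have diff: "(\<lambda>x. h (u x)) differentiable at x" for x
      using differentiable_chain_at[OF smooth_differentiable[OF assms(2)] smooth_differentiable[OF Suc.prems]]
      by (simp add: o_def)
    have "partial b (\<lambda>x. h (u x)) = (\<lambda>x. partial 1 h (u x) * partial b u x)" for b
      by (intro ext partial_compose smooth_differentiable Suc.prems assms)
    moreover have "Ck k (\<lambda>x. partial 1 h (u x))"
      using Suc.prems by (intro Suc.IH smooth_partial) auto
    moreover have "Ck k (partial b u)" if "b \<in> Basis" for b
      using smooth_partial[OF assms(2) that] by (simp add: smooth_def)
    ultimately show ?case using diff by (auto intro!: Ck_mult)
  qed
  with assms show ?thesis by (simp add: smooth_def)
qed

lemma partial_sum:
  assumes "\<And>i. i \<in> I \<Longrightarrow> f i differentiable at x"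
  shows "partial b (\<lambda>x. \<Sum>i\<in>I. f i x) x = (\<Sum>i\<in>I. partial b (f i) x)"
  using assms
proof (induction I rule: infinite_finite_induct)
  case (insert i I)
  then show ?case by (simp add: partial_add differentiable_sum)
qed auto

lemma partial_diff:
  assumes "u differentiable at x" "v differentiable at x"
  shows "partial b (\<lambda>x. u x - v x) x = partial b u x - partial b v x"
proof -
  obtain D D' where D: "(u has_derivative D) (at x)" "(v has_derivative D') (at x)"
    using assms by (auto simp: differentiable_def)
  show ?thesis
    using partial_eq[OF has_derivative_diff[OF D]] partial_eq[OF D(1)] partial_eq[OF D(2)] by simp
qed

lemma DERIV_along_line:
  assumes "smooth u"
  shows "((\<lambda>t. u (x + t *\<^sub>R v)) has_real_derivative (\<Sum>b\<in>Basis. (v \<bullet> b) * partial b u (x + t *\<^sub>R v))) (at t)"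
proof -
  have "((\<lambda>t. x + t *\<^sub>R v) has_derivative (\<lambda>s. s *\<^sub>R v)) (at t)"
    by (auto intro!: derivative_eq_intros)
  from has_derivative_compose[OF this has_derivative_partial[OF smooth_differentiable[OF assms]]]
  have "((\<lambda>t. u (x + t *\<^sub>R v)) has_derivative (\<lambda>s. \<Sum>b\<in>Basis. (s *\<^sub>R v \<bullet> b) * partial b u (x + t *\<^sub>R v))) (at t)" .
  then show ?thesis
    unfolding has_field_derivative_def
    by (rule has_derivative_eq_rhs) (auto simp: fun_eq_iff sum_distrib_left mult_ac)
qed

lemma DERIV_along_basis:
  assumes "smooth u" "b \<in> Basis"
  shows "((\<lambda>t. u (x + t *\<^sub>R b)) has_real_derivative partial b u (x + t *\<^sub>R b)) (at t)"
proof -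
  have "(\<Sum>c\<in>Basis. (b \<bullet> c) * partial c u (x + t *\<^sub>R b)) = (\<Sum>c\<in>Basis. if c = b then partial c u (x + t *\<^sub>R b) else 0)"
    using assms(2) by (intro sum.cong) (auto simp: inner_Basis)
  then show ?thesis using DERIV_along_line[OF assms(1), of x b t] assms(2) by simp
qed

text \<open>The mean value theorem is applied twice: in direction \<open>b\<close> to the increment
  in direction \<open>c\<close>, then in direction \<open>c\<close> to \<open>partial b u\<close>.
  Interchanging \<open>b\<close> and \<open>c\<close> changes the second difference only in the
  order of its terms, which is the source of Schwarz's theorem.\<close>

lemma double_difference:
  assumes "smooth u" "b \<in> Basis" "c \<in> Basis" "h > 0"
  obtains y where "dist y x \<le> 2 * h"
    "u (x + h *\<^sub>R b + h *\<^sub>R c) - u (x + h *\<^sub>R b) - u (x + h *\<^sub>R c) + u x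
      = h * h * partial c (partial b u) y"
proof -
  define f where "f t = u (x + h *\<^sub>R c + t *\<^sub>R b) - u (x + t *\<^sub>R b)" for t
  have f: "(f has_real_derivative (partial b u (x + h *\<^sub>R c + t *\<^sub>R b) - partial b u (x + t *\<^sub>R b))) (at t)" for t
    unfolding f_def by (intro DERIV_diff DERIV_along_basis assms)
  obtain s where s: "0 < s" "s < h"
    "f h - f 0 = (h - 0) * (partial b u (x + h *\<^sub>R c + s *\<^sub>R b) - partial b u (x + s *\<^sub>R b))"
    using MVT2[of 0 h f, OF \<open>h > 0\<close> f] by blast
  have g: "((\<lambda>t. partial b u (x + s *\<^sub>R b + t *\<^sub>R c)) has_real_derivative
      partial c (partial b u) (x + s *\<^sub>R b + t *\<^sub>R c)) (at t)" for t
    by (intro DERIV_along_basis smooth_partial assms)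
  obtain t where t: "0 < t" "t < h"
    "partial b u (x + s *\<^sub>R b + h *\<^sub>R c) - partial b u (x + s *\<^sub>R b + 0 *\<^sub>R c)
      = (h - 0) * partial c (partial b u) (x + s *\<^sub>R b + t *\<^sub>R c)"
    using MVT2[of 0 h "\<lambda>t. partial b u (x + s *\<^sub>R b + t *\<^sub>R c)", OF \<open>h > 0\<close> g] by blast
  show ?thesis
  proof (rule that)
    have "dist (x + s *\<^sub>R b + t *\<^sub>R c) x = norm (s *\<^sub>R b + t *\<^sub>R c)"
      by (simp add: dist_norm algebra_simps)
    also have "\<dots> \<le> norm (s *\<^sub>R b) + norm (t *\<^sub>R c)" by (rule norm_triangle_ineq)
    also have "\<dots> \<le> 2 * h" using s(1,2) t(1,2) assms(2,3) by simp
    finally show "dist (x + s *\<^sub>R b + t *\<^sub>R c) x \<le> 2 * h" .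
    show "u (x + h *\<^sub>R b + h *\<^sub>R c) - u (x + h *\<^sub>R b) - u (x + h *\<^sub>R c) + u x
      = h * h * partial c (partial b u) (x + s *\<^sub>R b + t *\<^sub>R c)"
      using s(3) t(3) by (simp add: f_def add_ac)
  qed
qed

text \<open>Schwarz's theorem. One second difference, expanded in the two orders, is h^2 times each
  of the mixed derivatives at some nearby point; both points tend to \<open>x\<close>, where the
  mixed derivatives are continuous.\<close>

lemma partial_commute:
  assumes u: "smooth u" and b: "b \<in> Basis" and c: "c \<in> Basis"
  shows "partial c (partial b u) x = partial b (partial c u) x"
proof -
  define h where "h k = 1 / real (Suc k)" for k
  have h0: "h k > 0" for k by (simp add: h_def)
  have hl: "(\<lambda>k. 2 * h k) \<longlonglongrightarrow> 0"
    using tendsto_mult_right[OF LIMSEQ_inverse_real_of_nat, of 2]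
    by (simp add: h_def divide_inverse)
  have "\<exists>y. dist y x \<le> 2 * h k \<and> u (x + h k *\<^sub>R b + h k *\<^sub>R c) - u (x + h k *\<^sub>R b) - u (x + h k *\<^sub>R c) + u x
      = h k * h k * partial c (partial b u) y" for k
    using double_difference[OF u b c h0[of k]] by blast
  then obtain y where y: "\<And>k. dist (y k) x \<le> 2 * h k"
    "\<And>k. u (x + h k *\<^sub>R b + h k *\<^sub>R c) - u (x + h k *\<^sub>R b) - u (x + h k *\<^sub>R c) + u x
      = h k * h k * partial c (partial b u) (y k)" by metis
  have "\<exists>z. dist z x \<le> 2 * h k \<and> u (x + h k *\<^sub>R c + h k *\<^sub>R b) - u (x + h k *\<^sub>R c) - u (x + h k *\<^sub>R b) + u x
      = h k * h k * partial b (partial c u) z" for k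
    using double_difference[OF u c b h0[of k]] by blast
  then obtain z where z: "\<And>k. dist (z k) x \<le> 2 * h k"
    "\<And>k. u (x + h k *\<^sub>R c + h k *\<^sub>R b) - u (x + h k *\<^sub>R c) - u (x + h k *\<^sub>R b) + u x
      = h k * h k * partial b (partial c u) (z k)" by metis
  have yl: "y \<longlonglongrightarrow> x"
    by (rule metric_tendsto_imp_tendsto[OF hl]) (use y(1) h0 in \<open>auto simp: less_imp_le\<close>)
  have zl: "z \<longlonglongrightarrow> x"
    by (rule metric_tendsto_imp_tendsto[OF hl]) (use z(1) h0 in \<open>auto simp: less_imp_le\<close>)
  have eq: "partial c (partial b u) (y k) = partial b (partial c u) (z k)" for k
  proof -
    have "h k * h k * partial c (partial b u) (y k) = h k * h k * partial b (partial c u) (z k)"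
      using y(2)[of k] z(2)[of k] unfolding add.assoc[of x] add.commute[of "h k *\<^sub>R c"] by linarith
    then show ?thesis using h0[of k] by simp
  qed
  have cont: "isCont (partial c (partial b u)) x" "isCont (partial b (partial c u)) x"
    using smooth_continuous_on[of _ UNIV] smooth_partial u b c continuous_on_eq_continuous_at[OF open_UNIV]
    by blast+
  have "(\<lambda>k. partial c (partial b u) (y k)) \<longlonglongrightarrow> partial c (partial b u) x"
    using isCont_tendsto_compose[OF cont(1) yl] .
  moreover have "(\<lambda>k. partial c (partial b u) (y k)) \<longlonglongrightarrow> partial b (partial c u) x"
    unfolding eq using isCont_tendsto_compose[OF cont(2) zl] .
  ultimately show ?thesis by (rule LIMSEQ_unique)
qed

section \<open>Dilations, rotations and the polar form of the Laplacian\<close>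

definition euler :: "('a::euclidean_space \<Rightarrow> real) \<Rightarrow> 'a \<Rightarrow> real" where
  "euler F x = (\<Sum>b\<in>Basis. (x \<bullet> b) * partial b F x)"

definition rot :: "'a::euclidean_space \<Rightarrow> 'a \<Rightarrow> ('a \<Rightarrow> real) \<Rightarrow> 'a \<Rightarrow> real" where
  "rot b c F x = (x \<bullet> b) * partial c F x - (x \<bullet> c) * partial b F x"

text \<open>The double sum meets every coordinate plane twice, hence the half. This is the
  Laplace-Beltrami operator of the unit sphere acting in the angular variables.\<close>

definition sph_lap :: "('a::euclidean_space \<Rightarrow> real) \<Rightarrow> 'a \<Rightarrow> real" where
  "sph_lap F x = (\<Sum>b\<in>Basis. \<Sum>c\<in>Basis. rot b c (rot b c F) x) / 2"

text \<open>r^2 times the radial part of the Laplacian: r^2 u_rr = E^2 u - E u and r u_r = E u for E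
  = \<open>euler\<close>, so the coefficient n - 1 of r u_r drops to n - 2.\<close>

definition rad_lap :: "('a::euclidean_space \<Rightarrow> real) \<Rightarrow> 'a \<Rightarrow> real" where
  "rad_lap F x = euler (euler F) x + (real DIM('a) - 2) * euler F x"

lemma smooth_euler: "smooth F \<Longrightarrow> smooth (euler F)"
  unfolding euler_def[abs_def] by (intro smooth_intros smooth_partial)

lemma smooth_rot: "smooth F \<Longrightarrow> b \<in> Basis \<Longrightarrow> c \<in> Basis \<Longrightarrow> smooth (rot b c F)"
  unfolding rot_def[abs_def] by (intro smooth_intros smooth_partial)

lemma partial_coord_mult:
  assumes "smooth F" "d \<in> Basis" "b \<in> Basis"
  shows "partial d (\<lambda>x. (x \<bullet> b) * F x) x = (if d = b then F x else 0) + (x \<bullet> b) * partial d F x"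
proof -
  have "partial d (\<lambda>x. (x \<bullet> b) * F x) x = (d \<bullet> b) * F x + (x \<bullet> b) * partial d F x"
    using partial_mult[OF smooth_differentiable[OF smooth_inner] smooth_differentiable[OF assms(1)], of d b x]
    by (simp add: partial_inner)
  then show ?thesis using assms by (simp add: inner_Basis)
qed

lemma partial_euler:
  assumes F: "smooth F" and d: "d \<in> Basis"
  shows "partial d (euler F) x = partial d F x + euler (partial d F) x"
proof -
  have "partial d (euler F) x = (\<Sum>b\<in>Basis. partial d (\<lambda>x. (x \<bullet> b) * partial b F x) x)"
    unfolding euler_def[abs_def]
    by (intro partial_sum smooth_differentiable smooth_intros smooth_partial F)
  also have "\<dots> = (\<Sum>b\<in>Basis. (if d = b then partial b F x else 0) + (x \<bullet> b) * partial b (partial d F) x)"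
    using F d by (intro sum.cong refl) (simp add: partial_coord_mult smooth_partial partial_commute)
  also have "\<dots> = partial d F x + euler (partial d F) x"
    using d by (simp add: sum.distrib euler_def)
  finally show ?thesis .
qed

lemma partial_rot:
  assumes F: "smooth F" and "d \<in> Basis" "b \<in> Basis" "c \<in> Basis"
  shows "partial d (rot b c F) x = (if d = b then partial c F x else 0) + (x \<bullet> b) * partial d (partial c F) x
     - ((if d = c then partial b F x else 0) + (x \<bullet> c) * partial d (partial b F) x)"
proof -
  have "partial d (rot b c F) x = partial d (\<lambda>x. (x \<bullet> b) * partial c F x) x - partial d (\<lambda>x. (x \<bullet> c) * partial b F x) x"
    unfolding rot_def[abs_def]
    by (intro partial_diff smooth_differentiable smooth_intros smooth_partial assms)
  then show ?thesis using assms by (simp add: partial_coord_mult smooth_partial)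
qed

lemma rot_mult:
  assumes "smooth F" "smooth G"
  shows "rot b c (\<lambda>x. F x * G x) x = rot b c F x * G x + F x * rot b c G x"
  using assms by (simp add: rot_def partial_mult smooth_differentiable algebra_simps)

lemma rot_coord:
  assumes "b \<in> Basis" "c \<in> Basis" "d \<in> Basis"
  shows "rot b c (\<lambda>x. x \<bullet> d) x = (if c = d then x \<bullet> b else 0) - (if b = d then x \<bullet> c else 0)"
  using assms by (simp add: rot_def partial_inner inner_Basis)

text \<open>Rotations and dilations commute as flows, hence so do their generators. Later this lets
  a rotation field pass through \<open>rad_lap\<close>.\<close>

lemma rot_euler_commute:
  assumes F: "smooth F" and b: "b \<in> Basis" and c: "c \<in> Basis"
  shows "rot b c (euler F) x = euler (rot b c F) x"
proof -
  have "euler (rot b c F) x = (\<Sum>d\<in>Basis. (x \<bullet> d) * ((if d = b then partial c F x else 0) + (x \<bullet> b) * partial d (partial c F) x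
     - ((if d = c then partial b F x else 0) + (x \<bullet> c) * partial d (partial b F) x)))"
    unfolding euler_def[of "rot b c F"] using assms by (intro sum.cong refl) (simp add: partial_rot)
  also have "\<dots> = (\<Sum>d\<in>Basis. (if d = b then (x \<bullet> d) * partial c F x else 0)) + (x \<bullet> b) * euler (partial c F) x
     - ((\<Sum>d\<in>Basis. (if d = c then (x \<bullet> d) * partial b F x else 0)) + (x \<bullet> c) * euler (partial b F) x)"
    unfolding euler_def sum_distrib_left sum.distrib[symmetric] sum_subtractf[symmetric]
    by (intro sum.cong refl) (auto simp: algebra_simps)
  also have "\<dots> = rot b c (euler F) x"
    using assms by (simp add: rot_def partial_euler algebra_simps)
  finally show ?thesis by simp
qed

lemma euler_euler:
  assumes F: "smooth F"
  shows "euler (euler F) x = euler F x + (\<Sum>d\<in>Basis. (x \<bullet> d) * euler (partial d F) x)"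
  unfolding euler_def[of "euler F"] using F
  by (simp add: partial_euler sum.distrib algebra_simps flip: euler_def)

lemma rot_rot_eq:
  assumes F: "smooth F" and b: "b \<in> Basis" and c: "c \<in> Basis" and "b \<noteq> c"
  shows "rot b c (rot b c F) x =
    (x \<bullet> b) * (x \<bullet> b) * partial c (partial c F) x + (x \<bullet> c) * (x \<bullet> c) * partial b (partial b F) x
    - 2 * (x \<bullet> b) * (x \<bullet> c) * partial b (partial c F) x - (x \<bullet> b) * partial b F x - (x \<bullet> c) * partial c F x"
  using assms partial_commute[OF F b c]
  unfolding rot_def[of b c "rot b c F"] by (simp add: partial_rot algebra_simps)

text \<open>This is r^2 times the Laplacian in polar form. Expanding the squares of all rotation
  fields leaves r^2 times the Laplacian, the second-order part of E^2 and a multiple of E.\<close>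

lemma sph_lap_eq:
  fixes x :: "'a::euclidean_space"
  assumes F: "smooth F"
  shows "(x \<bullet> x) * laplacian F x = rad_lap F x + sph_lap F x"
proof -
  let ?t = "\<lambda>b c. (x \<bullet> b) * (x \<bullet> b) * partial c (partial c F) x + (x \<bullet> c) * (x \<bullet> c) * partial b (partial b F) x
    - 2 * ((x \<bullet> b) * (x \<bullet> c) * partial b (partial c F) x) - (x \<bullet> b) * partial b F x - (x \<bullet> c) * partial c F x"
  \<comment> \<open>On the diagonal \<open>rot b b\<close> vanishes whereas \<open>?t b b\<close>
    equals \<open>- 2 * ((x \<bullet> b) * partial b F x)\<close>; the correction lets the sums run
    over all pairs and contributes 2 E F in total.\<close>
  have "rot b c (rot b c F) x = ?t b c + (if b = c then 2 * ((x \<bullet> b) * partial b F x) else 0)"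
    if "b \<in> Basis" "c \<in> Basis" for b c
  proof (cases "b = c")
    case True
    then show ?thesis by (simp add: rot_def)
  next
    case False
    then show ?thesis using rot_rot_eq[OF F that] by simp
  qed
  then have "2 * sph_lap F x = (\<Sum>b\<in>Basis. \<Sum>c\<in>Basis. ?t b c + (if b = c then 2 * ((x \<bullet> b) * partial b F x) else 0))"
    by (simp add: sph_lap_def)
  also have "\<dots> = (\<Sum>b\<in>Basis. \<Sum>c\<in>Basis. (x \<bullet> b) * (x \<bullet> b) * partial c (partial c F) x)
     + (\<Sum>b\<in>Basis. \<Sum>c\<in>Basis. (x \<bullet> c) * (x \<bullet> c) * partial b (partial b F) x)
     - 2 * (\<Sum>b\<in>Basis. \<Sum>c\<in>Basis. (x \<bullet> b) * (x \<bullet> c) * partial b (partial c F) x)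
     - (\<Sum>b\<in>Basis. \<Sum>c\<in>(Basis::'a set). (x \<bullet> b) * partial b F x) - (\<Sum>b\<in>(Basis::'a set). \<Sum>c\<in>Basis. (x \<bullet> c) * partial c F x)
     + 2 * euler F x"
    by (simp add: sum.distrib sum_subtractf sum_distrib_left euler_def)
  also have "(\<Sum>b\<in>Basis. \<Sum>c\<in>Basis. (x \<bullet> b) * (x \<bullet> b) * partial c (partial c F) x) = (x \<bullet> x) * laplacian F x"
    by (simp add: laplacian_def euclidean_inner[of x x] sum_product)
  also have "(\<Sum>b\<in>Basis. \<Sum>c\<in>Basis. (x \<bullet> c) * (x \<bullet> c) * partial b (partial b F) x) = (x \<bullet> x) * laplacian F x"
    by (subst sum.swap) (simp add: laplacian_def euclidean_inner[of x x] sum_product)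
  also have "(\<Sum>b\<in>Basis. \<Sum>c\<in>Basis. (x \<bullet> b) * (x \<bullet> c) * partial b (partial c F) x) = (\<Sum>d\<in>Basis. (x \<bullet> d) * euler (partial d F) x)"
    unfolding euler_def sum_distrib_left
    using partial_commute[OF F] by (intro sum.cong refl) (simp add: mult_ac)
  also have "\<dots> = euler (euler F) x - euler F x"
    using euler_euler[OF F, of x] by simp
  also have "(\<Sum>b\<in>Basis. \<Sum>c\<in>(Basis::'a set). (x \<bullet> b) * partial b F x) = real DIM('a) * euler F x"
    by (simp add: euler_def sum_distrib_left)
  also have "(\<Sum>b\<in>(Basis::'a set). \<Sum>c\<in>Basis. (x \<bullet> c) * partial c F x) = real DIM('a) * euler F x"
    by (simp add: euler_def)
  finally show ?thesis by (simp add: rad_lap_def algebra_simps)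
qed

lemma norm_grad_sq: "(norm (grad u x))\<^sup>2 = (\<Sum>b\<in>Basis. (partial b u x)\<^sup>2)"
proof -
  have "grad u x \<bullet> b = partial b u x" if "b \<in> Basis" for b
    using that by (simp add: grad_def inner_sum_left inner_Basis if_distrib cong: if_cong)
  then show ?thesis
    unfolding power2_norm_eq_inner
    by (subst euclidean_inner) (auto simp: power2_eq_square intro: sum.cong)
qed

text \<open>Lagrange's identity for the vectors x and grad u: the 2 x 2 minors of the pair are the
  numbers \<open>rot b c u x\<close>, each counted twice.\<close>

lemma lagrange_rot:
  "(x \<bullet> x) * (norm (grad u x))\<^sup>2 = (euler u x)\<^sup>2 + (\<Sum>b\<in>Basis. \<Sum>c\<in>Basis. (rot b c u x)\<^sup>2) / 2"
proof -
  have "(\<Sum>b\<in>Basis. \<Sum>c\<in>Basis. (rot b c u x)\<^sup>2) =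
     (\<Sum>b\<in>Basis. \<Sum>c\<in>Basis. (x \<bullet> b)\<^sup>2 * (partial c u x)\<^sup>2) + (\<Sum>b\<in>Basis. \<Sum>c\<in>Basis. (x \<bullet> c)\<^sup>2 * (partial b u x)\<^sup>2)
     - 2 * (\<Sum>b\<in>Basis. \<Sum>c\<in>Basis. ((x \<bullet> b) * partial b u x) * ((x \<bullet> c) * partial c u x))"
    unfolding sum_distrib_left sum.distrib[symmetric] sum_subtractf[symmetric]
    by (intro sum.cong refl) (simp add: rot_def power2_eq_square algebra_simps)
  also have *: "(\<Sum>b\<in>Basis. \<Sum>c\<in>Basis. (x \<bullet> b)\<^sup>2 * (partial c u x)\<^sup>2) = (x \<bullet> x) * (norm (grad u x))\<^sup>2"
    unfolding norm_grad_sq euclidean_inner[of x x] power2_eq_square[of "x \<bullet> _", symmetric] by (simp only: sum_product)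
  also have "(\<Sum>b\<in>Basis. \<Sum>c\<in>Basis. (x \<bullet> c)\<^sup>2 * (partial b u x)\<^sup>2) = (x \<bullet> x) * (norm (grad u x))\<^sup>2"
    unfolding *[symmetric] by (rule sum.swap)
  also have "(\<Sum>b\<in>Basis. \<Sum>c\<in>Basis. ((x \<bullet> b) * partial b u x) * ((x \<bullet> c) * partial c u x)) = (euler u x)\<^sup>2"
    by (simp add: euler_def sum_product power2_eq_square)
  finally show ?thesis by (simp add: field_simps)
qed

text \<open>|x|^2 times the component in direction \<open>i\<close> of the gradient projected
  orthogonally to x. The factor |x|^2 clears the denominator of the projection and keeps the
  coefficients polynomial.\<close>

definition tang :: "'a::euclidean_space \<Rightarrow> ('a \<Rightarrow> real) \<Rightarrow> 'a \<Rightarrow> real" where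
  "tang i F x = (x \<bullet> x) * partial i F x - (x \<bullet> i) * euler F x"

lemma smooth_tang: "smooth F \<Longrightarrow> i \<in> Basis \<Longrightarrow> smooth (tang i F)"
  unfolding tang_def[abs_def] by (intro smooth_intros smooth_partial smooth_euler)

lemma tang_eq_rot:
  assumes "i \<in> Basis"
  shows "tang i F x = (\<Sum>j\<in>Basis. (x \<bullet> j) * rot j i F x)"
  unfolding tang_def rot_def euler_def
  by (subst euclidean_inner) (simp add: sum_distrib_left sum_distrib_right sum_subtractf algebra_simps)

lemma partial_inner_self:
  assumes "i \<in> Basis"
  shows "partial i (\<lambda>x. x \<bullet> x) x = 2 * (x \<bullet> i)"
proof -
  have "((\<lambda>x. x \<bullet> x) has_derivative (\<lambda>h. x \<bullet> h + h \<bullet> x)) (at x)"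
    by (auto intro!: derivative_eq_intros)
  from partial_eq[OF this] show ?thesis by (simp add: inner_commute)
qed

lemma euler_mult:
  assumes "smooth F" "smooth G"
  shows "euler (\<lambda>x. F x * G x) x = euler F x * G x + F x * euler G x"
  unfolding euler_def sum_distrib_left sum_distrib_right sum.distrib[symmetric]
  by (intro sum.cong refl) (simp add: partial_mult assms smooth_differentiable algebra_simps)

lemma euler_diff:
  assumes "smooth F" "smooth G"
  shows "euler (\<lambda>x. F x - G x) x = euler F x - euler G x"
  unfolding euler_def sum_subtractf[symmetric]
  by (intro sum.cong refl) (simp add: partial_diff assms smooth_differentiable algebra_simps)

lemma euler_inner:
  shows "euler (\<lambda>x. x \<bullet> c) x = x \<bullet> c"
  unfolding euler_def partial_inner by (subst (2) euclidean_inner) (simp add: inner_commute)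

lemma euler_inner_self:
  shows "euler (\<lambda>x. x \<bullet> x) x = 2 * (x \<bullet> x)"
proof -
  have "euler (\<lambda>x. x \<bullet> x) x = 2 * (\<Sum>b\<in>Basis. (x \<bullet> b) * (x \<bullet> b))"
    unfolding euler_def sum_distrib_left by (intro sum.cong refl) (simp add: partial_inner_self)
  then show ?thesis by (simp add: euclidean_inner[symmetric])
qed

lemma tang_mult:
  assumes "smooth F" "smooth G"
  shows "tang i (\<lambda>x. F x * G x) x = tang i F x * G x + F x * tang i G x"
  unfolding tang_def using assms by (simp add: euler_mult partial_mult smooth_differentiable algebra_simps)

lemma tang_coord:
  assumes "i \<in> Basis" "j \<in> Basis"
  shows "tang i (\<lambda>x. x \<bullet> j) x = (if i = j then x \<bullet> x else 0) - (x \<bullet> i) * (x \<bullet> j)"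
  unfolding tang_def partial_inner euler_inner using assms by (simp add: inner_Basis)

lemma sum_coord_tang: "(\<Sum>i\<in>Basis. (x \<bullet> i) * tang i F x) = 0"
proof -
  have "(\<Sum>i\<in>Basis. (x \<bullet> i) * tang i F x) = (x \<bullet> x) * (\<Sum>i\<in>Basis. (x \<bullet> i) * partial i F x)
    - (\<Sum>i\<in>Basis. (x \<bullet> i) * (x \<bullet> i)) * euler F x"
    by (simp add: tang_def sum_distrib_left sum_distrib_right sum_subtractf algebra_simps)
  then show ?thesis by (simp add: euler_def euclidean_inner[symmetric])
qed

text \<open>Arranged so that the right-hand side is symmetric in \<open>i\<close> and
  \<open>j\<close> except for the term with \<open>(x \<bullet> j) * partial i F x\<close>; this
  makes the commutator a first-order operator.\<close>

lemma tang_tang: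
  assumes F: "smooth F" and i: "i \<in> Basis" and j: "j \<in> Basis"
  shows "tang i (tang j F) x = (x \<bullet> x) * ((x \<bullet> x) * partial i (partial j F) x
     - (if i = j then euler F x else 0) - (x \<bullet> j) * partial i F x
     - (x \<bullet> j) * euler (partial i F) x - (x \<bullet> i) * euler (partial j F) x)
     + (x \<bullet> i) * (x \<bullet> j) * (euler F x + euler (euler F) x)"
proof -
  have s: "smooth (partial j F)" "smooth (euler F)" using F j by (auto intro: smooth_partial smooth_euler)
  note sd = smooth_differentiable
  have "partial i (tang j F) x = partial i (\<lambda>x. (x \<bullet> x) * partial j F x) x - partial i (\<lambda>x. (x \<bullet> j) * euler F x) x"
    unfolding tang_def[abs_def] by (intro partial_diff sd smooth_intros s)
  also have "\<dots> = 2 * (x \<bullet> i) * partial j F x + (x \<bullet> x) * partial i (partial j F) x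
      - ((if i = j then euler F x else 0) + (x \<bullet> j) * (partial i F x + euler (partial i F) x))"
    using i j F s
    by (simp add: partial_mult[OF sd[OF smooth_inner_self] sd[OF s(1)]] partial_inner_self
        partial_coord_mult partial_euler)
  finally have 1: "partial i (tang j F) x = 2 * (x \<bullet> i) * partial j F x + (x \<bullet> x) * partial i (partial j F) x
      - ((if i = j then euler F x else 0) + (x \<bullet> j) * (partial i F x + euler (partial i F) x))" .
  have "euler (tang j F) x = euler (\<lambda>x. (x \<bullet> x) * partial j F x) x - euler (\<lambda>x. (x \<bullet> j) * euler F x) x"
    unfolding tang_def[abs_def] by (intro euler_diff smooth_intros s)
  also have "\<dots> = 2 * (x \<bullet> x) * partial j F x + (x \<bullet> x) * euler (partial j F) x
      - ((x \<bullet> j) * euler F x + (x \<bullet> j) * euler (euler F) x)"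
    by (simp add: euler_mult smooth_inner_self s euler_inner_self euler_inner)
  finally have 2: "euler (tang j F) x = 2 * (x \<bullet> x) * partial j F x + (x \<bullet> x) * euler (partial j F) x
      - ((x \<bullet> j) * euler F x + (x \<bullet> j) * euler (euler F) x)" .
  show ?thesis
    unfolding tang_def[of i] 1 2 by (simp add: algebra_simps)
qed

lemma tang_commute:
  assumes F: "smooth F" and i: "i \<in> Basis" and j: "j \<in> Basis"
  shows "tang i (tang j F) x - tang j (tang i F) x = (x \<bullet> i) * tang j F x - (x \<bullet> j) * tang i F x"
  unfolding tang_tang[OF F i j] tang_tang[OF F j i] partial_commute[OF F i j]
  by (simp add: tang_def algebra_simps)

text \<open>With D the gradient on the unit sphere, \<open>tang\<close> is |x| D, and it annihilates
  functions of |x|; the trace of its square is therefore |x|^2 times the spherical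
  Laplacian.\<close>

lemma sum_tang_tang:
  fixes x :: "'a::euclidean_space"
  assumes F: "smooth F"
  shows "(\<Sum>i\<in>Basis. tang i (tang i F) x) = (x \<bullet> x) * sph_lap F x"
proof -
  have "(\<Sum>i\<in>Basis. tang i (tang i F) x) = (\<Sum>i\<in>Basis. (x \<bullet> x) * ((x \<bullet> x) * partial i (partial i F) x
     - euler F x - (x \<bullet> i) * partial i F x - 2 * ((x \<bullet> i) * euler (partial i F) x))
     + (x \<bullet> i) * (x \<bullet> i) * (euler F x + euler (euler F) x))"
    by (intro sum.cong refl) (simp add: tang_tang[OF F] algebra_simps)
  also have "\<dots> = (x \<bullet> x) * ((x \<bullet> x) * laplacian F x - real DIM('a) * euler F x - euler F x
     - 2 * (\<Sum>i\<in>Basis. (x \<bullet> i) * euler (partial i F) x))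
     + (\<Sum>i\<in>Basis. (x \<bullet> i) * (x \<bullet> i)) * (euler F x + euler (euler F) x)"
    by (simp add: sum.distrib sum_subtractf sum_distrib_left[symmetric] sum_distrib_right[symmetric]
        laplacian_def euler_def[of F])
  also have "(\<Sum>i\<in>Basis. (x \<bullet> i) * euler (partial i F) x) = euler (euler F) x - euler F x"
    using euler_euler[OF F, of x] by simp
  also have "(\<Sum>i\<in>Basis. (x \<bullet> i) * (x \<bullet> i)) = x \<bullet> x"
    by (simp add: euclidean_inner[symmetric])
  also have "(x \<bullet> x) * ((x \<bullet> x) * laplacian F x - real DIM('a) * euler F x - euler F x
     - 2 * (euler (euler F) x - euler F x)) + (x \<bullet> x) * (euler F x + euler (euler F) x)
     = (x \<bullet> x) * ((x \<bullet> x) * laplacian F x - rad_lap F x)"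
    by (simp add: rad_lap_def algebra_simps)
  also have "(x \<bullet> x) * laplacian F x - rad_lap F x = sph_lap F x"
    using sph_lap_eq[OF F, of x] by simp
  finally show ?thesis .
qed

lemma sum_tang_sq:
  "(\<Sum>i\<in>Basis. (tang i u x)\<^sup>2) = (x \<bullet> x) * ((\<Sum>b\<in>Basis. \<Sum>c\<in>Basis. (rot b c u x)\<^sup>2) / 2)"
proof -
  have "(\<Sum>i\<in>Basis. (tang i u x)\<^sup>2) = (x \<bullet> x) * ((x \<bullet> x) * (\<Sum>i\<in>Basis. (partial i u x)\<^sup>2))
     - 2 * (x \<bullet> x) * euler u x * (\<Sum>i\<in>Basis. (x \<bullet> i) * partial i u x)
     + (\<Sum>i\<in>Basis. (x \<bullet> i) * (x \<bullet> i)) * (euler u x)\<^sup>2"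
    unfolding sum_distrib_left sum_distrib_right sum.distrib[symmetric] sum_subtractf[symmetric]
    by (intro sum.cong refl) (simp add: tang_def power2_eq_square algebra_simps)
  also have "(\<Sum>i\<in>Basis. (x \<bullet> i) * (x \<bullet> i)) = x \<bullet> x"
    by (simp add: euclidean_inner[symmetric])
  also have "(x \<bullet> x) * (\<Sum>i\<in>Basis. (partial i u x)\<^sup>2) = (euler u x)\<^sup>2 + (\<Sum>b\<in>Basis. \<Sum>c\<in>Basis. (rot b c u x)\<^sup>2) / 2"
    using lagrange_rot[of x u] by (simp add: norm_grad_sq)
  also have "(\<Sum>i\<in>Basis. (x \<bullet> i) * partial i u x) = euler u x" by (simp add: euler_def)
  finally show ?thesis by (simp add: algebra_simps power2_eq_square)
qed

text \<open>A pointwise form of bounded support that passes directly to derivatives and products.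
  Only points with norm strictly above \<open>\<rho>\<close> are constrained.\<close>

definition supp_in :: "real \<Rightarrow> ('a::euclidean_space \<Rightarrow> real) \<Rightarrow> bool" where
  "supp_in \<rho> u \<longleftrightarrow> (\<forall>x. norm x > \<rho> \<longrightarrow> u x = 0)"

lemma supp_in_partial:
  assumes "supp_in \<rho> u"
  shows "supp_in \<rho> (partial b u)"
  unfolding supp_in_def
proof safe
  fix x :: 'a assume x: "norm x > \<rho>"
  have "open {y::'a. norm y > \<rho>}" by (intro open_Collect_less continuous_intros)
  moreover have "((\<lambda>_. 0) has_derivative (\<lambda>_. 0)) (at x)" by simp
  ultimately have "(u has_derivative (\<lambda>_. 0)) (at x)"
    using has_derivative_transform_within_open[of "\<lambda>_. 0" "\<lambda>_. 0" x UNIV "{y. norm y > \<rho>}" u]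
      assms x by (auto simp: supp_in_def)
  then show "partial b u x = 0" by (simp add: partial_eq)
qed

lemma supp_in_euler: "supp_in \<rho> u \<Longrightarrow> supp_in \<rho> (euler u)"
  using supp_in_partial[of \<rho> u] by (auto simp: supp_in_def euler_def intro!: sum.neutral)

lemma supp_in_rot: "supp_in \<rho> u \<Longrightarrow> supp_in \<rho> (rot b c u)"
  using supp_in_partial[of \<rho> u] by (auto simp: supp_in_def rot_def)

lemma supp_in_tang: "supp_in \<rho> u \<Longrightarrow> supp_in \<rho> (tang i u)"
  using supp_in_partial[of \<rho> u i] supp_in_euler[of \<rho> u] by (auto simp: supp_in_def tang_def)

lemma supp_in_mult_left: "supp_in \<rho> u \<Longrightarrow> supp_in \<rho> (\<lambda>x. u x * v x)"
  by (auto simp: supp_in_def)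

lemma supp_in_mult_right: "supp_in \<rho> v \<Longrightarrow> supp_in \<rho> (\<lambda>x. u x * v x)"
  by (auto simp: supp_in_def)

lemma smooth_supp_bounded:
  assumes "smooth u" "supp_in \<rho> u"
  obtains C where "C \<ge> 0" "\<And>x. \<bar>u x\<bar> \<le> C"
proof -
  have "compact (u ` cball 0 \<rho>)"
    by (intro compact_continuous_image smooth_continuous_on assms compact_cball)
  then have "bounded (u ` cball 0 \<rho>)" by (rule compact_imp_bounded)
  then obtain C where C: "\<And>y. y \<in> u ` cball 0 \<rho> \<Longrightarrow> norm y \<le> C"
    unfolding bounded_iff by blast
  have "\<bar>u x\<bar> \<le> \<bar>C\<bar>" for x
    using C[of "u x"] assms(2) by (cases "norm x \<le> \<rho>") (auto simp: supp_in_def)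
  then show ?thesis using that[of "\<bar>C\<bar>"] by auto
qed

text \<open>The coefficients of \<open>euler\<close> are linear in x, so a factor |x| is gained at
  the origin. Two such factors reduce the singular weight V / r^4 to the integrable V / r^2.\<close>

lemma euler_bound:
  fixes F :: "'a::euclidean_space \<Rightarrow> real"
  assumes F: "smooth F" "supp_in \<rho> F"
  obtains C where "C \<ge> 0" "\<And>x. \<bar>euler F x\<bar> \<le> C * norm x"
proof -
  have "\<forall>b\<in>Basis. \<exists>C\<ge>0. \<forall>x. \<bar>partial b F x\<bar> \<le> C"
    using smooth_supp_bounded[OF smooth_partial supp_in_partial] F by metis
  then obtain C where C: "\<And>b. b \<in> Basis \<Longrightarrow> C b \<ge> 0" "\<And>b x. b \<in> Basis \<Longrightarrow> \<bar>partial b F x\<bar> \<le> C b"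
    by metis
  have "\<bar>euler F x\<bar> \<le> (\<Sum>b\<in>Basis. C b) * norm x" for x
  proof -
    have "\<bar>euler F x\<bar> \<le> (\<Sum>b\<in>Basis. \<bar>(x \<bullet> b) * partial b F x\<bar>)"
      unfolding euler_def by (rule sum_abs)
    also have "\<dots> \<le> (\<Sum>b\<in>Basis. C b * norm x)"
    proof (rule sum_mono)
      fix b :: 'a assume b: "b \<in> Basis"
      have "\<bar>(x \<bullet> b) * partial b F x\<bar> \<le> norm x * C b"
        unfolding abs_mult using b C by (intro mult_mono Basis_le_norm) auto
      then show "\<bar>(x \<bullet> b) * partial b F x\<bar> \<le> C b * norm x" by (simp add: mult.commute)
    qed
    finally show ?thesis by (simp add: sum_distrib_right)
  qed
  then show ?thesis using that[of "\<Sum>b\<in>Basis. C b"] C(1) by (simp add: sum_nonneg)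
qed

lemma rot_bound:
  fixes F :: "'a::euclidean_space \<Rightarrow> real"
  assumes F: "smooth F" "supp_in \<rho> F" and b: "b \<in> Basis" and c: "c \<in> Basis"
  obtains C where "C \<ge> 0" "\<And>x. \<bar>rot b c F x\<bar> \<le> C * norm x"
proof -
  obtain C where C: "C \<ge> 0" "\<And>x. \<bar>partial b F x\<bar> \<le> C"
    using smooth_supp_bounded[OF smooth_partial supp_in_partial] F b by metis
  obtain D where D: "D \<ge> 0" "\<And>x. \<bar>partial c F x\<bar> \<le> D"
    using smooth_supp_bounded[OF smooth_partial supp_in_partial] F c by metis
  have "\<bar>rot b c F x\<bar> \<le> (D + C) * norm x" for x
  proof -
    have "\<bar>rot b c F x\<bar> \<le> \<bar>(x \<bullet> b) * partial c F x\<bar> + \<bar>(x \<bullet> c) * partial b F x\<bar>"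
      unfolding rot_def by (rule abs_triangle_ineq4)
    also have "\<dots> \<le> norm x * D + norm x * C"
      unfolding abs_mult using b c C D by (intro add_mono mult_mono Basis_le_norm) auto
    finally show ?thesis by (simp add: algebra_simps)
  qed
  then show ?thesis using that[of "D + C"] C D by simp
qed

lemma test_functionD:
  fixes u :: "'a::euclidean_space \<Rightarrow> real"
  assumes "u \<in> test_functions (ball 0 R)" "R > 0"
  shows "smooth u" "\<exists>\<rho>. 0 < \<rho> \<and> \<rho> < R \<and> supp_in \<rho> u"
proof -
  show "smooth u" using assms by (simp add: test_functions_def smooth_def)
  let ?K = "closure {x. u x \<noteq> 0}"
  have K: "compact ?K" "?K \<subseteq> ball 0 R" using assms by (auto simp: test_functions_def)
  show "\<exists>\<rho>. 0 < \<rho> \<and> \<rho> < R \<and> supp_in \<rho> u"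
  proof (cases "?K = {}")
    case True
    then have "u x = 0" for x using closure_subset[of "{x. u x \<noteq> 0}"] by auto
    then show ?thesis using assms(2) by (intro exI[of _ "R / 2"]) (auto simp: supp_in_def)
  next
    case False
    obtain x0 where x0: "x0 \<in> ?K" "\<And>y. y \<in> ?K \<Longrightarrow> norm y \<le> norm x0"
      using continuous_attains_sup[OF K(1) False, of norm] by (auto intro: continuous_intros)
    \<comment> \<open>\<open>norm x0\<close> is the largest norm on the support; the maximum with R
      / 2 guarantees a positive radius.\<close>
    define \<rho> where "\<rho> = max (norm x0) (R / 2)"
    have "norm x0 < R" using x0(1) K(2) by auto
    then have "0 < \<rho> \<and> \<rho> < R" using assms(2) by (auto simp: \<rho>_def)
    moreover have "supp_in \<rho> u"
      unfolding supp_in_def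
    proof (safe, rule ccontr)
      fix x assume x: "\<rho> < norm x" "u x \<noteq> 0"
      then have "x \<in> ?K" using closure_subset[of "{x. u x \<noteq> 0}"] by auto
      from x0(2)[OF this] x(1) show False by (simp add: \<rho>_def)
    qed
    ultimately show ?thesis by blast
  qed
qed

lemma DERIV_along_ray:
  assumes "smooth F" "r \<noteq> 0"
  shows "((\<lambda>r. F (r *\<^sub>R \<theta>)) has_real_derivative euler F (r *\<^sub>R \<theta>) / r) (at r)"
proof -
  have "((\<lambda>t. F (0 + t *\<^sub>R \<theta>)) has_real_derivative (\<Sum>b\<in>Basis. (\<theta> \<bullet> b) * partial b F (0 + r *\<^sub>R \<theta>))) (at r)"
    by (rule DERIV_along_line[OF assms(1)])
  moreover have "(\<Sum>b\<in>Basis. (\<theta> \<bullet> b) * partial b F (r *\<^sub>R \<theta>)) = euler F (r *\<^sub>R \<theta>) / r"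
    using assms(2) by (simp add: euler_def sum_divide_distrib)
  ultimately show ?thesis by simp
qed

section \<open>Polar coordinates\<close>

lemma punctured_ball_borel [measurable, simp]: "ball (0::'a::euclidean_space) 1 - {0} \<in> sets borel"
  by (intro sets.Diff) auto

lemma nn_integral_lborel_scale:
  fixes F :: "'a::euclidean_space \<Rightarrow> ennreal"
  assumes [measurable]: "F \<in> borel_measurable borel" and t: "t > 0"
  shows "(\<integral>\<^sup>+x. F x \<partial>lborel) = ennreal (t ^ DIM('a)) * (\<integral>\<^sup>+x. F (t *\<^sub>R x) \<partial>lborel)"
proof -
  have "t \<noteq> 0" using t by simp
  from lborel_affine[OF this, of "0::'a"] have *: "lborel = density (distr lborel borel (\<lambda>x::'a. t *\<^sub>R x)) (\<lambda>_. ennreal (t ^ DIM('a)))"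
    using t by simp
  show ?thesis
    by (subst *) (simp add: nn_integral_density nn_integral_distr nn_integral_cmult)
qed

text \<open>Normalises the kernel |x|^n / t^(n + 1) on t > |x| that appears when polar coordinates
  are read off from dilations of the ball.\<close>

lemma nn_integral_inverse_power:
  fixes a :: real
  assumes a: "a > 0" and n: "n \<ge> 1"
  shows "(\<integral>\<^sup>+t. ennreal (a ^ n / t ^ (n + 1)) * indicator {a<..} t \<partial>lborel) = ennreal (1 / real n)"
proof -
  have "(\<integral>\<^sup>+t. ennreal (a ^ n / t ^ (n + 1)) * indicator {a<..} t \<partial>lborel)
      = (\<integral>\<^sup>+t. ennreal (a ^ n / t ^ (n + 1)) * indicator {a..} t \<partial>lborel)"
    using AE_lborel_singleton[of a] by (intro nn_integral_cong_AE) (auto simp: indicator_def)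
  also have "\<dots> = ennreal (0 - (- (a ^ n / (real n * a ^ n))))"
  proof (rule nn_integral_FTC_atLeast[where F = "\<lambda>t. - (a ^ n / (real n * t ^ n))"])
    show "((\<lambda>t. - (a ^ n / (real n * t ^ n))) has_real_derivative a ^ n / x ^ (n + 1)) (at x)" if "a \<le> x" for x
    proof -
      have x: "x > 0" using that a by simp
      obtain m where m: "n = Suc m" using n by (cases n) auto
      have "((\<lambda>t. - (a ^ n / real n) * inverse (t ^ n)) has_real_derivative
          - (a ^ n / real n) * (- (inverse (x ^ n) * (real n * x ^ m) * inverse (x ^ n)))) (at x)"
        using x m DERIV_cmult[OF DERIV_inverse_fun[OF DERIV_pow[of n x]], of "- (a ^ n / real n)"]
        by (simp add: mult_ac)
      moreover have "- (a ^ n / real n) * (- (inverse (x ^ n) * (real n * x ^ m) * inverse (x ^ n))) = a ^ n / x ^ (n + 1)"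
      proof -
        have "real n \<noteq> 0" "x ^ n = x * x ^ m" "x ^ m \<noteq> 0" using m x by auto
        then show ?thesis using x by (simp add: divide_simps)
      qed
      moreover have "(\<lambda>t. - (a ^ n / (real n * t ^ n))) = (\<lambda>t. - (a ^ n / real n) * inverse (t ^ n))"
        by (simp add: fun_eq_iff divide_inverse)
      ultimately show ?thesis by simp
    qed
    show "((\<lambda>t. - (a ^ n / (real n * t ^ n))) \<longlongrightarrow> 0) at_top"
    proof -
      have "filterlim (\<lambda>t::real. real n * t ^ n) at_top at_top"
        using n by (intro filterlim_tendsto_pos_mult_at_top[OF tendsto_const] filterlim_pow_at_top filterlim_ident) auto
      then have "((\<lambda>t. a ^ n / (real n * t ^ n)) \<longlongrightarrow> 0) at_top"
        by (intro real_tendsto_divide_at_top[OF tendsto_const])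
      from tendsto_minus[OF this] show ?thesis by simp
    qed
  qed (use a in auto)
  also have "0 - (- (a ^ n / (real n * a ^ n))) = 1 / real n" using a by simp
  finally show ?thesis .
qed

text \<open>Directions are taken from the solid punctured unit ball through \<open>sgn\<close>,
  which avoids surface measure. On the ray through y substitute r = |y| t, exchange the integrals,
  and substitute x = t y for fixed t; the integral of |x|^n / t^(n + 1) over t > |x| is 1 / n,
  whence the factor n in front.\<close>

lemma nn_integral_polar:
  fixes F :: "'a::euclidean_space \<Rightarrow> ennreal"
  assumes [measurable]: "F \<in> borel_measurable borel"
  shows "(\<integral>\<^sup>+x. F x \<partial>lborel) =
    ennreal (real DIM('a)) * (\<integral>\<^sup>+y. indicator (ball 0 1 - {0}) y *
      (\<integral>\<^sup>+r. indicator {0<..} r * ennreal (r ^ (DIM('a) - 1)) * F (r *\<^sub>R sgn y) \<partial>lborel) \<partial>(lborel :: 'a measure))"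
proof -
  let ?n = "DIM('a)"
  obtain m where m: "?n = Suc m" using DIM_positive[where 'a='a] by (cases "?n") auto
  have [measurable]: "(sgn :: 'a \<Rightarrow> 'a) \<in> borel \<rightarrow>\<^sub>M borel"
    unfolding sgn_div_norm[abs_def] by measurable
  have n0: "real ?n > 0" by simp
  \<comment> \<open>The integrand after r = |y| t: the Jacobian |y| and r^(n - 1) together give t^(n
    - 1) |y|^n, with \<open>m\<close> = n - 1.\<close>
  define K :: "real \<Rightarrow> 'a \<Rightarrow> ennreal"
    where "K t y = indicator {0<..} t * indicator (ball 0 1 - {0}) y * ennreal (t ^ m * norm y ^ ?n) * F (t *\<^sub>R y)" for t y
  define D :: "'a set" where "D = ball 0 1 - {0}"
  have [measurable]: "D \<in> sets borel" by (simp add: D_def)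
  have "(\<lambda>(y, t). K t y) \<in> borel_measurable (borel \<Otimes>\<^sub>M borel)"
    unfolding K_def D_def[symmetric] by measurable
  then have [measurable]: "(\<lambda>(y, t). K t y) \<in> borel_measurable (lborel \<Otimes>\<^sub>M lborel)"
    by (simp cong: measurable_cong_sets)
  have inner: "indicator (ball 0 1 - {0}) y *
      (\<integral>\<^sup>+r. indicator {0<..} r * ennreal (r ^ (?n - 1)) * F (r *\<^sub>R sgn y) \<partial>lborel) = (\<integral>\<^sup>+t. K t y \<partial>lborel)" for y :: 'a
  proof (cases "y \<in> ball 0 1 - {0}")
    case True
    then have y: "norm y > 0" by auto
    have "(\<integral>\<^sup>+r. indicator {0<..} r * ennreal (r ^ (?n - 1)) * F (r *\<^sub>R sgn y) \<partial>lborel)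
      = ennreal \<bar>norm y\<bar> * (\<integral>\<^sup>+t. indicator {0<..} (0 + norm y * t) * ennreal ((0 + norm y * t) ^ (?n - 1)) * F ((0 + norm y * t) *\<^sub>R sgn y) \<partial>lborel)"
      using y by (intro nn_integral_real_affine) auto
    also have "\<dots> = (\<integral>\<^sup>+t. ennreal (norm y) * (indicator {0<..} (norm y * t) * ennreal ((norm y * t) ^ m) * F ((norm y * t) *\<^sub>R sgn y)) \<partial>lborel)"
      by (subst nn_integral_cmult) (auto simp: m)
    also have "\<dots> = (\<integral>\<^sup>+t. K t y \<partial>lborel)"
    proof (rule nn_integral_cong)
      fix t :: real
      have "(norm y * t) *\<^sub>R sgn y = t *\<^sub>R y" using y by (simp add: sgn_div_norm)
      moreover have "t > 0 \<Longrightarrow> ennreal (norm y) * ennreal ((norm y * t) ^ m) = ennreal (t ^ m * norm y ^ ?n)"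
        using y by (subst ennreal_mult[symmetric]) (auto simp: m power_mult_distrib mult_ac)
      ultimately show "ennreal (norm y) * (indicator {0<..} (norm y * t) * ennreal ((norm y * t) ^ m) * F ((norm y * t) *\<^sub>R sgn y)) = K t y"
        using True y by (auto simp: K_def indicator_def zero_less_mult_iff mult.assoc[symmetric])
    qed
    finally show ?thesis using True by simp
  next
    case False
    then show ?thesis by (simp add: K_def)
  qed
  \<comment> \<open>With x = t y the condition |y| < 1 becomes |x| < t, and t^(n - 1) |y|^n becomes
    |x|^n / t; division by the Jacobian t^n gives the kernel.\<close>
  have slice: "(\<integral>\<^sup>+y. K t y \<partial>lborel) =
      (\<integral>\<^sup>+x. F x * (indicator (UNIV - {0}) x * (ennreal (norm x ^ ?n / t ^ (?n + 1)) * indicator {norm x<..} t)) \<partial>lborel)" for t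
  proof (cases "t > 0")
    case True
    define G where "G x = indicator (UNIV - {0}) x * (ennreal (norm x ^ ?n / t ^ (?n + 1)) * indicator {norm x<..} t) * F x" for x :: 'a
    have "(\<lambda>x::'a. indicator {norm x<..} t :: ennreal) = (\<lambda>x. indicator {x. norm x < t} x)"
      by (auto simp: indicator_def fun_eq_iff)
    then have [measurable]: "(\<lambda>x::'a. indicator {norm x<..} t :: ennreal) \<in> borel_measurable borel" by simp
    have [measurable]: "G \<in> borel_measurable borel" unfolding G_def by measurable
    have "(\<integral>\<^sup>+x. G x \<partial>lborel) = ennreal (t ^ ?n) * (\<integral>\<^sup>+x. G (t *\<^sub>R x) \<partial>lborel)"
      using True by (intro nn_integral_lborel_scale) auto
    also have "\<dots> = (\<integral>\<^sup>+x. ennreal (t ^ ?n) * G (t *\<^sub>R x) \<partial>lborel)"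
      by (subst nn_integral_cmult) auto
    also have "\<dots> = (\<integral>\<^sup>+y. K t y \<partial>lborel)"
    proof (rule nn_integral_cong)
      fix y :: 'a
      have "ennreal (t ^ ?n) * ennreal (norm (t *\<^sub>R y) ^ ?n / t ^ (?n + 1)) = ennreal (t ^ m * norm y ^ ?n)"
        using True by (subst ennreal_mult[symmetric]) (auto simp: m power_mult_distrib field_simps)
      then have "ennreal (t ^ ?n) * (ennreal (norm (t *\<^sub>R y) ^ ?n / t ^ (?n + 1)) * z) = ennreal (t ^ m * norm y ^ ?n) * z" for z
        by (simp add: mult.assoc[symmetric])
      then show "ennreal (t ^ ?n) * G (t *\<^sub>R y) = K t y"
        using True by (auto simp: G_def K_def indicator_def)
    qed
    finally show ?thesis by (simp add: G_def mult_ac)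
  next
    case False
    have "\<not> norm x < t" for x :: 'a using False norm_ge_zero[of x] by linarith
    then show ?thesis using False by (simp add: K_def)
  qed
  have [measurable]: "(\<lambda>(x::'a, t). indicator {norm x<..} t :: ennreal) \<in> borel_measurable (lborel \<Otimes>\<^sub>M lborel)"
  proof -
    have "(\<lambda>(x::'a, t). indicator {norm x<..} t :: ennreal) = indicator {z. norm (fst z) < snd z}"
      by (auto simp: indicator_def fun_eq_iff)
    moreover have "{z :: 'a \<times> real. norm (fst z) < snd z} \<in> sets (lborel \<Otimes>\<^sub>M lborel)"
      unfolding lborel_prod by (auto intro!: borel_open open_Collect_less continuous_intros)
    ultimately show ?thesis by simp
  qed
  have "(\<integral>\<^sup>+y. indicator (ball 0 1 - {0}) y *
      (\<integral>\<^sup>+r. indicator {0<..} r * ennreal (r ^ (?n - 1)) * F (r *\<^sub>R sgn y) \<partial>lborel) \<partial>(lborel :: 'a measure))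
    = (\<integral>\<^sup>+y. \<integral>\<^sup>+t. K t y \<partial>lborel \<partial>lborel)" by (simp only: inner)
  also have "\<dots> = (\<integral>\<^sup>+t. \<integral>\<^sup>+y. K t y \<partial>lborel \<partial>lborel)"
    by (rule lborel_pair.Fubini'[symmetric]) auto
  also have "\<dots> = (\<integral>\<^sup>+t. \<integral>\<^sup>+x. F x * (indicator (UNIV - {0}) x * (ennreal (norm x ^ ?n / t ^ (?n + 1)) * indicator {norm x<..} t)) \<partial>lborel \<partial>lborel)"
    by (simp add: slice)
  also have "\<dots> = (\<integral>\<^sup>+x. \<integral>\<^sup>+t. F x * (indicator (UNIV - {0}) x * (ennreal (norm x ^ ?n / t ^ (?n + 1)) * indicator {norm x<..} t)) \<partial>lborel \<partial>lborel)"
    by (rule lborel_pair.Fubini') measurable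
  also have "\<dots> = (\<integral>\<^sup>+x. F x * ennreal (1 / real ?n) \<partial>lborel)"
  proof (rule nn_integral_cong_AE, use AE_lborel_singleton[of "0::'a"] in eventually_elim)
    fix x :: 'a assume x: "x \<noteq> 0"
    have "(\<integral>\<^sup>+t. F x * (indicator (UNIV - {0}) x * (ennreal (norm x ^ ?n / t ^ (?n + 1)) * indicator {norm x<..} t)) \<partial>lborel)
      = F x * (\<integral>\<^sup>+t. ennreal (norm x ^ ?n / t ^ (?n + 1)) * indicator {norm x<..} t \<partial>lborel)"
      using x by (subst nn_integral_cmult[symmetric]) auto
    then show "(\<integral>\<^sup>+t. F x * (indicator (UNIV - {0}) x * (ennreal (norm x ^ ?n / t ^ (?n + 1)) * indicator {norm x<..} t)) \<partial>lborel) = F x * ennreal (1 / real ?n)"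
      using nn_integral_inverse_power[of "norm x" ?n] x by (simp add: Suc_leI)
  qed
  also have "\<dots> = (\<integral>\<^sup>+x. F x \<partial>lborel) * ennreal (1 / real ?n)"
    by (subst nn_integral_multc) auto
  finally have "ennreal (real ?n) * (\<integral>\<^sup>+y. indicator (ball 0 1 - {0}) y *
      (\<integral>\<^sup>+r. indicator {0<..} r * ennreal (r ^ (?n - 1)) * F (r *\<^sub>R sgn y) \<partial>lborel) \<partial>(lborel :: 'a measure))
     = (\<integral>\<^sup>+x. F x \<partial>lborel) * (ennreal (1 / real ?n) * ennreal (real ?n))" by (simp add: mult_ac)
  also have "ennreal (1 / real ?n) * ennreal (real ?n) = 1"
    using n0 by (subst ennreal_mult[symmetric]) auto
  finally show ?thesis by simp
qed

text \<open>Its image under \<open>sgn\<close> is the surface measure of the unit sphere; the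
  dimension appears as a factor because the area of the sphere is n times the volume of the
  ball.\<close>

definition polar_measure :: "'a::euclidean_space measure" where
  "polar_measure = density lborel (\<lambda>y. ennreal (real DIM('a)) * indicator (ball 0 1 - {0}) y)"

definition radial_measure :: "nat \<Rightarrow> real measure" where
  "radial_measure n = density lborel (\<lambda>r. indicator {0<..} r * ennreal (r ^ (n - 1)))"

lemma sets_polar_measure [measurable_cong, simp]: "sets polar_measure = sets borel"
  by (simp add: polar_measure_def)

lemma space_polar_measure [simp]: "space polar_measure = UNIV"
  by (simp add: polar_measure_def)

lemma sets_radial_measure [measurable_cong, simp]: "sets (radial_measure n) = sets borel"
  by (simp add: radial_measure_def)

lemma space_radial_measure [simp]: "space (radial_measure n) = UNIV"
  by (simp add: radial_measure_def)

lemma finite_polar_measure: "finite_measure (polar_measure :: 'a::euclidean_space measure)"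
proof
  have "emeasure (polar_measure :: 'a measure) UNIV = ennreal (real DIM('a)) * emeasure lborel (ball (0::'a) 1 - {0})"
    by (simp add: polar_measure_def emeasure_density nn_integral_cmult)
  also have "\<dots> < \<infinity>"
  proof -
    have "emeasure lborel (ball (0::'a) 1 - {0}) \<le> emeasure lborel (ball (0::'a) 1)"
      by (intro emeasure_mono) auto
    also have "\<dots> < \<infinity>" using emeasure_lborel_ball_finite by simp
    finally show ?thesis by (simp add: ennreal_mult_less_top)
  qed
  finally show "emeasure (polar_measure :: 'a measure) (space polar_measure) \<noteq> \<infinity>" by simp
qed

lemma emeasure_polar_pos: "emeasure (polar_measure :: 'a::euclidean_space measure) UNIV \<noteq> 0"
proof -
  have "emeasure (polar_measure :: 'a measure) UNIV = ennreal (real DIM('a)) * emeasure lborel (ball (0::'a) 1 - {0})"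
    by (simp add: polar_measure_def emeasure_density nn_integral_cmult)
  moreover have "emeasure lborel (ball (0::'a) 1 - {0}) = emeasure lborel (ball (0::'a) 1)"
    by (intro emeasure_Diff_null_set) (auto simp: null_sets_def)
  moreover have "emeasure lborel (ball (0::'a) 1) \<noteq> 0"
    by (simp add: emeasure_ball unit_ball_vol_pos[THEN less_imp_neq, symmetric] less_imp_le)
  ultimately show ?thesis by (simp add: ennreal_eq_0_iff)
qed

lemma sigma_finite_radial_measure: "sigma_finite_measure (radial_measure n)"
proof
  let ?A = "\<lambda>i::nat. {- real i..real i}"
  have "emeasure (radial_measure n) (?A i) \<noteq> \<infinity>" for i
  proof -
    have "emeasure (radial_measure n) (?A i) = (\<integral>\<^sup>+r. indicator {0<..} r * ennreal (r ^ (n - 1)) * indicator (?A i) r \<partial>lborel)"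
      by (simp add: radial_measure_def emeasure_density)
    also have "\<dots> \<le> (\<integral>\<^sup>+r. ennreal (real i ^ (n - 1)) * indicator (?A i) r \<partial>lborel)"
      by (intro nn_integral_mono) (auto simp: indicator_def intro!: power_mono)
    also have "\<dots> < \<infinity>" by (simp add: nn_integral_cmult ennreal_mult_less_top)
    finally show ?thesis by simp
  qed
  moreover have "(\<Union>i. ?A i) = UNIV"
  proof (safe; simp)
    fix x :: real
    obtain i :: nat where "\<bar>x\<bar> \<le> real i" using real_arch_simple by blast
    then show "\<exists>i. - real i \<le> x \<and> x \<le> real i" by (intro exI[of _ i]) auto
  qed
  ultimately show "\<exists>A. countable A \<and> A \<subseteq> sets (radial_measure n) \<and> \<Union> A = space (radial_measure n) \<and> (\<forall>a\<in>A. emeasure (radial_measure n) a \<noteq> \<infinity>)"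
    by (intro exI[of _ "range ?A"]) auto
qed

lemma measurable_sgn_euclidean [measurable]: "(sgn :: 'a::euclidean_space \<Rightarrow> 'a) \<in> borel \<rightarrow>\<^sub>M borel"
  unfolding sgn_div_norm[abs_def] by measurable

lemma nn_integral_radial_measure:
  assumes [measurable]: "f \<in> borel_measurable borel"
  shows "(\<integral>\<^sup>+r. f r \<partial>radial_measure n) = (\<integral>\<^sup>+r. ennreal (r ^ (n - 1)) * f r * indicator {0<..} r \<partial>lborel)"
  unfolding radial_measure_def by (subst nn_integral_density) (auto simp: mult_ac)

lemma nn_integral_polar':
  fixes F :: "'a::euclidean_space \<Rightarrow> ennreal"
  assumes F [measurable]: "F \<in> borel_measurable borel"
  shows "(\<integral>\<^sup>+x. F x \<partial>lborel) =
    (\<integral>\<^sup>+y. \<integral>\<^sup>+r. F (r *\<^sub>R sgn y) \<partial>radial_measure DIM('a) \<partial>(polar_measure :: 'a measure))"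
proof -
  interpret R: sigma_finite_measure "radial_measure DIM('a)" by (rule sigma_finite_radial_measure)
  define \<phi> where "\<phi> y = (\<integral>\<^sup>+r. F (r *\<^sub>R sgn y) \<partial>radial_measure DIM('a))" for y :: 'a
  have [measurable]: "\<phi> \<in> borel_measurable borel"
    unfolding \<phi>_def by measurable
  have \<phi>: "\<phi> y = (\<integral>\<^sup>+r. indicator {0<..} r * ennreal (r ^ (DIM('a) - 1)) * F (r *\<^sub>R sgn y) \<partial>lborel)" for y
    unfolding \<phi>_def by (subst nn_integral_radial_measure) (auto simp: mult_ac)
  have "(\<integral>\<^sup>+y. \<phi> y \<partial>polar_measure) = (\<integral>\<^sup>+y. ennreal (real DIM('a)) * (indicator (ball 0 1 - {0}) y * \<phi> y) \<partial>lborel)"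
    unfolding polar_measure_def by (subst nn_integral_density) (auto simp: mult_ac)
  also have "\<dots> = ennreal (real DIM('a)) * (\<integral>\<^sup>+y. indicator (ball 0 1 - {0}) y * \<phi> y \<partial>lborel)"
    by (rule nn_integral_cmult) simp
  also have "\<dots> = (\<integral>\<^sup>+x. F x \<partial>lborel)"
    unfolding nn_integral_polar[OF F] \<phi> ..
  finally show ?thesis by (simp add: \<phi>_def)
qed

text \<open>As an identity of measures the polar formula also transfers integrability and signed
  integrals, beyond nonnegative integrands.\<close>

lemma lborel_polar:
  "(lborel :: 'a::euclidean_space measure) =
     distr (polar_measure \<Otimes>\<^sub>M radial_measure DIM('a)) borel (\<lambda>(y, r). r *\<^sub>R sgn y)"
proof (rule measure_eqI)
  interpret R: sigma_finite_measure "radial_measure DIM('a)" by (rule sigma_finite_radial_measure)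
  fix A :: "'a set" assume "A \<in> sets lborel"
  then have [measurable]: "A \<in> sets borel" by simp
  have "emeasure lborel A = (\<integral>\<^sup>+x. indicator A x \<partial>lborel)" by simp
  also have "\<dots> = (\<integral>\<^sup>+y. \<integral>\<^sup>+r. indicator A (r *\<^sub>R sgn y) \<partial>radial_measure DIM('a) \<partial>(polar_measure :: 'a measure))"
    by (rule nn_integral_polar') simp
  also have "\<dots> = (\<integral>\<^sup>+z. indicator A (snd z *\<^sub>R sgn (fst z)) \<partial>((polar_measure :: 'a measure) \<Otimes>\<^sub>M radial_measure DIM('a)))"
    by (subst R.nn_integral_fst[symmetric]) auto
  also have "\<dots> = (\<integral>\<^sup>+x. indicator A x \<partial>distr (polar_measure \<Otimes>\<^sub>M radial_measure DIM('a)) borel (\<lambda>(y, r). r *\<^sub>R sgn y))"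
    by (subst nn_integral_distr) (auto simp: split_beta')
  also have "\<dots> = emeasure (distr (polar_measure \<Otimes>\<^sub>M radial_measure DIM('a)) borel (\<lambda>(y, r). r *\<^sub>R sgn y)) A"
    by simp
  finally show "emeasure lborel A = emeasure (distr (polar_measure \<Otimes>\<^sub>M radial_measure DIM('a)) borel (\<lambda>(y, r). r *\<^sub>R sgn y)) A" .
qed simp

lemma AE_polar_nonzero: "AE y in (polar_measure :: 'a::euclidean_space measure). y \<noteq> 0"
  unfolding polar_measure_def using AE_lborel_singleton[of "0::'a"]
  by (subst AE_density) (auto elim!: eventually_mono)

lemma integral_polar:
  fixes F :: "'a::euclidean_space \<Rightarrow> real"
  assumes "integrable lborel F"
  shows "integrable polar_measure (\<lambda>y::'a. \<integral>r. F (r *\<^sub>R sgn y) \<partial>radial_measure DIM('a))"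
    and "(\<integral>x. F x \<partial>lborel) = (\<integral>y. \<integral>r. F (r *\<^sub>R sgn y) \<partial>radial_measure DIM('a) \<partial>(polar_measure :: 'a measure))"
proof -
  interpret P: finite_measure "polar_measure :: 'a measure" by (rule finite_polar_measure)
  interpret R: sigma_finite_measure "radial_measure DIM('a)" by (rule sigma_finite_radial_measure)
  interpret PR: pair_sigma_finite "polar_measure :: 'a measure" "radial_measure DIM('a)" ..
  have [measurable]: "F \<in> borel_measurable borel" using borel_measurable_integrable[OF assms] by simp
  have int: "integrable ((polar_measure :: 'a measure) \<Otimes>\<^sub>M radial_measure DIM('a)) (\<lambda>(y, r). F (r *\<^sub>R sgn y))"
    using assms by (subst (asm) lborel_polar) (simp add: integrable_distr_eq split_beta')
  show "integrable polar_measure (\<lambda>y::'a. \<integral>r. F (r *\<^sub>R sgn y) \<partial>radial_measure DIM('a))"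
    using PR.integrable_fst'[OF int] by simp
  have "(\<integral>x. F x \<partial>lborel) = (\<integral>z. (case z of (y, r) \<Rightarrow> F (r *\<^sub>R sgn y)) \<partial>((polar_measure :: 'a measure) \<Otimes>\<^sub>M radial_measure DIM('a)))"
    by (subst lborel_polar) (simp add: integral_distr split_beta')
  also have "\<dots> = (\<integral>y. \<integral>r. F (r *\<^sub>R sgn y) \<partial>radial_measure DIM('a) \<partial>(polar_measure :: 'a measure))"
    using PR.integral_fst'[OF int] by simp
  finally show "(\<integral>x. F x \<partial>lborel) = (\<integral>y. \<integral>r. F (r *\<^sub>R sgn y) \<partial>radial_measure DIM('a) \<partial>(polar_measure :: 'a measure))" .
qed

lemma nn_integral_radial_fun:
  fixes g :: "real \<Rightarrow> ennreal"
  assumes [measurable]: "g \<in> borel_measurable borel"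
  shows "(\<integral>\<^sup>+x. g (norm (x::'a::euclidean_space)) \<partial>lborel) =
    emeasure (polar_measure :: 'a measure) UNIV * (\<integral>\<^sup>+r. ennreal (r ^ (DIM('a) - 1)) * g r * indicator {0<..} r \<partial>lborel)"
proof -
  have "(\<integral>\<^sup>+x. g (norm (x::'a)) \<partial>lborel) =
      (\<integral>\<^sup>+y. (\<integral>\<^sup>+r. ennreal (r ^ (DIM('a) - 1)) * g r * indicator {0<..} r \<partial>lborel) \<partial>(polar_measure :: 'a measure))"
  proof (subst nn_integral_polar', simp, rule nn_integral_cong_AE, use AE_polar_nonzero[where 'a='a] in eventually_elim)
    fix y :: 'a assume "y \<noteq> 0"
    then show "(\<integral>\<^sup>+r. g (norm (r *\<^sub>R sgn y)) \<partial>radial_measure DIM('a)) =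
       (\<integral>\<^sup>+r. ennreal (r ^ (DIM('a) - 1)) * g r * indicator {0<..} r \<partial>lborel)"
      by (subst nn_integral_radial_measure)
        (auto simp: norm_sgn indicator_def intro!: nn_integral_cong)
  qed
  then show ?thesis by (simp add: mult.commute)
qed

section \<open>Inequalities on a ray\<close>

lemma has_integral_DERIV:
  fixes F :: "real \<Rightarrow> real"
  assumes "a \<le> b" "\<And>x. a \<le> x \<Longrightarrow> x \<le> b \<Longrightarrow> (F has_real_derivative f x) (at x)"
  shows "(f has_integral (F b - F a)) {a..b}"
proof (rule fundamental_theorem_of_calculus[OF assms(1)])
  fix x assume "x \<in> {a..b}"
  then have "(F has_real_derivative f x) (at x within {a..b})"
    using assms(2)[of x] by (auto intro: has_field_derivative_at_within[of F "f x" x])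
  then show "(F has_vector_derivative f x) (at x within {a..b})"
    by (simp add: has_real_derivative_iff_has_vector_derivative)
qed

lemma nn_integral_Ioc_le:
  fixes f :: "real \<Rightarrow> ennreal"
  assumes meas [measurable]: "(\<lambda>r. f r * indicator {0<..\<rho>} r) \<in> borel_measurable borel"
    and \<rho>: "0 < \<rho>"
    and le: "\<And>\<epsilon>. 0 < \<epsilon> \<Longrightarrow> \<epsilon> < \<rho> \<Longrightarrow> (\<integral>\<^sup>+r\<in>{\<epsilon>..\<rho>}. f r \<partial>lborel) \<le> C"
  shows "(\<integral>\<^sup>+r\<in>{0<..\<rho>}. f r \<partial>lborel) \<le> C"
proof -
  \<comment> \<open>The shift by 2 keeps \<open>e k\<close> strictly below \<open>\<rho>\<close>
    already for k = 0; the intervals increase to (0, \<rho>].\<close>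
  define e where "e k = \<rho> / (real k + 2)" for k :: nat
  have e: "0 < e k" "e k < \<rho>" for k using \<rho> by (auto simp: e_def field_simps intro: add_pos_nonneg)
  have mono: "e k \<le> e j" if "j \<le> k" for j k
    unfolding e_def using \<rho> that by (intro divide_left_mono) auto
  have "f r * indicator {0<..\<rho>} r = (SUP k. f r * indicator {e k..\<rho>} r)" for r
  proof (cases "r \<in> {0<..\<rho>}")
    case True
    obtain k :: nat where k: "\<rho> / r \<le> real k" using real_arch_simple by blast
    have "e k \<le> r"
      using True k by (simp add: e_def field_simps)
    show ?thesis
    proof (rule antisym)
      show "f r * indicator {0<..\<rho>} r \<le> (SUP k. f r * indicator {e k..\<rho>} r)"
        using True \<open>e k \<le> r\<close> by (intro SUP_upper2[of k]) auto
      show "(SUP k. f r * indicator {e k..\<rho>} r) \<le> f r * indicator {0<..\<rho>} r"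
        using e(1) by (intro SUP_least) (auto simp: indicator_def intro: order.strict_trans1 less_le_trans)
    qed
  next
    case False
    then have "r \<notin> {e k..\<rho>}" for k using e(1)[of k] by auto
    then show ?thesis using False by simp
  qed
  then have "(\<integral>\<^sup>+r\<in>{0<..\<rho>}. f r \<partial>lborel) = (\<integral>\<^sup>+r. (SUP k. f r * indicator {e k..\<rho>} r) \<partial>lborel)"
    by simp
  also have "\<dots> = (SUP k. \<integral>\<^sup>+r. f r * indicator {e k..\<rho>} r \<partial>lborel)"
  proof (rule nn_integral_monotone_convergence_SUP)
    show "incseq (\<lambda>k r. f r * indicator {e k..\<rho>} r)"
      using mono by (force simp: incseq_def le_fun_def indicator_def intro: order_trans)
    fix k
    have "(\<lambda>r. f r * indicator {e k..\<rho>} r) = (\<lambda>r. f r * indicator {0<..\<rho>} r * indicator {e k..\<rho>} r)"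
      using e(1)[of k] by (auto simp: fun_eq_iff indicator_def)
    then show "(\<lambda>r. f r * indicator {e k..\<rho>} r) \<in> borel_measurable lborel" by simp
  qed
  also have "\<dots> \<le> C" using le e by (intro SUP_least) auto
  finally show ?thesis .
qed

lemma nn_integral_Icc_continuous:
  fixes f :: "real \<Rightarrow> real"
  assumes "continuous_on {a..b} f" "\<And>x. a \<le> x \<Longrightarrow> x \<le> b \<Longrightarrow> 0 \<le> f x"
  shows "(\<integral>\<^sup>+x\<in>{a..b}. ennreal (f x) \<partial>lborel) = ennreal (integral {a..b} f)"
proof -
  have i: "set_integrable lborel {a..b} f"
    by (rule borel_integrable_atLeastAtMost'[OF assms(1)])
  have "(\<integral>\<^sup>+x\<in>{a..b}. ennreal (f x) \<partial>lborel) = (\<integral>\<^sup>+x. ennreal (indicator {a..b} x *\<^sub>R f x) \<partial>lborel)"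
    by (intro nn_integral_cong) (auto simp: indicator_def)
  also have "\<dots> = ennreal (\<integral>x. indicator {a..b} x *\<^sub>R f x \<partial>lborel)"
    using i assms(2) by (intro nn_integral_eq_integral) (auto simp: set_integrable_def indicator_def)
  also have "\<dots> = ennreal (integral {a..b} f)"
    using set_borel_integral_eq_integral(2)[OF i] by (simp add: set_lebesgue_integral_def)
  finally show ?thesis .
qed

lemma measurable_Ioc_continuous:
  fixes f :: "real \<Rightarrow> real"
  assumes "continuous_on {0<..<R} f" "\<rho> < R"
  shows "(\<lambda>r. ennreal (f r) * indicator {0<..\<rho>} r) \<in> borel_measurable borel"
proof -
  have "continuous_on {0<..\<rho>} f" using assms by (auto intro: continuous_on_subset)
  then have "(\<lambda>r. indicator {0<..\<rho>} r *\<^sub>R f r) \<in> borel_measurable borel"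
    by (intro borel_measurable_continuous_on_indicator) auto
  then have "(\<lambda>r. ennreal (indicator {0<..\<rho>} r *\<^sub>R f r)) \<in> borel_measurable borel" by simp
  also have "(\<lambda>r. ennreal (indicator {0<..\<rho>} r *\<^sub>R f r)) = (\<lambda>r. ennreal (f r) * indicator {0<..\<rho>} r)"
    by (auto simp: fun_eq_iff indicator_def)
  finally show ?thesis .
qed

lemma nn_integral_Ioo_vanishing:
  fixes f :: "real \<Rightarrow> ennreal"
  assumes "\<And>r. \<rho> < r \<Longrightarrow> r < R \<Longrightarrow> f r = 0" "\<rho> < R"
  shows "(\<integral>\<^sup>+r\<in>{0<..<R}. f r \<partial>lborel) = (\<integral>\<^sup>+r\<in>{0<..\<rho>}. f r \<partial>lborel)"
proof (rule nn_integral_cong)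
  fix r
  show "f r * indicator {0<..<R} r = f r * indicator {0<..\<rho>} r"
    using assms(1)[of r] assms(2) by (cases "r \<le> \<rho>"; cases "r < R") (auto simp: indicator_def)
qed

text \<open>The weight r^(n - 1) V is the integrating factor of the Bessel equation. With V = 1 the
  same rule differentiates plain products with r^(n - 1).\<close>

lemma DERIV_weighted_flux:
  assumes n: "n \<ge> (1::nat)" and r: "r > 0"
    and V: "(V has_real_derivative V1) (at r)" and y: "(y1 has_real_derivative y2) (at r)" and V0: "V r \<noteq> 0"
  shows "((\<lambda>r. r ^ (n - 1) * V r * y1 r) has_real_derivative
     r ^ (n - 1) * V r * (y2 + ((real n - 1) / r + V1 / V r) * y1 r)) (at r)"
proof -
  \<comment> \<open>For n = 1 the exponent n - 2 is truncated to 0, but the coefficient n - 1 is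
    then 0. Multiplication by r states the identity uniformly in n.\<close>
  have eq: "real (n - Suc 0) * r ^ (n - Suc (Suc 0)) * r = (real n - 1) * r ^ (n - 1)"
  proof -
    obtain m where "n = Suc m" using n by (cases n) auto
    then show ?thesis by (cases m) auto
  qed
  have "((\<lambda>r. r ^ (n - 1) * V r * y1 r) has_real_derivative
     (real (n - Suc 0) * r ^ (n - Suc (Suc 0)) * V r + V1 * r ^ (n - 1)) * y1 r + y2 * (r ^ (n - 1) * V r)) (at r)"
    using V y by (auto intro!: derivative_eq_intros)
  moreover have "real (n - Suc 0) * r ^ (n - Suc (Suc 0)) = (real n - 1) * r ^ (n - 1) / r"
    using eq r by (simp add: field_simps)
  ultimately show ?thesis
    by (rule_tac DERIV_cong) (auto simp: field_simps V0 r[THEN less_imp_neq, symmetric])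
qed

lemma DERIV_bessel_flux:
  assumes n: "n \<ge> (1::nat)" and ode: "bessel_ode n R V W c y"
    and r: "r \<in> {0<..<R}" and V: "(V has_real_derivative deriv V r) (at r)" and V0: "V r > 0"
  shows "(y has_real_derivative deriv y r) (at r)"
    and "((\<lambda>r. r ^ (n - 1) * V r * deriv y r) has_real_derivative - (c * (r ^ (n - 1) * W r) * y r)) (at r)"
proof -
  have o: "y differentiable at r" "deriv y differentiable at r"
    "deriv (deriv y) r + ((real n - 1) / r + deriv V r / V r) * deriv y r + c * W r / V r * y r = 0"
    using ode r by (auto simp: bessel_ode_def)
  show "(y has_real_derivative deriv y r) (at r)"
    using o(1) by (simp add: DERIV_deriv_iff_real_differentiable)
  have "(deriv y has_real_derivative deriv (deriv y) r) (at r)"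
    using o(2) by (simp add: DERIV_deriv_iff_real_differentiable)
  from DERIV_weighted_flux[OF n _ V this] r V0
  have "((\<lambda>r. r ^ (n - 1) * V r * deriv y r) has_real_derivative r ^ (n - 1) * V r *
     (deriv (deriv y) r + ((real n - 1) / r + deriv V r / V r) * deriv y r)) (at r)" by auto
  moreover have "deriv (deriv y) r + ((real n - 1) / r + deriv V r / V r) * deriv y r = - (c * W r / V r * y r)"
    using o(3) by linarith
  moreover have "r ^ (n - 1) * V r * - (c * W r / V r * y r) = - (c * (r ^ (n - 1) * W r) * y r)"
    using V0 by simp
  ultimately show "((\<lambda>r. r ^ (n - 1) * V r * deriv y r) has_real_derivative - (c * (r ^ (n - 1) * W r) * y r)) (at r)"
    by (simp only:)
qed

text \<open>If the flux were nonnegative somewhere, it would be bounded below by some \<open>\<delta> > 0\<close> near the origin,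
  and the divergence of the integral of the inverse weight would force the solution to \<open>-\<infinity>\<close> there.\<close>

lemma bessel_flux_neg:
  assumes n: "n \<ge> (1::nat)" and c: "c > 0" and ode: "bessel_ode n R V W c y"
    and V: "\<And>r. r \<in> {0<..<R} \<Longrightarrow> (V has_real_derivative deriv V r) (at r)"
    and V0: "\<And>r. r \<in> {0<..<R} \<Longrightarrow> V r > 0" and W0: "\<And>r. r \<in> {0<..<R} \<Longrightarrow> W r > 0"
    and y0: "\<And>r. r \<in> {0<..<R} \<Longrightarrow> y r > 0"
    and div: "diverges_at_zero R (\<lambda>r. 1 / (r ^ (n - 1) * V r))"
    and r0: "r0 \<in> {0<..<R}"
  shows "deriv y r0 < 0"
proof (rule ccontr)
  let ?z = "\<lambda>r. r ^ (n - 1) * V r * deriv y r"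
  assume "\<not> deriv y r0 < 0"
  then have z0: "?z r0 \<ge> 0" using r0 V0[OF r0] by (auto intro!: mult_nonneg_nonneg)
  \<comment> \<open>The flux decreases strictly, so a nonnegative value at \<open>r0\<close> becomes
    a positive one at r0 / 2, which bounds the flux from below on all of (0, r1].\<close>
  define r1 where "r1 = r0 / 2"
  have r1: "0 < r1" "r1 < r0" "r1 < R" using r0 by (auto simp: r1_def)
  have dec: "?z b < ?z a" if "0 < a" "a < b" "b < R" for a b
  proof (rule DERIV_neg_imp_decreasing[OF that(2)])
    fix x assume "a \<le> x" "x \<le> b"
    then have x: "x \<in> {0<..<R}" using that by auto
    show "\<exists>w. (?z has_real_derivative w) (at x) \<and> w < 0"
      using DERIV_bessel_flux(2)[OF n ode x V[OF x] V0[OF x]] c W0[OF x] y0[OF x] x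
      by (intro exI[of _ "- (c * (x ^ (n - 1) * W x) * y x)"]) (auto intro!: mult_pos_pos)
  qed
  define \<delta> where "\<delta> = ?z r1"
  have \<delta>: "\<delta> > 0" using dec[of r1 r0] r1 r0 z0 by (auto simp: \<delta>_def)
  have zge: "?z r \<ge> \<delta>" if "0 < r" "r \<le> r1" for r
    using dec[of r r1] that r1 by (cases "r = r1") (auto simp: \<delta>_def less_imp_le)
  have Vc: "continuous_on {0<..<R} V"
    using V by (meson DERIV_isCont continuous_at_imp_continuous_on)
  have pos: "r ^ (n - 1) * V r > 0" if "r \<in> {0<..<R}" for r using that V0 by auto
  have fc: "continuous_on {0<..<R} (\<lambda>r. 1 / (r ^ (n - 1) * V r))"
    using V0 by (intro continuous_intros Vc) force
  have "(\<integral>\<^sup>+r\<in>{0<..r1}. ennreal (1 / (r ^ (n - 1) * V r)) \<partial>lborel) \<le> ennreal (y r1 / \<delta>)"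
  proof (rule nn_integral_Ioc_le[OF measurable_Ioc_continuous[OF fc r1(3)] r1(1)])
    fix \<epsilon> assume \<epsilon>: "0 < \<epsilon>" "\<epsilon> < r1"
    have sub: "{\<epsilon>..r1} \<subseteq> {0<..<R}" using \<epsilon> r1 by auto
    have fi: "continuous_on {\<epsilon>..r1} (\<lambda>r. 1 / (r ^ (n - 1) * V r))"
      by (rule continuous_on_subset[OF fc sub])
    have "(\<integral>\<^sup>+r\<in>{\<epsilon>..r1}. ennreal (1 / (r ^ (n - 1) * V r)) \<partial>lborel) = ennreal (integral {\<epsilon>..r1} (\<lambda>r. 1 / (r ^ (n - 1) * V r)))"
    proof (rule nn_integral_Icc_continuous[OF fi])
      fix r assume "\<epsilon> \<le> r" "r \<le> r1"
      with pos[of r] \<epsilon> r1 show "0 \<le> 1 / (r ^ (n - 1) * V r)" by simp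
    qed
    also have "integral {\<epsilon>..r1} (\<lambda>r. 1 / (r ^ (n - 1) * V r)) \<le> y r1 / \<delta>"
    proof -
      have i1: "((\<lambda>r. deriv y r / \<delta>) has_integral (y r1 / \<delta> - y \<epsilon> / \<delta>)) {\<epsilon>..r1}"
      proof (rule has_integral_DERIV)
        fix r assume "\<epsilon> \<le> r" "r \<le> r1"
        then have r: "r \<in> {0<..<R}" using sub by auto
        show "((\<lambda>r. y r / \<delta>) has_real_derivative deriv y r / \<delta>) (at r)"
          using DERIV_bessel_flux(1)[OF n ode r V[OF r] V0[OF r]] by (rule DERIV_cdivide)
      qed (use \<epsilon> in auto)
      have i2: "((\<lambda>r. 1 / (r ^ (n - 1) * V r)) has_integral integral {\<epsilon>..r1} (\<lambda>r. 1 / (r ^ (n - 1) * V r))) {\<epsilon>..r1}"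
        by (intro integrable_integral integrable_continuous_real fi)
      have i3: "1 / (r ^ (n - 1) * V r) \<le> deriv y r / \<delta>" if "r \<in> {\<epsilon>..r1}" for r
      proof -
        have "r \<in> {0<..<R}" using that sub by auto
        from pos[OF this] zge[of r] that \<epsilon> \<delta> show ?thesis by (simp add: field_simps)
      qed
      have "integral {\<epsilon>..r1} (\<lambda>r. 1 / (r ^ (n - 1) * V r)) \<le> y r1 / \<delta> - y \<epsilon> / \<delta>"
        by (rule has_integral_le[OF i2 i1 i3])
      moreover have "y \<epsilon> / \<delta> > 0" using y0[of \<epsilon>] \<epsilon> r1 \<delta> by auto
      ultimately show ?thesis by linarith
    qed
    finally show "(\<integral>\<^sup>+r\<in>{\<epsilon>..r1}. ennreal (1 / (r ^ (n - 1) * V r)) \<partial>lborel) \<le> ennreal (y r1 / \<delta>)"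
      by (simp add: ennreal_leI)
  qed
  moreover have "(\<integral>\<^sup>+r\<in>{0<..<r1}. ennreal (1 / (r ^ (n - 1) * V r)) \<partial>lborel) = \<infinity>"
    using div r1 by (auto simp: diverges_at_zero_def)
  moreover have "(\<integral>\<^sup>+r\<in>{0<..<r1}. ennreal (1 / (r ^ (n - 1) * V r)) \<partial>lborel)
     \<le> (\<integral>\<^sup>+r\<in>{0<..r1}. ennreal (1 / (r ^ (n - 1) * V r)) \<partial>lborel)"
    by (intro nn_integral_mono) (auto simp: indicator_def)
  ultimately show False by (simp add: top_unique)
qed

text \<open>With \<open>h = p y' / y < 0\<close>, where \<open>p = r\<^sup>n\<^sup>-\<^sup>1 V\<close>, the Riccati equation for \<open>h\<close> turns
  \<open>p v'\<^sup>2 - c q v\<^sup>2 - (h v\<^sup>2)'\<close> into the square \<open>(p v' - h v)\<^sup>2 / p\<close>.\<close>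

lemma hardy_ray:
  assumes n: "n \<ge> (1::nat)" and c: "c > 0" and ode: "bessel_ode n R V W c y"
    and V: "\<And>r. r \<in> {0<..<R} \<Longrightarrow> (V has_real_derivative deriv V r) (at r)"
    and V0: "\<And>r. r \<in> {0<..<R} \<Longrightarrow> V r > 0" and W0: "\<And>r. r \<in> {0<..<R} \<Longrightarrow> W r > 0"
    and Wc: "continuous_on {0<..<R} W"
    and y0: "\<And>r. r \<in> {0<..<R} \<Longrightarrow> y r > 0"
    and div: "diverges_at_zero R (\<lambda>r. 1 / (r ^ (n - 1) * V r))"
    and v: "\<And>r. r \<in> {0<..<R} \<Longrightarrow> (v has_real_derivative v1 r) (at r)"
    and v1: "continuous_on {0<..<R} v1"
    and \<rho>: "0 < \<rho>" "\<rho> < R" and v0: "\<And>r. \<rho> \<le> r \<Longrightarrow> r < R \<Longrightarrow> v r = 0"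
  shows "ennreal c * (\<integral>\<^sup>+r\<in>{0<..<R}. ennreal (r ^ (n - 1) * W r * (v r)\<^sup>2) \<partial>lborel)
     \<le> (\<integral>\<^sup>+r\<in>{0<..<R}. ennreal (r ^ (n - 1) * V r * (v1 r)\<^sup>2) \<partial>lborel)"
proof -
  define p where "p r = r ^ (n - 1) * V r" for r
  define q where "q r = r ^ (n - 1) * W r" for r
  define h where "h r = p r * deriv y r / y r" for r
  have p0: "p r > 0" and q0: "q r > 0" if "r \<in> {0<..<R}" for r
    using that V0 W0 by (auto simp: p_def q_def)
  have contI: "continuous_on {0<..<R} f" if "\<And>r. r \<in> {0<..<R} \<Longrightarrow> (f has_real_derivative f1 r) (at r)" for f f1
    using that by (meson DERIV_isCont continuous_at_imp_continuous_on)
  have pc: "continuous_on {0<..<R} p" unfolding p_def by (intro continuous_intros contI[OF V])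
  have qc: "continuous_on {0<..<R} q" unfolding q_def by (intro continuous_intros Wc)
  have vc: "continuous_on {0<..<R} v" by (rule contI[OF v])
  have h: "(h has_real_derivative - (c * q r) - (h r)\<^sup>2 / p r) (at r)" if r: "r \<in> {0<..<R}" for r
  proof -
    have "((\<lambda>r. p r * deriv y r / y r) has_real_derivative
       (- (c * q r * y r) * y r - (p r * deriv y r) * deriv y r) / (y r * y r)) (at r)"
      using DERIV_bessel_flux[OF n ode r V[OF r] V0[OF r]] y0[OF r] unfolding p_def q_def
      by (intro DERIV_divide) auto
    moreover have "(- (c * q r * y r) * y r - (p r * deriv y r) * deriv y r) / (y r * y r) = - (c * q r) - (h r)\<^sup>2 / p r"
      using y0[OF r] p0[OF r] by (simp add: h_def field_simps power2_eq_square)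
    ultimately show ?thesis unfolding h_def[abs_def] by simp
  qed
  have hneg: "h r < 0" if r: "r \<in> {0<..<R}" for r
    using bessel_flux_neg[OF n c ode V V0 W0 y0 div r] p0[OF r] y0[OF r]
    by (auto simp: h_def divide_less_0_iff mult_less_0_iff)
  have c1: "continuous_on {0<..<R} (\<lambda>r. c * (q r * (v r)\<^sup>2))" by (intro continuous_intros qc vc)
  have c2: "continuous_on {0<..<R} (\<lambda>r. p r * (v1 r)\<^sup>2)" by (intro continuous_intros pc v1)
  have main: "(\<integral>\<^sup>+r\<in>{0<..\<rho>}. ennreal (c * (q r * (v r)\<^sup>2)) \<partial>lborel) \<le> (\<integral>\<^sup>+r\<in>{0<..<R}. ennreal (p r * (v1 r)\<^sup>2) \<partial>lborel)"
  proof (rule nn_integral_Ioc_le[OF measurable_Ioc_continuous[OF c1 \<rho>(2)] \<rho>(1)])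
    fix \<epsilon> assume \<epsilon>: "0 < \<epsilon>" "\<epsilon> < \<rho>"
    have sub: "{\<epsilon>..\<rho>} \<subseteq> {0<..<R}" using \<epsilon> \<rho> by auto
    note cs = continuous_on_subset[OF _ sub]
    have hd: "((\<lambda>r. h r * (v r)\<^sup>2) has_real_derivative
        (- (c * q r) - (h r)\<^sup>2 / p r) * (v r)\<^sup>2 + h r * (2 * v r * v1 r)) (at r)" if "r \<in> {0<..<R}" for r
      using h[OF that] v[OF that] by (auto intro!: derivative_eq_intros)
    have j1: "((\<lambda>r. (- (c * q r) - (h r)\<^sup>2 / p r) * (v r)\<^sup>2 + h r * (2 * v r * v1 r)) has_integral
        (h \<rho> * (v \<rho>)\<^sup>2 - h \<epsilon> * (v \<epsilon>)\<^sup>2)) {\<epsilon>..\<rho>}"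
    proof (rule has_integral_DERIV)
      fix r assume "\<epsilon> \<le> r" "r \<le> \<rho>"
      then show "((\<lambda>r. h r * (v r)\<^sup>2) has_real_derivative
        (- (c * q r) - (h r)\<^sup>2 / p r) * (v r)\<^sup>2 + h r * (2 * v r * v1 r)) (at r)"
        using \<epsilon> \<rho> by (intro hd) auto
    qed (use \<epsilon> in auto)
    have j2: "((\<lambda>r. p r * (v1 r)\<^sup>2 - c * (q r * (v r)\<^sup>2)) has_integral
        (integral {\<epsilon>..\<rho>} (\<lambda>r. p r * (v1 r)\<^sup>2) - integral {\<epsilon>..\<rho>} (\<lambda>r. c * (q r * (v r)\<^sup>2)))) {\<epsilon>..\<rho>}"
      by (intro has_integral_diff integrable_integral integrable_continuous_real cs c1 c2)
    have j3: "(- (c * q r) - (h r)\<^sup>2 / p r) * (v r)\<^sup>2 + h r * (2 * v r * v1 r)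
        \<le> p r * (v1 r)\<^sup>2 - c * (q r * (v r)\<^sup>2)" if "r \<in> {\<epsilon>..\<rho>}" for r
    proof -
      have "p r > 0" using p0 that sub by auto
      then have "p r * (v1 r)\<^sup>2 - c * (q r * (v r)\<^sup>2) - ((- (c * q r) - (h r)\<^sup>2 / p r) * (v r)\<^sup>2 + h r * (2 * v r * v1 r))
        = (p r * v1 r - h r * v r)\<^sup>2 / p r"
        by (simp add: field_simps power2_eq_square)
      moreover have "(p r * v1 r - h r * v r)\<^sup>2 / p r \<ge> 0" using \<open>p r > 0\<close> by simp
      ultimately show ?thesis by linarith
    qed
    have "h \<rho> * (v \<rho>)\<^sup>2 - h \<epsilon> * (v \<epsilon>)\<^sup>2 \<le> integral {\<epsilon>..\<rho>} (\<lambda>r. p r * (v1 r)\<^sup>2) - integral {\<epsilon>..\<rho>} (\<lambda>r. c * (q r * (v r)\<^sup>2))"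
      by (rule has_integral_le[OF j1 j2 j3])
    \<comment> \<open>At \<open>\<epsilon>\<close> only the sign of \<open>h\<close> is available,
      since \<open>v\<close> need not be small near the origin; at \<open>\<rho>\<close> the
      function \<open>v\<close> vanishes.\<close>
    moreover have "h \<rho> * (v \<rho>)\<^sup>2 - h \<epsilon> * (v \<epsilon>)\<^sup>2 \<ge> 0"
    proof -
      have "h \<epsilon> * (v \<epsilon>)\<^sup>2 \<le> 0" using hneg[of \<epsilon>] \<epsilon> \<rho> by (intro mult_nonpos_nonneg) auto
      moreover have "v \<rho> = 0" using v0 \<rho> by auto
      ultimately show ?thesis by simp
    qed
    ultimately have le: "integral {\<epsilon>..\<rho>} (\<lambda>r. c * (q r * (v r)\<^sup>2)) \<le> integral {\<epsilon>..\<rho>} (\<lambda>r. p r * (v1 r)\<^sup>2)" by linarith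
    have "(\<integral>\<^sup>+r\<in>{\<epsilon>..\<rho>}. ennreal (c * (q r * (v r)\<^sup>2)) \<partial>lborel) = ennreal (integral {\<epsilon>..\<rho>} (\<lambda>r. c * (q r * (v r)\<^sup>2)))"
    proof (rule nn_integral_Icc_continuous[OF cs[OF c1]])
      fix r assume "\<epsilon> \<le> r" "r \<le> \<rho>"
      with q0[of r] c \<epsilon> \<rho> show "0 \<le> c * (q r * (v r)\<^sup>2)" by simp
    qed
    also have "\<dots> \<le> ennreal (integral {\<epsilon>..\<rho>} (\<lambda>r. p r * (v1 r)\<^sup>2))" using le by (rule ennreal_leI)
    also have "\<dots> = (\<integral>\<^sup>+r\<in>{\<epsilon>..\<rho>}. ennreal (p r * (v1 r)\<^sup>2) \<partial>lborel)"
    proof (rule nn_integral_Icc_continuous[OF cs[OF c2], symmetric])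
      fix r assume "\<epsilon> \<le> r" "r \<le> \<rho>"
      with p0[of r] \<epsilon> \<rho> show "0 \<le> p r * (v1 r)\<^sup>2" by simp
    qed
    also have "\<dots> \<le> (\<integral>\<^sup>+r\<in>{0<..<R}. ennreal (p r * (v1 r)\<^sup>2) \<partial>lborel)"
      using sub by (intro nn_integral_mono) (auto simp: indicator_def)
    finally show "(\<integral>\<^sup>+r\<in>{\<epsilon>..\<rho>}. ennreal (c * (q r * (v r)\<^sup>2)) \<partial>lborel) \<le> (\<integral>\<^sup>+r\<in>{0<..<R}. ennreal (p r * (v1 r)\<^sup>2) \<partial>lborel)" .
  qed
  have m: "(\<lambda>r. ennreal (q r * (v r)\<^sup>2) * indicator {0<..\<rho>} r) \<in> borel_measurable borel"
    by (intro measurable_Ioc_continuous[OF _ \<rho>(2)] continuous_intros qc vc)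
  have "ennreal c * (\<integral>\<^sup>+r\<in>{0<..<R}. ennreal (q r * (v r)\<^sup>2) \<partial>lborel)
      = ennreal c * (\<integral>\<^sup>+r\<in>{0<..\<rho>}. ennreal (q r * (v r)\<^sup>2) \<partial>lborel)"
    by (subst nn_integral_Ioo_vanishing[of \<rho>]) (auto simp: v0 \<rho>)
  also have "\<dots> = (\<integral>\<^sup>+r\<in>{0<..\<rho>}. ennreal (c * (q r * (v r)\<^sup>2)) \<partial>lborel)"
    using c m by (subst nn_integral_cmult[symmetric]) (auto simp: ennreal_mult' mult_ac)
  finally show ?thesis using main unfolding p_def q_def by simp
qed

text \<open>Otherwise X' > \<delta> / r^n \<ge> \<delta> / r for all small r, so X - \<delta> ln r
  increases and X falls below every bound as r tends to 0, against positivity.\<close>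

lemma small_slope:
  fixes X X1 :: "real \<Rightarrow> real"
  assumes n: "n \<ge> (1::nat)" and X: "\<And>r. r \<in> {0<..<R} \<Longrightarrow> (X has_real_derivative X1 r) (at r)"
    and X0: "\<And>r. r \<in> {0<..<R} \<Longrightarrow> X r > 0" and \<delta>: "\<delta> > 0" and r0: "0 < r0" "r0 < R"
  shows "\<exists>\<epsilon>. 0 < \<epsilon> \<and> \<epsilon> < r0 \<and> X1 \<epsilon> * \<epsilon> ^ n \<le> \<delta>"
proof (rule ccontr)
  assume neg: "\<not> ?thesis"
  define s where "s = min r0 1 / 2"
  have s: "0 < s" "s < r0" "s < 1" "s < R" using r0 by (auto simp: s_def min_def)
  \<comment> \<open>Chosen such that \<delta> ln \<epsilon> = \<delta> ln s - X s: monotonicity of X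
    - \<delta> ln r then gives X \<epsilon> < 0.\<close>
  define \<epsilon> where "\<epsilon> = s * exp (- X s / \<delta>)"
  have Xs: "X s > 0" using X0 s by auto
  have "exp (- X s / \<delta>) < 1" using Xs \<delta> by simp
  then have \<epsilon>: "0 < \<epsilon>" "\<epsilon> < s" using s by (auto simp: \<epsilon>_def)
  have "X \<epsilon> - \<delta> * ln \<epsilon> < X s - \<delta> * ln s"
  proof (rule DERIV_pos_imp_increasing[OF \<epsilon>(2)])
    fix r assume "\<epsilon> \<le> r" "r \<le> s"
    then have r: "0 < r" "r < r0" "r \<le> 1" "r \<in> {0<..<R}" using \<epsilon> s by auto
    have "\<delta> < X1 r * r ^ n" using neg r by (auto simp: not_le)
    moreover have "r ^ n \<le> r" using power_decreasing[of 1 n r] n r by simp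
    moreover have "X1 r > 0" using calculation(1) \<delta> r
      by (smt (verit) mult_nonpos_nonneg zero_le_power)
    ultimately have "\<delta> < X1 r * r"
      by (smt (verit) mult_left_mono)
    then have "X1 r - \<delta> * (1 / r) > 0" using r by (simp add: field_simps)
    moreover have "((\<lambda>r. X r - \<delta> * ln r) has_real_derivative X1 r - \<delta> * (1 / r)) (at r)"
      using X[OF r(4)] r(1) by (auto intro!: derivative_eq_intros)
    ultimately show "\<exists>y. ((\<lambda>r. X r - \<delta> * ln r) has_real_derivative y) (at r) \<and> 0 < y" by blast
  qed
  moreover have "ln \<epsilon> = ln s - X s / \<delta>" using s by (simp add: \<epsilon>_def ln_mult)
  then have "\<delta> * ln \<epsilon> = \<delta> * ln s - X s" using \<delta> by (simp add: field_simps)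
  ultimately have "X \<epsilon> < 0" by linarith
  then show False using X0[of \<epsilon>] \<epsilon> s by auto
qed

lemma set_integrable_bounded_factor:
  fixes J k :: "real \<Rightarrow> real"
  assumes J: "set_integrable lborel {0<..<R} J" and k: "continuous_on {0<..<R} k"
    and M: "\<And>r. r \<in> {0<..<R} \<Longrightarrow> \<bar>k r\<bar> \<le> M"
  shows "set_integrable lborel {0<..<R} (\<lambda>r. J r * k r)"
proof -
  have "integrable lborel (\<lambda>r. M * (indicator {0<..<R} r *\<^sub>R J r))"
    using J by (simp add: set_integrable_def)
  moreover have "(\<lambda>r. (indicator {0<..<R} r *\<^sub>R J r) * (indicator {0<..<R} r *\<^sub>R k r)) \<in> borel_measurable lborel"
  proof -
    have "(\<lambda>r. indicator {0<..<R} r *\<^sub>R k r) \<in> borel_measurable borel"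
      by (intro borel_measurable_continuous_on_indicator k) auto
    moreover have "(\<lambda>r. indicator {0<..<R} r *\<^sub>R J r) \<in> borel_measurable lborel"
      using J unfolding set_integrable_def by (rule borel_measurable_integrable)
    ultimately show ?thesis by simp
  qed
  moreover have "(\<lambda>r. (indicator {0<..<R} r *\<^sub>R J r) * (indicator {0<..<R} r *\<^sub>R k r)) = (\<lambda>r. indicator {0<..<R} r *\<^sub>R (J r * k r))"
    by (auto simp: fun_eq_iff indicator_def)
  ultimately have "integrable lborel (\<lambda>r. indicator {0<..<R} r *\<^sub>R (J r * k r))"
  proof (elim Bochner_Integration.integrable_bound, goal_cases)
    case 1
    then show ?case by simp
  next
    case 2
    show ?case
    proof (intro AE_I2)
      fix r
      show "norm (indicator {0<..<R} r *\<^sub>R (J r * k r)) \<le> norm (M * (indicator {0<..<R} r *\<^sub>R J r))"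
      proof (cases "r \<in> {0<..<R}")
        case True
        from M[OF this] have "\<bar>J r\<bar> * \<bar>k r\<bar> \<le> \<bar>J r\<bar> * \<bar>M\<bar>" by (intro mult_left_mono) auto
        then show ?thesis using True by (simp add: abs_mult mult_ac)
      qed simp
    qed
  qed
  then show ?thesis by (simp add: set_integrable_def)
qed

text \<open>Up to the factor \<open>-V / r\<close>, the integrand below equals \<open>(r\<^sup>n g\<^sup>2)'' - 2 r\<^sup>n g'\<^sup>2\<close>. Two integrations by
  parts move the derivatives to \<open>X = V / r\<close>. The boundary term \<open>X' r\<^sup>n g\<^sup>2\<close> need not tend to zero at
  the origin, but positivity of \<open>X\<close> makes it small or negative along a sequence.\<close>

lemma ray_second_order:
  fixes V W X1 X2 g g1 g2 :: "real \<Rightarrow> real"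
  assumes n: "n \<ge> (1::nat)"
    and V0: "\<And>r. r \<in> {0<..<R} \<Longrightarrow> V r > 0" and W0: "\<And>r. r \<in> {0<..<R} \<Longrightarrow> W r > 0"
    and Vc: "continuous_on {0<..<R} V" and Wc: "continuous_on {0<..<R} W"
    and X1: "\<And>r. r \<in> {0<..<R} \<Longrightarrow> ((\<lambda>r. V r / r) has_real_derivative X1 r) (at r)"
    and X2: "\<And>r. r \<in> {0<..<R} \<Longrightarrow> (X1 has_real_derivative X2 r) (at r)"
    and X2le: "\<And>r. r \<in> {0<..<R} \<Longrightarrow> X2 r \<le> W r / r"
    and hardy: "(\<integral>\<^sup>+r\<in>{0<..<R}. ennreal (r ^ (n - 1) * W r * (g r)\<^sup>2) \<partial>lborel)
       \<le> (\<integral>\<^sup>+r\<in>{0<..<R}. ennreal (r ^ (n - 1) * V r * (g1 r)\<^sup>2) \<partial>lborel)"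
    and J: "set_integrable lborel {0<..<R} (\<lambda>r. r ^ (n - 1) * V r / r\<^sup>2)"
    and lim: "((\<lambda>r. r ^ (n - 1) * V r / r) \<longlongrightarrow> 0) (at_right 0)"
    and g: "\<And>r. r \<in> {0<..<R} \<Longrightarrow> (g has_real_derivative g1 r) (at r)"
    and g1: "\<And>r. r \<in> {0<..<R} \<Longrightarrow> (g1 has_real_derivative g2 r) (at r)"
    and g2: "continuous_on {0<..<R} g2"
    and C: "\<And>r. r \<in> {0<..<R} \<Longrightarrow> \<bar>g r\<bar> \<le> C" "\<And>r. r \<in> {0<..<R} \<Longrightarrow> \<bar>g1 r\<bar> \<le> C"
      "\<And>r. r \<in> {0<..<R} \<Longrightarrow> \<bar>g2 r\<bar> \<le> C"
    and \<rho>: "0 < \<rho>" "\<rho> < R" and z: "\<And>r. \<rho> \<le> r \<Longrightarrow> r < R \<Longrightarrow> g r = 0" "\<And>r. \<rho> \<le> r \<Longrightarrow> r < R \<Longrightarrow> g1 r = 0"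
  defines "F \<equiv> \<lambda>r. r ^ (n - 1) * V r * (- 2 * g r * g2 r - 4 * real n * g r * g1 r / r - real n * (real n - 1) * (g r)\<^sup>2 / r\<^sup>2)"
  shows "set_integrable lborel {0<..<R} F" and "0 \<le> (LINT r:{0<..<R}|lborel. F r)"
    and "(\<integral>\<^sup>+r\<in>{0<..<R}. ennreal (r ^ (n - 1) * W r * (g r)\<^sup>2) \<partial>lborel) \<le> ennreal (LINT r:{0<..<R}|lborel. F r)"
proof -
  define I where "I = {0<..<R}"
  have contI: "continuous_on I f" if "\<And>r. r \<in> I \<Longrightarrow> (f has_real_derivative f1 r) (at r)" for f f1
    using that by (meson DERIV_isCont continuous_at_imp_continuous_on)
  have gc: "continuous_on I g" and g1c: "continuous_on I g1"
    by (rule contI[OF g[folded I_def]], assumption) (rule contI[OF g1[folded I_def]], assumption)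
  have R0: "R > 0" using \<rho> by simp
  have C0: "C \<ge> 0" using C(1)[of \<rho>] \<rho> by auto
  define J where "J r = r ^ (n - 1) * V r / r\<^sup>2" for r
  define q where "q r = r ^ (n - 1) * W r * (g r)\<^sup>2" for r
  define A where "A r = r ^ (n - 1) * V r * (g1 r)\<^sup>2" for r
  \<comment> \<open>This is r^n g^2, written with an explicit constant weight so that
    \<open>DERIV_weighted_flux\<close> applies; \<open>\<Phi>1\<close> and \<open>\<Phi>2\<close>
    are its first two derivatives.\<close>
  define \<Phi> where "\<Phi> r = r ^ (n - 1) * 1 * (r * (g r)\<^sup>2)" for r
  define \<Phi>1 where "\<Phi>1 r = r ^ (n - 1) * 1 * (real n * (g r)\<^sup>2 + 2 * r * g r * g1 r)" for r
  define \<Phi>2 where "\<Phi>2 r = r ^ (n - 1) * (real n * (real n - 1) * (g r)\<^sup>2 / r + 4 * real n * g r * g1 r + 2 * r * ((g1 r)\<^sup>2 + g r * g2 r))" for r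
  have b2: "\<bar>a * b\<bar> \<le> C\<^sup>2" if "\<bar>a\<bar> \<le> C" "\<bar>b\<bar> \<le> C" for a b
    unfolding abs_mult power2_eq_square using that C0 by (intro mult_mono) auto
  have J': "set_integrable lborel {0<..<R} J" using J by (simp add: J_def[abs_def])
  \<comment> \<open>The integrands \<open>F\<close> and \<open>A\<close> are the integrable
    \<open>J\<close> times a quadratic expression in \<open>g\<close>, \<open>g1\<close>,
    \<open>g2\<close> with coefficients polynomial in r; this bounds the second factor.\<close>
  have bnd: "\<bar>c1 * r * r * x + c2 * r * y + c3 * w\<bar> \<le> \<bar>c1\<bar> * R * R * C\<^sup>2 + \<bar>c2\<bar> * R * C\<^sup>2 + \<bar>c3\<bar> * C\<^sup>2"
    if "r \<in> {0<..<R}" "\<bar>x\<bar> \<le> C\<^sup>2" "\<bar>y\<bar> \<le> C\<^sup>2" "\<bar>w\<bar> \<le> C\<^sup>2" for c1 c2 c3 r x y w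
  proof -
    have "\<bar>c1 * r * r * x + c2 * r * y + c3 * w\<bar> \<le> \<bar>c1 * r * r * x\<bar> + \<bar>c2 * r * y\<bar> + \<bar>c3 * w\<bar>" by linarith
    also have "\<dots> \<le> \<bar>c1\<bar> * R * R * C\<^sup>2 + \<bar>c2\<bar> * R * C\<^sup>2 + \<bar>c3\<bar> * C\<^sup>2"
      unfolding abs_mult using that by (intro add_mono mult_mono) auto
    finally show ?thesis .
  qed
  have "set_integrable lborel {0<..<R} (\<lambda>r. J r * ((- 2) * r * r * (g r * g2 r) + (- 4 * real n) * r * (g r * g1 r) + (- (real n * (real n - 1))) * (g r * g r)))"
  proof (rule set_integrable_bounded_factor[OF J'])
    show "continuous_on {0<..<R} (\<lambda>r. (- 2) * r * r * (g r * g2 r) + (- 4 * real n) * r * (g r * g1 r) + (- (real n * (real n - 1))) * (g r * g r))"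
      by (intro continuous_intros gc[unfolded I_def] g1c[unfolded I_def] g2)
    fix r assume "r \<in> {0<..<R}"
    then show "\<bar>(- 2) * r * r * (g r * g2 r) + (- 4 * real n) * r * (g r * g1 r) + (- (real n * (real n - 1))) * (g r * g r)\<bar>
        \<le> \<bar>- 2\<bar> * R * R * C\<^sup>2 + \<bar>- 4 * real n\<bar> * R * C\<^sup>2 + \<bar>- (real n * (real n - 1))\<bar> * C\<^sup>2"
      by (intro bnd b2 C)
  qed
  moreover have "J r * ((- 2) * r * r * (g r * g2 r) + (- 4 * real n) * r * (g r * g1 r) + (- (real n * (real n - 1))) * (g r * g r)) = F r"
    if "r \<in> {0<..<R}" for r
    using that by (simp add: J_def F_def field_simps power2_eq_square)
  ultimately show Fi: "set_integrable lborel {0<..<R} F"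
    using set_integrable_cong[of lborel lborel "{0<..<R}" "{0<..<R}"] by (metis (no_types, lifting))
  have Ai: "set_integrable lborel {0<..<R} A"
  proof -
    have "set_integrable lborel {0<..<R} (\<lambda>r. J r * (1 * r * r * (g1 r * g1 r) + 0 * r * (g1 r * g1 r) + 0 * (g1 r * g1 r)))"
    proof (rule set_integrable_bounded_factor[OF J'])
      show "continuous_on {0<..<R} (\<lambda>r. 1 * r * r * (g1 r * g1 r) + 0 * r * (g1 r * g1 r) + 0 * (g1 r * g1 r))"
        by (intro continuous_intros g1c[unfolded I_def])
      fix r assume "r \<in> {0<..<R}"
      then show "\<bar>1 * r * r * (g1 r * g1 r) + 0 * r * (g1 r * g1 r) + 0 * (g1 r * g1 r)\<bar>
          \<le> \<bar>1\<bar> * R * R * C\<^sup>2 + \<bar>0\<bar> * R * C\<^sup>2 + \<bar>0\<bar> * C\<^sup>2"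
        by (intro bnd b2 C)
    qed
    moreover have "J r * (1 * r * r * (g1 r * g1 r) + 0 * r * (g1 r * g1 r) + 0 * (g1 r * g1 r)) = A r" if "r \<in> {0<..<R}" for r
      using that by (simp add: J_def A_def field_simps power2_eq_square)
    ultimately show ?thesis
      using set_integrable_cong[of lborel lborel "{0<..<R}" "{0<..<R}"] by (metis (no_types, lifting))
  qed
  define P where "P r = V r / r * \<Phi>2 r" for r
  have FP: "F r = 2 * A r - P r" if "r \<in> {0<..<R}" for r
    using that by (simp add: F_def A_def P_def \<Phi>2_def field_simps power2_eq_square)
  have Pi: "set_integrable lborel {0<..<R} P"
  proof -
    have "set_integrable lborel {0<..<R} (\<lambda>r. 2 * A r - F r)"
      using Ai Fi by (intro set_integral_diff set_integrable_mult_right) auto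
    moreover have "2 * A r - F r = P r" if "r \<in> {0<..<R}" for r using FP[OF that] by simp
    ultimately show ?thesis
      using set_integrable_cong[of lborel lborel "{0<..<R}" "{0<..<R}"] by (metis (no_types, lifting))
  qed
  have A0: "A r \<ge> 0" and q0: "q r \<ge> 0" if "r \<in> {0<..<R}" for r
    using V0[OF that] W0[OF that] that by (auto simp: A_def q_def)
  have Ann: "(\<integral>\<^sup>+r\<in>{0<..<R}. ennreal (A r) \<partial>lborel) = ennreal (LINT r:{0<..<R}|lborel. A r)"
  proof -
    have "(\<integral>\<^sup>+r\<in>{0<..<R}. ennreal (A r) \<partial>lborel) = (\<integral>\<^sup>+r. ennreal (indicator {0<..<R} r *\<^sub>R A r) \<partial>lborel)"
      by (intro nn_integral_cong) (auto simp: indicator_def)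
    also have "\<dots> = ennreal (LINT r:{0<..<R}|lborel. A r)"
      unfolding set_lebesgue_integral_def using Ai A0
      by (intro nn_integral_eq_integral) (auto simp: set_integrable_def indicator_def)
    finally show ?thesis .
  qed
  have qc: "continuous_on I q" unfolding q_def I_def using Wc gc[unfolded I_def] by (intro continuous_intros)
  have qnn: "(\<integral>\<^sup>+r. ennreal (indicator {0<..<R} r *\<^sub>R q r) \<partial>lborel) = (\<integral>\<^sup>+r\<in>{0<..<R}. ennreal (q r) \<partial>lborel)"
    by (intro nn_integral_cong) (auto simp: indicator_def)
  have qle: "(\<integral>\<^sup>+r\<in>{0<..<R}. ennreal (q r) \<partial>lborel) \<le> ennreal (LINT r:{0<..<R}|lborel. A r)"
    using hardy Ann unfolding q_def A_def by simp
  have qi: "set_integrable lborel {0<..<R} q"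
    unfolding set_integrable_def
  proof (rule integrableI_nonneg)
    show "(\<lambda>r. indicator {0<..<R} r *\<^sub>R q r) \<in> borel_measurable lborel"
      using borel_measurable_continuous_on_indicator[of "{0<..<R}" q] qc by (simp add: I_def)
    show "AE r in lborel. 0 \<le> indicator {0<..<R} r *\<^sub>R q r"
      using q0 by (intro AE_I2) (auto simp: indicator_def)
    show "(\<integral>\<^sup>+r. ennreal (indicator {0<..<R} r *\<^sub>R q r) \<partial>lborel) < \<infinity>"
      unfolding qnn using qle by (rule order.strict_trans1) simp
  qed
  define K where "K = (LINT r:{0<..<R}|lborel. q r)"
  have qK: "(\<integral>\<^sup>+r\<in>{0<..<R}. ennreal (q r) \<partial>lborel) = ennreal K"
    unfolding qnn[symmetric] K_def set_lebesgue_integral_def using qi q0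
    by (intro nn_integral_eq_integral) (auto simp: set_integrable_def indicator_def)
  have K0: "K \<ge> 0" unfolding K_def set_lebesgue_integral_def
    by (rule Bochner_Integration.integral_nonneg) (use q0 in \<open>auto simp: indicator_def\<close>)
  have LA0: "(LINT r:{0<..<R}|lborel. A r) \<ge> 0" unfolding set_lebesgue_integral_def
    by (rule Bochner_Integration.integral_nonneg) (use A0 in \<open>auto simp: indicator_def\<close>)
  have KA: "K \<le> (LINT r:{0<..<R}|lborel. A r)"
    using qle LA0 unfolding qK by (simp add: ennreal_le_iff)
  have \<Phi>d: "(\<Phi> has_real_derivative \<Phi>1 r) (at r)" if "r \<in> {0<..<R}" for r
  proof -
    have "((\<lambda>r. r * (g r)\<^sup>2) has_real_derivative (g r)\<^sup>2 + 2 * r * g r * g1 r) (at r)"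
      using g[OF that] by (auto intro!: derivative_eq_intros)
    from DERIV_weighted_flux[OF n _ DERIV_const[of 1] this] that
    have "(\<Phi> has_real_derivative r ^ (n - 1) * 1 * ((g r)\<^sup>2 + 2 * r * g r * g1 r + ((real n - 1) / r + 0 / 1) * (r * (g r)\<^sup>2))) (at r)"
      unfolding \<Phi>_def[abs_def] by auto
    moreover have "r ^ (n - 1) * 1 * ((g r)\<^sup>2 + 2 * r * g r * g1 r + ((real n - 1) / r + 0 / 1) * (r * (g r)\<^sup>2)) = \<Phi>1 r"
      using that by (simp add: \<Phi>1_def field_simps)
    ultimately show ?thesis by simp
  qed
  have \<Phi>1d: "(\<Phi>1 has_real_derivative \<Phi>2 r) (at r)" if "r \<in> {0<..<R}" for r
  proof -
    have "((\<lambda>r. real n * (g r)\<^sup>2 + 2 * r * g r * g1 r) has_real_derivative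
       2 * real n * g r * g1 r + 2 * g r * g1 r + 2 * r * ((g1 r)\<^sup>2 + g r * g2 r)) (at r)"
      using g[OF that] g1[OF that] by (auto intro!: derivative_eq_intros simp: algebra_simps power2_eq_square)
    from DERIV_weighted_flux[OF n _ DERIV_const[of 1] this] that
    have "(\<Phi>1 has_real_derivative r ^ (n - 1) * 1 * (2 * real n * g r * g1 r + 2 * g r * g1 r + 2 * r * ((g1 r)\<^sup>2 + g r * g2 r)
       + ((real n - 1) / r + 0 / 1) * (real n * (g r)\<^sup>2 + 2 * r * g r * g1 r))) (at r)"
      unfolding \<Phi>1_def[abs_def] by auto
    moreover have "r ^ (n - 1) * 1 * (2 * real n * g r * g1 r + 2 * g r * g1 r + 2 * r * ((g1 r)\<^sup>2 + g r * g2 r)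
       + ((real n - 1) / r + 0 / 1) * (real n * (g r)\<^sup>2 + 2 * r * g r * g1 r)) = \<Phi>2 r"
      using that by (simp add: \<Phi>2_def field_simps)
    ultimately show ?thesis by simp
  qed
  have Pc: "continuous_on I P"
    unfolding P_def \<Phi>2_def I_def using Vc gc g1c g2 by (intro continuous_intros) (auto simp: I_def)
  \<comment> \<open>Green's identity on the interval from \<open>\<epsilon>\<close> to
    \<open>\<rho>\<close> moves both derivatives to V / r, where the bound on \<open>X2\<close>
    applies. The boundary at \<open>\<rho>\<close> disappears with \<open>g\<close>; at
    \<open>\<epsilon>\<close> the term with \<open>X1\<close> is kept, and the other is bounded by a
    multiple of the quantity that \<open>lim\<close> sends to 0.\<close>
  have step: "(LINT r:{\<epsilon>..\<rho>}|lborel. P r) \<le> K + (X1 \<epsilon> * \<epsilon> ^ n) * (g \<epsilon>)\<^sup>2 + (\<epsilon> ^ (n - 1) * V \<epsilon> / \<epsilon>) * ((real n + 2 * R) * C\<^sup>2)"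
    if \<epsilon>: "0 < \<epsilon>" "\<epsilon> < \<rho>" for \<epsilon>
  proof -
    have sub: "{\<epsilon>..\<rho>} \<subseteq> I" using \<epsilon> \<rho> by (auto simp: I_def)
    note cs = continuous_on_subset[OF _ sub]
    have i1: "((\<lambda>r. X2 r * \<Phi> r - P r) has_integral
       ((X1 \<rho> * \<Phi> \<rho> - V \<rho> / \<rho> * \<Phi>1 \<rho>) - (X1 \<epsilon> * \<Phi> \<epsilon> - V \<epsilon> / \<epsilon> * \<Phi>1 \<epsilon>))) {\<epsilon>..\<rho>}"
    proof (rule has_integral_DERIV)
      fix r assume "\<epsilon> \<le> r" "r \<le> \<rho>"
      then have r: "r \<in> {0<..<R}" using \<epsilon> \<rho> by auto
      show "((\<lambda>r. X1 r * \<Phi> r - V r / r * \<Phi>1 r) has_real_derivative X2 r * \<Phi> r - P r) (at r)"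
        using DERIV_diff[OF DERIV_mult[OF X2[OF r] \<Phi>d[OF r]] DERIV_mult[OF X1[OF r] \<Phi>1d[OF r]]]
        by (simp add: P_def algebra_simps)
    qed (use \<epsilon> in auto)
    have i2: "((\<lambda>r. q r - P r) has_integral (integral {\<epsilon>..\<rho>} q - integral {\<epsilon>..\<rho>} P)) {\<epsilon>..\<rho>}"
      by (intro has_integral_diff integrable_integral integrable_continuous_real cs qc Pc)
    have i3: "X2 r * \<Phi> r - P r \<le> q r - P r" if "r \<in> {\<epsilon>..\<rho>}" for r
    proof -
      have r: "r \<in> {0<..<R}" using that sub by (auto simp: I_def)
      have "X2 r * \<Phi> r \<le> W r / r * \<Phi> r"
        using X2le[OF r] r by (intro mult_right_mono) (auto simp: \<Phi>_def)
      also have "W r / r * \<Phi> r = q r" using r by (simp add: \<Phi>_def q_def)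
      finally show ?thesis by simp
    qed
    have "(X1 \<rho> * \<Phi> \<rho> - V \<rho> / \<rho> * \<Phi>1 \<rho>) - (X1 \<epsilon> * \<Phi> \<epsilon> - V \<epsilon> / \<epsilon> * \<Phi>1 \<epsilon>) \<le> integral {\<epsilon>..\<rho>} q - integral {\<epsilon>..\<rho>} P"
      by (rule has_integral_le[OF i1 i2 i3])
    moreover have "\<Phi> \<rho> = 0" "\<Phi>1 \<rho> = 0" using z(1)[of \<rho>] \<rho> by (auto simp: \<Phi>_def \<Phi>1_def)
    ultimately have le: "integral {\<epsilon>..\<rho>} P \<le> integral {\<epsilon>..\<rho>} q + X1 \<epsilon> * \<Phi> \<epsilon> - V \<epsilon> / \<epsilon> * \<Phi>1 \<epsilon>" by simp
    have s: "{\<epsilon>..\<rho>} \<subseteq> {0<..<R}" using sub by (simp add: I_def)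
    have "set_integrable lborel {\<epsilon>..\<rho>} P" "set_integrable lborel {\<epsilon>..\<rho>} q"
      using Pi qi s by (auto intro: set_integrable_subset)
    then have e: "integral {\<epsilon>..\<rho>} P = (LINT r:{\<epsilon>..\<rho>}|lborel. P r)" "integral {\<epsilon>..\<rho>} q = (LINT r:{\<epsilon>..\<rho>}|lborel. q r)"
      by (simp_all add: set_borel_integral_eq_integral)
    have qm: "(LINT r:{\<epsilon>..\<rho>}|lborel. q r) \<le> K"
      unfolding K_def set_lebesgue_integral_def
      using qi set_integrable_subset[OF qi _ s] q0 s
      by (intro integral_mono) (auto simp: set_integrable_def indicator_def)
    have "r ^ (n - 1) * r = r ^ n" for r :: real using n by (cases n) auto
    then have p1: "X1 \<epsilon> * \<Phi> \<epsilon> = (X1 \<epsilon> * \<epsilon> ^ n) * (g \<epsilon>)\<^sup>2"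
      by (simp add: \<Phi>_def mult.assoc[symmetric])
    have p2: "- (V \<epsilon> / \<epsilon> * \<Phi>1 \<epsilon>) \<le> (\<epsilon> ^ (n - 1) * V \<epsilon> / \<epsilon>) * ((real n + 2 * R) * C\<^sup>2)"
    proof -
      have \<epsilon>I: "\<epsilon> \<in> {0<..<R}" using \<epsilon> \<rho> by auto
      have "- (2 * \<epsilon> * (g \<epsilon> * g1 \<epsilon>)) \<le> 2 * R * C\<^sup>2"
      proof -
        have "\<bar>g \<epsilon> * g1 \<epsilon>\<bar> \<le> C\<^sup>2" using C \<epsilon>I by (intro b2) auto
        then have "(2 * \<epsilon>) * \<bar>g \<epsilon> * g1 \<epsilon>\<bar> \<le> (2 * R) * C\<^sup>2" using \<epsilon> \<rho> by (intro mult_mono) auto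
        then show ?thesis using \<epsilon> abs_ge_minus_self[of "2 * \<epsilon> * (g \<epsilon> * g1 \<epsilon>)"] by (simp add: abs_mult)
      qed
      moreover have "real n * (g \<epsilon>)\<^sup>2 \<ge> 0" "real n * C\<^sup>2 \<ge> 0" by auto
      moreover have "2 * \<epsilon> * g \<epsilon> * g1 \<epsilon> = 2 * \<epsilon> * (g \<epsilon> * g1 \<epsilon>)" by simp
      moreover have "(real n + 2 * R) * C\<^sup>2 = real n * C\<^sup>2 + 2 * R * C\<^sup>2" by (simp add: distrib_right)
      ultimately have "- (real n * (g \<epsilon>)\<^sup>2 + 2 * \<epsilon> * g \<epsilon> * g1 \<epsilon>) \<le> (real n + 2 * R) * C\<^sup>2"
        by linarith
      then have "(\<epsilon> ^ (n - 1) * V \<epsilon> / \<epsilon>) * - (real n * (g \<epsilon>)\<^sup>2 + 2 * \<epsilon> * g \<epsilon> * g1 \<epsilon>)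
          \<le> (\<epsilon> ^ (n - 1) * V \<epsilon> / \<epsilon>) * ((real n + 2 * R) * C\<^sup>2)"
        using V0[OF \<epsilon>I] \<epsilon> by (intro mult_left_mono) auto
      moreover have "- (V \<epsilon> / \<epsilon> * \<Phi>1 \<epsilon>) = (\<epsilon> ^ (n - 1) * V \<epsilon> / \<epsilon>) * - (real n * (g \<epsilon>)\<^sup>2 + 2 * \<epsilon> * g \<epsilon> * g1 \<epsilon>)"
      proof -
        have "- (a / e * (b * 1 * u)) = (b * a / e) * - u" for a b e u :: real by (simp add: divide_inverse mult_ac)
        then show ?thesis unfolding \<Phi>1_def .
      qed
      ultimately show ?thesis by simp
    qed
    show ?thesis using le qm p1 p2 unfolding e by linarith
  qed
  \<comment> \<open>The estimate is used only along radii where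
    \<open>X1 \<epsilon> * \<epsilon> ^ n\<close> is at most 1 / (j + 1); dominated convergence
    along the same sequence recovers the integral over (0, R).\<close>
  have "\<exists>\<epsilon>. 0 < \<epsilon> \<and> \<epsilon> < min \<rho> (1 / real (Suc j)) \<and> X1 \<epsilon> * \<epsilon> ^ n \<le> 1 / real (Suc j)" for j
  proof (rule small_slope[OF n X1])
    show "V r / r > 0" if "r \<in> {0<..<R}" for r using V0[OF that] that by simp
    show "0 < min \<rho> (1 / real (Suc j))" "min \<rho> (1 / real (Suc j)) < R" using \<rho> by auto
  qed auto
  then have "\<forall>j. \<exists>\<epsilon>. 0 < \<epsilon> \<and> \<epsilon> < min \<rho> (1 / real (Suc j)) \<and> X1 \<epsilon> * \<epsilon> ^ n \<le> 1 / real (Suc j)" ..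
  from choice[OF this] obtain e where e': "\<forall>j. 0 < e j \<and> e j < min \<rho> (1 / real (Suc j)) \<and> X1 (e j) * e j ^ n \<le> 1 / real (Suc j)" ..
  then have e: "0 < e j" "e j < min \<rho> (1 / real (Suc j))" "X1 (e j) * e j ^ n \<le> 1 / real (Suc j)" for j
    by blast+
  have inv0: "(\<lambda>j. 1 / real (Suc j)) \<longlonglongrightarrow> 0"
    using LIMSEQ_inverse_real_of_nat by (simp add: inverse_eq_divide)
  have e0: "e \<longlonglongrightarrow> 0"
    by (rule real_tendsto_sandwich[OF _ _ tendsto_const inv0]) (use e in \<open>auto simp: less_imp_le\<close>)
  have e0r: "filterlim e (at_right 0) sequentially"
  proof -
    have "e j \<noteq> 0" for j using e(1)[of j] by simp
    then show ?thesis using e0 e(1) by (auto simp: filterlim_at)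
  qed
  have "(LINT r:{e j..\<rho>}|lborel. P r) \<le> K + 1 / real (Suc j) * C\<^sup>2 + (e j ^ (n - 1) * V (e j) / e j) * ((real n + 2 * R) * C\<^sup>2)" for j
  proof -
    have ej: "0 < e j" "e j < \<rho>" using e by auto
    have "(g (e j))\<^sup>2 \<le> C\<^sup>2" using b2[of "g (e j)" "g (e j)"] C(1)[of "e j"] ej \<rho> by (simp add: power2_eq_square)
    have "(X1 (e j) * e j ^ n) * (g (e j))\<^sup>2 \<le> 1 / real (Suc j) * (g (e j))\<^sup>2"
      using e(3) by (intro mult_right_mono) auto
    also have "\<dots> \<le> 1 / real (Suc j) * C\<^sup>2" using \<open>(g (e j))\<^sup>2 \<le> C\<^sup>2\<close> by (intro mult_left_mono) auto
    finally show ?thesis using step[OF ej] by linarith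
  qed
  moreover have "(\<lambda>j. K + 1 / real (Suc j) * C\<^sup>2 + (e j ^ (n - 1) * V (e j) / e j) * ((real n + 2 * R) * C\<^sup>2)) \<longlonglongrightarrow> K + 0 * C\<^sup>2 + 0 * ((real n + 2 * R) * C\<^sup>2)"
    by (intro tendsto_intros inv0 filterlim_compose[OF lim e0r])
  moreover have "(\<lambda>j. LINT r:{e j..\<rho>}|lborel. P r) \<longlonglongrightarrow> (LINT r:{0<..<R}|lborel. P r)"
    unfolding set_lebesgue_integral_def
  proof (rule integral_dominated_convergence[where w = "\<lambda>r. norm (indicator {0<..<R} r *\<^sub>R P r)"])
    show "integrable lborel (\<lambda>r. norm (indicator {0<..<R} r *\<^sub>R P r))"
      using Pi unfolding set_integrable_def by (rule integrable_norm)
    show "(\<lambda>r. indicator {0<..<R} r *\<^sub>R P r) \<in> borel_measurable lborel"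
      using Pi unfolding set_integrable_def by (rule borel_measurable_integrable)
    have "{e j..\<rho>} \<subseteq> {0<..<R}" for j using e(1)[of j] \<rho> by auto
    then show "(\<lambda>r. indicator {e j..\<rho>} r *\<^sub>R P r) \<in> borel_measurable lborel" for j
      using set_integrable_subset[OF Pi, of "{e j..\<rho>}"] unfolding set_integrable_def
      by (auto intro: borel_measurable_integrable)
    show "AE r in lborel. (\<lambda>j. indicator {e j..\<rho>} r *\<^sub>R P r) \<longlonglongrightarrow> indicator {0<..<R} r *\<^sub>R P r"
    proof (intro AE_I2)
      fix r
      show "(\<lambda>j. indicator {e j..\<rho>} r *\<^sub>R P r) \<longlonglongrightarrow> indicator {0<..<R} r *\<^sub>R P r"
      proof (cases "r \<in> {0<..<R}")
        case True
        have "\<forall>\<^sub>F j in sequentially. e j < r" using order_tendstoD(2)[OF e0, of r] True by auto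
        then have "\<forall>\<^sub>F j in sequentially. indicator {e j..\<rho>} r *\<^sub>R P r = indicator {0<..<R} r *\<^sub>R P r"
        proof eventually_elim
          case (elim j)
          have "P r = 0" if "r > \<rho>" using z[of r] that True by (simp add: P_def \<Phi>2_def)
          then show ?case using elim True by (auto simp: indicator_def)
        qed
        then show ?thesis by (rule tendsto_eventually)
      next
        case False
        then have "r \<notin> {e j..\<rho>}" for j using e(1)[of j] \<rho> by auto
        then show ?thesis using False by simp
      qed
    qed
    show "AE r in lborel. norm (indicator {e j..\<rho>} r *\<^sub>R P r) \<le> norm (indicator {0<..<R} r *\<^sub>R P r)" for j
      using e(1)[of j] \<rho> by (intro AE_I2) (auto simp: indicator_def)
  qed
  ultimately have PK: "(LINT r:{0<..<R}|lborel. P r) \<le> K + 0 * C\<^sup>2 + 0 * ((real n + 2 * R) * C\<^sup>2)"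
    by (intro LIMSEQ_le[where X = "\<lambda>j. LINT r:{e j..\<rho>}|lborel. P r"]) auto
  have "(LINT r:{0<..<R}|lborel. F r) = (LINT r:{0<..<R}|lborel. 2 * A r - P r)"
    by (rule set_lebesgue_integral_cong) (use FP in auto)
  also have "\<dots> = 2 * (LINT r:{0<..<R}|lborel. A r) - (LINT r:{0<..<R}|lborel. P r)"
    using Ai Pi by (subst set_integral_diff) auto
  \<comment> \<open>Of the two copies of the energy \<open>A\<close>, one compensates the integral
    of \<open>P\<close>, which is at most \<open>K\<close>; the other is itself at least
    \<open>K\<close> by Hardy's inequality for \<open>g\<close>.\<close>
  finally have KF: "K \<le> (LINT r:{0<..<R}|lborel. F r)" using PK KA by linarith
  then show "0 \<le> (LINT r:{0<..<R}|lborel. F r)" using K0 by linarith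
  from KF show "(\<integral>\<^sup>+r\<in>{0<..<R}. ennreal (r ^ (n - 1) * W r * (g r)\<^sup>2) \<partial>lborel) \<le> ennreal (LINT r:{0<..<R}|lborel. F r)"
    using qK unfolding q_def by (simp add: ennreal_leI)
qed

section \<open>Wirtinger's inequality on an interval and on a circle\<close>

lemma antiderivative_exists:
  fixes f :: "real \<Rightarrow> real"
  assumes "continuous_on UNIV f"
  obtains F where "\<And>x. (F has_real_derivative f x) (at x)"
  using einterval_antiderivative[of "-\<infinity>" "\<infinity>" f] assms
  by (auto simp: has_real_derivative_iff_has_vector_derivative continuous_on_eq_continuous_at)

lemma integral_periodic_shift:
  fixes g :: "real \<Rightarrow> real"
  assumes g: "continuous_on UNIV g" and per: "\<And>t. g (t + p) = g t" and p: "p \<ge> 0"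
  shows "integral {a..a + p} g = integral {0..p} g"
proof -
  obtain G where G: "\<And>x. (G has_real_derivative g x) (at x)" using antiderivative_exists[OF g] by blast
  have i: "integral {a..a + p} g = G (a + p) - G a" for a
    by (rule integral_unique, rule has_integral_DERIV) (use p G in auto)
  have "((\<lambda>a. G (a + p) - G a) has_real_derivative 0) (at a)" for a
  proof -
    have "((\<lambda>a. G (a + p)) has_real_derivative g (a + p)) (at a)"
      using G[of "a + p"] by (simp add: DERIV_shift)
    from DERIV_diff[OF this G[of a]] per show ?thesis by simp
  qed
  then have "G (a + p) - G a = G (0 + p) - G 0"
    by (intro DERIV_isconst_all[of "\<lambda>a. G (a + p) - G a"]) auto
  then show ?thesis using i[of a] i[of 0] by simp
qed

text \<open>The square is completed as in \<open>hardy_ray\<close>, with cos (l (t - s - pi / 2)) as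
  positive comparison function. For l < 1 it has no zero on the closed interval, so its logarithmic
  derivative \<open>k\<close> is finite there; then l tends to 1.\<close>

lemma wirtinger_dirichlet:
  fixes h h1 :: "real \<Rightarrow> real"
  assumes h: "\<And>t. (h has_real_derivative h1 t) (at t)" and h1: "continuous_on UNIV h1"
    and z: "h s = 0" "h (s + pi) = 0"
  shows "integral {s..s + pi} (\<lambda>t. (h t)\<^sup>2) \<le> integral {s..s + pi} (\<lambda>t. (h1 t)\<^sup>2)"
proof -
  let ?S = "{s..s + pi}"
  have hc: "continuous_on UNIV h" using h by (meson DERIV_isCont continuous_at_imp_continuous_on)
  have c: "continuous_on ?S (\<lambda>t. (h t)\<^sup>2)" "continuous_on ?S (\<lambda>t. (h1 t)\<^sup>2)"
    by (auto intro!: continuous_intros intro: continuous_on_subset hc h1)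
  have "l\<^sup>2 * integral ?S (\<lambda>t. (h t)\<^sup>2) \<le> integral ?S (\<lambda>t. (h1 t)\<^sup>2)" if l: "0 < l" "l < 1" for l :: real
  proof -
    define k where "k t = - (l * tan (l * (t - s - pi / 2)))" for t
    have cos: "cos (l * (t - s - pi / 2)) > 0" if "t \<in> ?S" for t
    proof -
      have "\<bar>l * (t - s - pi / 2)\<bar> = l * \<bar>t - s - pi / 2\<bar>" using l by (simp add: abs_mult)
      also have "\<dots> \<le> l * (pi / 2)" using that l by (intro mult_left_mono) (auto simp: abs_if)
      also have "\<dots> < pi / 2" using l by simp
      finally show ?thesis by (intro cos_gt_zero_pi) linarith+
    qed
    have i1: "((\<lambda>t. (h t)\<^sup>2 * (- (l\<^sup>2) - (k t)\<^sup>2) + 2 * h t * h1 t * k t) has_integral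
        ((h (s + pi))\<^sup>2 * k (s + pi) - (h s)\<^sup>2 * k s)) ?S"
    proof (rule has_integral_DERIV)
      fix t assume t: "s \<le> t" "t \<le> s + pi"
      have ne: "cos (l * (t - s - pi / 2)) \<noteq> 0" using cos[of t] t by auto
      have "(k has_real_derivative - (l * (inverse ((cos (l * (t - s - pi / 2)))\<^sup>2) * l))) (at t)"
        unfolding k_def[abs_def] using ne by (auto intro!: derivative_eq_intros)
      moreover have "- (l * (inverse ((cos (l * (t - s - pi / 2)))\<^sup>2) * l)) = - (l\<^sup>2) - (k t)\<^sup>2"
      proof -
        have "inverse ((cos (l * (t - s - pi / 2)))\<^sup>2) = 1 + (tan (l * (t - s - pi / 2)))\<^sup>2"
          using tan_sec[OF ne] by (simp add: power_inverse)
        then show ?thesis by (simp only: k_def) (simp add: power2_eq_square algebra_simps)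
      qed
      ultimately have "(k has_real_derivative - (l\<^sup>2) - (k t)\<^sup>2) (at t)" by simp
      then show "((\<lambda>t. (h t)\<^sup>2 * k t) has_real_derivative (h t)\<^sup>2 * (- (l\<^sup>2) - (k t)\<^sup>2) + 2 * h t * h1 t * k t) (at t)"
        using h[of t] by (auto intro!: derivative_eq_intros)
    qed simp
    have i2: "((\<lambda>t. (h1 t)\<^sup>2 - l\<^sup>2 * (h t)\<^sup>2) has_integral (integral ?S (\<lambda>t. (h1 t)\<^sup>2) - l\<^sup>2 * integral ?S (\<lambda>t. (h t)\<^sup>2))) ?S"
      by (intro has_integral_diff has_integral_mult_right integrable_integral integrable_continuous_real c)
    have "(h t)\<^sup>2 * (- (l\<^sup>2) - (k t)\<^sup>2) + 2 * h t * h1 t * k t \<le> (h1 t)\<^sup>2 - l\<^sup>2 * (h t)\<^sup>2" for t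
      using zero_le_power2[of "h1 t - h t * k t"] by (simp add: power2_eq_square algebra_simps)
    from has_integral_le[OF i1 i2 this] show ?thesis using z by simp
  qed
  note le = this
  have "((\<lambda>l. l\<^sup>2 * integral ?S (\<lambda>t. (h t)\<^sup>2)) \<longlongrightarrow> 1\<^sup>2 * integral ?S (\<lambda>t. (h t)\<^sup>2)) (at_left (1::real))"
    by (intro tendsto_intros)
  moreover have "\<forall>\<^sub>F l in at_left (1::real). l\<^sup>2 * integral ?S (\<lambda>t. (h t)\<^sup>2) \<le> integral ?S (\<lambda>t. (h1 t)\<^sup>2)"
  proof -
    have "\<forall>\<^sub>F l in at_left (1::real). l \<in> {0<..<1}" by (rule eventually_at_left_real) simp
    then show ?thesis by eventually_elim (use le in auto)
  qed
  ultimately have "1\<^sup>2 * integral ?S (\<lambda>t. (h t)\<^sup>2) \<le> integral ?S (\<lambda>t. (h1 t)\<^sup>2)"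
    by (intro tendsto_upperbound[where F = "at_left (1::real)"]) auto
  then show ?thesis by simp
qed

text \<open>Some s satisfies f s = f (s + pi). Then f - f s vanishes at s, s + pi and s + 2 pi, and
  the Dirichlet inequality applies on both halves; since f has mean zero, subtracting a constant can
  only increase the integral of the square.\<close>

lemma wirtinger:
  fixes f f1 :: "real \<Rightarrow> real"
  assumes f: "\<And>t. (f has_real_derivative f1 t) (at t)" and f1: "continuous_on UNIV f1"
    and per: "\<And>t. f (t + 2 * pi) = f t" and mean: "integral {0..2 * pi} f = 0"
  shows "integral {0..2 * pi} (\<lambda>t. (f t)\<^sup>2) \<le> integral {0..2 * pi} (\<lambda>t. (f1 t)\<^sup>2)"
proof -
  have fc: "continuous_on UNIV f" using f by (meson DERIV_isCont continuous_at_imp_continuous_on)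
  have per1: "f1 (t + 2 * pi) = f1 t" for t
  proof -
    have "((\<lambda>t. f (t + 2 * pi)) has_real_derivative f1 (t + 2 * pi)) (at t)"
      using f[of "t + 2 * pi"] by (simp add: DERIV_shift)
    then show ?thesis using DERIV_unique[OF f[of t]] by (simp add: per)
  qed
  define d where "d t = f (t + pi) - f t" for t
  have dc: "continuous_on S d" for S
    unfolding d_def by (intro continuous_intros continuous_on_compose2[OF fc] continuous_on_subset[OF fc]) auto
  \<comment> \<open>By periodicity \<open>d\<close> takes opposite values at 0 and pi, so it has a
    zero in between.\<close>
  have dpi: "d pi = - d 0" using per[of 0] by (simp add: d_def)
  have "\<exists>t0\<in>{0..pi}. d t0 = 0"
  proof (cases "d 0 \<le> 0")
    case True
    then show ?thesis using IVT'[of d 0 0 pi] dpi dc by auto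
  next
    case False
    then show ?thesis using IVT2'[of d pi 0 0] dpi dc by auto
  qed
  then obtain s where s: "d s = 0" by blast
  define a where "a = f s"
  define h where "h t = f t - a" for t
  have h: "(h has_real_derivative f1 t) (at t)" for t
    unfolding h_def[abs_def] using f[of t] by (auto intro!: derivative_eq_intros)
  have z: "h s = 0" "h (s + pi) = 0" "h (s + pi + pi) = 0"
    using s per[of s] by (auto simp: h_def a_def d_def add.assoc)
  have hc: "continuous_on S h" for S unfolding h_def by (intro continuous_intros continuous_on_subset[OF fc]) auto
  have f1c: "continuous_on S f1" for S by (rule continuous_on_subset[OF f1]) auto
  have split: "integral {s..s + 2 * pi} g = integral {s..s + pi} g + integral {s + pi..s + pi + pi} g"
    if g: "continuous_on UNIV g" for g :: "real \<Rightarrow> real"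
  proof -
    have "g integrable_on {s..s + pi + pi}"
      by (intro integrable_continuous_real continuous_on_subset[OF g]) auto
    from Henstock_Kurzweil_Integration.integral_combine[OF _ _ this, of "s + pi"]
    have "integral {s..s + pi} g + integral {s + pi..s + pi + pi} g = integral {s..s + pi + pi} g"
      by simp
    moreover have "s + 2 * pi = s + pi + pi" by simp
    ultimately show ?thesis by (simp only:)
  qed
  have c: "continuous_on UNIV (\<lambda>t. (h t)\<^sup>2)" "continuous_on UNIV (\<lambda>t. (f1 t)\<^sup>2)" "continuous_on UNIV (\<lambda>t. (f t)\<^sup>2)"
    by (auto intro!: continuous_intros hc f1c fc)
  have "integral {s..s + 2 * pi} (\<lambda>t. (h t)\<^sup>2) \<le> integral {s..s + 2 * pi} (\<lambda>t. (f1 t)\<^sup>2)"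
    unfolding split[OF c(1)] split[OF c(2)]
    by (intro add_mono wirtinger_dirichlet h f1 z)
  moreover have "integral {s..s + 2 * pi} (\<lambda>t. (h t)\<^sup>2) = integral {0..2 * pi} (\<lambda>t. (h t)\<^sup>2)"
    by (rule integral_periodic_shift[OF c(1)]) (auto simp: h_def per)
  moreover have "integral {s..s + 2 * pi} (\<lambda>t. (f1 t)\<^sup>2) = integral {0..2 * pi} (\<lambda>t. (f1 t)\<^sup>2)"
    by (rule integral_periodic_shift[OF c(2)]) (auto simp: per1)
  moreover have "integral {0..2 * pi} (\<lambda>t. (h t)\<^sup>2) = integral {0..2 * pi} (\<lambda>t. (f t)\<^sup>2) + 2 * pi * a\<^sup>2"
  proof -
    have ci: "((\<lambda>x. a\<^sup>2) has_integral 2 * pi * a\<^sup>2) {0..2 * pi}"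
      using has_integral_const_real[of "a\<^sup>2" 0 "2 * pi"] by simp
    have "((\<lambda>t. (f t)\<^sup>2 - 2 * a * f t + a\<^sup>2) has_integral
      (integral {0..2 * pi} (\<lambda>t. (f t)\<^sup>2) - 2 * a * integral {0..2 * pi} f + 2 * pi * a\<^sup>2)) {0..2 * pi}"
      by (intro has_integral_add has_integral_diff has_integral_mult_right integrable_integral
          integrable_continuous_real ci
          continuous_on_subset[OF c(3)] continuous_on_subset[OF fc]) auto
    moreover have "(\<lambda>t. (f t)\<^sup>2 - 2 * a * f t + a\<^sup>2) = (\<lambda>t. (h t)\<^sup>2)"
      by (auto simp: h_def power2_eq_square algebra_simps)
    ultimately show ?thesis using mean by (simp add: integral_unique)
  qed
  moreover have "2 * pi * a\<^sup>2 \<ge> 0" by simp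
  ultimately show ?thesis by linarith
qed

section \<open>Sturm--Liouville equations\<close>

text \<open>Integrating L exp (2 L |t - r0|) from \<open>r0\<close> produces at most half the
  exponential, so each integration halves the bound \<open>M\<close>. The two cases are the two
  sides of \<open>r0\<close>.\<close>

lemma growth_bound:
  fixes F f :: "real \<Rightarrow> real"
  assumes F: "\<And>r. r \<in> {\<alpha>..\<beta>} \<Longrightarrow> (F has_real_derivative f r) (at r)"
    and r0: "r0 \<in> {\<alpha>..\<beta>}" "F r0 = 0" and L: "L > 0" and M: "M \<ge> 0"
    and f: "\<And>r. r \<in> {\<alpha>..\<beta>} \<Longrightarrow> \<bar>f r\<bar> \<le> L * (M * exp (2 * L * \<bar>r - r0\<bar>))"
    and r: "r \<in> {\<alpha>..\<beta>}"
  shows "\<bar>F r\<bar> \<le> M / 2 * exp (2 * L * \<bar>r - r0\<bar>)"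
proof (cases "r0 \<le> r")
  case True
  define G where "G s = M / 2 * exp (2 * L * (s - r0))" for s
  have G: "(G has_real_derivative L * (M * exp (2 * L * (s - r0)))) (at s)" for s
    unfolding G_def[abs_def] by (auto intro!: derivative_eq_intros)
  have iF: "(f has_integral (F r - F r0)) {r0..r}"
    using True r r0 by (intro has_integral_DERIV F) auto
  have iG: "((\<lambda>s. L * (M * exp (2 * L * (s - r0)))) has_integral (G r - G r0)) {r0..r}"
    using True by (intro has_integral_DERIV G) auto
  have le: "\<bar>f s\<bar> \<le> L * (M * exp (2 * L * (s - r0)))" if "s \<in> {r0..r}" for s
    using f[of s] that r r0 by auto
  have "F r - F r0 \<le> G r - G r0" by (rule has_integral_le[OF iF iG]) (use le in fastforce)
  moreover have "- (F r - F r0) \<le> G r - G r0"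
    by (rule has_integral_le[OF has_integral_neg[OF iF] iG]) (use le in fastforce)
  moreover have "G r0 \<ge> 0" using M by (simp add: G_def)
  ultimately show ?thesis using r0 True by (simp add: G_def)
next
  case False
  define G where "G s = - (M / 2 * exp (2 * L * (r0 - s)))" for s
  have G: "(G has_real_derivative L * (M * exp (2 * L * (r0 - s)))) (at s)" for s
    unfolding G_def[abs_def] by (auto intro!: derivative_eq_intros)
  have iF: "(f has_integral (F r0 - F r)) {r..r0}"
    using False r r0 by (intro has_integral_DERIV F) auto
  have iG: "((\<lambda>s. L * (M * exp (2 * L * (r0 - s)))) has_integral (G r0 - G r)) {r..r0}"
    using False by (intro has_integral_DERIV G) auto
  have le: "\<bar>f s\<bar> \<le> L * (M * exp (2 * L * (r0 - s)))" if "s \<in> {r..r0}" for s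
    using f[of s] that r r0 by auto
  have "F r0 - F r \<le> G r0 - G r" by (rule has_integral_le[OF iF iG]) (use le in fastforce)
  moreover have "- (F r0 - F r) \<le> G r0 - G r"
    by (rule has_integral_le[OF has_integral_neg[OF iF] iG]) (use le in fastforce)
  moreover have "G r0 \<le> 0" using M by (simp add: G_def)
  ultimately show ?thesis using r0 False by (simp add: G_def)
qed

text \<open>Picard iteration: the weight \<open>exp (2 L |r - r0|)\<close> makes each integration a contraction by \<open>1/2\<close>
  on every compact subinterval.\<close>

lemma linear_system_exists:
  fixes p q :: "real \<Rightarrow> real"
  assumes p: "continuous_on {0<..<R} p" "\<And>r. r \<in> {0<..<R} \<Longrightarrow> p r > 0"
    and q: "continuous_on {0<..<R} q" and r0: "r0 \<in> {0<..<R}"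
  obtains y z where "\<And>r. r \<in> {0<..<R} \<Longrightarrow> (y has_real_derivative z r / p r) (at r)"
    "\<And>r. r \<in> {0<..<R} \<Longrightarrow> (z has_real_derivative - (q r * y r)) (at r)" "y r0 = a0" "z r0 = b0"
proof -
  define I where "I = {0<..<R}"
  have ne: "p r \<noteq> 0" if "r \<in> I" for r using p(2)[of r] that by (auto simp: I_def)
  have anti: "\<exists>F. (\<forall>r\<in>I. (F has_real_derivative f r) (at r)) \<and> F r0 = 0" if "continuous_on I f" for f :: "real \<Rightarrow> real"
  proof -
    have "(0::ereal) < ereal R" using r0 by auto
    moreover have "isCont f x" if "(0::ereal) < ereal x" "ereal x < ereal R" for x
      using \<open>continuous_on I f\<close> that by (simp add: I_def continuous_on_eq_continuous_at)
    ultimately obtain F where F: "\<forall>x. (0::ereal) < ereal x \<longrightarrow> ereal x < ereal R \<longrightarrow> (F has_vector_derivative f x) (at x)"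
      using einterval_antiderivative[of 0 "ereal R" f] by blast
    have "((\<lambda>x. F x - F r0) has_real_derivative f r) (at r)" if "r \<in> I" for r
    proof -
      have "(F has_real_derivative f r) (at r)"
        using F that by (simp add: I_def has_real_derivative_iff_has_vector_derivative)
      from DERIV_diff[OF this DERIV_const[of "F r0"]] show ?thesis by simp
    qed
    then show ?thesis by (intro exI[of _ "\<lambda>x. F x - F r0"]) auto
  qed
  \<comment> \<open>The antiderivative on (0, R) that vanishes at \<open>r0\<close>.\<close>
  define A where "A f = (SOME F. (\<forall>r\<in>I. (F has_real_derivative f r) (at r)) \<and> F r0 = 0)" for f :: "real \<Rightarrow> real"
  have A: "\<And>r. r \<in> I \<Longrightarrow> (A f has_real_derivative f r) (at r)" "A f r0 = 0" if "continuous_on I f" for f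
    using someI_ex[OF anti[OF that]] by (auto simp: A_def)
  \<comment> \<open>\<open>S k\<close> holds the k-th increment of the Picard iteration, not the
    k-th iterate. The solution is the sum of the series, and all increments after the constant
    initial one vanish at \<open>r0\<close>.\<close>
  define S where "S = rec_nat (\<lambda>_. a0, \<lambda>_. b0) (\<lambda>k s. (A (\<lambda>r. snd s r / p r), A (\<lambda>r. - (q r * fst s r))))"
  define Y where "Y k = fst (S k)" for k
  define Z where "Z k = snd (S k)" for k
  have Y0: "Y 0 = (\<lambda>_. a0)" "Z 0 = (\<lambda>_. b0)" by (simp_all add: Y_def Z_def S_def)
  have YS: "Y (Suc k) = A (\<lambda>r. Z k r / p r)" "Z (Suc k) = A (\<lambda>r. - (q r * Y k r))" for k
    by (simp_all add: Y_def Z_def S_def)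
  have contI: "continuous_on I f" if "\<And>r. r \<in> I \<Longrightarrow> (f has_real_derivative f1 r) (at r)" for f f1
    using that by (meson DERIV_isCont continuous_at_imp_continuous_on)
  have pc: "continuous_on I p" and qc: "continuous_on I q" using p q by (auto simp: I_def)
  have cYZ: "continuous_on I (Y k) \<and> continuous_on I (Z k)" for k
  proof (induction k)
    case (Suc k)
    have "continuous_on I (\<lambda>r. Z k r / p r)" "continuous_on I (\<lambda>r. - (q r * Y k r))"
      using Suc pc qc ne by (auto intro!: continuous_intros)
    then show ?case unfolding YS using contI[OF A(1)] by blast
  qed (simp add: Y0)
  have c1: "continuous_on I (\<lambda>r. Z k r / p r)" and c2: "continuous_on I (\<lambda>r. - (q r * Y k r))" for k
    using cYZ[of k] pc qc ne by (auto intro!: continuous_intros)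
  define y where "y r = (\<Sum>k. Y k r)" for r
  define z where "z r = (\<Sum>k. Z k r)" for r
  have main: "(y has_real_derivative z r / p r) (at r) \<and> (z has_real_derivative - (q r * y r)) (at r)" if r: "r \<in> {0<..<R}" for r
  proof -
    \<comment> \<open>Differentiation is local, so for each \<open>r\<close> it suffices to work on
      a compact interval with \<open>r0\<close> and \<open>r\<close> in its interior, where 1 / p
      and q are bounded.\<close>
    define \<alpha> where "\<alpha> = min r0 r / 2"
    define \<beta> where "\<beta> = (max r0 r + R) / 2"
    have ab: "0 < \<alpha>" "\<alpha> < r0" "\<alpha> < r" "r0 < \<beta>" "r < \<beta>" "\<beta> < R"
      using r r0 by (auto simp: \<alpha>_def \<beta>_def min_def max_def)
    define T where "T = {\<alpha>..\<beta>}"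
    have TI: "T \<subseteq> I" using ab by (auto simp: T_def I_def)
    have "continuous_on T (\<lambda>r. \<bar>1 / p r\<bar> + \<bar>q r\<bar>)"
      using TI ne by (intro continuous_intros continuous_on_subset[OF pc] continuous_on_subset[OF qc]) auto
    then have "bounded ((\<lambda>r. \<bar>1 / p r\<bar> + \<bar>q r\<bar>) ` T)"
      unfolding T_def by (intro compact_imp_bounded compact_continuous_image) auto
    then obtain L0 where L0: "\<And>r. r \<in> T \<Longrightarrow> \<bar>1 / p r\<bar> + \<bar>q r\<bar> \<le> L0"
      unfolding bounded_iff by (metis abs_ge_self image_eqI order_trans real_norm_def)
    define L where "L = max L0 1"
    have L: "L > 0" "\<And>r. r \<in> T \<Longrightarrow> \<bar>1 / p r\<bar> \<le> L" "\<And>r. r \<in> T \<Longrightarrow> \<bar>q r\<bar> \<le> L"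
    proof -
      fix r assume "r \<in> T"
      from L0[OF this] abs_ge_zero[of "1 / p r"] abs_ge_zero[of "q r"]
      show "\<bar>1 / p r\<bar> \<le> L" "\<bar>q r\<bar> \<le> L" unfolding L_def by linarith+
    qed (simp add: L_def)
    define M where "M = max \<bar>a0\<bar> \<bar>b0\<bar>"
    have M: "M \<ge> 0" by (simp add: M_def)
    let ?e = "\<lambda>s. exp (2 * L * \<bar>s - r0\<bar>)"
    have e1: "?e s \<ge> 1" for s using L by simp
    have bound: "\<forall>s\<in>T. \<bar>Y k s\<bar> \<le> M / 2 ^ k * ?e s \<and> \<bar>Z k s\<bar> \<le> M / 2 ^ k * ?e s" for k
    proof (induction k)
      case 0
      have "\<bar>a0\<bar> * 1 \<le> M * ?e s" "\<bar>b0\<bar> * 1 \<le> M * ?e s" for s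
        using e1 by (intro mult_mono; simp add: M_def)+
      then show ?case by (simp add: Y0)
    next
      case (Suc k)
      have Mk: "M / 2 ^ k \<ge> 0" using M by simp
      have T: "\<And>s. s \<in> T \<Longrightarrow> s \<in> I" using TI by auto
      show ?case
      proof (intro ballI conjI)
        fix s assume s: "s \<in> T"
        have "\<bar>Y (Suc k) s\<bar> \<le> (M / 2 ^ k) / 2 * ?e s"
        proof (rule growth_bound[of \<alpha> \<beta> "Y (Suc k)" "\<lambda>r. Z k r / p r"])
          fix t assume t: "t \<in> {\<alpha>..\<beta>}"
          then have tT: "t \<in> T" by (simp add: T_def)
          show "(Y (Suc k) has_real_derivative Z k t / p t) (at t)"
            unfolding YS using A(1)[OF c1 T[OF tT]] .
          have "\<bar>1 / p t\<bar> * \<bar>Z k t\<bar> \<le> L * (M / 2 ^ k * ?e t)"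
            using L(2)[OF tT] Suc tT L(1) by (intro mult_mono) auto
          then show "\<bar>Z k t / p t\<bar> \<le> L * (M / 2 ^ k * ?e t)" by (simp add: abs_mult[symmetric])
        qed (use s ab L Mk A(2)[OF c1] in \<open>auto simp: T_def YS\<close>)
        then show "\<bar>Y (Suc k) s\<bar> \<le> M / 2 ^ Suc k * ?e s" by simp
        have "\<bar>Z (Suc k) s\<bar> \<le> (M / 2 ^ k) / 2 * ?e s"
        proof (rule growth_bound[of \<alpha> \<beta> "Z (Suc k)" "\<lambda>r. - (q r * Y k r)"])
          fix t assume t: "t \<in> {\<alpha>..\<beta>}"
          then have tT: "t \<in> T" by (simp add: T_def)
          show "(Z (Suc k) has_real_derivative - (q t * Y k t)) (at t)"
            unfolding YS using A(1)[OF c2 T[OF tT]] .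
          have "\<bar>q t\<bar> * \<bar>Y k t\<bar> \<le> L * (M / 2 ^ k * ?e t)"
            using L(3)[OF tT] Suc tT L(1) by (intro mult_mono) auto
          then show "\<bar>- (q t * Y k t)\<bar> \<le> L * (M / 2 ^ k * ?e t)" by (simp add: abs_mult)
        qed (use s ab L Mk A(2)[OF c2] in \<open>auto simp: T_def YS\<close>)
        then show "\<bar>Z (Suc k) s\<bar> \<le> M / 2 ^ Suc k * ?e s" by simp
      qed
    qed
    define E where "E = exp (2 * L * (\<beta> - \<alpha>))"
    have eE: "?e s \<le> E" if "s \<in> T" for s
      unfolding E_def using that ab L by (auto simp: T_def)
    have b': "\<bar>Y k s\<bar> \<le> M * E * (1 / 2) ^ k" "\<bar>Z k s\<bar> \<le> M * E * (1 / 2) ^ k" if "s \<in> T" for k s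
    proof -
      have "M / 2 ^ k * ?e s \<le> M / 2 ^ k * E" using eE[OF that] M by (intro mult_left_mono) auto
      also have "\<dots> = M * E * (1 / 2) ^ k" by (simp add: power_divide)
      finally show "\<bar>Y k s\<bar> \<le> M * E * (1 / 2) ^ k" "\<bar>Z k s\<bar> \<le> M * E * (1 / 2) ^ k"
        using bound[of k] that by (auto intro: order_trans)
    qed
    have geo: "summable (\<lambda>k. K * (1 / 2) ^ k)" for K :: real by (intro summable_mult summable_geometric) simp
    have sumY: "summable (\<lambda>k. Y k s)" and sumZ: "summable (\<lambda>k. Z k s)" if "s \<in> T" for s
      by (rule summable_comparison_test'[OF geo[of "M * E"], where N = 0], simp add: b'[OF that])+
    \<comment> \<open>Termwise derivatives form the shifted sequence, with 0 for the constant
      initial term; undoing the shift after summation returns the equation.\<close>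
    define dY where "dY k r = (case k of 0 \<Rightarrow> 0 | Suc j \<Rightarrow> Z j r / p r)" for k r
    define dZ where "dZ k r = (case k of 0 \<Rightarrow> 0 | Suc j \<Rightarrow> - (q r * Y j r))" for k r
    have ME: "M * E \<ge> 0" using M by (simp add: E_def)
    have dYb: "norm (dY k s) \<le> 2 * L * (M * E) * (1 / 2) ^ k" and dZb: "norm (dZ k s) \<le> 2 * L * (M * E) * (1 / 2) ^ k" if "s \<in> T" for k s
    proof -
      have *: "norm (dY k s) \<le> 2 * L * (M * E) * (1 / 2) ^ k \<and> norm (dZ k s) \<le> 2 * L * (M * E) * (1 / 2) ^ k"
      proof (cases k)
        case 0
        then show ?thesis using L ME by (simp add: dY_def dZ_def)
      next
        case (Suc j)
        have "\<bar>1 / p s\<bar> * \<bar>Z j s\<bar> \<le> L * (M * E * (1 / 2) ^ j)" "\<bar>q s\<bar> * \<bar>Y j s\<bar> \<le> L * (M * E * (1 / 2) ^ j)"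
          using L(2,3)[OF that] b'[OF that, of j] L(1) by (intro mult_mono; simp)+
        then show ?thesis using Suc by (simp add: dY_def dZ_def abs_mult)
      qed
      then show "norm (dY k s) \<le> 2 * L * (M * E) * (1 / 2) ^ k" "norm (dZ k s) \<le> 2 * L * (M * E) * (1 / 2) ^ k" by auto
    qed
    have rint: "r \<in> interior T" using ab by (simp add: T_def)
    have rT: "r \<in> T" using rint interior_subset by blast
    have dY: "(Y k has_real_derivative dY k s) (at s within T)" and dZ: "(Z k has_real_derivative dZ k s) (at s within T)" if "s \<in> T" for k s
    proof -
      have sI: "s \<in> I" using that TI by auto
      show "(Y k has_real_derivative dY k s) (at s within T)"
        using A(1)[OF c1 sI] by (cases k) (auto simp: Y0 YS dY_def intro: has_field_derivative_at_within)
      show "(Z k has_real_derivative dZ k s) (at s within T)"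
        using A(1)[OF c2 sI] by (cases k) (auto simp: Y0 YS dZ_def intro: has_field_derivative_at_within)
    qed
    have "(y has_real_derivative (\<Sum>k. dY k r)) (at r)"
      unfolding y_def[abs_def]
    proof (rule has_field_derivative_series'(2)[of T Y dY r r])
      show "uniformly_convergent_on T (\<lambda>n x. \<Sum>i<n. dY i x)"
        by (rule Weierstrass_m_test'[OF dYb geo])
    qed (use dY rT rint sumY[OF rT] in \<open>auto simp: T_def\<close>)
    moreover have "(z has_real_derivative (\<Sum>k. dZ k r)) (at r)"
      unfolding z_def[abs_def]
    proof (rule has_field_derivative_series'(2)[of T Z dZ r r])
      show "uniformly_convergent_on T (\<lambda>n x. \<Sum>i<n. dZ i x)"
        by (rule Weierstrass_m_test'[OF dZb geo])
    qed (use dZ rT rint sumZ[OF rT] in \<open>auto simp: T_def\<close>)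
    moreover have "(\<Sum>k. dY k r) = z r / p r"
    proof -
      have "summable (\<lambda>k. dY k r)"
        by (rule summable_comparison_test'[OF geo, where N = 0]) (rule dYb[OF rT])
      from suminf_split_head[OF this] have "(\<Sum>k. dY k r) = (\<Sum>k. dY (Suc k) r)" by (simp add: dY_def)
      also have "\<dots> = z r / p r" unfolding z_def using suminf_divide[OF sumZ[OF rT]] by (simp add: dY_def)
      finally show ?thesis .
    qed
    moreover have "(\<Sum>k. dZ k r) = - (q r * y r)"
    proof -
      have "summable (\<lambda>k. dZ k r)"
        by (rule summable_comparison_test'[OF geo, where N = 0]) (rule dZb[OF rT])
      from suminf_split_head[OF this] have "(\<Sum>k. dZ k r) = (\<Sum>k. dZ (Suc k) r)" by (simp add: dZ_def)
      also have "\<dots> = (\<Sum>k. (- q r) * Y k r)" by (simp add: dZ_def)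
      also have "\<dots> = - (q r * y r)" unfolding y_def using suminf_mult[OF sumY[OF rT], of "- q r"] by simp
      finally show ?thesis .
    qed
    ultimately show ?thesis by simp
  qed
  have "y r0 = a0"
  proof -
    have "Y k r0 = 0" if "k \<notin> {0}" for k using that A(2)[OF c1] by (cases k) (auto simp: YS)
    then have "(\<Sum>k. Y k r0) = (\<Sum>k\<in>{0}. Y k r0)" by (intro suminf_finite) auto
    then show ?thesis by (simp add: y_def Y0)
  qed
  moreover have "z r0 = b0"
  proof -
    have "Z k r0 = 0" if "k \<notin> {0}" for k using that A(2)[OF c2] by (cases k) (auto simp: YS)
    then have "(\<Sum>k. Z k r0) = (\<Sum>k\<in>{0}. Z k r0)" by (intro suminf_finite) auto
    then show ?thesis by (simp add: z_def Y0)
  qed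
  ultimately show ?thesis using that main by blast
qed

text \<open>The equation (p y')' + q y = 0 as a first-order system with z = p y'. In this form p
  enters undifferentiated, and continuity of p suffices for existence.\<close>

definition sturm_sol :: "real \<Rightarrow> (real \<Rightarrow> real) \<Rightarrow> (real \<Rightarrow> real) \<Rightarrow> (real \<Rightarrow> real) \<Rightarrow> (real \<Rightarrow> real) \<Rightarrow> bool" where
  "sturm_sol R p q y z \<longleftrightarrow> (\<forall>r\<in>{0<..<R}. (y has_real_derivative z r / p r) (at r) \<and>
     (z has_real_derivative - (q r * y r)) (at r))"

lemma sturm_sol_exists:
  fixes p q :: "real \<Rightarrow> real"
  assumes "continuous_on {0<..<R} p" "\<And>r. r \<in> {0<..<R} \<Longrightarrow> p r > 0"
    and "continuous_on {0<..<R} q" "r0 \<in> {0<..<R}"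
  shows "\<exists>y z. sturm_sol R p q y z \<and> y r0 = a0 \<and> z r0 = b0"
proof (rule linear_system_exists[OF assms, of a0 b0])
  fix y z
  assume a: "\<And>r. r \<in> {0<..<R} \<Longrightarrow> (y has_real_derivative z r / p r) (at r)"
    "\<And>r. r \<in> {0<..<R} \<Longrightarrow> (z has_real_derivative - (q r * y r)) (at r)" "y r0 = a0" "z r0 = b0"
  then have "sturm_sol R p q y z" unfolding sturm_sol_def by blast
  with a(3,4) show "\<exists>y z. sturm_sol R p q y z \<and> y r0 = a0 \<and> z r0 = b0" by blast
qed

lemma sturm_sol_comb:
  assumes "sturm_sol R p q y1 z1" "sturm_sol R p q y2 z2"
  shows "sturm_sol R p q (\<lambda>r. y1 r + s * y2 r) (\<lambda>r. z1 r + s * z2 r)"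
  unfolding sturm_sol_def
proof safe
  fix r assume r: "r \<in> {0<..<R}"
  show "((\<lambda>r. y1 r + s * y2 r) has_real_derivative (z1 r + s * z2 r) / p r) (at r)"
    using assms r unfolding sturm_sol_def by (auto intro!: derivative_eq_intros simp: add_divide_distrib)
  show "((\<lambda>r. z1 r + s * z2 r) has_real_derivative - (q r * (y1 r + s * y2 r))) (at r)"
    using assms r unfolding sturm_sol_def by (auto intro!: derivative_eq_intros simp: algebra_simps)
qed

text \<open>Does the work of a uniqueness theorem: a solution that vanishes together with its flux
  at one point has Wronskian 0 with every other solution.\<close>

lemma sturm_wronskian:
  assumes "sturm_sol R p q y1 z1" "sturm_sol R p q y2 z2" "a \<in> {0<..<R}" "b \<in> {0<..<R}"
  shows "y1 a * z2 a - y2 a * z1 a = y1 b * z2 b - y2 b * z1 b"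
proof -
  let ?w = "\<lambda>r. y1 r * z2 r - y2 r * z1 r"
  have w: "(?w has_real_derivative 0) (at r)" if "r \<in> {0<..<R}" for r
    using assms(1,2) that unfolding sturm_sol_def by (auto intro!: derivative_eq_intros)
  have "?w s = ?w t" if "s \<in> {0<..<R}" "t \<in> {0<..<R}" "s < t" for s t
  proof -
    have "continuous_on {s..t} ?w"
      using that by (intro continuous_at_imp_continuous_on ballI DERIV_isCont[OF w]) auto
    then show ?thesis
      using DERIV_isconst2[of s t ?w t] w that by auto
  qed
  then show ?thesis using assms(3,4) by (metis linorder_less_linear)
qed

lemma sturm_continuous:
  assumes "sturm_sol R p q y z"
  shows "continuous_on {0<..<R} y" "continuous_on {0<..<R} z"
  using assms unfolding sturm_sol_def
  by (meson DERIV_isCont continuous_at_imp_continuous_on)+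

text \<open>Since \<open>c < 1\<close>, a nontrivial solution with two zeros would violate the energy inequality on the
  interval between them.\<close>

lemma sturm_two_zeros:
  fixes p q :: "real \<Rightarrow> real"
  assumes p: "continuous_on {0<..<R} p" "\<And>r. r \<in> {0<..<R} \<Longrightarrow> p r > 0"
    and q: "continuous_on {0<..<R} q" "\<And>r. r \<in> {0<..<R} \<Longrightarrow> q r > 0"
    and c: "c < 1"
    and H: "\<And>a b v v1. 0 < a \<Longrightarrow> a < b \<Longrightarrow> b < R \<Longrightarrow> (\<And>r. r \<in> {0<..<R} \<Longrightarrow> (v has_real_derivative v1 r) (at r))
       \<Longrightarrow> continuous_on {0<..<R} v1 \<Longrightarrow> v a = 0 \<Longrightarrow> v b = 0 \<Longrightarrow>
       integral {a..b} (\<lambda>r. q r * (v r)\<^sup>2) \<le> integral {a..b} (\<lambda>r. p r * (v1 r)\<^sup>2)"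
    and sol: "sturm_sol R p (\<lambda>r. c * q r) y z"
    and ab: "0 < a" "a < b" "b < R" "y a = 0" "y b = 0" and r: "a \<le> r" "r \<le> b"
  shows "y r = 0" "z r = 0"
proof -
  have yc: "continuous_on {0<..<R} y" and zc: "continuous_on {0<..<R} z" using sturm_continuous[OF sol] .
  have sub: "{a..b} \<subseteq> {0<..<R}" using ab by auto
  note cs = continuous_on_subset[OF _ sub]
  have z1c: "continuous_on {0<..<R} (\<lambda>r. z r / p r)"
    using p(2) by (intro continuous_intros zc p(1)) force
  have k1: "continuous_on {0<..<R} (\<lambda>r. p r * (z r / p r)\<^sup>2)" by (intro continuous_intros z1c p)
  have k2: "continuous_on {0<..<R} (\<lambda>r. q r * (y r)\<^sup>2)" by (intro continuous_intros yc q)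
  have y': "(y has_real_derivative z r / p r) (at r)" if "r \<in> {0<..<R}" for r
    using sol that by (auto simp: sturm_sol_def)
  have E: "integral {a..b} (\<lambda>r. q r * (y r)\<^sup>2) \<le> integral {a..b} (\<lambda>r. p r * (z r / p r)\<^sup>2)"
    using H[OF ab(1-3) y' z1c ab(4,5)] by blast
  have i1: "((\<lambda>r. p r * (z r / p r)\<^sup>2 - c * (q r * (y r)\<^sup>2)) has_integral (y b * z b - y a * z a)) {a..b}"
  proof (rule has_integral_DERIV)
    fix r assume "a \<le> r" "r \<le> b"
    then have r: "r \<in> {0<..<R}" using ab by auto
    have "((\<lambda>r. y r * z r) has_real_derivative (z r / p r) * z r + (- (c * q r * y r)) * y r) (at r)"
      using sol r unfolding sturm_sol_def by (intro DERIV_mult) auto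
    moreover have "(z r / p r) * z r + (- (c * q r * y r)) * y r = p r * (z r / p r)\<^sup>2 - c * (q r * (y r)\<^sup>2)"
      using p(2)[OF r] by (simp add: field_simps power2_eq_square)
    ultimately show "((\<lambda>r. y r * z r) has_real_derivative p r * (z r / p r)\<^sup>2 - c * (q r * (y r)\<^sup>2)) (at r)" by simp
  qed (use ab in auto)
  have i2: "((\<lambda>r. p r * (z r / p r)\<^sup>2 - c * (q r * (y r)\<^sup>2)) has_integral
     (integral {a..b} (\<lambda>r. p r * (z r / p r)\<^sup>2) - c * integral {a..b} (\<lambda>r. q r * (y r)\<^sup>2))) {a..b}"
    by (intro has_integral_diff has_integral_mult_right integrable_integral integrable_continuous_real cs k1 k2)
  have "integral {a..b} (\<lambda>r. p r * (z r / p r)\<^sup>2) = c * integral {a..b} (\<lambda>r. q r * (y r)\<^sup>2)"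
    using has_integral_unique[OF i1 i2] ab by simp
  with E have "(1 - c) * integral {a..b} (\<lambda>r. q r * (y r)\<^sup>2) \<le> 0" by (simp add: algebra_simps)
  then have "integral {a..b} (\<lambda>r. q r * (y r)\<^sup>2) \<le> 0" using c by (simp add: mult_le_0_iff)
  moreover have nn: "q r * (y r)\<^sup>2 \<ge> 0" if "r \<in> {a..b}" for r
    using q(2)[of r] that sub by (auto intro!: mult_nonneg_nonneg simp: less_imp_le)
  ultimately have "integral {a..b} (\<lambda>r. q r * (y r)\<^sup>2) = 0"
    using Henstock_Kurzweil_Integration.integral_nonneg[of "\<lambda>r. q r * (y r)\<^sup>2" "{a..b}"]
      integrable_continuous_real[OF cs[OF k2]] by (intro antisym) auto
  then have "\<forall>r\<in>{a..b}. q r * (y r)\<^sup>2 = 0"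
    using integral_eq_0_iff[OF cs[OF k2] ab(2) nn] by auto
  then have y0: "y s = 0" if "a \<le> s" "s \<le> b" for s
  proof -
    have "q s * (y s)\<^sup>2 = 0" using \<open>\<forall>r\<in>{a..b}. q r * (y r)\<^sup>2 = 0\<close> that by simp
    moreover have "q s > 0" using q(2)[of s] that ab by auto
    ultimately show ?thesis by simp
  qed
  show "y r = 0" using y0 r by simp
  have zi: "z s = 0" if "a < s" "s < b" for s
  proof -
    have "(y has_real_derivative 0) (at s)"
      by (rule has_field_derivative_transform_within_open[of "\<lambda>_. 0" 0 s "{a<..<b}"]) (use that y0 in auto)
    from DERIV_unique[OF this y'[of s]] p(2)[of s] that ab show ?thesis by auto
  qed
  show "z r = 0"
  proof -
    define m where "m = (a + b) / 2"
    have m: "a < m" "m < b" using ab by (auto simp: m_def)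
    have "continuous_on {0<..<R} (\<lambda>s. c * q s)" "r \<in> {0<..<R}" using r ab q by (auto intro!: continuous_intros)
    \<comment> \<open>At the end points the vanishing of y on one side does not determine y'. A
      solution with y1 = 1 and z1 = 0 at \<open>r\<close> has Wronskian z r there, and the Wronskian
      is 0 at the interior point \<open>m\<close>.\<close>
    from sturm_sol_exists[OF p this, of 1 0]
    obtain y1 z1 where s1: "sturm_sol R p (\<lambda>r. c * q r) y1 z1" and yz: "y1 r = 1" "z1 r = 0" by blast
    have "y1 r * z r - y r * z1 r = y1 m * z m - y m * z1 m"
      by (rule sturm_wronskian[OF s1 sol]) (use r ab m in auto)
    then show ?thesis using yz y0[of m] zi[of m] m by simp
  qed
qed

text \<open>\<open>y1\<close> and \<open>y2\<close> are the solutions with data (1, 0) and (0, 1) at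
  the midpoint \<open>r0\<close>. No nontrivial solution has two zeros, so \<open>y2\<close>
  vanishes only at \<open>r0\<close>, and y1 + s y2 vanishes at another point r exactly for s = - y1
  r / y2 r. These values on the right of \<open>r0\<close> never exceed those on the left, and a
  number s separating the two sets gives a nonnegative solution. A zero of it would be a minimum,
  with zero flux as well, which the Wronskian with \<open>y2\<close> rules out.\<close>

lemma sturm_positive_solution:
  fixes p q :: "real \<Rightarrow> real"
  assumes R: "R > 0"
    and p: "continuous_on {0<..<R} p" "\<And>r. r \<in> {0<..<R} \<Longrightarrow> p r > 0"
    and q: "continuous_on {0<..<R} q" "\<And>r. r \<in> {0<..<R} \<Longrightarrow> q r > 0"
    and c: "c < 1"
    and H: "\<And>a b v v1. 0 < a \<Longrightarrow> a < b \<Longrightarrow> b < R \<Longrightarrow> (\<And>r. r \<in> {0<..<R} \<Longrightarrow> (v has_real_derivative v1 r) (at r))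
       \<Longrightarrow> continuous_on {0<..<R} v1 \<Longrightarrow> v a = 0 \<Longrightarrow> v b = 0 \<Longrightarrow>
       integral {a..b} (\<lambda>r. q r * (v r)\<^sup>2) \<le> integral {a..b} (\<lambda>r. p r * (v1 r)\<^sup>2)"
  shows "\<exists>y z. sturm_sol R p (\<lambda>r. c * q r) y z \<and> (\<forall>r\<in>{0<..<R}. y r > 0)"
proof -
  define r0 where "r0 = R / 2"
  have r0: "0 < r0" "r0 < R" using R by (auto simp: r0_def)
  have qc: "continuous_on {0<..<R} (\<lambda>r. c * q r)" using q by (intro continuous_intros)
  have r0I: "r0 \<in> {0<..<R}" using r0 by auto
  obtain y1 z1 where 1: "sturm_sol R p (\<lambda>r. c * q r) y1 z1" "y1 r0 = 1" "z1 r0 = 0"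
    using sturm_sol_exists[OF p qc r0I, of 1 0] by blast
  obtain y2 z2 where 2: "sturm_sol R p (\<lambda>r. c * q r) y2 z2" "y2 r0 = 0" "z2 r0 = 1"
    using sturm_sol_exists[OF p qc r0I, of 0 1] by blast
  have tz: "y r = 0 \<and> z r = 0" if "sturm_sol R p (\<lambda>r. c * q r) y z" "0 < a" "a < b" "b < R" "y a = 0" "y b = 0" "a \<le> r" "r \<le> b" for y z a b r
    using sturm_two_zeros[OF p q c H that] by blast
  have cont: "continuous_on {a..b} y" if "sturm_sol R p (\<lambda>r. c * q r) y z" "0 < a" "b < R" for y z a b
    using sturm_continuous(1)[OF that(1)] by (rule continuous_on_subset) (use that in auto)
  have y2ne: "y2 r \<noteq> 0" if "0 < r" "r < R" "r \<noteq> r0" for r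
  proof
    assume "y2 r = 0"
    then have "z2 r0 = 0"
      using tz[OF 2(1), of r r0 r0] tz[OF 2(1), of r0 r r0] that r0 2(2) by (cases "r < r0") auto
    then show False using 2(3) by simp
  qed
  have d2: "(y2 has_real_derivative 1 / p r0) (at r0)"
    using 2(1)[unfolded sturm_sol_def, rule_format, OF r0I] 2(3) by simp
  have d2p: "1 / p r0 > 0" using p(2) r0 by simp
  have y2pos: "y2 r > 0" if rr: "r0 < r" "r < R" for r
  proof (rule ccontr)
    assume "\<not> y2 r > 0"
    obtain d where d: "d > 0" "\<And>h. 0 < h \<Longrightarrow> h < d \<Longrightarrow> y2 r0 < y2 (r0 + h)"
      using DERIV_pos_inc_right[OF d2 d2p] by blast
    define h where "h = min (d / 2) ((r - r0) / 2)"
    have h: "0 < h" "h < d" "r0 + h < r" using d rr by (auto simp: h_def min_def field_simps)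
    then have "y2 (r0 + h) > 0" using d 2 by auto
    then obtain x where "r0 + h \<le> x" "x \<le> r" "y2 x = 0"
      using IVT2'[of y2 r 0 "r0 + h"] cont[OF 2(1), of "r0 + h" r] \<open>\<not> y2 r > 0\<close> h rr r0 by auto
    then show False using y2ne[of x] h rr r0 by auto
  qed
  have y2neg: "y2 r < 0" if rr: "0 < r" "r < r0" for r
  proof (rule ccontr)
    assume "\<not> y2 r < 0"
    obtain d where d: "d > 0" "\<And>h. 0 < h \<Longrightarrow> h < d \<Longrightarrow> y2 (r0 - h) < y2 r0"
      using DERIV_pos_inc_left[OF d2 d2p] by blast
    define h where "h = min (d / 2) ((r0 - r) / 2)"
    have h: "0 < h" "h < d" "r < r0 - h" using d rr by (auto simp: h_def min_def field_simps)
    then have "y2 (r0 - h) < 0" using d 2 by auto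
    then obtain x where "r \<le> x" "x \<le> r0 - h" "y2 x = 0"
      using IVT2'[of y2 "r0 - h" 0 r] cont[OF 2(1), of r "r0 - h"] \<open>\<not> y2 r < 0\<close> h rr r0 by auto
    then show False using y2ne[of x] h rr r0 by auto
  qed
  define t where "t r = - y1 r / y2 r" for r
  have tle: "t b \<le> t a" if ab: "0 < a" "a < r0" "r0 < b" "b < R" for a b
  proof -
    let ?y = "\<lambda>r. y1 r + t b * y2 r" and ?z = "\<lambda>r. z1 r + t b * z2 r"
    have s: "sturm_sol R p (\<lambda>r. c * q r) ?y ?z" by (rule sturm_sol_comb[OF 1(1) 2(1)])
    have yb: "?y b = 0" using y2ne[of b] ab r0 by (simp add: t_def)
    \<comment> \<open>If this failed, the combination would vanish somewhere between
      \<open>a\<close> and \<open>r0\<close> and also at \<open>b\<close>, hence at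
      \<open>r0\<close>, where it equals 1.\<close>
    have "?y a > 0"
    proof (rule ccontr)
      assume "\<not> ?y a > 0"
      then obtain x where x: "a \<le> x" "x \<le> r0" "?y x = 0"
        using IVT'[of ?y a 0 r0] cont[OF s, of a r0] ab r0 1 2 by auto
      have "?y r0 = 0" using tz[OF s, of x b r0] x yb ab r0 by auto
      then show False using 1 2 by simp
    qed
    then show ?thesis using y2neg[of a] ab by (simp add: t_def field_simps)
  qed
  define s where "s = (SUP b\<in>{r0<..<R}. t b)"
  have ne: "{r0<..<R} \<noteq> {}" using r0 by auto
  have bdd: "bdd_above (t ` {r0<..<R})"
    using tle[of "r0 / 2"] r0 by (intro bdd_aboveI2[of _ _ "t (r0 / 2)"]) auto
  have s1: "t b \<le> s" if "r0 < b" "b < R" for b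
    unfolding s_def using that by (intro cSUP_upper bdd) auto
  have s2: "s \<le> t a" if "0 < a" "a < r0" for a
    unfolding s_def using that tle by (intro cSUP_least ne) auto
  define y where "y = (\<lambda>r. y1 r + s * y2 r)"
  define z where "z = (\<lambda>r. z1 r + s * z2 r)"
  have sol: "sturm_sol R p (\<lambda>r. c * q r) y z" unfolding y_def z_def by (rule sturm_sol_comb[OF 1(1) 2(1)])
  have yr0: "y r0 = 1" "z r0 = s" using 1 2 by (auto simp: y_def z_def)
  have nonneg: "y r \<ge> 0" if r: "0 < r" "r < R" for r
  proof (cases r r0 rule: linorder_cases)
    case less
    from s2[OF r(1) less] y2neg[OF r(1) less] have "t r * y2 r \<le> s * y2 r" by (intro mult_right_mono_neg) auto
    then show ?thesis using y2neg[OF r(1) less] by (simp add: y_def t_def)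
  next
    case equal
    then show ?thesis using yr0 by simp
  next
    case greater
    from s1[OF greater r(2)] y2pos[OF greater r(2)] have "t r * y2 r \<le> s * y2 r" by (intro mult_right_mono) auto
    then show ?thesis using y2pos[OF greater r(2)] by (simp add: y_def t_def)
  qed
  have "y r > 0" if r: "r \<in> {0<..<R}" for r
  proof (rule ccontr)
    assume "\<not> y r > 0"
    with nonneg[of r] r have y0: "y r = 0" by auto
    have yd: "(y has_real_derivative z r / p r) (at r)" using sol r by (auto simp: sturm_sol_def)
    have "z r / p r = 0"
    proof (rule DERIV_local_min[OF yd])
      show "0 < min r (R - r)" using r by auto
      show "\<forall>x. \<bar>r - x\<bar> < min r (R - r) \<longrightarrow> y r \<le> y x" using nonneg y0 r by auto
    qed
    then have "z r = 0" using p(2)[OF r] by simp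
    moreover have "y r * z2 r - y2 r * z r = y r0 * z2 r0 - y2 r0 * z r0"
      by (rule sturm_wronskian[OF sol 2(1) r r0I])
    ultimately show False using y0 yr0 2 by simp
  qed
  with sol show ?thesis by blast
qed

text \<open>V is differentiable, so y' = z / p can be differentiated once more by the quotient
  rule.\<close>

lemma bessel_ode_of_sturm:
  assumes n: "n \<ge> (1::nat)"
    and V: "\<And>r. r \<in> {0<..<R} \<Longrightarrow> (V has_real_derivative deriv V r) (at r)"
    and V0: "\<And>r. r \<in> {0<..<R} \<Longrightarrow> V r > 0"
    and sol: "sturm_sol R (\<lambda>r. r ^ (n - 1) * V r) (\<lambda>r. c * (r ^ (n - 1) * W r)) y z"
  shows "bessel_ode n R V W c y"
  unfolding bessel_ode_def
proof (intro ballI conjI)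
  fix r assume r: "r \<in> {0<..<R}"
  let ?p = "\<lambda>r. r ^ (n - 1) * V r"
  have y: "(y has_real_derivative z s / ?p s) (at s)" if "s \<in> {0<..<R}" for s
    using sol that by (auto simp: sturm_sol_def)
  have p0: "?p r > 0" using r V0 by auto
  have dy: "deriv y s = z s / ?p s" if "s \<in> {0<..<R}" for s
    using y[OF that] by (rule DERIV_imp_deriv)
  show "y differentiable at r" using y[OF r] by (auto simp: real_differentiable_def)
  \<comment> \<open>The logarithmic derivative of p = r^(n - 1) V.\<close>
  define \<kappa> where "\<kappa> = (real n - 1) / r + deriv V r / V r"
  have "((\<lambda>r. r ^ (n - 1) * V r * 1) has_real_derivative ?p r * (0 + \<kappa> * 1)) (at r)"
    unfolding \<kappa>_def using r V0[OF r] by (intro DERIV_weighted_flux[OF n _ V[OF r]]) auto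
  then have p': "(?p has_real_derivative ?p r * \<kappa>) (at r)" by simp
  have z': "(z has_real_derivative - (c * (r ^ (n - 1) * W r) * y r)) (at r)"
    using sol r by (auto simp: sturm_sol_def)
  have "((\<lambda>s. z s / ?p s) has_real_derivative
      (- (c * (r ^ (n - 1) * W r) * y r) * ?p r - z r * (?p r * \<kappa>)) / (?p r * ?p r)) (at r)"
    by (rule DERIV_divide[OF z' p' less_imp_neq[OF p0, symmetric]])
  also have "(- (c * (r ^ (n - 1) * W r) * y r) * ?p r - z r * (?p r * \<kappa>)) / (?p r * ?p r)
     = - (c * W r / V r * y r) - \<kappa> * (z r / ?p r)"
  proof -
    have "(- (c * (P * w) * t) * (P * v) - u * (P * v * \<kappa>)) / (P * v * (P * v)) = - (c * w / v * t) - \<kappa> * (u / (P * v))"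
      if "P \<noteq> 0" "v \<noteq> 0" for P v w t u :: real
      using that by (simp add: divide_simps) (simp add: algebra_simps)
    moreover have "V r \<noteq> 0" "r ^ (n - 1) \<noteq> 0" using r V0[OF r] by auto
    ultimately show ?thesis by blast
  qed
  finally have "(deriv y has_real_derivative - (c * W r / V r * y r) - \<kappa> * (z r / ?p r)) (at r)"
    by (rule has_field_derivative_transform_within_open[of _ _ _ "{0<..<R}"]) (use r dy in auto)
  note dd = this
  show "deriv y differentiable at r" using dd by (auto simp: real_differentiable_def)
  show "deriv (deriv y) r + ((real n - 1) / r + deriv V r / V r) * deriv y r + c * W r / V r * y r = 0"
    unfolding DERIV_imp_deriv[OF dd] dy[OF r] \<kappa>_def[symmetric] by simp
qed

text \<open>The weight is a supremum that need not be attained, so solutions for all c strictly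
  between 0 and 1 are enough.\<close>

lemma bessel_weight_ge_1I:
  assumes "\<And>c. 0 < c \<Longrightarrow> c < 1 \<Longrightarrow> has_positive_solution n R V W c"
  shows "bessel_pair n R V W \<and> bessel_weight n R V W \<ge> 1"
proof
  show "bessel_pair n R V W" unfolding bessel_pair_def using assms[of "1/2"] by (intro exI[of _ "1/2"]) auto
  show "bessel_weight n R V W \<ge> 1"
  proof (rule dense_le)
    fix e :: ereal assume "e < 1"
    then have "max e 0 < 1" by simp
    then obtain c where c: "max e 0 < ereal c" "ereal c < 1" using ereal_dense2 by blast
    then have "0 < c" "c < 1" by auto
    then have "ereal c \<le> bessel_weight n R V W"
      unfolding bessel_weight_def using assms by (intro Sup_upper) auto
    then show "e \<le> bessel_weight n R V W" using c by (auto intro: order_trans less_imp_le)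
  qed
qed

lemma bessel_weight_ge_1D:
  assumes "bessel_weight n R V W \<ge> 1" "b < 1"
  obtains c where "c > 0" "c > b" "has_positive_solution n R V W c"
proof -
  have "ereal b < 1" using assms(2) by simp
  then have "ereal b < bessel_weight n R V W" using assms(1) by (rule less_le_trans)
  then show ?thesis unfolding bessel_weight_def less_Sup_iff using that by auto
qed

section \<open>Smooth approximation on an interval\<close>

lemma has_partial_real:
  fixes f :: "real \<Rightarrow> real"
  assumes "(f has_real_derivative d) (at x)"
  shows "partial 1 f x = d" "f differentiable at x"
  using assms partial_eq[of f "(*) d" x 1]
  by (auto simp: has_field_derivative_def differentiable_def)

lemma Ck_real_Suc:
  fixes f :: "real \<Rightarrow> real"
  assumes "\<And>x. (f has_real_derivative f' x) (at x)" "Ck k f'"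
  shows "Ck (Suc k) f"
proof -
  have "partial 1 f = f'" using has_partial_real(1)[OF assms(1)] by auto
  then show ?thesis using has_partial_real(2)[OF assms(1)] assms(2) by simp
qed

lemma smooth_real_antiderivative:
  fixes f :: "real \<Rightarrow> real"
  assumes "\<And>x. (f has_real_derivative f' x) (at x)" "smooth f'"
  shows "smooth f"
  unfolding smooth_def using Ck_SucD[OF Ck_real_Suc[OF assms(1) smooth_Ck[OF assms(2)]]] by blast

lemma smooth_real_polynomial_function:
  fixes f :: "real \<Rightarrow> real"
  assumes "real_polynomial_function f"
  shows "smooth f"
  using assms
proof induction
  case (linear f)
  interpret bounded_linear f by fact
  have "f x = (x \<bullet> 1) * f 1" for x using scaleR[of x 1] by simp
  then have eq: "f = (\<lambda>x. (x \<bullet> 1) * f 1)" by (rule ext)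
  have "smooth (\<lambda>x. (x \<bullet> 1) * f 1)" by (intro smooth_intros)
  then show ?case by (subst eq)
qed (auto intro: smooth_intros)

text \<open>The polynomial factor makes the family closed under differentiation, so that smoothness
  becomes an induction; \<open>flat 1\<close> is the classical exp (- 1 / x).\<close>

definition flat :: "real poly \<Rightarrow> real \<Rightarrow> real" where
  "flat P x = (if x > 0 then poly P (1 / x) * exp (- (1 / x)) else 0)"

lemma tendsto_poly_exp_0: "((\<lambda>t. poly P t * exp (- t)) \<longlongrightarrow> (0::real)) at_top"
proof -
  have "((\<lambda>t. \<Sum>i\<le>degree P. coeff P i * (t ^ i / exp t)) \<longlongrightarrow> (\<Sum>i\<le>degree P. coeff P i * 0)) at_top"
    by (intro tendsto_intros tendsto_power_div_exp_0)
  moreover have "(\<Sum>i\<le>degree P. coeff P i * (t ^ i / exp t)) = poly P t * exp (- t)" for t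
    by (simp add: poly_altdef sum_distrib_left exp_minus divide_inverse mult_ac)
  ultimately show ?thesis by simp
qed

text \<open>For x > 0 and t = 1 / x the derivative in x is - t^2 times the derivative in t, which
  maps P(t) exp (- t) to t^2 (P - P') exp (- t); \<open>[:0, 0, 1:]\<close> is t^2. At 0 the
  difference quotient from the right is again of this type and tends to 0.\<close>

lemma flat_DERIV: "(flat P has_real_derivative flat ([:0, 0, 1:] * (P - pderiv P)) x) (at x)"
proof (cases x "0::real" rule: linorder_cases)
  case less
  have "((\<lambda>_. 0) has_real_derivative 0) (at x)" by simp
  then have "(flat P has_real_derivative 0) (at x)"
    by (rule has_field_derivative_transform_within_open[of _ _ _ "{..<0}"]) (use less in \<open>auto simp: flat_def\<close>)
  then show ?thesis using less by (simp add: flat_def)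
next
  case greater
  have "((\<lambda>x. poly P (1 / x) * exp (- (1 / x))) has_real_derivative
     poly (pderiv P) (1 / x) * (- (1 / x\<^sup>2)) * exp (- (1 / x)) + exp (- (1 / x)) * (1 / x\<^sup>2) * poly P (1 / x)) (at x)"
  proof -
    have i: "((\<lambda>x. 1 / x) has_real_derivative - (1 / x\<^sup>2)) (at x)"
      using greater by (auto intro!: derivative_eq_intros simp: power2_eq_square)
    have "((\<lambda>x. poly P (1 / x)) has_real_derivative poly (pderiv P) (1 / x) * (- (1 / x\<^sup>2))) (at x)"
      by (rule DERIV_chain2[OF poly_DERIV i])
    moreover have "((\<lambda>x. exp (- (1 / x))) has_real_derivative exp (- (1 / x)) * (1 / x\<^sup>2)) (at x)"
      using DERIV_chain2[OF DERIV_exp DERIV_minus[OF i]] by simp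
    ultimately show ?thesis by (rule DERIV_mult)
  qed
  moreover have "poly (pderiv P) (1 / x) * (- (1 / x\<^sup>2)) * exp (- (1 / x)) + exp (- (1 / x)) * (1 / x\<^sup>2) * poly P (1 / x)
      = flat ([:0, 0, 1:] * (P - pderiv P)) x"
    using greater by (simp add: flat_def algebra_simps power2_eq_square)
  ultimately have "((\<lambda>x. poly P (1 / x) * exp (- (1 / x))) has_real_derivative flat ([:0, 0, 1:] * (P - pderiv P)) x) (at x)"
    by simp
  then show ?thesis
    by (rule has_field_derivative_transform_within_open[of _ _ _ "{0<..}"]) (use greater in \<open>auto simp: flat_def\<close>)
next
  case equal
  have "((\<lambda>h. flat P h / h) \<longlongrightarrow> 0) (at_right 0)"
  proof -
    have "((\<lambda>t. poly ([:0, 1:] * P) t * exp (- t)) \<longlongrightarrow> 0) at_top" by (rule tendsto_poly_exp_0)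
    moreover have "filterlim (\<lambda>h::real. 1 / h) at_top (at_right 0)"
      using filterlim_inverse_at_top_right by (simp add: divide_inverse)
    ultimately have "((\<lambda>h. poly ([:0, 1:] * P) (1 / h) * exp (- (1 / h))) \<longlongrightarrow> 0) (at_right 0)"
      by (rule filterlim_compose)
    then show ?thesis
      by (rule Lim_transform_eventually)
        (auto simp: flat_def eventually_at_filter intro!: always_eventually)
  qed
  moreover have "((\<lambda>h. flat P h / h) \<longlongrightarrow> 0) (at_left 0)"
    by (rule tendsto_eventually) (auto simp: flat_def eventually_at_filter intro!: always_eventually)
  ultimately have "((\<lambda>h. flat P h / h) \<longlongrightarrow> 0) (at 0)" by (simp add: filterlim_split_at)
  then show ?thesis using equal by (simp add: DERIV_def flat_def)
qed

lemma smooth_flat: "smooth (flat P)"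
proof -
  have "Ck k (flat P)" for k P
  proof (induction k arbitrary: P)
    case 0
    have "continuous_on UNIV (flat P)"
      using flat_DERIV by (meson DERIV_isCont continuous_at_imp_continuous_on)
    then show ?case by simp
  next
    case (Suc k)
    show ?case by (rule Ck_real_Suc[OF flat_DERIV Suc])
  qed
  then show ?thesis by (simp add: smooth_def)
qed

text \<open>The arguments vanish at distance (B - A) / (4 (j + 1)) from the respective end points,
  so the support lies strictly inside (A, B) and exhausts it as j grows; the 4 makes both arguments
  equal to 1 at the midpoint when j = 0.\<close>

definition bump :: "real \<Rightarrow> real \<Rightarrow> nat \<Rightarrow> real \<Rightarrow> real" where
  "bump A B j x = flat 1 (4 / (B - A) * real (Suc j) * (x - A) - 1) * flat 1 (4 / (B - A) * real (Suc j) * (B - x) - 1)"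

lemma flat_1_range: "0 \<le> flat 1 x" "flat 1 x \<le> 1"
  by (auto simp: flat_def)

lemma bump_range: "0 \<le> bump A B j x" "bump A B j x \<le> 1"
  using flat_1_range by (auto simp: bump_def intro: mult_le_one)

lemma smooth_bump: "smooth (bump A B j)"
proof -
  have "smooth (\<lambda>x::real. 4 / (B - A) * real (Suc j) * ((x \<bullet> 1) - A) - 1)" "smooth (\<lambda>x::real. 4 / (B - A) * real (Suc j) * (B - (x \<bullet> 1)) - 1)"
    by (intro smooth_intros)+
  from smooth_mult[OF smooth_compose[OF smooth_flat this(1)] smooth_compose[OF smooth_flat this(2)]]
  show ?thesis unfolding bump_def[abs_def] by simp
qed

lemma bump_support:
  assumes "A < B" "x \<le> A + (B - A) / (4 * real (Suc j)) \<or> B - (B - A) / (4 * real (Suc j)) \<le> x"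
  shows "bump A B j x = 0"
  using assms(2)
proof
  assume "x \<le> A + (B - A) / (4 * real (Suc j))"
  then have "4 / (B - A) * real (Suc j) * (x - A) \<le> 4 / (B - A) * real (Suc j) * ((B - A) / (4 * real (Suc j)))"
    using assms(1) by (intro mult_left_mono) auto
  also have "\<dots> = 1" using assms(1) by (simp del: of_nat_Suc)
  finally show ?thesis by (simp add: bump_def flat_def)
next
  assume "B - (B - A) / (4 * real (Suc j)) \<le> x"
  then have "4 / (B - A) * real (Suc j) * (B - x) \<le> 4 / (B - A) * real (Suc j) * ((B - A) / (4 * real (Suc j)))"
    using assms(1) by (intro mult_left_mono) auto
  also have "\<dots> = 1" using assms(1) by (simp del: of_nat_Suc)
  finally show ?thesis by (simp add: bump_def flat_def)
qed

lemma flat_1_tendsto: "((flat 1) \<longlongrightarrow> 1) at_top"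
proof -
  have "((\<lambda>x::real. exp (- (1 / x))) \<longlongrightarrow> exp (- 0)) at_top"
    by (intro tendsto_exp tendsto_minus real_tendsto_divide_at_top[OF tendsto_const filterlim_ident])
  then have "((\<lambda>x::real. exp (- (1 / x))) \<longlongrightarrow> 1) at_top" by simp
  then show ?thesis
  proof (rule Lim_transform_eventually)
    show "\<forall>\<^sub>F x::real in at_top. exp (- (1 / x)) = flat 1 x"
      using eventually_gt_at_top[of 0] by eventually_elim (simp add: flat_def)
  qed
qed

lemma bump_tendsto:
  assumes "A < x" "x < B"
  shows "(\<lambda>j. bump A B j x) \<longlonglongrightarrow> 1"
proof -
  have *: "filterlim (\<lambda>j. 4 / (B - A) * real (Suc j) * d - 1) at_top sequentially" if "d > 0" for d
  proof -
    have "filterlim (\<lambda>j. real (Suc j)) at_top sequentially"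
      by (rule filterlim_compose[OF filterlim_real_sequentially filterlim_Suc])
    then have "filterlim (\<lambda>j. (4 / (B - A) * d) * real (Suc j)) at_top sequentially"
      using assms that by (intro filterlim_tendsto_pos_mult_at_top[OF tendsto_const]) auto
    then have "filterlim (\<lambda>j. - 1 + (4 / (B - A) * d) * real (Suc j)) at_top sequentially"
      by (rule filterlim_tendsto_add_at_top[OF tendsto_const])
    then show ?thesis by (simp add: algebra_simps)
  qed
  have "(\<lambda>j. flat 1 (4 / (B - A) * real (Suc j) * (x - A) - 1)) \<longlonglongrightarrow> 1"
    using assms by (intro filterlim_compose[OF flat_1_tendsto] *) auto
  moreover have "(\<lambda>j. flat 1 (4 / (B - A) * real (Suc j) * (B - x) - 1)) \<longlonglongrightarrow> 1"
    using assms by (intro filterlim_compose[OF flat_1_tendsto] *) auto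
  ultimately show ?thesis unfolding bump_def using tendsto_mult by fastforce
qed

lemma bump_integral_pos:
  assumes "A < B"
  shows "integral {A..B} (bump A B 0) > 0"
proof -
  have c: "continuous_on {A..B} (bump A B 0)" by (intro smooth_continuous_on smooth_bump)
  have "4 / (B - A) * ((A + B) / 2 - A) - 1 = 1" "4 / (B - A) * (B - (A + B) / 2) - 1 = 1"
    using assms by (simp_all add: field_simps)
  then have "bump A B 0 ((A + B) / 2) > 0" by (simp add: bump_def flat_def)
  moreover have "(A + B) / 2 \<in> {A..B}" using assms by auto
  ultimately have "integral {A..B} (bump A B 0) \<noteq> 0"
    using integral_eq_0_iff[OF c assms] bump_range(1) by fastforce
  moreover have "integral {A..B} (bump A B 0) \<ge> 0"
    by (intro Henstock_Kurzweil_Integration.integral_nonneg integrable_continuous_real c bump_range)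
  ultimately show ?thesis by simp
qed

text \<open>The derivative is approximated first, by polynomials times bumps, corrected by a multiple of a
  fixed bump so that the antiderivative has compact support.\<close>

lemma smooth_approximation:
  fixes U U1 :: "real \<Rightarrow> real"
  assumes AB: "A < B" and U: "\<And>s. A \<le> s \<Longrightarrow> s \<le> B \<Longrightarrow> (U has_real_derivative U1 s) (at s)"
    and U1: "continuous_on {A..B} U1" and z: "U A = 0" "U B = 0"
  obtains h h1 :: "nat \<Rightarrow> real \<Rightarrow> real" and \<delta> :: "nat \<Rightarrow> real" and C :: real
  where "\<And>j. smooth (h j)" "\<And>j s. (h j has_real_derivative h1 j s) (at s)" "\<And>j. smooth (h1 j)"
    "\<And>j. \<delta> j > 0" "\<And>j s. s \<le> A + \<delta> j \<or> B - \<delta> j \<le> s \<Longrightarrow> h j s = 0"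
    "\<And>j s. \<bar>h j s\<bar> \<le> C" "\<And>j s. \<bar>h1 j s\<bar> \<le> C"
    "\<And>s. A < s \<Longrightarrow> s < B \<Longrightarrow> (\<lambda>j. h j s) \<longlonglongrightarrow> U s" "\<And>s. A < s \<Longrightarrow> s < B \<Longrightarrow> (\<lambda>j. h1 j s) \<longlonglongrightarrow> U1 s"
proof -
  obtain K0 where K0: "\<And>s. s \<in> {A..B} \<Longrightarrow> \<bar>U1 s\<bar> \<le> K0"
  proof -
    have "bounded (U1 ` {A..B})" by (intro compact_imp_bounded compact_continuous_image U1) auto
    then show ?thesis using that unfolding bounded_iff by (metis image_eqI real_norm_def)
  qed
  define K where "K = K0 + 1"
  have K1: "K \<ge> 1" using K0[of A] AB by (auto simp: K_def)
  have "\<forall>j. \<exists>g. real_polynomial_function g \<and> (\<forall>s\<in>{A..B}. \<bar>U1 s - g s\<bar> < 1 / real (Suc j))"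
  proof
    fix j
    have "0 < 1 / real (Suc j)" by simp
    then show "\<exists>g. real_polynomial_function g \<and> (\<forall>s\<in>{A..B}. \<bar>U1 s - g s\<bar> < 1 / real (Suc j))"
      using Stone_Weierstrass_real_polynomial_function[OF compact_Icc U1] by metis
  qed
  from choice[OF this] obtain P where P: "\<And>j. real_polynomial_function (P j)"
    "\<And>j s. s \<in> {A..B} \<Longrightarrow> \<bar>U1 s - P j s\<bar> < 1 / real (Suc j)" by blast
  have inv0: "(\<lambda>j. 1 / real (Suc j)) \<longlonglongrightarrow> 0"
    using LIMSEQ_inverse_real_of_nat by (simp add: inverse_eq_divide)
  have Plim: "(\<lambda>j. P j s) \<longlonglongrightarrow> U1 s" if "s \<in> {A..B}" for s
  proof (rule metric_tendsto_imp_tendsto[OF inv0])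
    show "\<forall>\<^sub>F j in sequentially. dist (P j s) (U1 s) \<le> dist (1 / real (Suc j)) 0"
      using P(2)[OF that] by (intro always_eventually allI) (simp add: dist_real_def abs_minus_commute less_imp_le)
  qed
  have PK: "\<bar>P j s\<bar> \<le> K" if "s \<in> {A..B}" for j s
  proof -
    have "1 / real (Suc j) \<le> 1" by simp
    then show ?thesis using P(2)[OF that, of j] K0[OF that] unfolding K_def by linarith
  qed
  define f where "f j s = P j s * bump A B j s" for j s
  have fs: "smooth (f j)" for j
    unfolding f_def[abs_def] by (intro smooth_mult smooth_bump smooth_real_polynomial_function P)
  have fz: "f j s = 0" if "s \<le> A + (B - A) / (4 * real (Suc j)) \<or> B - (B - A) / (4 * real (Suc j)) \<le> s" for j s
    using bump_support[OF AB that] by (simp add: f_def)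
  have dpos: "(B - A) / (4 * real (Suc j)) > 0" for j using AB by simp
  have fK: "\<bar>f j s\<bar> \<le> K" for j s
  proof (cases "s \<in> {A..B}")
    case True
    have "\<bar>P j s\<bar> * \<bar>bump A B j s\<bar> \<le> K * 1"
      using PK[OF True] bump_range K1 by (intro mult_mono) (auto simp: abs_le_iff intro: order_trans[of _ 0])
    then show ?thesis by (simp add: f_def abs_mult)
  next
    case False
    then have "f j s = 0" using dpos[of j] by (intro fz) auto
    then show ?thesis using K1 by simp
  qed
  have flim: "(\<lambda>j. f j s) \<longlonglongrightarrow> U1 s" if "A < s" "s < B" for s
  proof -
    have "s \<in> {A..B}" using that by auto
    from tendsto_mult[OF Plim[OF this] bump_tendsto[OF that]] show ?thesis by (simp add: f_def)
  qed
  have intlim: "(\<lambda>j. integral {A..t} (f j)) \<longlonglongrightarrow> U t" if t: "A \<le> t" "t \<le> B" for t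
  proof -
    let ?g = "\<lambda>s. if s \<in> {A<..<B} then U1 s else 0"
    have "(\<lambda>j. integral {A..t} (f j)) \<longlonglongrightarrow> integral {A..t} ?g"
    proof (rule dominated_convergence(2)[where h = "\<lambda>_. K"])
      show "f j integrable_on {A..t}" for j
        by (intro integrable_continuous_real smooth_continuous_on fs)
      show "(\<lambda>j. f j s) \<longlonglongrightarrow> ?g s" if "s \<in> {A..t}" for s
      proof (cases "s \<in> {A<..<B}")
        case True
        then show ?thesis using flim[of s] by simp
      next
        case False
        then have "s \<le> A \<or> B \<le> s" using that by auto
        then have "f j s = 0" for j using dpos[of j] by (intro fz) auto
        then show ?thesis by (subst if_not_P[OF False]) simp
      qed
    qed (use fK in auto)
    also have "integral {A..t} ?g = integral {A..t} U1"
      by (rule integral_spike[of "{A, B}"]) (use t in auto)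
    also have "integral {A..t} U1 = U t - U A"
      by (rule integral_unique, rule has_integral_DERIV) (use t U in auto)
    finally show ?thesis using z by simp
  qed
  define \<kappa> where "\<kappa> = integral {A..B} (bump A B 0)"
  have \<kappa>: "\<kappa> > 0" unfolding \<kappa>_def by (rule bump_integral_pos[OF AB])
  define m where "m j = integral {A..B} (f j)" for j
  \<comment> \<open>The limit is U B - U A = 0, so the correction of the mean in \<open>h1\<close>
    does not affect the limits.\<close>
  have m0: "m \<longlonglongrightarrow> 0" using intlim[of B] AB z by (simp add: m_def[abs_def])
  define h1 where "h1 j s = f j s - m j / \<kappa> * bump A B 0 s" for j s
  have h1s: "smooth (h1 j)" for j
    unfolding h1_def[abs_def] by (intro smooth_diff smooth_mult smooth_const fs smooth_bump)
  have h1z: "h1 j s = 0" if "s \<le> A + (B - A) / (4 * real (Suc j)) \<or> B - (B - A) / (4 * real (Suc j)) \<le> s" for j s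
  proof -
    have "(B - A) / (4 * real (Suc j)) \<le> (B - A) / (4 * real (Suc 0))"
      using AB by (intro divide_left_mono) auto
    then have "bump A B 0 s = 0" using that by (intro bump_support[OF AB]) linarith
    then show ?thesis using fz[OF that] by (simp add: h1_def)
  qed
  have mK: "\<bar>m j\<bar> \<le> K * (B - A)" for j
  proof -
    have "norm (integral {A..B} (f j)) \<le> K * (B - A)"
      by (rule integral_bound) (use AB fK in \<open>auto intro: smooth_continuous_on fs\<close>)
    then show ?thesis by (simp add: m_def)
  qed
  define C1 where "C1 = K + K * (B - A) / \<kappa>"
  have C1: "\<bar>h1 j s\<bar> \<le> C1" for j s
  proof -
    have "\<bar>m j / \<kappa> * bump A B 0 s\<bar> \<le> (K * (B - A) / \<kappa>) * 1"
      unfolding abs_mult using mK[of j] bump_range[of A B 0 s] \<kappa> K1 AB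
      by (intro mult_mono) (auto simp: abs_div divide_right_mono)
    then show ?thesis using fK[of j s] unfolding h1_def C1_def by linarith
  qed
  have "\<forall>j. \<exists>G. \<forall>s. (G has_real_derivative h1 j s) (at s)"
    using antiderivative_exists[OF smooth_continuous_on[OF h1s]] by metis
  from choice[OF this] obtain G where G: "\<And>j s. (G j has_real_derivative h1 j s) (at s)" by blast
  define h where "h j s = G j s - G j A" for j s
  have hd: "(h j has_real_derivative h1 j s) (at s)" for j s
    using DERIV_diff[OF G DERIV_const] by (simp add: h_def[abs_def])
  have hs: "smooth (h j)" for j by (rule smooth_real_antiderivative[OF hd h1s])
  have hi: "(h1 j has_integral (h j t - h j s)) {s..t}" if "s \<le> t" for j s t
    using that hd by (rule has_integral_DERIV)
  have hint: "h j t = integral {A..t} (h1 j)" if "A \<le> t" for j t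
    using integral_unique[OF hi[OF that, of j]] by (simp add: h_def)
  have hB: "h j B = 0" for j
  proof -
    have "((\<lambda>s. f j s - m j / \<kappa> * bump A B 0 s) has_integral (m j - m j / \<kappa> * \<kappa>)) {A..B}"
      unfolding m_def[of j] \<kappa>_def
      by (intro has_integral_diff has_integral_mult_right integrable_integral integrable_continuous_real
          smooth_continuous_on fs smooth_bump)
    then show ?thesis using hint[of B j] AB \<kappa> by (simp add: h1_def[abs_def] integral_unique)
  qed
  have hz: "h j s = 0" if s: "s \<le> A + (B - A) / (4 * real (Suc j)) \<or> B - (B - A) / (4 * real (Suc j)) \<le> s" for j s
  proof -
    have const: "h j a = h j b" if "a \<le> b" "\<And>t. t \<in> {a..b} \<Longrightarrow> h1 j t = 0" for a b
    proof -
      have "((\<lambda>_. 0) has_integral (h j b - h j a)) {a..b}"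
        by (rule has_integral_eq[OF _ hi[OF that(1)]]) (use that in auto)
      then show ?thesis using has_integral_unique[OF has_integral_0] by fastforce
    qed
    from s show ?thesis
    proof
      assume s: "s \<le> A + (B - A) / (4 * real (Suc j))"
      have "h j (min s A) = h j (max s A)" by (rule const) (use s dpos[of j] in \<open>auto intro!: h1z\<close>)
      moreover have "h j A = 0" by (simp add: h_def)
      ultimately show ?thesis by (auto simp: min_def max_def split: if_splits)
    next
      assume s: "B - (B - A) / (4 * real (Suc j)) \<le> s"
      have "h j (min s B) = h j (max s B)" by (rule const) (use s dpos[of j] in \<open>auto intro!: h1z\<close>)
      then show ?thesis using hB[of j] by (auto simp: min_def max_def split: if_splits)
    qed
  qed
  have C1p: "C1 \<ge> 0" using C1[of 0 A] by linarith
  have hC: "\<bar>h j s\<bar> \<le> C1 * (B - A)" for j s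
  proof (cases "A \<le> s \<and> s \<le> B")
    case True
    have "norm (integral {A..s} (h1 j)) \<le> C1 * (s - A)"
      by (rule integral_bound) (use True C1 in \<open>auto intro: smooth_continuous_on h1s\<close>)
    also have "\<dots> \<le> C1 * (B - A)" using True C1p by (intro mult_left_mono) auto
    finally show ?thesis using hint[of s j] True by simp
  next
    case False
    then have "h j s = 0" using dpos[of j] by (intro hz) auto
    then show ?thesis using C1p AB by simp
  qed
  have hlim: "(\<lambda>j. h j s) \<longlonglongrightarrow> U s" if s: "A < s" "s < B" for s
  proof -
    have "h j s = integral {A..s} (f j) - m j / \<kappa> * integral {A..s} (bump A B 0)" for j
    proof -
      have "((\<lambda>t. f j t - m j / \<kappa> * bump A B 0 t) has_integral (integral {A..s} (f j) - m j / \<kappa> * integral {A..s} (bump A B 0))) {A..s}"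
        by (intro has_integral_diff has_integral_mult_right integrable_integral integrable_continuous_real
            smooth_continuous_on fs smooth_bump)
      then show ?thesis using hint[of s j] s by (simp add: h1_def[abs_def] integral_unique)
    qed
    moreover have "(\<lambda>j. integral {A..s} (f j) - m j / \<kappa> * integral {A..s} (bump A B 0)) \<longlonglongrightarrow> U s - 0 / \<kappa> * integral {A..s} (bump A B 0)"
      using s \<kappa> by (intro tendsto_intros intlim m0) auto
    ultimately show ?thesis by simp
  qed
  have h1lim: "(\<lambda>j. h1 j s) \<longlonglongrightarrow> U1 s" if s: "A < s" "s < B" for s
  proof -
    have "(\<lambda>j. f j s - m j / \<kappa> * bump A B 0 s) \<longlonglongrightarrow> U1 s - 0 / \<kappa> * bump A B 0 s"
      using s \<kappa> by (intro tendsto_intros flim m0) auto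
    then show ?thesis by (simp add: h1_def)
  qed
  show ?thesis
  proof (rule that[of h h1 "\<lambda>j. (B - A) / (4 * real (Suc j))" "max C1 (C1 * (B - A))"])
    show "\<bar>h j s\<bar> \<le> max C1 (C1 * (B - A))" "\<bar>h1 j s\<bar> \<le> max C1 (C1 * (B - A))" for j s
      using hC[of j s] C1[of j s] by auto
  qed (use hs hd h1s dpos hz hlim h1lim in auto)
qed

lemma test_functionI:
  fixes u :: "'a::euclidean_space \<Rightarrow> real"
  assumes "smooth u" "\<And>x. norm x > \<rho> \<Longrightarrow> u x = 0" "\<rho> < R"
  shows "u \<in> test_functions (ball 0 R)"
proof -
  have "{x. u x \<noteq> 0} \<subseteq> cball 0 \<rho>" using assms(2) by (auto simp: not_less[symmetric])
  then have cl: "closure {x. u x \<noteq> 0} \<subseteq> cball 0 \<rho>" by (intro closure_minimal) auto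
  then have "compact (closure {x. u x \<noteq> 0})"
    by (meson bounded_cball bounded_subset closed_closure compact_eq_bounded_closed)
  moreover have "cball (0::'a) \<rho> \<subseteq> ball 0 R" using assms(3) by auto
  ultimately show ?thesis using cl assms(1) by (auto simp: test_functions_def smooth_def)
qed

section \<open>The spectral gap of the sphere\<close>

lemma nn_integral_lborel_translate:
  fixes f :: "'a::euclidean_space \<Rightarrow> ennreal"
  assumes [measurable]: "f \<in> borel_measurable borel"
  shows "(\<integral>\<^sup>+x. f (x + c) \<partial>lborel) = (\<integral>\<^sup>+x. f x \<partial>lborel)"
proof -
  have "(\<integral>\<^sup>+x. f x \<partial>lborel) = (\<integral>\<^sup>+x. f x \<partial>distr lborel borel ((+) c))" by (simp add: lborel_distr_plus)
  also have "\<dots> = (\<integral>\<^sup>+x. f (c + x) \<partial>lborel)" by (subst nn_integral_distr) auto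
  finally show ?thesis by (simp add: add.commute)
qed

text \<open>Lebesgue measure is determined up to a factor by translation invariance, and a linear isometry
  preserves the volume of the unit ball.\<close>

lemma lborel_linear_isometry:
  fixes A A' :: "'a::euclidean_space \<Rightarrow> 'a"
  assumes A: "bounded_linear A" and norm: "\<And>x. norm (A x) = norm x" and inv: "\<And>x. A (A' x) = x"
  shows "distr lborel borel A = lborel"
proof (rule measure_eqI)
  interpret bounded_linear A by fact
  have [measurable]: "A \<in> borel \<rightarrow>\<^sub>M borel"
    by (intro borel_measurable_continuous_onI linear_continuous_on A)
  fix B assume "B \<in> sets (distr lborel borel A)"
  then have [measurable]: "B \<in> sets borel" by simp
  let ?E = "ball (0::'a) 1"
  have [measurable]: "?E \<in> sets borel" by simp
  have "(\<lambda>(x, y). indicator ?E x * indicator B (A y + x) :: ennreal) \<in> borel_measurable (borel \<Otimes>\<^sub>M borel)"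
    "(\<lambda>(x, y). indicator ?E (x - A y) * indicator B x :: ennreal) \<in> borel_measurable (borel \<Otimes>\<^sub>M borel)"
    by measurable
  then have m: "(\<lambda>(x, y). indicator ?E x * indicator B (A y + x) :: ennreal) \<in> borel_measurable (lborel \<Otimes>\<^sub>M lborel)"
    "(\<lambda>(x, y). indicator ?E (x - A y) * indicator B x :: ennreal) \<in> borel_measurable (lborel \<Otimes>\<^sub>M lborel)"
    by (simp_all cong: measurable_cong_sets)
  \<comment> \<open>The double integral of 1_E(x) 1_B(A y + x), with E the unit ball, is evaluated
    in both orders. In one order the inverse map absorbs x into a translation of y; in the other,
    preservation of the norm turns the factor 1_E into the indicator of a unit ball around
    \<open>A' x\<close>.\<close>
  have "emeasure lborel ?E * (\<integral>\<^sup>+y. indicator B (A y) \<partial>lborel)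
      = (\<integral>\<^sup>+x. indicator ?E x * (\<integral>\<^sup>+y. indicator B (A y) \<partial>lborel) \<partial>lborel)"
    by (subst nn_integral_multc) (auto intro!: borel_measurable_indicator)
  also have "\<dots> = (\<integral>\<^sup>+x. \<integral>\<^sup>+y. indicator ?E x * indicator B (A y + x) \<partial>lborel \<partial>lborel)"
  proof (rule nn_integral_cong)
    fix x :: 'a
    have "(\<integral>\<^sup>+y. indicator B (A y) \<partial>lborel) = (\<integral>\<^sup>+y. indicator B (A (y + A' x)) \<partial>lborel :: ennreal)"
      by (rule nn_integral_lborel_translate[symmetric]) simp
    then have "(\<integral>\<^sup>+y. indicator B (A y) \<partial>lborel) = (\<integral>\<^sup>+y. indicator B (A y + x) \<partial>lborel :: ennreal)"
      by (simp add: add inv)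
    then show "indicator ?E x * (\<integral>\<^sup>+y. indicator B (A y) \<partial>lborel) = (\<integral>\<^sup>+y. indicator ?E x * indicator B (A y + x) \<partial>lborel :: ennreal)"
      by (subst nn_integral_cmult) auto
  qed
  also have "\<dots> = (\<integral>\<^sup>+y. \<integral>\<^sup>+x. indicator ?E x * indicator B (A y + x) \<partial>lborel \<partial>lborel)"
    by (rule lborel_pair.Fubini'[OF m(1), symmetric])
  also have "\<dots> = (\<integral>\<^sup>+y. \<integral>\<^sup>+x. indicator ?E (x - A y) * indicator B x \<partial>lborel \<partial>lborel)"
  proof (rule nn_integral_cong)
    fix y :: 'a
    have "(\<integral>\<^sup>+x. indicator ?E ((x + A y) - A y) * indicator B (x + A y) \<partial>lborel :: ennreal)
       = (\<integral>\<^sup>+x. indicator ?E (x - A y) * indicator B x \<partial>lborel)"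
      by (rule nn_integral_lborel_translate[where f = "\<lambda>x. indicator ?E (x - A y) * indicator B x"]) simp
    then show "(\<integral>\<^sup>+x. indicator ?E x * indicator B (A y + x) \<partial>lborel :: ennreal) = (\<integral>\<^sup>+x. indicator ?E (x - A y) * indicator B x \<partial>lborel)"
      by (simp add: add.commute)
  qed
  also have "\<dots> = (\<integral>\<^sup>+x. \<integral>\<^sup>+y. indicator ?E (x - A y) * indicator B x \<partial>lborel \<partial>lborel)"
    by (rule lborel_pair.Fubini'[OF m(2)])
  also have "\<dots> = (\<integral>\<^sup>+x. emeasure lborel ?E * indicator B x \<partial>lborel)"
  proof (rule nn_integral_cong)
    fix x :: 'a
    have "(indicator ?E (x - A y) :: ennreal) = indicator (ball (A' x) 1) y" for y
    proof -
      have "x - A y = A (A' x - y)" by (simp add: diff inv)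
      then have "norm (x - A y) = dist (A' x) y" by (simp add: norm dist_norm)
      then show ?thesis by (auto simp: indicator_def dist_norm norm_minus_commute)
    qed
    then have "(\<integral>\<^sup>+y. indicator ?E (x - A y) * indicator B x \<partial>lborel :: ennreal) = emeasure lborel (ball (A' x) 1) * indicator B x"
      by (subst nn_integral_multc) (auto intro!: borel_measurable_indicator)
    then show "(\<integral>\<^sup>+y. indicator ?E (x - A y) * indicator B x \<partial>lborel :: ennreal) = emeasure lborel ?E * indicator B x"
      by (simp add: emeasure_ball)
  qed
  also have "\<dots> = emeasure lborel ?E * emeasure lborel B"
    by (subst nn_integral_cmult) auto
  finally have eq: "emeasure lborel ?E * (\<integral>\<^sup>+y. indicator B (A y) \<partial>lborel) = emeasure lborel ?E * emeasure lborel B" .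
  have "emeasure lborel ?E \<noteq> 0"
    using unit_ball_vol_pos[of "real DIM('a)"] by (simp add: emeasure_ball ennreal_eq_0_iff not_le)
  moreover have "emeasure lborel ?E \<noteq> \<infinity>" using emeasure_lborel_ball_finite[of "0::'a" 1] by simp
  ultimately have "(\<integral>\<^sup>+y. indicator B (A y) \<partial>lborel) = emeasure lborel B"
    using eq by (simp add: ennreal_mult_cancel_left)
  moreover have "(\<integral>\<^sup>+y. indicator B (A y) \<partial>lborel) = emeasure (distr lborel borel A) B"
    by (subst nn_integral_indicator[symmetric], simp) (subst nn_integral_distr, auto)
  ultimately show "emeasure (distr lborel borel A) B = emeasure lborel B" by simp
qed simp

section \<open>Rotations in coordinate planes and averages over them\<close>

definition plane_rot :: "'a::euclidean_space \<Rightarrow> 'a \<Rightarrow> real \<Rightarrow> 'a \<Rightarrow> 'a" where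
  "plane_rot b c t x = x + ((cos t - 1) * (x \<bullet> b) - sin t * (x \<bullet> c)) *\<^sub>R b
     + (sin t * (x \<bullet> b) + (cos t - 1) * (x \<bullet> c)) *\<^sub>R c"

context
  fixes b c :: "'a::euclidean_space"
  assumes b: "b \<in> Basis" and c: "c \<in> Basis" and bc: "b \<noteq> c"
begin

lemma basis_inner: "b \<bullet> b = 1" "c \<bullet> c = 1" "b \<bullet> c = 0" "c \<bullet> b = 0"
  using b c bc by (simp_all add: inner_Basis)

lemma plane_rot_inner:
  "plane_rot b c t x \<bullet> b = cos t * (x \<bullet> b) - sin t * (x \<bullet> c)"
  "plane_rot b c t x \<bullet> c = sin t * (x \<bullet> b) + cos t * (x \<bullet> c)"
  by (simp_all add: plane_rot_def inner_add_left basis_inner algebra_simps)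

lemma cos_sin_combine: "cos t * (cos t * y) + sin t * (sin t * y) = (y::real)"
proof -
  have "cos t * (cos t * y) + sin t * (sin t * y) = ((sin t)\<^sup>2 + (cos t)\<^sup>2) * y"
    by (simp only: power2_eq_square distrib_right mult.assoc add.commute)
  then show ?thesis by simp
qed

lemma norm_plane_rot: "norm (plane_rot b c t x) = norm x"
proof -
  let ?\<alpha> = "(cos t - 1) * (x \<bullet> b) - sin t * (x \<bullet> c)" and ?\<beta> = "sin t * (x \<bullet> b) + (cos t - 1) * (x \<bullet> c)"
  have "plane_rot b c t x \<bullet> plane_rot b c t x = x \<bullet> x + 2 * ?\<alpha> * (x \<bullet> b) + 2 * ?\<beta> * (x \<bullet> c) + ?\<alpha> * ?\<alpha> + ?\<beta> * ?\<beta>"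
    unfolding plane_rot_def
    by (simp add: inner_add_left inner_add_right basis_inner inner_commute[of b x] inner_commute[of c x] algebra_simps)
  also have "\<dots> = x \<bullet> x + ((x \<bullet> b)\<^sup>2 + (x \<bullet> c)\<^sup>2) * ((sin t)\<^sup>2 + (cos t)\<^sup>2 - 1)"
    using cos_sin_combine[of t "(x \<bullet> b) * (x \<bullet> b)"] cos_sin_combine[of t "(x \<bullet> c) * (x \<bullet> c)"]
    by (simp add: power2_eq_square algebra_simps)
  also have "\<dots> = x \<bullet> x" by simp
  finally show ?thesis by (simp add: norm_eq_sqrt_inner)
qed

lemma plane_rot_inverse: "plane_rot b c t (plane_rot b c (- t) x) = x"
proof -
  have "x + (\<alpha> *\<^sub>R b + \<beta> *\<^sub>R c) + \<alpha>' *\<^sub>R b + \<beta>' *\<^sub>R c = x" if "\<alpha> + \<alpha>' = 0" "\<beta> + \<beta>' = 0" for \<alpha> \<beta> \<alpha>' \<beta>'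
  proof -
    have "x + (\<alpha> *\<^sub>R b + \<beta> *\<^sub>R c) + \<alpha>' *\<^sub>R b + \<beta>' *\<^sub>R c = x + (\<alpha> + \<alpha>') *\<^sub>R b + (\<beta> + \<beta>') *\<^sub>R c"
      by (simp add: algebra_simps)
    then show ?thesis using that by simp
  qed
  note * = this
  show ?thesis
    unfolding plane_rot_def[of b c t "plane_rot b c (- t) x"] plane_rot_inner
    unfolding plane_rot_def[of b c "- t" x] add.assoc[of x]
    unfolding add.assoc[of x, symmetric]
    by (subst add.assoc[of x], rule *)
      (use cos_sin_combine[of t "x \<bullet> b"] cos_sin_combine[of t "x \<bullet> c"] in \<open>simp_all add: algebra_simps\<close>)
qed

lemma bounded_linear_plane_rot: "bounded_linear (plane_rot b c t)"
  unfolding plane_rot_def[abs_def]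
  by (intro bounded_linear_add bounded_linear_ident bounded_linear_scaleR_const bounded_linear_sub
      bounded_linear_const_mult bounded_linear_inner_left)

lemma distr_plane_rot: "distr lborel borel (plane_rot b c t) = lborel"
  by (rule lborel_linear_isometry[OF bounded_linear_plane_rot norm_plane_rot plane_rot_inverse])

lemma plane_rot_0: "plane_rot b c 0 x = x" and plane_rot_2pi: "plane_rot b c (t + 2 * pi) x = plane_rot b c t x"
  by (simp_all add: plane_rot_def)

text \<open>\<open>rot b c\<close> generates the rotations: the orbit through x has velocity - (y .
  c) b + (y . b) c at its point y.\<close>

lemma DERIV_plane_rot:
  assumes "smooth F"
  shows "((\<lambda>t. F (plane_rot b c t x)) has_real_derivative rot b c F (plane_rot b c t x)) (at t)"
proof -
  let ?v = "- (plane_rot b c t x \<bullet> c) *\<^sub>R b + (plane_rot b c t x \<bullet> b) *\<^sub>R c"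
  have "((\<lambda>t. plane_rot b c t x) has_derivative (\<lambda>s. s *\<^sub>R ?v)) (at t)"
    unfolding plane_rot_inner unfolding plane_rot_def
    by (auto intro!: derivative_eq_intros simp: fun_eq_iff algebra_simps)
  from has_derivative_compose[OF this has_derivative_partial[OF smooth_differentiable[OF assms]]]
  have d: "((\<lambda>t. F (plane_rot b c t x)) has_derivative
     (\<lambda>s. \<Sum>d\<in>Basis. (s *\<^sub>R ?v \<bullet> d) * partial d F (plane_rot b c t x))) (at t)" .
  have "(\<Sum>d\<in>Basis. (s *\<^sub>R ?v \<bullet> d) * partial d F (plane_rot b c t x)) = rot b c F (plane_rot b c t x) * s" for s
  proof -
    have "(\<Sum>d\<in>Basis. (s *\<^sub>R ?v \<bullet> d) * partial d F (plane_rot b c t x)) =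
      (\<Sum>d\<in>Basis. (if d = b then - s * (plane_rot b c t x \<bullet> c) * partial d F (plane_rot b c t x) else 0)
        + (if d = c then s * (plane_rot b c t x \<bullet> b) * partial d F (plane_rot b c t x) else 0))"
      using b c bc by (intro sum.cong refl) (auto simp: inner_Basis inner_add_left inner_diff_left)
    then show ?thesis using b c by (simp add: sum.distrib rot_def algebra_simps)
  qed
  then show ?thesis using d unfolding has_field_derivative_def by (auto elim!: has_derivative_eq_rhs)
qed

lemma continuous_plane_rot: "continuous_on UNIV (\<lambda>(x, t). plane_rot b c t x)"
  unfolding plane_rot_def split_beta' by (intro continuous_intros)

lemma integral_plane_rot:
  fixes f :: "'a \<Rightarrow> real"
  assumes [measurable]: "f \<in> borel_measurable borel"
  shows "(\<integral>x. f (plane_rot b c t x) \<partial>lborel) = (\<integral>x. f x \<partial>lborel)"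
proof -
  have [measurable]: "plane_rot b c t \<in> borel \<rightarrow>\<^sub>M borel"
    by (intro borel_measurable_continuous_onI linear_continuous_on bounded_linear_plane_rot)
  have "(\<integral>x. f x \<partial>lborel) = (\<integral>x. f x \<partial>distr lborel borel (plane_rot b c t))" by (simp add: distr_plane_rot)
  also have "\<dots> = (\<integral>x. f (plane_rot b c t x) \<partial>lborel)" by (rule integral_distr) auto
  finally show ?thesis by simp
qed

text \<open>Fubini plus invariance: each rotation preserves both Lebesgue measure and |x|, so
  averaging over the angle does not change a radially weighted integral. It turns inequalities on
  single circles into integrated ones.\<close>

lemma rotation_average:
  fixes w :: "real \<Rightarrow> real" and H :: "'a \<Rightarrow> real"
  assumes w [measurable]: "w \<in> borel_measurable borel" and wi: "integrable lborel (\<lambda>x::'a. w (norm x))"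
    and H: "continuous_on UNIV H" and C: "\<And>x. \<bar>H x\<bar> \<le> C"
  shows "integrable lborel (\<lambda>x. w (norm x) * integral {0..2 * pi} (\<lambda>t. H (plane_rot b c t x)))"
    and "(\<integral>x. w (norm x) * integral {0..2 * pi} (\<lambda>t. H (plane_rot b c t x)) \<partial>lborel) = 2 * pi * (\<integral>x. w (norm x) * H x \<partial>lborel)"
proof -
  let ?S = "{0..2 * pi}"
  have [measurable]: "H \<in> borel_measurable borel" by (rule borel_measurable_continuous_onI[OF H])
  have rm: "(\<lambda>(x, t). plane_rot b c t x) \<in> borel \<Otimes>\<^sub>M borel \<rightarrow>\<^sub>M borel"
    unfolding borel_prod by (rule borel_measurable_continuous_onI[OF continuous_plane_rot])
  have rm': "(\<lambda>z. plane_rot b c (snd z) (fst z)) \<in> lborel \<Otimes>\<^sub>M lborel \<rightarrow>\<^sub>M borel"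
    using rm by (simp add: split_beta' cong: measurable_cong_sets)
  let ?f = "\<lambda>(x, t). w (norm x) * (indicator ?S t * H (plane_rot b c t x))"
  have fm: "?f \<in> borel_measurable (lborel \<Otimes>\<^sub>M lborel)"
    unfolding split_beta' using rm' by measurable
  have wf: "(\<integral>\<^sup>+x. ennreal \<bar>w (norm x)\<bar> \<partial>(lborel :: 'a measure)) < \<infinity>"
    using wi by (simp add: integrable_iff_bounded)
  have C0: "C \<ge> 0" using C[of 0] by linarith
  have fi: "integrable (lborel \<Otimes>\<^sub>M lborel) ?f"
    unfolding integrable_iff_bounded
  proof
    show "?f \<in> borel_measurable (lborel \<Otimes>\<^sub>M lborel)" by (rule fm)
    have "(\<integral>\<^sup>+z. ennreal (norm (?f z)) \<partial>(lborel \<Otimes>\<^sub>M lborel)) \<le> (\<integral>\<^sup>+z. ennreal \<bar>w (norm (fst z))\<bar> * (ennreal C * indicator ?S (snd z)) \<partial>((lborel :: 'a measure) \<Otimes>\<^sub>M lborel))"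
    proof (rule nn_integral_mono)
      fix z :: "'a \<times> real"
      have "norm (?f z) \<le> \<bar>w (norm (fst z))\<bar> * (C * indicator ?S (snd z))"
        using C[of "plane_rot b c (snd z) (fst z)"] by (auto simp: split_beta' abs_mult indicator_def intro!: mult_left_mono)
      then have "ennreal (norm (?f z)) \<le> ennreal (\<bar>w (norm (fst z))\<bar> * (C * indicator ?S (snd z)))" by (rule ennreal_leI)
      also have "\<dots> = ennreal \<bar>w (norm (fst z))\<bar> * (ennreal C * indicator ?S (snd z))"
        using C0 by (simp add: ennreal_mult indicator_def)
      finally show "ennreal (norm (?f z)) \<le> ennreal \<bar>w (norm (fst z))\<bar> * (ennreal C * indicator ?S (snd z))" .
    qed
    also have "\<dots> = (\<integral>\<^sup>+x. \<integral>\<^sup>+t. ennreal \<bar>w (norm x)\<bar> * (ennreal C * indicator ?S t) \<partial>lborel \<partial>(lborel :: 'a measure))"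
      by (subst lborel.nn_integral_fst[symmetric]) auto
    also have "\<dots> = (\<integral>\<^sup>+x. ennreal \<bar>w (norm x)\<bar> * (ennreal C * emeasure lborel ?S) \<partial>(lborel :: 'a measure))"
      by (simp add: nn_integral_cmult)
    also have "\<dots> = (\<integral>\<^sup>+x. ennreal \<bar>w (norm x)\<bar> \<partial>(lborel :: 'a measure)) * (ennreal C * emeasure lborel ?S)"
      by (rule nn_integral_multc) simp
    also have "\<dots> < \<infinity>" using wf by (simp add: ennreal_mult_less_top)
    finally show "(\<integral>\<^sup>+z. ennreal (norm (?f z)) \<partial>(lborel \<Otimes>\<^sub>M lborel)) < \<infinity>" .
  qed
  have inner: "(\<integral>t. w (norm x) * (indicator ?S t * H (plane_rot b c t x)) \<partial>lborel) = w (norm x) * integral ?S (\<lambda>t. H (plane_rot b c t x))" for x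
  proof -
    have "continuous_on UNIV (\<lambda>t. plane_rot b c t x)"
      unfolding plane_rot_def by (intro continuous_intros)
    from continuous_on_compose2[OF H this] have "continuous_on ?S (\<lambda>t. H (plane_rot b c t x))"
      by (auto intro: continuous_on_subset)
    then have "set_integrable lborel ?S (\<lambda>t. H (plane_rot b c t x))" by (rule borel_integrable_atLeastAtMost')
    from set_borel_integral_eq_integral(2)[OF this] show ?thesis
      by (simp add: set_lebesgue_integral_def)
  qed
  show "integrable lborel (\<lambda>x. w (norm x) * integral ?S (\<lambda>t. H (plane_rot b c t x)))"
    using lborel_pair.integrable_fst'[OF fi] by (simp only: prod.case inner)
  have "(\<integral>x. w (norm x) * integral ?S (\<lambda>t. H (plane_rot b c t x)) \<partial>lborel)
     = (\<integral>x. \<integral>t. w (norm x) * (indicator ?S t * H (plane_rot b c t x)) \<partial>lborel \<partial>lborel)" by (simp only: inner)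
  also have "\<dots> = (\<integral>t. \<integral>x. w (norm x) * (indicator ?S t * H (plane_rot b c t x)) \<partial>lborel \<partial>lborel)"
    by (rule lborel_pair.Fubini_integral[symmetric]) (rule fi)
  also have "\<dots> = (\<integral>t. indicator ?S t * (\<integral>x. w (norm x) * H x \<partial>(lborel :: 'a measure)) \<partial>lborel)"
  proof (rule Bochner_Integration.integral_cong[OF refl])
    fix t :: real
    have "(\<integral>x. w (norm (plane_rot b c t x)) * H (plane_rot b c t x) \<partial>lborel) = (\<integral>x. w (norm x) * H x \<partial>lborel)"
      by (rule integral_plane_rot) simp
    moreover have "(\<integral>x. w (norm x) * (indicator ?S t * H (plane_rot b c t x)) \<partial>lborel)
        = (\<integral>x. indicator ?S t * (w (norm (plane_rot b c t x)) * H (plane_rot b c t x)) \<partial>lborel)"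
      by (simp add: norm_plane_rot mult_ac)
    ultimately show "(\<integral>x. w (norm x) * (indicator ?S t * H (plane_rot b c t x)) \<partial>lborel) = indicator ?S t * (\<integral>x. w (norm x) * H x \<partial>lborel)"
      by simp
  qed
  also have "\<dots> = 2 * pi * (\<integral>x. w (norm x) * H x \<partial>(lborel :: 'a measure))" by simp
  finally show "(\<integral>x. w (norm x) * integral ?S (\<lambda>t. H (plane_rot b c t x)) \<partial>lborel) = 2 * pi * (\<integral>x. w (norm x) * H x \<partial>lborel)" .
qed

end

section \<open>Rotation and tangential fields under a radial weight\<close>

context
  fixes w :: "real \<Rightarrow> real" and \<rho> :: real
  assumes w [measurable]: "w \<in> borel_measurable borel"
    and wi: "integrable lborel (\<lambda>x::'a::euclidean_space. w (norm x))"
begin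

lemma weight_integrable:
  fixes F :: "'a \<Rightarrow> real"
  assumes "smooth F" "supp_in \<rho> F"
  shows "integrable lborel (\<lambda>x. w (norm x) * F x)"
proof -
  obtain C where C: "\<And>x. \<bar>F x\<bar> \<le> C" using smooth_supp_bounded[OF assms] by blast
  have [measurable]: "F \<in> borel_measurable borel" by (rule smooth_measurable[OF assms(1)])
  have "integrable lborel (\<lambda>x::'a. C * w (norm x))" using wi by simp
  then show ?thesis
  proof (rule Bochner_Integration.integrable_bound)
    show "AE x in lborel. norm (w (norm x) * F x) \<le> norm (C * w (norm x))"
    proof (intro AE_I2)
      fix x :: 'a
      have "\<bar>w (norm x)\<bar> * \<bar>F x\<bar> \<le> \<bar>w (norm x)\<bar> * \<bar>C\<bar>" using C[of x] by (intro mult_left_mono) auto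
      then show "norm (w (norm x) * F x) \<le> norm (C * w (norm x))" by (simp add: abs_mult mult.commute)
    qed
  qed simp
qed

text \<open>Along each orbit circle \<open>rot b c F\<close> is the derivative of a function of
  period 2 pi, so its average over the circle is 0.\<close>

lemma integral_rot_0:
  fixes F :: "'a \<Rightarrow> real"
  assumes F: "smooth F" "supp_in \<rho> F" and b: "b \<in> Basis" and c: "c \<in> Basis"
  shows "(\<integral>x. w (norm x) * rot b c F x \<partial>lborel) = 0"
proof (cases "b = c")
  case True
  then show ?thesis by (simp add: rot_def)
next
  case False
  note bc = b c False
  have G: "smooth (rot b c F)" "supp_in \<rho> (rot b c F)" using F b c by (auto intro: smooth_rot supp_in_rot)
  obtain C where C: "\<And>x. \<bar>rot b c F x\<bar> \<le> C" using smooth_supp_bounded[OF G] by blast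
  have "integral {0..2 * pi} (\<lambda>t. rot b c F (plane_rot b c t x)) = 0" for x
  proof -
    have "((\<lambda>t. rot b c F (plane_rot b c t x)) has_integral (F (plane_rot b c (2 * pi) x) - F (plane_rot b c 0 x))) {0..2 * pi}"
      by (intro has_integral_DERIV DERIV_plane_rot[OF bc F(1)]) simp
    then show ?thesis using plane_rot_2pi[OF bc, of 0 x] by (simp add: integral_unique)
  qed
  then show ?thesis
    using rotation_average(2)[OF bc w wi smooth_continuous_on[OF G(1)] C] by simp
qed

lemma integral_rot_by_parts:
  fixes F G :: "'a \<Rightarrow> real"
  assumes F: "smooth F" "supp_in \<rho> F" and G: "smooth G" and b: "b \<in> Basis" and c: "c \<in> Basis"
  shows "(\<integral>x. w (norm x) * (rot b c F x * G x) \<partial>lborel) = - (\<integral>x. w (norm x) * (F x * rot b c G x) \<partial>lborel)"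
proof -
  have i1: "integrable lborel (\<lambda>x. w (norm x) * (rot b c F x * G x))"
    by (intro weight_integrable smooth_mult smooth_rot supp_in_mult_left supp_in_rot F G b c)
  have i2: "integrable lborel (\<lambda>x. w (norm x) * (F x * rot b c G x))"
    by (intro weight_integrable smooth_mult smooth_rot supp_in_mult_left F G b c)
  have "(\<integral>x. w (norm x) * rot b c (\<lambda>x. F x * G x) x \<partial>lborel) = 0"
    by (intro integral_rot_0 smooth_mult supp_in_mult_left F G b c)
  then have "(\<integral>x. w (norm x) * (rot b c F x * G x) + w (norm x) * (F x * rot b c G x) \<partial>lborel) = 0"
    by (simp add: rot_mult[OF F(1) G] distrib_left)
  then show ?thesis using i1 i2 by simp
qed

text \<open>The divergence theorem on spheres. \<open>tang i\<close> is a combination of rotations;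
  when these are integrated by parts, each of the n - 1 basis vectors j other than \<open>i\<close>
  contributes one copy of the coordinate, because \<open>rot j i\<close> maps (x . j) to - (x .
  i).\<close>

lemma integral_tang:
  fixes G :: "'a \<Rightarrow> real"
  assumes G: "smooth G" "supp_in \<rho> G" and i: "i \<in> Basis"
  shows "(\<integral>x. w (norm x) * tang i G x \<partial>lborel) = (real DIM('a) - 1) * (\<integral>x. w (norm x) * ((x \<bullet> i) * G x) \<partial>lborel)"
proof -
  have int: "integrable lborel (\<lambda>x. w (norm x) * (rot j i G x * (x \<bullet> j)))" if "j \<in> Basis" for j
    by (intro weight_integrable smooth_intros smooth_rot supp_in_mult_left supp_in_rot G i that)
  have "(\<integral>x. w (norm x) * tang i G x \<partial>lborel) = (\<integral>x. (\<Sum>j\<in>Basis. w (norm x) * (rot j i G x * (x \<bullet> j))) \<partial>lborel)"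
    by (simp add: tang_eq_rot[OF i] sum_distrib_left mult_ac)
  also have "\<dots> = (\<Sum>j\<in>Basis. \<integral>x. w (norm x) * (rot j i G x * (x \<bullet> j)) \<partial>lborel)"
    by (rule Bochner_Integration.integral_sum) (rule int)
  also have "\<dots> = (\<Sum>j\<in>Basis. (if j = i then 0 else (\<integral>x. w (norm x) * ((x \<bullet> i) * G x) \<partial>lborel)))"
  proof (rule sum.cong[OF refl])
    fix j :: 'a assume j: "j \<in> Basis"
    show "(\<integral>x. w (norm x) * (rot j i G x * (x \<bullet> j)) \<partial>lborel) = (if j = i then 0 else (\<integral>x. w (norm x) * ((x \<bullet> i) * G x) \<partial>lborel))"
    proof (cases "j = i")
      case True
      then show ?thesis by (simp add: rot_def)
    next
      case False
      have "rot j i (\<lambda>x. x \<bullet> j) x = - (x \<bullet> i)" for x using False rot_coord[OF j i j] by simp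
      then show ?thesis
        using integral_rot_by_parts[OF G smooth_inner[of j] j i] False by (simp add: mult_ac)
    qed
  qed
  also have "\<dots> = (real DIM('a) - 1) * (\<integral>x. w (norm x) * ((x \<bullet> i) * G x) \<partial>lborel)"
    using i by (simp add: sum.If_cases Int_commute Collect_neg_eq[symmetric] Diff_eq[symmetric] of_nat_diff DIM_positive Suc_leI)
  finally show ?thesis .
qed

text \<open>On each orbit circle \<open>rot b c F\<close> is the derivative of a periodic function
  and has mean zero, so Wirtinger's inequality holds for it. For n = 2 this is already the spectral
  gap.\<close>

lemma integral_rot_wirtinger:
  fixes F :: "'a \<Rightarrow> real"
  assumes F: "smooth F" "supp_in \<rho> F" and b: "b \<in> Basis" and c: "c \<in> Basis" and w0: "\<And>r. w r \<ge> 0"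
  shows "(\<integral>x. w (norm x) * (rot b c F x)\<^sup>2 \<partial>lborel) \<le> (\<integral>x. w (norm x) * (rot b c (rot b c F) x)\<^sup>2 \<partial>lborel)"
proof (cases "b = c")
  case True
  then show ?thesis by (simp add: rot_def)
next
  case False
  note bc = b c False
  have G: "smooth (rot b c F)" "supp_in \<rho> (rot b c F)" using F b c by (auto intro: smooth_rot supp_in_rot)
  have G2: "smooth (rot b c (rot b c F))" "supp_in \<rho> (rot b c (rot b c F))" using G b c by (auto intro: smooth_rot supp_in_rot)
  obtain C where C: "\<And>x. \<bar>rot b c F x\<bar> \<le> C" using smooth_supp_bounded[OF G] by blast
  obtain D where D: "\<And>x. \<bar>rot b c (rot b c F) x\<bar> \<le> D" using smooth_supp_bounded[OF G2] by blast
  have sq: "\<bar>a\<^sup>2\<bar> \<le> e\<^sup>2" if "\<bar>a\<bar> \<le> e" for a e :: real using that by (simp add: abs_le_square_iff[symmetric])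
  have c1: "continuous_on UNIV (\<lambda>x. (rot b c F x)\<^sup>2)" "continuous_on UNIV (\<lambda>x. (rot b c (rot b c F) x)\<^sup>2)"
    by (intro continuous_intros smooth_continuous_on G G2)+
  note avg1 = rotation_average[OF bc w wi c1(1) sq[OF C]] and avg2 = rotation_average[OF bc w wi c1(2) sq[OF D]]
  have le: "integral {0..2 * pi} (\<lambda>t. (rot b c F (plane_rot b c t x))\<^sup>2) \<le> integral {0..2 * pi} (\<lambda>t. (rot b c (rot b c F) (plane_rot b c t x))\<^sup>2)" for x
  proof (rule wirtinger)
    show "((\<lambda>t. rot b c F (plane_rot b c t x)) has_real_derivative rot b c (rot b c F) (plane_rot b c t x)) (at t)" for t
      by (rule DERIV_plane_rot[OF bc G(1)])
    show "continuous_on UNIV (\<lambda>t. rot b c (rot b c F) (plane_rot b c t x))"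
      using DERIV_plane_rot[OF bc G2(1)] by (meson DERIV_isCont continuous_at_imp_continuous_on)
    show "rot b c F (plane_rot b c (t + 2 * pi) x) = rot b c F (plane_rot b c t x)" for t
      by (simp add: plane_rot_2pi[OF bc])
    have "((\<lambda>t. rot b c F (plane_rot b c t x)) has_integral (F (plane_rot b c (2 * pi) x) - F (plane_rot b c 0 x))) {0..2 * pi}"
      by (intro has_integral_DERIV DERIV_plane_rot[OF bc F(1)]) simp
    then show "integral {0..2 * pi} (\<lambda>t. rot b c F (plane_rot b c t x)) = 0"
      using plane_rot_2pi[OF bc, of 0 x] by (simp add: integral_unique)
  qed
  have "(\<integral>x. w (norm x) * integral {0..2 * pi} (\<lambda>t. (rot b c F (plane_rot b c t x))\<^sup>2) \<partial>lborel)
     \<le> (\<integral>x. w (norm x) * integral {0..2 * pi} (\<lambda>t. (rot b c (rot b c F) (plane_rot b c t x))\<^sup>2) \<partial>lborel)"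
    by (intro integral_mono avg1 avg2 mult_left_mono le w0)
  then show ?thesis unfolding avg1(2) avg2(2) by simp
qed

text \<open>The integrated Bochner formula on spheres. The matrix \<open>K\<close> is the spherical Hessian, which is
  symmetric and annihilates the normal, so its trace lives on a space of dimension \<open>n - 1\<close>.\<close>

lemma bochner_pointwise:
  fixes u :: "'a \<Rightarrow> real" and x :: 'a
  assumes u: "smooth u" and n: "DIM('a) \<ge> 2"
  defines "M \<equiv> \<lambda>i j. tang i (tang j u) x"
  shows "(\<Sum>i\<in>Basis. M i i)\<^sup>2 \<le> (real DIM('a) - 1) * (\<Sum>i\<in>Basis. \<Sum>j\<in>Basis. M i j * M j i)"
proof (cases "x = 0")
  case True
  then show ?thesis by (simp add: M_def tang_def)
next
  case False
  let ?n = "real DIM('a)"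
  define r where "r = x \<bullet> x"
  define s where "s = (\<Sum>i\<in>Basis. M i i)"
  have r: "r > 0" using False by (simp add: r_def)
  define v where "v i = tang i u x" for i
  \<comment> \<open>\<open>tang_commute\<close> gives M i j - M j i = (x . i) v j - (x . j) v i, so
    adding (x . j) v i symmetrises M.\<close>
  define K where "K i j = M i j + (x \<bullet> j) * v i" for i j
  have n1: "?n - 1 > 0" using n by simp
  have xv: "(\<Sum>i\<in>Basis. (x \<bullet> i) * v i) = 0" unfolding v_def by (rule sum_coord_tang)
  have xx: "(\<Sum>i\<in>Basis. (x \<bullet> i) * (x \<bullet> i)) = r" by (simp add: r_def euclidean_inner[of x x])
  have xM: "(\<Sum>i\<in>Basis. (x \<bullet> i) * M i j) = 0" for j
    unfolding M_def by (rule sum_coord_tang)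
  have sym: "K i j = K j i" if "i \<in> Basis" "j \<in> Basis" for i j
    using tang_commute[OF u that, of x] by (simp add: K_def M_def v_def algebra_simps)
  have xK: "(\<Sum>i\<in>Basis. (x \<bullet> i) * K i j) = 0" for j
  proof -
    have "(\<Sum>i\<in>Basis. (x \<bullet> i) * K i j) = (\<Sum>i\<in>Basis. (x \<bullet> i) * M i j) + (x \<bullet> j) * (\<Sum>i\<in>Basis. (x \<bullet> i) * v i)"
      by (simp add: K_def algebra_simps sum.distrib sum_distrib_left)
    then show ?thesis using xM xv by simp
  qed
  have trK: "(\<Sum>i\<in>Basis. K i i) = s"
    using xv by (simp add: K_def s_def sum.distrib)
  \<comment> \<open>The correction terms drop out of the trace of M^2 because K annihilates x and v
    is orthogonal to x; by symmetry the trace of K^2 is a sum of squares.\<close>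
  have MM: "(\<Sum>i\<in>Basis. \<Sum>j\<in>Basis. M i j * M j i) = (\<Sum>i\<in>Basis. \<Sum>j\<in>Basis. K i j * K i j)"
  proof -
    have "(\<Sum>i\<in>Basis. \<Sum>j\<in>Basis. M i j * M j i) =
      (\<Sum>i\<in>Basis. \<Sum>j\<in>Basis. K i j * K j i - v i * ((x \<bullet> j) * K j i) - v j * ((x \<bullet> i) * K i j) + ((x \<bullet> i) * v i) * ((x \<bullet> j) * v j))"
      by (intro sum.cong refl) (simp add: K_def algebra_simps)
    also have "\<dots> = (\<Sum>i\<in>Basis. \<Sum>j\<in>Basis. K i j * K j i) - (\<Sum>i\<in>Basis. v i * (\<Sum>j\<in>Basis. (x \<bullet> j) * K j i))
       - (\<Sum>i\<in>Basis. \<Sum>j\<in>Basis. v j * ((x \<bullet> i) * K i j)) + (\<Sum>i\<in>Basis. (x \<bullet> i) * v i) * (\<Sum>j\<in>Basis. (x \<bullet> j) * v j)"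
      unfolding sum_product by (simp only: sum.distrib sum_subtractf sum_distrib_left)
    also have "(\<Sum>i\<in>Basis. \<Sum>j\<in>Basis. v j * ((x \<bullet> i) * K i j)) = (\<Sum>j\<in>Basis. v j * (\<Sum>i\<in>Basis. (x \<bullet> i) * K i j))"
      by (subst sum.swap) (simp add: sum_distrib_left)
    also have "(\<Sum>i\<in>Basis. \<Sum>j\<in>Basis. K i j * K j i) = (\<Sum>i\<in>Basis. \<Sum>j\<in>Basis. K i j * K i j)"
      using sym by (intro sum.cong refl) auto
    finally show ?thesis using xK xv by simp
  qed
  \<comment> \<open>Here \<open>r\<close> is |x|^2, and \<open>\<tau>\<close> is chosen so that
    \<tau> (r \<delta> i j - (x . i) (x . j)), a multiple of the projection onto the tangent space,
    has the same trace as K. The squared distance to it gives the bound with n - 1 in place of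
    n.\<close>
  define \<tau> where "\<tau> = s / ((?n - 1) * r)"
  define \<delta> :: "'a \<Rightarrow> 'a \<Rightarrow> real" where "\<delta> i j = (if i = j then 1 else 0)" for i j
  have d: "(\<Sum>j\<in>Basis. \<delta> i j * f j) = f i" if "i \<in> Basis" for i f
    using that by (simp add: \<delta>_def if_distrib[of "\<lambda>t. t * _"] cong: if_cong)
  have "0 \<le> (\<Sum>i\<in>Basis. \<Sum>j\<in>Basis. (K i j - \<tau> * (r * \<delta> i j - (x \<bullet> i) * (x \<bullet> j)))\<^sup>2)"
    by (intro sum_nonneg) auto
  also have "\<dots> = (\<Sum>i\<in>Basis. \<Sum>j\<in>Basis. K i j * K i j - (2 * \<tau> * r) * (\<delta> i j * K i j) + (2 * \<tau>) * ((x \<bullet> j) * ((x \<bullet> i) * K i j))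
      + (\<tau> * \<tau> * r * r) * (\<delta> i j * \<delta> i j) - (2 * \<tau> * \<tau> * r) * (\<delta> i j * ((x \<bullet> i) * (x \<bullet> j))) + (\<tau> * \<tau>) * (((x \<bullet> i) * (x \<bullet> i)) * ((x \<bullet> j) * (x \<bullet> j))))"
    by (intro sum.cong refl) (simp add: power2_eq_square algebra_simps)
  also have "\<dots> = (\<Sum>i\<in>Basis. \<Sum>j\<in>Basis. K i j * K i j) - (2 * \<tau> * r) * (\<Sum>i\<in>Basis. \<Sum>j\<in>Basis. \<delta> i j * K i j)
      + (2 * \<tau>) * (\<Sum>i\<in>Basis. \<Sum>j\<in>Basis. (x \<bullet> j) * ((x \<bullet> i) * K i j))
      + (\<tau> * \<tau> * r * r) * (\<Sum>i\<in>Basis. \<Sum>j\<in>Basis. \<delta> i j * \<delta> i j)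
      - (2 * \<tau> * \<tau> * r) * (\<Sum>i\<in>Basis. \<Sum>j\<in>Basis. \<delta> i j * ((x \<bullet> i) * (x \<bullet> j)))
      + (\<tau> * \<tau>) * (\<Sum>i\<in>Basis. \<Sum>j\<in>Basis. ((x \<bullet> i) * (x \<bullet> i)) * ((x \<bullet> j) * (x \<bullet> j)))"
    by (simp only: sum.distrib sum_subtractf sum_distrib_left)
  also have "(\<Sum>i\<in>Basis. \<Sum>j\<in>Basis. \<delta> i j * K i j) = s" using d trK by simp
  also have "(\<Sum>i\<in>Basis. \<Sum>j\<in>Basis. (x \<bullet> j) * ((x \<bullet> i) * K i j)) = 0"
    by (subst sum.swap) (simp add: sum_distrib_left[symmetric] xK)
  also have "(\<Sum>i\<in>Basis. \<Sum>j\<in>Basis. \<delta> i j * \<delta> i j) = ?n"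
  proof -
    have "(\<Sum>i\<in>Basis. \<Sum>j\<in>Basis. \<delta> i j * \<delta> i j) = (\<Sum>i\<in>(Basis::'a set). \<delta> i i)" using d by (intro sum.cong refl) auto
    then show ?thesis by (simp add: \<delta>_def)
  qed
  also have "(\<Sum>i\<in>Basis. \<Sum>j\<in>Basis. \<delta> i j * ((x \<bullet> i) * (x \<bullet> j))) = r" using d xx by simp
  also have "(\<Sum>i\<in>Basis. \<Sum>j\<in>Basis. ((x \<bullet> i) * (x \<bullet> i)) * ((x \<bullet> j) * (x \<bullet> j))) = r * r"
    unfolding sum_product[symmetric] xx ..
  finally have "0 \<le> (\<Sum>i\<in>Basis. \<Sum>j\<in>Basis. K i j * K i j) - 2 * \<tau> * r * s + \<tau> * \<tau> * r * r * (?n - 1)"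
    by (simp add: algebra_simps)
  also have "\<tau> * r = s / (?n - 1)" using r by (simp add: \<tau>_def)
  then have "- 2 * \<tau> * r * s + \<tau> * \<tau> * r * r * (?n - 1) = - (s * s / (?n - 1))"
  proof -
    assume e: "\<tau> * r = s / (?n - 1)"
    have "- 2 * \<tau> * r * s + \<tau> * \<tau> * r * r * (?n - 1) = - 2 * (\<tau> * r) * s + (\<tau> * r) * (\<tau> * r) * (?n - 1)" by (simp add: algebra_simps)
    also have "\<dots> = - (s * s / (?n - 1))"
    proof -
      have "- 2 * (s / m) * s + (s / m) * (s / m) * m = - (s * s / m)" if "m > 0" for m :: real
        using that by (simp add: field_simps)
      from this[OF n1] show ?thesis unfolding e .
    qed
    finally show ?thesis .
  qed
  then have "(\<Sum>i\<in>Basis. \<Sum>j\<in>Basis. K i j * K i j) - 2 * \<tau> * r * s + \<tau> * \<tau> * r * r * (?n - 1) = (\<Sum>i\<in>Basis. \<Sum>j\<in>Basis. K i j * K i j) - s * s / (?n - 1)"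
    by simp
  finally have "s * s / (?n - 1) \<le> (\<Sum>i\<in>Basis. \<Sum>j\<in>Basis. M i j * M j i)" unfolding MM by simp
  then show ?thesis unfolding s_def[symmetric] using n1 by (simp add: field_simps power2_eq_square)
qed

text \<open>\<open>integral_tang\<close> is applied to the products v i M j j and v i M i j. In the
  difference the third derivatives of u enter only through a commutator, which
  \<open>tang_commute\<close> reduces to second derivatives. The coefficient n - 2 is the Ricci
  curvature of the sphere.\<close>

lemma bochner_integrated:
  fixes u :: "'a \<Rightarrow> real"
  assumes u: "smooth u" "supp_in \<rho> u"
  defines "M \<equiv> \<lambda>i j. tang i (tang j u)"
  shows "(\<integral>x. w (norm x) * ((\<Sum>i\<in>Basis. M i i x)\<^sup>2 - (\<Sum>i\<in>Basis. \<Sum>j\<in>Basis. M i j x * M j i x)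
     - (real DIM('a) - 2) * ((x \<bullet> x) * (\<Sum>i\<in>Basis. (tang i u x)\<^sup>2))) \<partial>lborel) = 0"
proof -
  let ?n = "real DIM('a)"
  define v where "v i = tang i u" for i
  have v: "smooth (v i)" "supp_in \<rho> (v i)" if "i \<in> Basis" for i
    using u that by (auto simp: v_def intro: smooth_tang supp_in_tang)
  have M: "smooth (M i j)" "supp_in \<rho> (M i j)" if "i \<in> Basis" "j \<in> Basis" for i j
    using u that by (auto simp: M_def intro: smooth_tang supp_in_tang)
  define g1 where "g1 i j x = tang i (\<lambda>x. v i x * M j j x) x - (?n - 1) * ((x \<bullet> i) * (v i x * M j j x))" for i j x
  define g2 where "g2 i j x = tang j (\<lambda>x. v i x * M i j x) x - (?n - 1) * ((x \<bullet> j) * (v i x * M i j x))" for i j x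
  have z1: "integrable lborel (\<lambda>x. w (norm x) * (tang k G x - (?n - 1) * ((x \<bullet> k) * G x))) \<and>
     (\<integral>x. w (norm x) * (tang k G x - (?n - 1) * ((x \<bullet> k) * G x)) \<partial>lborel) = 0"
    if "smooth G" "supp_in \<rho> G" "k \<in> Basis" for k :: 'a and G
  proof -
    have i1: "integrable lborel (\<lambda>x. w (norm x) * tang k G x)"
      by (intro weight_integrable smooth_tang supp_in_tang that)
    have i2: "integrable lborel (\<lambda>x. w (norm x) * ((x \<bullet> k) * G x))"
      by (intro weight_integrable smooth_mult smooth_inner supp_in_mult_right that)
    have e: "w (norm x) * (tang k G x - (?n - 1) * ((x \<bullet> k) * G x)) = w (norm x) * tang k G x - (?n - 1) * (w (norm x) * ((x \<bullet> k) * G x))" for x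
      by (simp add: algebra_simps)
    show ?thesis unfolding e using i1 i2 integral_tang[OF that] by simp
  qed
  have G: "smooth (\<lambda>x. v i x * M k l x)" "supp_in \<rho> (\<lambda>x. v i x * M k l x)" if "i \<in> Basis" "k \<in> Basis" "l \<in> Basis" for i k l
    using v M that by (auto intro: smooth_mult supp_in_mult_left)
  have i1: "integrable lborel (\<lambda>x. w (norm x) * (g1 i j x - g2 i j x))" and e1: "(\<integral>x. w (norm x) * (g1 i j x - g2 i j x) \<partial>lborel) = 0"
    if "i \<in> Basis" "j \<in> Basis" for i j
    using z1[OF G(1)[of i j j] G(2)[of i j j], of i] z1[OF G(1)[of i i j] G(2)[of i i j], of j] that
    unfolding g1_def[symmetric] g2_def[symmetric] by (auto simp: right_diff_distrib)
  have "(\<Sum>i\<in>Basis. \<Sum>j\<in>Basis. g1 i j x - g2 i j x) = (\<Sum>i\<in>Basis. M i i x)\<^sup>2 - (\<Sum>i\<in>Basis. \<Sum>j\<in>Basis. M i j x * M j i x)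
     - (?n - 2) * ((x \<bullet> x) * (\<Sum>i\<in>Basis. (tang i u x)\<^sup>2))" for x
  proof -
    have "g1 i j x - g2 i j x = M i i x * M j j x - M i j x * M j i x
       + (2 - ?n) * (((x \<bullet> i) * v i x) * M j j x) - (2 - ?n) * (v i x * ((x \<bullet> j) * M i j x))"
      if i: "i \<in> Basis" and j: "j \<in> Basis" for i j
    proof -
      have a: "tang i (v i) x = M i i x" "tang j (v i) x = M j i x" by (simp_all add: v_def M_def)
      have "tang i (M j j) x - tang j (M i j) x = (x \<bullet> i) * M j j x - (x \<bullet> j) * M i j x"
        unfolding M_def by (rule tang_commute[OF smooth_tang[OF u(1) j] i j])
      then have b: "tang i (M j j) x = tang j (M i j) x + (x \<bullet> i) * M j j x - (x \<bullet> j) * M i j x" by simp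
      show ?thesis
        unfolding g1_def g2_def tang_mult[OF v(1)[OF i] M(1)[OF j j]] tang_mult[OF v(1)[OF i] M(1)[OF i j]] a b
        by (simp add: algebra_simps)
    qed
    then have "(\<Sum>i\<in>Basis. \<Sum>j\<in>Basis. g1 i j x - g2 i j x) = (\<Sum>i\<in>Basis. \<Sum>j\<in>Basis. M i i x * M j j x - M i j x * M j i x
       + (2 - ?n) * (((x \<bullet> i) * v i x) * M j j x) - (2 - ?n) * (v i x * ((x \<bullet> j) * M i j x)))"
      by (intro sum.cong refl) auto
    also have "\<dots> = (\<Sum>i\<in>Basis. M i i x) * (\<Sum>j\<in>Basis. M j j x) - (\<Sum>i\<in>Basis. \<Sum>j\<in>Basis. M i j x * M j i x)
       + (2 - ?n) * ((\<Sum>i\<in>Basis. (x \<bullet> i) * v i x) * (\<Sum>j\<in>Basis. M j j x)) - (2 - ?n) * (\<Sum>i\<in>Basis. v i x * (\<Sum>j\<in>Basis. (x \<bullet> j) * M i j x))"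
      unfolding sum_product by (simp only: sum.distrib sum_subtractf sum_distrib_left)
    also have "(\<Sum>i\<in>Basis. (x \<bullet> i) * v i x) = 0" unfolding v_def by (rule sum_coord_tang)
    also have "(\<Sum>i\<in>Basis. v i x * (\<Sum>j\<in>Basis. (x \<bullet> j) * M i j x)) = - ((x \<bullet> x) * (\<Sum>i\<in>Basis. (tang i u x)\<^sup>2))"
    proof -
      \<comment> \<open>Tangential differentiation of the orthogonality relation between x and v;
        this is where the curvature term comes from.\<close>
      have "(\<Sum>j\<in>Basis. (x \<bullet> j) * M i j x) = - ((x \<bullet> x) * v i x)" if i: "i \<in> Basis" for i
      proof -
        have "tang i (\<lambda>x. \<Sum>j\<in>Basis. (x \<bullet> j) * v j x) x = (\<Sum>j\<in>Basis. tang i (\<lambda>x. (x \<bullet> j) * v j x) x)"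
        proof -
          have s: "smooth (\<lambda>x. (x \<bullet> j) * v j x)" if "j \<in> Basis" for j using v that by (intro smooth_intros)
          have "partial k (\<lambda>x. \<Sum>j\<in>Basis. (x \<bullet> j) * v j x) x = (\<Sum>j\<in>Basis. partial k (\<lambda>x. (x \<bullet> j) * v j x) x)" for k
            by (intro partial_sum smooth_differentiable s)
          then show ?thesis
            unfolding tang_def euler_def
            by (simp add: sum_subtractf sum_distrib_left) (subst sum.swap, simp)
        qed
        also have "\<dots> = (\<Sum>j\<in>Basis. ((if i = j then x \<bullet> x else 0) - (x \<bullet> i) * (x \<bullet> j)) * v j x + (x \<bullet> j) * M i j x)"
          using v i by (intro sum.cong refl) (simp add: tang_mult[OF smooth_inner] tang_coord, simp add: M_def v_def)
        also have "\<dots> = (\<Sum>j\<in>Basis. (if i = j then (x \<bullet> x) * v j x else 0) - (x \<bullet> i) * ((x \<bullet> j) * v j x) + (x \<bullet> j) * M i j x)"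
          by (intro sum.cong refl) (auto simp: algebra_simps)
        also have "\<dots> = (x \<bullet> x) * v i x - (x \<bullet> i) * (\<Sum>j\<in>Basis. (x \<bullet> j) * v j x) + (\<Sum>j\<in>Basis. (x \<bullet> j) * M i j x)"
          using i by (simp add: sum.distrib sum_subtractf sum_distrib_left)
        also have "(\<Sum>j\<in>Basis. (x \<bullet> j) * v j x) = 0" unfolding v_def by (rule sum_coord_tang)
        also have "(\<lambda>x. \<Sum>j\<in>Basis. (x \<bullet> j) * v j x) = (\<lambda>x. 0)" unfolding v_def by (simp add: sum_coord_tang)
        finally show ?thesis by (simp add: tang_def euler_def)
      qed
      then show ?thesis by (simp add: v_def sum_distrib_left sum_negf[symmetric] power2_eq_square mult_ac)
    qed
    finally show ?thesis by (simp add: power2_eq_square algebra_simps)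
  qed
  note pw = this
  have "(\<integral>x. w (norm x) * (\<Sum>i\<in>Basis. \<Sum>j\<in>Basis. g1 i j x - g2 i j x) \<partial>lborel) = (\<integral>x. (\<Sum>i\<in>Basis. \<Sum>j\<in>Basis. w (norm x) * (g1 i j x - g2 i j x)) \<partial>lborel)"
    by (simp add: sum_distrib_left)
  also have "\<dots> = (\<Sum>i\<in>Basis. \<Sum>j\<in>Basis. \<integral>x. w (norm x) * (g1 i j x - g2 i j x) \<partial>lborel)"
    using i1 by (simp add: Bochner_Integration.integral_sum)
  also have "\<dots> = 0" using e1 by (intro sum.neutral ballI) auto
  finally show ?thesis unfolding pw .
qed

text \<open>Inserting the trace bound into the integrated identity compares (n - 2) / (n - 1) times
  the integral of \<open>s\<close> squared with n - 2 times that of \<open>q\<close>; division by n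
  - 2 is the reason for n \<ge> 3.\<close>

lemma sphere_gap_bochner:
  fixes u :: "'a \<Rightarrow> real"
  assumes u: "smooth u" "supp_in \<rho> u" and n: "DIM('a) \<ge> 3" and w0: "\<And>r. w r \<ge> 0"
  shows "(real DIM('a) - 1) * (\<integral>x. w (norm x) * ((x \<bullet> x) * (\<Sum>i\<in>Basis. (tang i u x)\<^sup>2)) \<partial>lborel)
     \<le> (\<integral>x. w (norm x) * (\<Sum>i\<in>Basis. tang i (tang i u) x)\<^sup>2 \<partial>lborel)"
proof -
  let ?n = "real DIM('a)"
  define s where "s x = (\<Sum>i\<in>Basis. tang i (tang i u) x)" for x
  define q where "q x = (x \<bullet> x) * (\<Sum>i\<in>Basis. (tang i u x)\<^sup>2)" for x
  define T where "T x = (\<Sum>i\<in>Basis. \<Sum>j\<in>Basis. tang i (tang j u) x * tang j (tang i u) x)" for x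
  have n3: "?n \<ge> 3" using n by simp
  have sup: "supp_in \<rho> (\<lambda>x. \<Sum>i\<in>I. f i x)" if "\<And>i. i \<in> I \<Longrightarrow> supp_in \<rho> (f i)" for f and I :: "'a set"
    using that by (auto simp: supp_in_def intro!: sum.neutral)
  have s: "smooth s" "supp_in \<rho> s"
    unfolding s_def[abs_def] by (intro smooth_sum smooth_tang sup supp_in_tang u; assumption)+
  have q1: "smooth q"
    unfolding q_def[abs_def] power2_eq_square by (intro smooth_mult smooth_inner_self smooth_sum smooth_tang u)
  have q2: "supp_in \<rho> q"
    unfolding q_def[abs_def] power2_eq_square
    by (rule supp_in_mult_right, rule sup, rule supp_in_mult_left, rule supp_in_tang, rule u)
  have T: "smooth T" "supp_in \<rho> T"
    unfolding T_def[abs_def] by (intro smooth_mult smooth_sum smooth_tang sup supp_in_mult_left supp_in_tang u; assumption)+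
  note ok = s q1 q2 T
  have i_s: "integrable lborel (\<lambda>x. w (norm x) * (s x)\<^sup>2)" unfolding power2_eq_square
    by (intro weight_integrable smooth_mult supp_in_mult_left ok)
  have iq: "integrable lborel (\<lambda>x. w (norm x) * q x)" by (intro weight_integrable ok)
  have iT: "integrable lborel (\<lambda>x. w (norm x) * T x)" by (intro weight_integrable ok)
  have "0 = (\<integral>x. w (norm x) * ((s x)\<^sup>2 - T x - (?n - 2) * q x) \<partial>lborel)"
    using bochner_integrated[OF u] by (simp add: s_def q_def T_def)
  also have "\<dots> \<le> (\<integral>x. (?n - 2) / (?n - 1) * (w (norm x) * (s x)\<^sup>2) - (?n - 2) * (w (norm x) * q x) \<partial>lborel)"
  proof (rule integral_mono)
    have "integrable lborel (\<lambda>x. w (norm x) * (s x)\<^sup>2 - w (norm x) * T x - (?n - 2) * (w (norm x) * q x))"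
      using i_s iq iT by simp
    then show "integrable lborel (\<lambda>x. w (norm x) * ((s x)\<^sup>2 - T x - (?n - 2) * q x))" by (simp add: algebra_simps)
    show "integrable lborel (\<lambda>x. (?n - 2) / (?n - 1) * (w (norm x) * (s x)\<^sup>2) - (?n - 2) * (w (norm x) * q x))"
      using i_s iq by simp
    fix x :: 'a
    have "(s x)\<^sup>2 \<le> (?n - 1) * T x" unfolding s_def T_def using bochner_pointwise[OF u(1), of x] n by simp
    then have "(s x)\<^sup>2 / (?n - 1) \<le> T x" using n3 by (simp add: field_simps)
    moreover have "(?n - 2) / (?n - 1) * (s x)\<^sup>2 = (s x)\<^sup>2 - (s x)\<^sup>2 / (?n - 1)" using n3 by (simp add: field_simps)
    ultimately have "(s x)\<^sup>2 - T x - (?n - 2) * q x \<le> (?n - 2) / (?n - 1) * (s x)\<^sup>2 - (?n - 2) * q x" by linarith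
    from mult_left_mono[OF this w0[of "norm x"]]
    show "w (norm x) * ((s x)\<^sup>2 - T x - (?n - 2) * q x) \<le> (?n - 2) / (?n - 1) * (w (norm x) * (s x)\<^sup>2) - (?n - 2) * (w (norm x) * q x)"
      by (simp add: right_diff_distrib mult_ac)
  qed
  also have "\<dots> = (?n - 2) / (?n - 1) * ((\<integral>x. w (norm x) * (s x)\<^sup>2 \<partial>lborel) - (?n - 1) * (\<integral>x. w (norm x) * q x \<partial>lborel))"
    using i_s iq n3 by (simp add: right_diff_distrib)
  finally have "0 \<le> (\<integral>x. w (norm x) * (s x)\<^sup>2 \<partial>lborel) - (?n - 1) * (\<integral>x. w (norm x) * q x \<partial>lborel)"
    using n3 by (simp add: zero_le_mult_iff zero_le_divide_iff)
  then show ?thesis by (simp add: s_def q_def)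
qed

end

lemma rot_minus:
  assumes "smooth F"
  shows "rot b c (\<lambda>x. - F x) x = - rot b c F x"
  using partial_diff[OF smooth_differentiable[OF smooth_const[of 0]] smooth_differentiable[OF assms], of _ x]
  by (simp add: rot_def)

text \<open>For n = 1 the factor on the left is 0, for n = 2 the claim is Wirtinger's inequality on
  circles, and from n = 3 on the Bochner argument applies. There \<open>tang\<close> carries one
  factor |x| per derivative, so the weight is divided by |x|^4 beforehand.\<close>

lemma sphere_gap:
  fixes u :: "'a::euclidean_space \<Rightarrow> real" and w :: "real \<Rightarrow> real"
  assumes w [measurable]: "w \<in> borel_measurable borel" and w0: "\<And>r. w r \<ge> 0"
    and wi: "integrable lborel (\<lambda>x::'a. w (norm x))" "integrable lborel (\<lambda>x::'a. w (norm x) / norm x ^ 4)"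
    and u: "smooth u" "supp_in \<rho> u"
  shows "(real DIM('a) - 1) * (\<integral>x. w (norm x) * ((\<Sum>b\<in>Basis. \<Sum>c\<in>Basis. (rot b c u x)\<^sup>2) / 2) \<partial>lborel)
     \<le> (\<integral>x. w (norm x) * (sph_lap u x)\<^sup>2 \<partial>lborel)"
proof -
  consider "DIM('a) = 1" | "DIM('a) = 2" | "DIM('a) \<ge> 3" using DIM_positive[where 'a='a] by linarith
  then show ?thesis
  proof cases
    case 1
    then obtain b where b: "(Basis :: 'a set) = {b}" by (auto simp: card_1_singleton_iff)
    show ?thesis using 1 w0 by (auto intro!: Bochner_Integration.integral_nonneg)
  next
    case 2
    then obtain b c where bc: "(Basis :: 'a set) = {b, c}" "b \<noteq> c" by (auto simp: card_2_iff)
    have B: "b \<in> Basis" "c \<in> Basis" using bc by auto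
    have cb: "rot c b F = (\<lambda>x. - rot b c F x)" for F :: "'a \<Rightarrow> real" by (auto simp: rot_def fun_eq_iff)
    have bb: "rot b b F x = 0" "rot c c F x = 0" for F :: "'a \<Rightarrow> real" and x by (simp_all add: rot_def)
    have S: "sph_lap u x = rot b c (rot b c u) x" for x
      unfolding sph_lap_def bc(1) using bc(2)
      by (simp add: bb cb rot_minus[OF smooth_rot[OF u(1) B]])
    have Q: "(\<Sum>b\<in>Basis. \<Sum>c\<in>Basis. (rot b c u x)\<^sup>2) / 2 = (rot b c u x)\<^sup>2" for x
      unfolding bc(1) using bc(2) by (simp add: bb cb)
    show ?thesis unfolding S Q using integral_rot_wirtinger[OF w wi(1) u B w0] 2 by simp
  next
    case 3
    let ?w = "\<lambda>r. w r / r ^ 4"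
    have [measurable]: "?w \<in> borel_measurable borel" by measurable
    have m: "?w \<in> borel_measurable borel" by measurable
    have w0': "?w r \<ge> 0" for r using w0[of r] by simp
    have e1: "?w (norm x) * (\<Sum>i\<in>Basis. tang i (tang i u) x)\<^sup>2 = w (norm x) * (sph_lap u x)\<^sup>2" for x
    proof (cases "x = 0")
      case True
      then show ?thesis by (simp add: sph_lap_def rot_def)
    next
      case False
      have "x \<bullet> x = norm x ^ 2" by (simp add: power2_norm_eq_inner)
      then have "(\<Sum>i\<in>Basis. tang i (tang i u) x)\<^sup>2 = norm x ^ 4 * (sph_lap u x)\<^sup>2"
        by (simp add: sum_tang_tang[OF u(1)] power_mult_distrib)
      then show ?thesis using False by simp
    qed
    have e2: "?w (norm x) * ((x \<bullet> x) * (\<Sum>i\<in>Basis. (tang i u x)\<^sup>2)) = w (norm x) * ((\<Sum>b\<in>Basis. \<Sum>c\<in>Basis. (rot b c u x)\<^sup>2) / 2)" for x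
    proof (cases "x = 0")
      case True
      then show ?thesis by (simp add: rot_def)
    next
      case False
      have "(x \<bullet> x) * (x \<bullet> x) = norm x ^ 4" by (simp add: power2_norm_eq_inner[symmetric] power2_eq_square eval_nat_numeral)
      then have eq: "(x \<bullet> x) * (\<Sum>i\<in>Basis. (tang i u x)\<^sup>2) = norm x ^ 4 * ((\<Sum>b\<in>Basis. \<Sum>c\<in>Basis. (rot b c u x)\<^sup>2) / 2)"
        unfolding sum_tang_sq by (simp only: mult.assoc[symmetric])
      show ?thesis unfolding eq using False by simp
    qed
    show ?thesis
      using sphere_gap_bochner[OF m wi(2) u 3 w0'] unfolding e1 e2 .
  qed
qed

section \<open>Hardy's inequality and Bessel pairs\<close>

text \<open>The profiles are arbitrary outside (0, R); extended by 0 they are measurable on the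
  whole line. The composition with the norm changes the integrand at most on the null set consisting
  of the origin and outside the ball.\<close>

definition cutoff :: "real \<Rightarrow> (real \<Rightarrow> real) \<Rightarrow> real \<Rightarrow> real" where
  "cutoff R f r = (if 0 < r \<and> r < R then f r else 0)"

lemma cutoff_measurable:
  assumes "continuous_on {0<..<R} f"
  shows "cutoff R f \<in> borel_measurable borel"
proof -
  have "(\<lambda>r. indicator {0<..<R} r *\<^sub>R f r) \<in> borel_measurable borel"
    by (intro borel_measurable_continuous_on_indicator assms) auto
  also have "(\<lambda>r. indicator {0<..<R} r *\<^sub>R f r) = cutoff R f"
    by (auto simp: cutoff_def fun_eq_iff indicator_def)
  finally show ?thesis .
qed

lemma nn_integral_ball_cutoff:
  "(\<integral>\<^sup>+x\<in>ball (0::'a::euclidean_space) R. ennreal (f (norm x) * g x) \<partial>lborel) = (\<integral>\<^sup>+x. ennreal (cutoff R f (norm x) * g x) \<partial>lborel)"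
proof (rule nn_integral_cong_AE, use AE_lborel_singleton[of "0::'a"] in eventually_elim)
  fix x :: 'a assume "x \<noteq> 0"
  then show "ennreal (f (norm x) * g x) * indicator (ball 0 R) x = ennreal (cutoff R f (norm x) * g x)"
    by (auto simp: cutoff_def indicator_def)
qed

text \<open>The consequence of (1) from which the integral inequalities are drawn. The functions
  vanish near R but carry no condition at 0, since u and u_r along a ray need not vanish at the
  origin.\<close>

definition ray_hardy :: "nat \<Rightarrow> real \<Rightarrow> (real \<Rightarrow> real) \<Rightarrow> (real \<Rightarrow> real) \<Rightarrow> bool" where
  "ray_hardy n R V W \<longleftrightarrow> (\<forall>v v1 \<rho>. (\<forall>r\<in>{0<..<R}. (v has_real_derivative v1 r) (at r)) \<longrightarrow> continuous_on {0<..<R} v1 \<longrightarrow>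
     0 < \<rho> \<longrightarrow> \<rho> < R \<longrightarrow> (\<forall>r. \<rho> \<le> r \<longrightarrow> r < R \<longrightarrow> v r = 0) \<longrightarrow>
     (\<integral>\<^sup>+r\<in>{0<..<R}. ennreal (r ^ (n - 1) * W r * (v r)\<^sup>2) \<partial>lborel)
       \<le> (\<integral>\<^sup>+r\<in>{0<..<R}. ennreal (r ^ (n - 1) * V r * (v1 r)\<^sup>2) \<partial>lborel))"

text \<open>The consequence of (2) or (3) from which (1) is recovered. Both end points are interior
  with value 0, so neither singular end of (0, R) enters.\<close>

definition segment_hardy :: "nat \<Rightarrow> real \<Rightarrow> (real \<Rightarrow> real) \<Rightarrow> (real \<Rightarrow> real) \<Rightarrow> bool" where
  "segment_hardy n R V W \<longleftrightarrow> (\<forall>a b v v1. 0 < a \<longrightarrow> a < b \<longrightarrow> b < R \<longrightarrow> (\<forall>r\<in>{0<..<R}. (v has_real_derivative v1 r) (at r)) \<longrightarrow>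
     continuous_on {0<..<R} v1 \<longrightarrow> v a = 0 \<longrightarrow> v b = 0 \<longrightarrow>
     integral {a..b} (\<lambda>r. (r ^ (n - 1) * W r) * (v r)\<^sup>2) \<le> integral {a..b} (\<lambda>r. (r ^ (n - 1) * V r) * (v1 r)\<^sup>2))"

text \<open>Approximation by a factor rather than by a difference, since both sides may be
  infinite.\<close>

lemma ennreal_le_of_almost:
  fixes X Y :: ennreal
  assumes "\<And>b. b < 1 \<Longrightarrow> \<exists>c>b. c > 0 \<and> ennreal c * X \<le> Y"
  shows "X \<le> Y"
proof (cases X)
  case top
  obtain c where "c > 0" "ennreal c * X \<le> Y" using assms[of 0] by auto
  then have "Y = top" using top by (simp add: ennreal_mult_top top_unique)
  then show ?thesis by simp
next
  case (real x)
  show ?thesis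
  proof (cases Y)
    case (real y)
    have "x \<le> y"
    proof (rule ccontr)
      assume "\<not> x \<le> y"
      then have x: "x > 0" "y / x < 1" using \<open>0 \<le> y\<close> by auto
      obtain c where c: "c > y / x" "c > 0" "ennreal c * X \<le> Y" using assms[OF x(2)] by blast
      have "ennreal (c * x) \<le> ennreal y"
        using c \<open>X = ennreal x\<close> \<open>Y = ennreal y\<close> x by (simp add: ennreal_mult)
      then have "c * x \<le> y" using \<open>0 \<le> y\<close> by (simp add: ennreal_le_iff)
      then show False using c(1) x by (simp add: field_simps)
    qed
    then show ?thesis using \<open>X = ennreal x\<close> \<open>Y = ennreal y\<close> by (simp add: ennreal_leI)
  qed simp
qed

text \<open>Dominated convergence; the approximants converge only inside (a, b), and the end points
  form a null set.\<close>

lemma segment_hardy_limit: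
  fixes v v1 :: "real \<Rightarrow> real" and \<psi> \<psi>1 :: "nat \<Rightarrow> real \<Rightarrow> real"
  assumes ab: "a < b" and p: "continuous_on {a..b} p" and q: "continuous_on {a..b} q"
    and \<psi>: "\<And>j. continuous_on {a..b} (\<psi> j)" "\<And>j. continuous_on {a..b} (\<psi>1 j)"
    and C: "\<And>j r. r \<in> {a..b} \<Longrightarrow> \<bar>\<psi> j r\<bar> \<le> C" "\<And>j r. r \<in> {a..b} \<Longrightarrow> \<bar>\<psi>1 j r\<bar> \<le> C"
    and lim: "\<And>r. a < r \<Longrightarrow> r < b \<Longrightarrow> (\<lambda>j. \<psi> j r) \<longlonglongrightarrow> v r" "\<And>r. a < r \<Longrightarrow> r < b \<Longrightarrow> (\<lambda>j. \<psi>1 j r) \<longlonglongrightarrow> v1 r"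
    and le: "\<And>j. integral {a..b} (\<lambda>r. q r * (\<psi> j r)\<^sup>2) \<le> integral {a..b} (\<lambda>r. p r * (\<psi>1 j r)\<^sup>2)"
  shows "integral {a..b} (\<lambda>r. q r * (v r)\<^sup>2) \<le> integral {a..b} (\<lambda>r. p r * (v1 r)\<^sup>2)"
proof -
  have conv: "(\<lambda>j. integral {a..b} (\<lambda>r. f r * (\<phi> j r)\<^sup>2)) \<longlonglongrightarrow> integral {a..b} (\<lambda>r. f r * (y r)\<^sup>2)"
    if f: "continuous_on {a..b} f" and \<phi>: "\<And>j. continuous_on {a..b} (\<phi> j)" "\<And>j r. r \<in> {a..b} \<Longrightarrow> \<bar>\<phi> j r\<bar> \<le> C"
      "\<And>r. a < r \<Longrightarrow> r < b \<Longrightarrow> (\<lambda>j. \<phi> j r) \<longlonglongrightarrow> y r" for f y :: "real \<Rightarrow> real" and \<phi> :: "nat \<Rightarrow> real \<Rightarrow> real"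
  proof -
    have s1: "integral {a..b} (\<lambda>r. if r \<in> {a<..<b} then f r * (y r)\<^sup>2 else 0) = integral {a..b} (\<lambda>r. f r * (y r)\<^sup>2)"
      by (rule integral_spike[of "{a, b}"]) auto
    have s2: "integral {a..b} (\<lambda>r. if r \<in> {a<..<b} then f r * (\<phi> j r)\<^sup>2 else 0) = integral {a..b} (\<lambda>r. f r * (\<phi> j r)\<^sup>2)" for j
      by (rule integral_spike[of "{a, b}"]) auto
    have "(\<lambda>j. integral {a..b} (\<lambda>r. if r \<in> {a<..<b} then f r * (\<phi> j r)\<^sup>2 else 0)) \<longlonglongrightarrow> integral {a..b} (\<lambda>r. if r \<in> {a<..<b} then f r * (y r)\<^sup>2 else 0)"
    proof (rule dominated_convergence(2)[where h = "\<lambda>r. \<bar>f r\<bar> * C\<^sup>2"])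
      show "(\<lambda>r. if r \<in> {a<..<b} then f r * (\<phi> j r)\<^sup>2 else 0) integrable_on {a..b}" for j
      proof (rule integrable_spike[of "\<lambda>r. f r * (\<phi> j r)\<^sup>2" _ "{a, b}"])
        show "(\<lambda>r. f r * (\<phi> j r)\<^sup>2) integrable_on {a..b}"
          by (intro integrable_continuous_real continuous_intros f \<phi>)
      qed auto
      show "(\<lambda>r. \<bar>f r\<bar> * C\<^sup>2) integrable_on {a..b}"
        by (intro integrable_continuous_real continuous_intros f)
      show "norm (if r \<in> {a<..<b} then f r * (\<phi> j r)\<^sup>2 else 0) \<le> \<bar>f r\<bar> * C\<^sup>2" if "r \<in> {a..b}" for j r
      proof -
        have "(\<phi> j r)\<^sup>2 \<le> C\<^sup>2" using \<phi>(2)[OF that, of j] by (simp add: abs_le_square_iff[symmetric])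
        then have "\<bar>f r\<bar> * (\<phi> j r)\<^sup>2 \<le> \<bar>f r\<bar> * C\<^sup>2" by (intro mult_left_mono) auto
        then show ?thesis by (auto simp: abs_mult)
      qed
      show "(\<lambda>j. if r \<in> {a<..<b} then f r * (\<phi> j r)\<^sup>2 else 0) \<longlonglongrightarrow> (if r \<in> {a<..<b} then f r * (y r)\<^sup>2 else 0)" for r
        using \<phi>(3)[of r] by (auto intro!: tendsto_intros)
    qed
    then show ?thesis unfolding s1 s2 .
  qed
  show ?thesis
    by (rule LIMSEQ_le[OF conv[OF q \<psi>(1) C(1) lim(1)] conv[OF p \<psi>(2) C(2) lim(2)]]) (use le in auto)
qed

section \<open>Hardy's inequality in the ball and the Bessel equation\<close>

locale weight_pair =
  fixes n :: nat and R :: real and V W :: "real \<Rightarrow> real"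
  assumes n: "n \<ge> 1" and R: "R > 0"
    and V_pos: "\<And>r. r \<in> {0<..<R} \<Longrightarrow> V r > 0" and W_pos: "\<And>r. r \<in> {0<..<R} \<Longrightarrow> W r > 0"
    and V_deriv: "\<And>r. r \<in> {0<..<R} \<Longrightarrow> (V has_real_derivative deriv V r) (at r)"
    and dV_cont: "continuous_on {0<..<R} (deriv V)" and W_cont: "continuous_on {0<..<R} W"
    and div: "diverges_at_zero R (\<lambda>r. 1 / (r ^ (n - 1) * V r))"
    and V_fin: "(\<integral>\<^sup>+r\<in>{0<..<R}. ennreal (r ^ (n - 1) * V r) \<partial>lborel) < \<infinity>"
begin

lemma V_cont: "continuous_on {0<..<R} V"
  using V_deriv by (meson DERIV_isCont continuous_at_imp_continuous_on)

lemma cutoff_V_measurable [measurable]: "cutoff R V \<in> borel_measurable borel"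
  by (rule cutoff_measurable[OF V_cont])

lemma cutoff_W_measurable [measurable]: "cutoff R W \<in> borel_measurable borel"
  by (rule cutoff_measurable[OF W_cont])

lemma cutoff_dV_measurable [measurable]: "cutoff R (deriv V) \<in> borel_measurable borel"
  by (rule cutoff_measurable[OF dV_cont])

lemma cutoff_V_nonneg: "cutoff R V r \<ge> 0" and cutoff_W_nonneg: "cutoff R W r \<ge> 0"
  using V_pos[of r] W_pos[of r] by (auto simp: cutoff_def)

lemma nn_integral_ray:
  fixes F :: "'a::euclidean_space \<Rightarrow> real"
  assumes [measurable]: "F \<in> borel_measurable borel" "cutoff R f \<in> borel_measurable borel" and \<theta>: "norm \<theta> = 1"
  shows "(\<integral>\<^sup>+r. ennreal (cutoff R f (norm (r *\<^sub>R \<theta>)) * F (r *\<^sub>R \<theta>)) \<partial>radial_measure n) = (\<integral>\<^sup>+r\<in>{0<..<R}. ennreal (r ^ (n - 1) * f r * F (r *\<^sub>R \<theta>)) \<partial>lborel)"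
proof (subst nn_integral_radial_measure, simp, rule nn_integral_cong)
  fix r :: real
  show "ennreal (r ^ (n - 1)) * ennreal (cutoff R f (norm (r *\<^sub>R \<theta>)) * F (r *\<^sub>R \<theta>)) * indicator {0<..} r
     = ennreal (r ^ (n - 1) * f r * F (r *\<^sub>R \<theta>)) * indicator {0<..<R} r"
    using \<theta> by (cases "0 < r"; cases "r < R") (auto simp: cutoff_def ennreal_mult'[symmetric] mult.assoc)
qed

lemma nn_integral_ray_mono:
  fixes F F1 :: "'a::euclidean_space \<Rightarrow> real"
  assumes dim: "DIM('a) = n" and [measurable]: "F \<in> borel_measurable borel" "F1 \<in> borel_measurable borel"
    and ray: "\<And>\<theta>::'a. norm \<theta> = 1 \<Longrightarrow> (\<integral>\<^sup>+r\<in>{0<..<R}. ennreal (r ^ (n - 1) * W r * (F (r *\<^sub>R \<theta>))\<^sup>2) \<partial>lborel)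
       \<le> (\<integral>\<^sup>+r\<in>{0<..<R}. ennreal (r ^ (n - 1) * V r * (F1 (r *\<^sub>R \<theta>))\<^sup>2) \<partial>lborel)"
  shows "(\<integral>\<^sup>+x. ennreal (cutoff R W (norm x) * (F x)\<^sup>2) \<partial>lborel) \<le> (\<integral>\<^sup>+x. ennreal (cutoff R V (norm x) * (F1 x)\<^sup>2) \<partial>lborel)"
proof -
  have "(\<integral>\<^sup>+x. ennreal (cutoff R W (norm x) * (F x)\<^sup>2) \<partial>lborel) =
      (\<integral>\<^sup>+y. \<integral>\<^sup>+r. ennreal (cutoff R W (norm (r *\<^sub>R sgn y)) * (F (r *\<^sub>R sgn y))\<^sup>2) \<partial>radial_measure n \<partial>(polar_measure :: 'a measure))"
    unfolding dim[symmetric] by (rule nn_integral_polar') simp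
  also have "\<dots> \<le> (\<integral>\<^sup>+y. \<integral>\<^sup>+r. ennreal (cutoff R V (norm (r *\<^sub>R sgn y)) * (F1 (r *\<^sub>R sgn y))\<^sup>2) \<partial>radial_measure n \<partial>(polar_measure :: 'a measure))"
  proof (rule nn_integral_mono_AE, use AE_polar_nonzero[where 'a='a] in eventually_elim)
    fix y :: 'a assume "y \<noteq> 0"
    then have y: "norm (sgn y) = 1" by (simp add: norm_sgn)
    show "(\<integral>\<^sup>+r. ennreal (cutoff R W (norm (r *\<^sub>R sgn y)) * (F (r *\<^sub>R sgn y))\<^sup>2) \<partial>radial_measure n)
        \<le> (\<integral>\<^sup>+r. ennreal (cutoff R V (norm (r *\<^sub>R sgn y)) * (F1 (r *\<^sub>R sgn y))\<^sup>2) \<partial>radial_measure n)"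
      using nn_integral_ray[of "\<lambda>x. (F x)\<^sup>2" W, OF _ _ y] nn_integral_ray[of "\<lambda>x. (F1 x)\<^sup>2" V, OF _ _ y] ray[OF y]
      by simp
  qed
  also have "\<dots> = (\<integral>\<^sup>+x. ennreal (cutoff R V (norm x) * (F1 x)\<^sup>2) \<partial>lborel)"
    unfolding dim[symmetric] by (rule nn_integral_polar'[symmetric]) simp
  finally show ?thesis .
qed

text \<open>The weight yields a positive solution for some constant above every b < 1; letting b
  tend to 1 gives the constant 1.\<close>

lemma ray_hardy_of_bessel:
  assumes "bessel_weight n R V W \<ge> 1"
  shows "ray_hardy n R V W"
  unfolding ray_hardy_def
proof (intro allI impI)
  fix v v1 \<rho>
  assume v: "\<forall>r\<in>{0<..<R}. (v has_real_derivative v1 r) (at r)" and v1: "continuous_on {0<..<R} v1"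
    and \<rho>: "0 < \<rho>" "\<rho> < R" and v0: "\<forall>r. \<rho> \<le> r \<longrightarrow> r < R \<longrightarrow> v r = 0"
  show "(\<integral>\<^sup>+r\<in>{0<..<R}. ennreal (r ^ (n - 1) * W r * (v r)\<^sup>2) \<partial>lborel)
       \<le> (\<integral>\<^sup>+r\<in>{0<..<R}. ennreal (r ^ (n - 1) * V r * (v1 r)\<^sup>2) \<partial>lborel)"
  proof (rule ennreal_le_of_almost)
    fix b :: real assume "b < 1"
    then obtain c where c: "c > 0" "c > b" "has_positive_solution n R V W c"
      using bessel_weight_ge_1D[OF assms] by blast
    then obtain y where y: "bessel_ode n R V W c y" "\<And>r. r \<in> {0<..<R} \<Longrightarrow> y r > 0"
      unfolding has_positive_solution_def by blast
    have "ennreal c * (\<integral>\<^sup>+r\<in>{0<..<R}. ennreal (r ^ (n - 1) * W r * (v r)\<^sup>2) \<partial>lborel)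
       \<le> (\<integral>\<^sup>+r\<in>{0<..<R}. ennreal (r ^ (n - 1) * V r * (v1 r)\<^sup>2) \<partial>lborel)"
      by (rule hardy_ray[OF n c(1) y(1) V_deriv V_pos W_pos W_cont y(2) div bspec[OF v] v1 \<rho>]) (use v0 in auto)
    then show "\<exists>c>b. c > 0 \<and> ennreal c * (\<integral>\<^sup>+r\<in>{0<..<R}. ennreal (r ^ (n - 1) * W r * (v r)\<^sup>2) \<partial>lborel)
       \<le> (\<integral>\<^sup>+r\<in>{0<..<R}. ennreal (r ^ (n - 1) * V r * (v1 r)\<^sup>2) \<partial>lborel)" using c by blast
  qed
qed

lemma ray_hardyD:
  assumes "ray_hardy n R V W" "\<And>r. r \<in> {0<..<R} \<Longrightarrow> (v has_real_derivative v1 r) (at r)" "continuous_on {0<..<R} v1"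
    "0 < \<rho>" "\<rho> < R" "\<And>r. \<rho> \<le> r \<Longrightarrow> r < R \<Longrightarrow> v r = 0"
  shows "(\<integral>\<^sup>+r\<in>{0<..<R}. ennreal (r ^ (n - 1) * W r * (v r)\<^sup>2) \<partial>lborel)
       \<le> (\<integral>\<^sup>+r\<in>{0<..<R}. ennreal (r ^ (n - 1) * V r * (v1 r)\<^sup>2) \<partial>lborel)"
  using assms unfolding ray_hardy_def by blast

lemma bessel_of_segment_hardy:
  assumes H: "segment_hardy n R V W"
  shows "bessel_pair n R V W \<and> bessel_weight n R V W \<ge> 1"
proof (rule bessel_weight_ge_1I)
  fix c :: real assume c: "0 < c" "c < 1"
  have "\<exists>y z. sturm_sol R (\<lambda>r. r ^ (n - 1) * V r) (\<lambda>r. c * (r ^ (n - 1) * W r)) y z \<and> (\<forall>r\<in>{0<..<R}. y r > 0)"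
  proof (rule sturm_positive_solution[OF R _ _ _ _ c(2)])
    show "continuous_on {0<..<R} (\<lambda>r. r ^ (n - 1) * V r)" "continuous_on {0<..<R} (\<lambda>r. r ^ (n - 1) * W r)"
      by (intro continuous_intros V_cont W_cont)+
    show "r ^ (n - 1) * V r > 0" "r ^ (n - 1) * W r > 0" if "r \<in> {0<..<R}" for r
      using V_pos[OF that] W_pos[OF that] that by auto
    fix a b and v v1 :: "real \<Rightarrow> real"
    assume "0 < a" "a < b" "b < R" "\<And>r. r \<in> {0<..<R} \<Longrightarrow> (v has_real_derivative v1 r) (at r)"
      "continuous_on {0<..<R} v1" "v a = 0" "v b = 0"
    then show "integral {a..b} (\<lambda>r. r ^ (n - 1) * W r * (v r)\<^sup>2) \<le> integral {a..b} (\<lambda>r. r ^ (n - 1) * V r * (v1 r)\<^sup>2)"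
      using H unfolding segment_hardy_def by blast
  qed
  then obtain y z where "sturm_sol R (\<lambda>r. r ^ (n - 1) * V r) (\<lambda>r. c * (r ^ (n - 1) * W r)) y z" "\<forall>r\<in>{0<..<R}. y r > 0"
    by blast
  with bessel_ode_of_sturm[OF n V_deriv V_pos] show "has_positive_solution n R V W c"
    unfolding has_positive_solution_def by blast
qed

lemma ray_continuous:
  fixes F :: "'a::real_normed_vector \<Rightarrow> real"
  assumes "continuous_on UNIV F"
  shows "continuous_on S (\<lambda>r. F (r *\<^sub>R \<theta>))"
  by (rule continuous_on_compose2[OF assms]) (auto intro!: continuous_intros)

lemma hardy_iff:
  fixes u :: "'a::euclidean_space \<Rightarrow> real"
  shows "hardy (ball 0 R) V W u \<longleftrightarrow>
     (\<integral>\<^sup>+x. ennreal (cutoff R W (norm x) * (u x)\<^sup>2) \<partial>lborel) \<le> (\<integral>\<^sup>+x. ennreal (cutoff R V (norm x) * (norm (grad u x))\<^sup>2) \<partial>lborel)"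
  unfolding hardy_def
  using nn_integral_ball_cutoff[of W "\<lambda>x. (u x)\<^sup>2" R] nn_integral_ball_cutoff[of V "\<lambda>x. (norm (grad u x))\<^sup>2" R]
  by simp

text \<open>The gradient is bounded below by its radial component, the only one that an inequality
  along rays sees.\<close>

lemma euler_le_grad: "(euler u x / norm x)\<^sup>2 \<le> (norm (grad u x))\<^sup>2"
proof (cases "x = 0")
  case False
  have "(norm x)\<^sup>2 * (norm (grad u x))\<^sup>2 \<ge> (euler u x)\<^sup>2"
    using lagrange_rot[of x u] by (simp add: power2_norm_eq_inner sum_nonneg)
  then show ?thesis using False by (simp add: power_divide field_simps)
qed simp

lemma hardy_of_ray_hardy:
  fixes u :: "'a::euclidean_space \<Rightarrow> real"
  assumes dim: "DIM('a) = n" and H: "ray_hardy n R V W" and u: "u \<in> test_functions (ball 0 R)"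
  shows "hardy (ball 0 R) V W u"
proof -
  have su: "smooth u" using test_functionD(1)[OF u R] .
  obtain \<rho> where \<rho>: "0 < \<rho>" "\<rho> < R" "supp_in \<rho> u" using test_functionD(2)[OF u R] by blast
  \<comment> \<open>\<open>supp_in\<close> gives vanishing only strictly beyond
    \<open>\<rho>\<close>, while \<open>ray_hardyD\<close> asks for it from the chosen radius on;
    any radius strictly between \<open>\<rho>\<close> and \<open>R\<close> serves.\<close>
  define \<rho>' where "\<rho>' = (\<rho> + R) / 2"
  have \<rho>': "0 < \<rho>'" "\<rho>' < R" "\<rho> < \<rho>'" using \<rho> by (auto simp: \<rho>'_def)
  have se: "smooth (euler u)" by (rule smooth_euler[OF su])
  have [measurable]: "u \<in> borel_measurable borel" "euler u \<in> borel_measurable borel"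
    by (intro smooth_measurable su se)+
  have "(\<integral>\<^sup>+x. ennreal (cutoff R W (norm x) * (u x)\<^sup>2) \<partial>lborel) \<le> (\<integral>\<^sup>+x. ennreal (cutoff R V (norm x) * (euler u x / norm x)\<^sup>2) \<partial>lborel)"
  proof (rule nn_integral_ray_mono[OF dim])
    fix \<theta> :: 'a assume \<theta>: "norm \<theta> = 1"
    have "(\<integral>\<^sup>+r\<in>{0<..<R}. ennreal (r ^ (n - 1) * W r * (u (r *\<^sub>R \<theta>))\<^sup>2) \<partial>lborel)
       \<le> (\<integral>\<^sup>+r\<in>{0<..<R}. ennreal (r ^ (n - 1) * V r * (euler u (r *\<^sub>R \<theta>) / r)\<^sup>2) \<partial>lborel)"
    proof (rule ray_hardyD[OF H _ _ \<rho>'(1,2)])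
      show "((\<lambda>r. u (r *\<^sub>R \<theta>)) has_real_derivative euler u (r *\<^sub>R \<theta>) / r) (at r)" if "r \<in> {0<..<R}" for r
        using that by (intro DERIV_along_ray[OF su]) auto
      show "continuous_on {0<..<R} (\<lambda>r. euler u (r *\<^sub>R \<theta>) / r)"
        by (intro continuous_intros ray_continuous smooth_continuous_on se) auto
      show "u (r *\<^sub>R \<theta>) = 0" if "\<rho>' \<le> r" for r
        using \<rho>(1,3) \<rho>' that \<theta> unfolding supp_in_def by auto
    qed
    also have "\<dots> = (\<integral>\<^sup>+r\<in>{0<..<R}. ennreal (r ^ (n - 1) * V r * (euler u (r *\<^sub>R \<theta>) / norm (r *\<^sub>R \<theta>))\<^sup>2) \<partial>lborel)"
      using \<theta> by (intro nn_integral_cong) (auto simp: indicator_def)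
    finally show "(\<integral>\<^sup>+r\<in>{0<..<R}. ennreal (r ^ (n - 1) * W r * (u (r *\<^sub>R \<theta>))\<^sup>2) \<partial>lborel)
       \<le> (\<integral>\<^sup>+r\<in>{0<..<R}. ennreal (r ^ (n - 1) * V r * (euler u (r *\<^sub>R \<theta>) / norm (r *\<^sub>R \<theta>))\<^sup>2) \<partial>lborel)" .
  qed measurable
  also have "\<dots> \<le> (\<integral>\<^sup>+x. ennreal (cutoff R V (norm x) * (norm (grad u x))\<^sup>2) \<partial>lborel)"
    by (intro nn_integral_mono ennreal_leI mult_left_mono euler_le_grad cutoff_V_nonneg)
  finally show ?thesis unfolding hardy_iff .
qed

text \<open>In polar coordinates both sides carry the total mass of the directions, which is finite
  and positive and therefore cancels.\<close>

lemma segment_of_radial: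
  fixes \<psi> \<psi>1 :: "real \<Rightarrow> real"
  assumes dim: "DIM('a::euclidean_space) = n" and ab: "0 < a" "a < b" "b < R"
    and c: "continuous_on UNIV \<psi>" "continuous_on UNIV \<psi>1"
    and z: "\<And>r. 0 < r \<Longrightarrow> r < a \<or> b < r \<Longrightarrow> \<psi> r = 0" "\<And>r. 0 < r \<Longrightarrow> r < a \<or> b < r \<Longrightarrow> \<psi>1 r = 0"
    and le: "(\<integral>\<^sup>+x. ennreal (cutoff R W (norm (x::'a)) * (\<psi> (norm x))\<^sup>2) \<partial>lborel) \<le> (\<integral>\<^sup>+x. ennreal (cutoff R V (norm (x::'a)) * (\<psi>1 (norm x))\<^sup>2) \<partial>lborel)"
  shows "integral {a..b} (\<lambda>r. (r ^ (n - 1) * W r) * (\<psi> r)\<^sup>2) \<le> integral {a..b} (\<lambda>r. (r ^ (n - 1) * V r) * (\<psi>1 r)\<^sup>2)"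
proof -
  let ?P = "emeasure (polar_measure :: 'a measure) UNIV"
  have [measurable]: "\<psi> \<in> borel_measurable borel" "\<psi>1 \<in> borel_measurable borel"
    by (intro borel_measurable_continuous_onI c)+
  have sub: "{a..b} \<subseteq> {0<..<R}" using ab by auto
  have tr: "(\<integral>\<^sup>+x. ennreal (cutoff R f (norm (x::'a)) * (\<phi> (norm x))\<^sup>2) \<partial>lborel) = ?P * ennreal (integral {a..b} (\<lambda>r. (r ^ (n - 1) * f r) * (\<phi> r)\<^sup>2))"
    if [measurable]: "cutoff R f \<in> borel_measurable borel" "\<phi> \<in> borel_measurable borel"
      and f: "continuous_on {0<..<R} f" "\<And>r. r \<in> {0<..<R} \<Longrightarrow> f r > 0" and \<phi>: "continuous_on UNIV \<phi>"
      "\<And>r. 0 < r \<Longrightarrow> r < a \<or> b < r \<Longrightarrow> \<phi> r = 0" for f \<phi> :: "real \<Rightarrow> real"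
  proof -
    have "(\<integral>\<^sup>+x. ennreal (cutoff R f (norm (x::'a)) * (\<phi> (norm x))\<^sup>2) \<partial>lborel)
      = ?P * (\<integral>\<^sup>+r. ennreal (r ^ (n - 1)) * ennreal (cutoff R f r * (\<phi> r)\<^sup>2) * indicator {0<..} r \<partial>lborel)"
      unfolding dim[symmetric] by (rule nn_integral_radial_fun[of "\<lambda>r. ennreal (cutoff R f r * (\<phi> r)\<^sup>2)"]) simp
    also have "(\<integral>\<^sup>+r. ennreal (r ^ (n - 1)) * ennreal (cutoff R f r * (\<phi> r)\<^sup>2) * indicator {0<..} r \<partial>lborel)
      = (\<integral>\<^sup>+r\<in>{a..b}. ennreal ((r ^ (n - 1) * f r) * (\<phi> r)\<^sup>2) \<partial>lborel)"
    proof (rule nn_integral_cong)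
      fix r :: real
      show "ennreal (r ^ (n - 1)) * ennreal (cutoff R f r * (\<phi> r)\<^sup>2) * indicator {0<..} r = ennreal ((r ^ (n - 1) * f r) * (\<phi> r)\<^sup>2) * indicator {a..b} r"
      proof (cases "a \<le> r \<and> r \<le> b")
        case True
        then show ?thesis using ab by (simp add: cutoff_def ennreal_mult'[symmetric] mult.assoc)
      next
        case False
        then have "r > 0 \<Longrightarrow> \<phi> r = 0" by (intro \<phi>) auto
        then show ?thesis using False by (cases "r > 0") auto
      qed
    qed
    also have "\<dots> = ennreal (integral {a..b} (\<lambda>r. (r ^ (n - 1) * f r) * (\<phi> r)\<^sup>2))"
    proof (rule nn_integral_Icc_continuous)
      show "continuous_on {a..b} (\<lambda>r. (r ^ (n - 1) * f r) * (\<phi> r)\<^sup>2)"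
        by (intro continuous_intros continuous_on_subset[OF f(1) sub] continuous_on_subset[OF \<phi>(1)]) auto
      show "0 \<le> (r ^ (n - 1) * f r) * (\<phi> r)\<^sup>2" if "a \<le> r" "r \<le> b" for r
        using f(2)[of r] that ab by (auto intro!: mult_nonneg_nonneg simp: less_imp_le)
    qed
    finally show ?thesis .
  qed
  have P: "?P \<noteq> 0" "?P \<noteq> top"
    using emeasure_polar_pos[where 'a='a] finite_measure.emeasure_finite[OF finite_polar_measure[where 'a='a], of UNIV]
    by (auto simp: top.not_eq_extremum)
  have "?P * ennreal (integral {a..b} (\<lambda>r. (r ^ (n - 1) * W r) * (\<psi> r)\<^sup>2)) \<le> ?P * ennreal (integral {a..b} (\<lambda>r. (r ^ (n - 1) * V r) * (\<psi>1 r)\<^sup>2))"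
    using le tr[of W \<psi>] tr[of V \<psi>1] W_cont V_cont W_pos V_pos c z by simp
  then have "ennreal (integral {a..b} (\<lambda>r. (r ^ (n - 1) * W r) * (\<psi> r)\<^sup>2)) \<le> ennreal (integral {a..b} (\<lambda>r. (r ^ (n - 1) * V r) * (\<psi>1 r)\<^sup>2))"
    using P by (subst (asm) ennreal_mult_le_mult_iff) auto
  moreover have "integral {a..b} (\<lambda>r. (r ^ (n - 1) * V r) * (\<psi>1 r)\<^sup>2) \<ge> 0"
  proof (rule Henstock_Kurzweil_Integration.integral_nonneg)
    show "(\<lambda>r. (r ^ (n - 1) * V r) * (\<psi>1 r)\<^sup>2) integrable_on {a..b}"
      by (intro integrable_continuous_real continuous_intros continuous_on_subset[OF V_cont sub] continuous_on_subset[OF c(2)]) auto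
    show "0 \<le> (r ^ (n - 1) * V r) * (\<psi>1 r)\<^sup>2" if "r \<in> {a..b}" for r
      using V_pos[of r] that ab by (auto intro!: mult_nonneg_nonneg simp: less_imp_le)
  qed
  ultimately show ?thesis by (simp add: ennreal_le_iff)
qed

lemma grad_compose_sq:
  fixes h :: "real \<Rightarrow> real" and x :: "'a::euclidean_space"
  assumes "smooth h" "\<And>s. (h has_real_derivative h1 s) (at s)"
  shows "partial b (\<lambda>x. h (x \<bullet> x)) x = h1 (x \<bullet> x) * partial b (\<lambda>x. x \<bullet> x) x"
  using partial_compose[OF smooth_differentiable[OF smooth_inner_self] smooth_differentiable[OF assms(1)], of b x]
    has_partial_real(1)[OF assms(2), of "x \<bullet> x"] by simp

text \<open>The variable \<open>s = r\<^sup>2\<close> makes radial test functions smooth at the origin. The exponent \<open>m = 0\<close> corresponds to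
  \<open>u = h(r\<^sup>2)\<close>, and \<open>m = 1\<close> to \<open>u\<^sub>r = r h(r\<^sup>2)\<close>.\<close>

lemma segment_hardyI:
  assumes dim: "DIM('a::euclidean_space) = n"
    and test: "\<And>a b h h1. 0 < a \<Longrightarrow> a < b \<Longrightarrow> b < R \<Longrightarrow> smooth h \<Longrightarrow> (\<And>s. (h has_real_derivative h1 s) (at s)) \<Longrightarrow>
      (\<And>s. s < a\<^sup>2 \<or> b\<^sup>2 < s \<Longrightarrow> h s = 0) \<Longrightarrow>
      (\<integral>\<^sup>+x. ennreal (cutoff R W (norm x) * (norm (x::'a) ^ m * h ((norm x)\<^sup>2))\<^sup>2) \<partial>lborel)
        \<le> (\<integral>\<^sup>+x. ennreal (cutoff R V (norm x) * (real m * norm (x::'a) ^ (m - 1) * h ((norm x)\<^sup>2) + 2 * norm x ^ (m + 1) * h1 ((norm x)\<^sup>2))\<^sup>2) \<partial>lborel)"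
  shows "segment_hardy n R V W"
  unfolding segment_hardy_def
proof (intro allI impI)
  fix a b and v v1 :: "real \<Rightarrow> real"
  assume ab: "0 < a" "a < b" "b < R" and v: "\<forall>r\<in>{0<..<R}. (v has_real_derivative v1 r) (at r)"
    and v1: "continuous_on {0<..<R} v1" and z: "v a = 0" "v b = 0"
  have sq: "0 < sqrt s" "sqrt s \<in> {0<..<R}" "s > 0" if "a\<^sup>2 \<le> s" "s \<le> b\<^sup>2" for s
  proof -
    have "a\<^sup>2 > 0" using ab by simp
    then show s0: "s > 0" using that(1) by linarith
    have "sqrt s \<le> sqrt (b\<^sup>2)" using that(2) by (rule real_sqrt_le_mono)
    then have "sqrt s \<le> b" using ab by simp
    then show "0 < sqrt s" "sqrt s \<in> {0<..<R}" using ab s0 by auto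
  qed
  have AB: "a\<^sup>2 < b\<^sup>2" using ab by (simp add: power2_strict_mono)
  \<comment> \<open>\<open>i\<close> is s^(-1/2). The function to approximate is v (sqrt s)
    s^(-m/2): if h is close to it, then r^m h(r^2) is close to v.\<close>
  define i where "i s = inverse (sqrt s)" for s :: real
  define i1 where "i1 s = - (i s * (i s / 2) * i s)" for s
  have I: "(i has_real_derivative i1 s) (at s)" if "a\<^sup>2 \<le> s" "s \<le> b\<^sup>2" for s
  proof -
    have "sqrt s \<noteq> 0" using sq(1)[OF that] by simp
    then show ?thesis unfolding i_def[abs_def] i1_def
      using sq(3)[OF that] by (intro DERIV_inverse' DERIV_real_sqrt)
  qed
  define U1 where "U1 s = v1 (sqrt s) * (i s / 2) * i s ^ m + real m * (i1 s * i s ^ (m - 1)) * v (sqrt s)" for s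
  have U: "((\<lambda>s. v (sqrt s) * i s ^ m) has_real_derivative U1 s) (at s)" if "a\<^sup>2 \<le> s" "s \<le> b\<^sup>2" for s
  proof -
    have "((\<lambda>s. v (sqrt s)) has_real_derivative v1 (sqrt s) * (i s / 2)) (at s)"
      unfolding i_def using v sq[OF that] by (intro DERIV_chain2[of v] DERIV_real_sqrt) auto
    from DERIV_mult[OF this DERIV_power[OF I[OF that], of m]] show ?thesis by (simp add: U1_def)
  qed
  have vc: "continuous_on {0<..<R} v" using v by (meson DERIV_isCont continuous_at_imp_continuous_on)
  have sqs: "sqrt ` {a\<^sup>2..b\<^sup>2} \<subseteq> {0<..<R}" using sq(2) by fastforce
  have sqc: "continuous_on {a\<^sup>2..b\<^sup>2} sqrt" by (intro continuous_intros)
  have cont: "continuous_on {a\<^sup>2..b\<^sup>2} (\<lambda>s. v1 (sqrt s))" "continuous_on {a\<^sup>2..b\<^sup>2} (\<lambda>s. v (sqrt s))"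
    by (rule continuous_on_compose2[OF v1 sqc sqs]) (rule continuous_on_compose2[OF vc sqc sqs])
  have ic: "continuous_on {a\<^sup>2..b\<^sup>2} i" using I by (meson DERIV_isCont atLeastAtMost_iff continuous_at_imp_continuous_on)
  have U1c: "continuous_on {a\<^sup>2..b\<^sup>2} U1"
    unfolding U1_def[abs_def] i1_def[abs_def] by (intro continuous_intros cont ic) auto
  have zz: "v (sqrt (a\<^sup>2)) * i (a\<^sup>2) ^ m = 0" "v (sqrt (b\<^sup>2)) * i (b\<^sup>2) ^ m = 0" using z ab by simp_all
  show "integral {a..b} (\<lambda>r. (r ^ (n - 1) * W r) * (v r)\<^sup>2) \<le> integral {a..b} (\<lambda>r. (r ^ (n - 1) * V r) * (v1 r)\<^sup>2)"
  proof (rule smooth_approximation[OF AB U U1c zz])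
    fix h h1 :: "nat \<Rightarrow> real \<Rightarrow> real" and \<delta> C
    assume h: "\<And>j. smooth (h j)" "\<And>j s. (h j has_real_derivative h1 j s) (at s)" "\<And>j. smooth (h1 j)"
      and \<delta>: "\<And>j. \<delta> j > 0" "\<And>j s. s \<le> a\<^sup>2 + \<delta> j \<or> b\<^sup>2 - \<delta> j \<le> s \<Longrightarrow> h j s = 0"
      and C: "\<And>j s. \<bar>h j s\<bar> \<le> C" "\<And>j s. \<bar>h1 j s\<bar> \<le> C"
      and lim: "\<And>s. a\<^sup>2 < s \<Longrightarrow> s < b\<^sup>2 \<Longrightarrow> (\<lambda>j. h j s) \<longlonglongrightarrow> v (sqrt s) * i s ^ m"
        "\<And>s. a\<^sup>2 < s \<Longrightarrow> s < b\<^sup>2 \<Longrightarrow> (\<lambda>j. h1 j s) \<longlonglongrightarrow> U1 s"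
    have hz: "h j s = 0" if "s < a\<^sup>2 \<or> b\<^sup>2 < s" for j s
      using that \<delta>(1)[of j] by (intro \<delta>(2)) auto
    have h1z: "h1 j s = 0" if "s < a\<^sup>2 \<or> b\<^sup>2 < s" for j s
    proof -
      have "((\<lambda>_. 0) has_real_derivative 0) (at s)" by simp
      then have "(h j has_real_derivative 0) (at s)"
        by (rule has_field_derivative_transform_within_open[of _ _ _ "{..<a\<^sup>2} \<union> {b\<^sup>2<..}"])
          (use that in \<open>auto simp: hz\<close>)
      then show ?thesis using DERIV_unique[OF h(2)] by blast
    qed
    have pw: "r\<^sup>2 < a\<^sup>2 \<or> b\<^sup>2 < r\<^sup>2" if "0 < r" "r < a \<or> b < r" for r :: real
      using that ab power2_strict_mono[of r a] power2_strict_mono[of b r] by auto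
    have hc: "continuous_on UNIV (h j)" "continuous_on UNIV (h1 j)" for j
      using h by (auto intro: smooth_continuous_on)
    define \<psi> where "\<psi> j r = r ^ m * h j (r\<^sup>2)" for j r
    define \<psi>1 where "\<psi>1 j r = real m * r ^ (m - 1) * h j (r\<^sup>2) + 2 * r ^ (m + 1) * h1 j (r\<^sup>2)" for j r
    have c: "continuous_on UNIV (\<psi> j)" "continuous_on UNIV (\<psi>1 j)" for j
      unfolding \<psi>_def[abs_def] \<psi>1_def[abs_def]
      by (intro continuous_intros continuous_on_compose2[OF hc(1)] continuous_on_compose2[OF hc(2)]; simp)+
    have key: "integral {a..b} (\<lambda>r. (r ^ (n - 1) * W r) * (\<psi> j r)\<^sup>2) \<le> integral {a..b} (\<lambda>r. (r ^ (n - 1) * V r) * (\<psi>1 j r)\<^sup>2)" for j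
    proof (rule segment_of_radial[OF dim ab c])
      show "\<psi> j r = 0" "\<psi>1 j r = 0" if "0 < r" "r < a \<or> b < r" for r
        using hz[OF pw[OF that]] h1z[OF pw[OF that]] by (simp_all add: \<psi>_def \<psi>1_def)
    qed (unfold \<psi>_def \<psi>1_def, rule test[OF ab h(1,2) hz])
    have sub: "{a..b} \<subseteq> {0<..<R}" using ab by auto
    have C0: "C \<ge> 0" using C(1)[of 0 0] by linarith
    have sl: "a\<^sup>2 < r\<^sup>2" "r\<^sup>2 < b\<^sup>2" "sqrt (r\<^sup>2) = r" if "a < r" "r < b" for r
      using that ab by (auto simp: power2_strict_mono)
    define K1 where "K1 = real m * R ^ (m - 1)"
    define K2 where "K2 = 2 * R ^ (m + 1)"
    define D where "D = R ^ m * C + (K1 * C + K2 * C)"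
    have b: "R ^ m * C \<ge> 0" "K1 * C + K2 * C \<ge> 0" using C0 R by (simp_all add: K1_def K2_def)
    have bd: "\<bar>k * t\<bar> \<le> K * C" if "0 \<le> k" "k \<le> K" "\<bar>t\<bar> \<le> C" for k K t
      unfolding abs_mult using that by (intro mult_mono) auto
    show ?thesis
    proof (rule segment_hardy_limit[OF ab(2) _ _ _ _ _ _ _ _ key])
      show "continuous_on {a..b} (\<lambda>r. r ^ (n - 1) * V r)" "continuous_on {a..b} (\<lambda>r. r ^ (n - 1) * W r)"
        by (intro continuous_intros continuous_on_subset[OF V_cont sub] continuous_on_subset[OF W_cont sub])+
      show "continuous_on {a..b} (\<psi> j)" "continuous_on {a..b} (\<psi>1 j)" for j
        by (rule continuous_on_subset[OF c(1)], simp) (rule continuous_on_subset[OF c(2)], simp)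
      fix r assume r: "r \<in> {a..b}"
      have rR: "0 \<le> r ^ k" "r ^ k \<le> R ^ k" for k using r ab by (auto intro: power_mono)
      show "\<bar>\<psi> j r\<bar> \<le> D" for j
        using bd[OF rR(1,2) C(1), of m j "r\<^sup>2"] b unfolding \<psi>_def D_def by linarith
      show "\<bar>\<psi>1 j r\<bar> \<le> D" for j
      proof -
        have "\<bar>real m * r ^ (m - 1) * h j (r\<^sup>2)\<bar> \<le> K1 * C" "\<bar>2 * r ^ (m + 1) * h1 j (r\<^sup>2)\<bar> \<le> K2 * C"
          unfolding K1_def K2_def by (intro bd C mult_nonneg_nonneg mult_left_mono rR; simp)+
        then show ?thesis
          using b abs_triangle_ineq[of "real m * r ^ (m - 1) * h j (r\<^sup>2)" "2 * r ^ (m + 1) * h1 j (r\<^sup>2)"]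
          unfolding \<psi>1_def D_def by linarith
      qed
    next
      fix r assume r: "a < r" "r < b"
      have r0: "r > 0" "i (r\<^sup>2) = 1 / r" using r ab by (simp_all add: i_def inverse_eq_divide)
      have l: "(\<lambda>j. h j (r\<^sup>2)) \<longlonglongrightarrow> v r * i (r\<^sup>2) ^ m" "(\<lambda>j. h1 j (r\<^sup>2)) \<longlonglongrightarrow> U1 (r\<^sup>2)"
        using lim(1)[of "r\<^sup>2"] lim(2)[of "r\<^sup>2"] sl[OF r] by simp_all
      have "(\<lambda>j. \<psi> j r) \<longlonglongrightarrow> r ^ m * (v r * i (r\<^sup>2) ^ m)"
        unfolding \<psi>_def by (intro tendsto_intros l)
      moreover have "r ^ m * (v r * i (r\<^sup>2) ^ m) = v r" using r0 by (simp add: power_divide)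
      ultimately show "(\<lambda>j. \<psi> j r) \<longlonglongrightarrow> v r" by (simp only:)
      have "(\<lambda>j. \<psi>1 j r) \<longlonglongrightarrow> real m * r ^ (m - 1) * (v r * i (r\<^sup>2) ^ m) + 2 * r ^ (m + 1) * U1 (r\<^sup>2)"
        unfolding \<psi>1_def by (intro tendsto_intros l)
      moreover have "real m * r ^ (m - 1) * (v r * i (r\<^sup>2) ^ m) + 2 * r ^ (m + 1) * U1 (r\<^sup>2) = v1 r"
        unfolding U1_def i1_def r0(2) sl(3)[OF r] using r0(1)
        by (cases m) (simp_all add: field_simps power_divide)
      ultimately show "(\<lambda>j. \<psi>1 j r) \<longlonglongrightarrow> v1 r" by (simp only:)
    qed
  qed
qed

lemma segment_hardy_of_hardy:
  assumes dim: "DIM('a::euclidean_space) = n"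
    and H: "\<forall>u\<in>test_functions (ball (0::'a) R). hardy (ball 0 R) V W u"
  shows "segment_hardy n R V W"
proof (rule segment_hardyI[where m = 0, OF dim])
  fix a b and h h1 :: "real \<Rightarrow> real"
  assume ab: "0 < a" "a < b" "b < R" and h: "smooth h" "\<And>s. (h has_real_derivative h1 s) (at s)"
    and hz: "\<And>s. s < a\<^sup>2 \<or> b\<^sup>2 < s \<Longrightarrow> h s = 0"
  define u where "u x = h (x \<bullet> x)" for x :: 'a
  have su: "smooth u" unfolding u_def[abs_def] by (rule smooth_compose[OF h(1) smooth_inner_self])
  have "u \<in> test_functions (ball 0 R)"
  proof (rule test_functionI[OF su])
    fix x :: 'a assume "norm x > b"
    then have "x \<bullet> x > b\<^sup>2" using ab power2_strict_mono[of b "norm x"] by (simp add: power2_norm_eq_inner)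
    then show "u x = 0" unfolding u_def by (intro hz) auto
  qed (use ab in auto)
  then have "(\<integral>\<^sup>+x. ennreal (cutoff R W (norm x) * (u x)\<^sup>2) \<partial>lborel) \<le> (\<integral>\<^sup>+x. ennreal (cutoff R V (norm x) * (norm (grad u x))\<^sup>2) \<partial>lborel)"
    using H unfolding hardy_iff by blast
  moreover have "(norm (grad u x))\<^sup>2 = (2 * norm x * h1 ((norm x)\<^sup>2))\<^sup>2" for x
  proof -
    have "(norm (grad u x))\<^sup>2 = (\<Sum>b\<in>Basis. (h1 (x \<bullet> x) * (2 * (x \<bullet> b)))\<^sup>2)"
      unfolding norm_grad_sq u_def
      by (intro sum.cong refl) (simp add: grad_compose_sq[OF h] partial_inner_self)
    also have "\<dots> = (2 * h1 (x \<bullet> x))\<^sup>2 * (\<Sum>b\<in>Basis. (x \<bullet> b) * (x \<bullet> b))"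
      unfolding sum_distrib_left by (intro sum.cong refl) (simp add: power2_eq_square)
    also have "(\<Sum>b\<in>Basis. (x \<bullet> b) * (x \<bullet> b)) = (norm x)\<^sup>2"
      by (simp add: euclidean_inner[symmetric] power2_norm_eq_inner)
    finally show ?thesis by (simp add: power2_norm_eq_inner[symmetric] power_mult_distrib)
  qed
  ultimately show "(\<integral>\<^sup>+x. ennreal (cutoff R W (norm x) * (norm (x::'a) ^ 0 * h ((norm x)\<^sup>2))\<^sup>2) \<partial>lborel)
      \<le> (\<integral>\<^sup>+x. ennreal (cutoff R V (norm x) * (real 0 * norm (x::'a) ^ (0 - 1) * h ((norm x)\<^sup>2) + 2 * norm x ^ (0 + 1) * h1 ((norm x)\<^sup>2))\<^sup>2) \<partial>lborel)"
    by (simp add: u_def power2_norm_eq_inner)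
qed

end

section \<open>The Hardy--Rellich inequality\<close>

text \<open>The class in which two factors compensate the weight V / r^4. It contains the images of
  smooth functions of bounded support under \<open>euler\<close>, \<open>rot\<close>,
  \<open>rad_lap\<close> and \<open>sph_lap\<close>.\<close>

definition vanishing :: "real \<Rightarrow> ('a::euclidean_space \<Rightarrow> real) \<Rightarrow> bool" where
  "vanishing \<rho> F \<longleftrightarrow> smooth F \<and> supp_in \<rho> F \<and> (\<exists>C\<ge>0. \<forall>x. \<bar>F x\<bar> \<le> C * norm x)"

lemma vanishing_smooth: "vanishing \<rho> F \<Longrightarrow> smooth F" and vanishing_supp: "vanishing \<rho> F \<Longrightarrow> supp_in \<rho> F"
  by (auto simp: vanishing_def)

lemma vanishing_euler: "smooth F \<Longrightarrow> supp_in \<rho> F \<Longrightarrow> vanishing \<rho> (euler F)"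
  unfolding vanishing_def using euler_bound[of F \<rho>] smooth_euler[of F] supp_in_euler[of \<rho> F] by metis

lemma vanishing_rot: "smooth F \<Longrightarrow> supp_in \<rho> F \<Longrightarrow> b \<in> Basis \<Longrightarrow> c \<in> Basis \<Longrightarrow> vanishing \<rho> (rot b c F)"
  unfolding vanishing_def using rot_bound[of F \<rho> b c] smooth_rot[of F b c] supp_in_rot[of \<rho> F b c] by metis

lemma vanishing_add:
  assumes "vanishing \<rho> F" "vanishing \<rho> G"
  shows "vanishing \<rho> (\<lambda>x. F x + G x)"
proof -
  obtain C D where C: "C \<ge> 0" "\<And>x. \<bar>F x\<bar> \<le> C * norm x" and D: "D \<ge> 0" "\<And>x. \<bar>G x\<bar> \<le> D * norm x"
    using assms by (auto simp: vanishing_def)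
  have "\<bar>F x + G x\<bar> \<le> (C + D) * norm x" for x
    using C(2)[of x] D(2)[of x] abs_triangle_ineq[of "F x" "G x"] by (simp add: distrib_right)
  moreover have "smooth (\<lambda>x. F x + G x)" "supp_in \<rho> (\<lambda>x. F x + G x)"
    using assms by (auto simp: vanishing_def supp_in_def intro: smooth_add)
  ultimately show ?thesis unfolding vanishing_def using C D by (intro conjI exI[of _ "C + D"]) auto
qed

lemma vanishing_cmult:
  assumes "vanishing \<rho> F"
  shows "vanishing \<rho> (\<lambda>x. k * F x)"
proof -
  obtain C where C: "C \<ge> 0" "\<And>x. \<bar>F x\<bar> \<le> C * norm x" using assms by (auto simp: vanishing_def)
  have "\<bar>k * F x\<bar> \<le> (\<bar>k\<bar> * C) * norm x" for x
    using mult_left_mono[OF C(2)[of x], of "\<bar>k\<bar>"] by (simp add: abs_mult mult.assoc)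
  moreover have "smooth (\<lambda>x. k * F x)" "supp_in \<rho> (\<lambda>x. k * F x)"
    using assms by (auto simp: vanishing_def supp_in_def intro: smooth_mult)
  ultimately show ?thesis unfolding vanishing_def using C by (intro conjI exI[of _ "\<bar>k\<bar> * C"]) auto
qed

lemma vanishing_zero: "vanishing \<rho> (\<lambda>x. 0)"
  by (auto simp: vanishing_def supp_in_def intro: exI[of _ 0])

lemma vanishing_sum: "(\<And>i. i \<in> I \<Longrightarrow> vanishing \<rho> (f i)) \<Longrightarrow> vanishing \<rho> (\<lambda>x. \<Sum>i\<in>I. f i x)"
  by (induction I rule: infinite_finite_induct) (auto intro: vanishing_add vanishing_zero)

lemma vanishing_rad_lap: "smooth u \<Longrightarrow> supp_in \<rho> u \<Longrightarrow> vanishing \<rho> (rad_lap u)"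
  unfolding rad_lap_def[abs_def]
  by (intro vanishing_add vanishing_cmult vanishing_euler smooth_euler supp_in_euler)

lemma vanishing_sph_lap:
  assumes "smooth u" "supp_in \<rho> u"
  shows "vanishing \<rho> (sph_lap u)"
proof -
  have "vanishing \<rho> (\<lambda>x. (1 / 2) * (\<Sum>b\<in>Basis. \<Sum>c\<in>Basis. rot b c (rot b c u) x))"
    using assms by (intro vanishing_cmult vanishing_sum vanishing_rot smooth_rot supp_in_rot)
  then show ?thesis by (simp add: sph_lap_def[abs_def])
qed

lemma integral_radial_measure:
  fixes f :: "real \<Rightarrow> real"
  assumes [measurable]: "f \<in> borel_measurable borel"
  shows "(\<integral>r. f r \<partial>radial_measure n) = (\<integral>r. indicator {0<..} r * r ^ (n - 1) * f r \<partial>lborel)"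
proof -
  have "radial_measure n = density lborel (\<lambda>r. ennreal (indicator {0<..} r * r ^ (n - 1)))"
    unfolding radial_measure_def by (rule arg_cong[where f = "density lborel"]) (auto simp: fun_eq_iff indicator_def)
  then show ?thesis
    by (simp add: integral_density indicator_def)
qed

context weight_pair
begin

lemma radial_cutoff_integrable:
  assumes dim: "DIM('a::euclidean_space) = n" and [measurable]: "cutoff R f \<in> borel_measurable borel"
    and f0: "\<And>r. r \<in> {0<..<R} \<Longrightarrow> f r \<ge> 0" and fin: "(\<integral>\<^sup>+r\<in>{0<..<R}. ennreal (r ^ (n - 1) * f r) \<partial>lborel) < \<infinity>"
  shows "integrable lborel (\<lambda>x::'a. cutoff R f (norm x))"
proof (rule integrableI_nonneg)
  show "AE x::'a in lborel. 0 \<le> cutoff R f (norm x)" using f0 by (auto simp: cutoff_def)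
  have "(\<integral>\<^sup>+x. ennreal (cutoff R f (norm (x::'a))) \<partial>lborel)
    = emeasure (polar_measure :: 'a measure) UNIV * (\<integral>\<^sup>+r. ennreal (r ^ (n - 1)) * ennreal (cutoff R f r) * indicator {0<..} r \<partial>lborel)"
    unfolding dim[symmetric] by (rule nn_integral_radial_fun[of "\<lambda>r. ennreal (cutoff R f r)"]) simp
  also have "(\<integral>\<^sup>+r. ennreal (r ^ (n - 1)) * ennreal (cutoff R f r) * indicator {0<..} r \<partial>lborel) = (\<integral>\<^sup>+r\<in>{0<..<R}. ennreal (r ^ (n - 1) * f r) \<partial>lborel)"
  proof (rule nn_integral_cong)
    fix r :: real
    show "ennreal (r ^ (n - 1)) * ennreal (cutoff R f r) * indicator {0<..} r = ennreal (r ^ (n - 1) * f r) * indicator {0<..<R} r"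
      by (cases "0 < r"; cases "r < R") (auto simp: cutoff_def ennreal_mult'[symmetric])
  qed
  also have "emeasure (polar_measure :: 'a measure) UNIV * \<dots> < \<infinity>"
    using fin finite_measure.emeasure_finite[OF finite_polar_measure[where 'a='a], of UNIV]
    by (auto simp: ennreal_mult_less_top top.not_eq_extremum)
  finally show "(\<integral>\<^sup>+x. ennreal (cutoff R f (norm (x::'a))) \<partial>lborel) < \<infinity>" .
qed measurable

lemma V_integrable:
  assumes "DIM('a::euclidean_space) = n"
  shows "integrable lborel (\<lambda>x::'a. cutoff R V (norm x))"
  using V_fin V_pos by (intro radial_cutoff_integrable[OF assms]) (auto simp: less_imp_le)

end

text \<open>The two facts for which the growth condition in (b) is used: V / |x|^2 is integrable
  over the ball, and the boundary weight r^(n - 2) V of an integration by parts tends to 0.\<close>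

locale rellich_pair = weight_pair +
  assumes J: "set_integrable lborel {0<..<R} (\<lambda>r. r ^ (n - 1) * V r / r\<^sup>2)"
    and lim0: "((\<lambda>r. r ^ (n - 1) * V r / r) \<longlongrightarrow> 0) (at_right 0)"
begin

lemma V_inverse_square_integrable:
  assumes dim: "DIM('a::euclidean_space) = n"
  shows "integrable lborel (\<lambda>x::'a. cutoff R V (norm x) / (norm x)\<^sup>2)"
proof -
  have e: "cutoff R (\<lambda>r. V r / r\<^sup>2) r = cutoff R V r / r\<^sup>2" for r by (simp add: cutoff_def)
  have m: "cutoff R (\<lambda>r. V r / r\<^sup>2) \<in> borel_measurable borel"
    by (intro cutoff_measurable continuous_intros V_cont) auto
  have "integrable lborel (\<lambda>x::'a. cutoff R (\<lambda>r. V r / r\<^sup>2) (norm x))"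
  proof (rule radial_cutoff_integrable[OF dim m])
    show "V r / r\<^sup>2 \<ge> 0" if "r \<in> {0<..<R}" for r using V_pos[OF that] by simp
    have "(\<integral>\<^sup>+r\<in>{0<..<R}. ennreal (r ^ (n - 1) * (V r / r\<^sup>2)) \<partial>lborel) \<le> (\<integral>\<^sup>+r. ennreal (norm (indicator {0<..<R} r *\<^sub>R (r ^ (n - 1) * V r / r\<^sup>2))) \<partial>lborel)"
      by (intro nn_integral_mono) (auto simp: indicator_def intro!: ennreal_leI divide_right_mono)
    also have "\<dots> < \<infinity>" using J unfolding set_integrable_def integrable_iff_bounded by blast
    finally show "(\<integral>\<^sup>+r\<in>{0<..<R}. ennreal (r ^ (n - 1) * (V r / r\<^sup>2)) \<partial>lborel) < \<infinity>" .
  qed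
  then show ?thesis by (simp add: e)
qed

text \<open>The fourth power appears because \<open>euler (euler u) x - euler u x\<close> and the
  other second-order quantities carry a factor r^2 and enter quadratically.\<close>

definition wt :: "real \<Rightarrow> real" where
  "wt r = cutoff R V r / r ^ 4"

lemma wt_measurable [measurable]: "wt \<in> borel_measurable borel"
  unfolding wt_def[abs_def] by measurable

lemma wt_nonneg: "wt r \<ge> 0"
  using cutoff_V_nonneg[of r] by (simp add: wt_def)

lemma wt_integrable:
  fixes F G :: "'a::euclidean_space \<Rightarrow> real"
  assumes dim: "DIM('a) = n" and F: "vanishing \<rho> F" and G: "vanishing \<rho> G"
  shows "integrable lborel (\<lambda>x. wt (norm x) * (F x * G x))"
proof -
  obtain C D where C: "C \<ge> 0" "\<And>x. \<bar>F x\<bar> \<le> C * norm x" and D: "D \<ge> 0" "\<And>x. \<bar>G x\<bar> \<le> D * norm x"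
    using F G by (auto simp: vanishing_def)
  have [measurable]: "F \<in> borel_measurable borel" "G \<in> borel_measurable borel"
    using F G by (auto intro: smooth_measurable vanishing_smooth)
  have "integrable lborel (\<lambda>x::'a. (C * D) * (cutoff R V (norm x) / (norm x)\<^sup>2))"
    by (intro integrable_mult_right V_inverse_square_integrable dim)
  then show ?thesis
  proof (rule Bochner_Integration.integrable_bound)
    show "AE x in lborel. norm (wt (norm x) * (F x * G x)) \<le> norm ((C * D) * (cutoff R V (norm x) / (norm x)\<^sup>2))"
    proof (intro AE_I2)
      fix x :: 'a
      show "norm (wt (norm x) * (F x * G x)) \<le> norm ((C * D) * (cutoff R V (norm x) / (norm x)\<^sup>2))"
      proof (cases "x = 0")
        case False
        have "\<bar>F x\<bar> * \<bar>G x\<bar> \<le> (C * norm x) * (D * norm x)" using C D by (intro mult_mono) auto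
        then have "wt (norm x) * (\<bar>F x\<bar> * \<bar>G x\<bar>) \<le> wt (norm x) * ((C * norm x) * (D * norm x))"
          using wt_nonneg by (intro mult_left_mono) auto
        also have "\<dots> = (C * D) * (cutoff R V (norm x) / (norm x)\<^sup>2)"
          using False by (simp add: wt_def field_simps eval_nat_numeral)
        finally show ?thesis
          using wt_nonneg[of "norm x"] cutoff_V_nonneg[of "norm x"] C D by (simp add: abs_mult)
      qed (simp add: wt_def cutoff_def)
    qed
  qed simp
qed

text \<open>\<open>wt\<close> alone need not be integrable at the origin.\<close>

definition wtc :: "real \<Rightarrow> real \<Rightarrow> real" where
  "wtc \<epsilon> r = (if \<epsilon> < r then wt r else 0)"

lemma wtc_measurable [measurable]: "wtc \<epsilon> \<in> borel_measurable borel"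
  unfolding wtc_def[abs_def] by measurable

lemma wtc_nonneg: "wtc \<epsilon> r \<ge> 0"
  using wt_nonneg by (simp add: wtc_def)

text \<open>Away from the origin every negative power of |x| is bounded. The powers 4 and 8 come
  from \<open>wt\<close> and from the further |x|^(-4) demanded by
  \<open>sphere_gap\<close>.\<close>

lemma wtc_integrable:
  assumes dim: "DIM('a::euclidean_space) = n" and \<epsilon>: "\<epsilon> > 0"
  shows "integrable lborel (\<lambda>x::'a. wtc \<epsilon> (norm x))" "integrable lborel (\<lambda>x::'a. wtc \<epsilon> (norm x) / norm x ^ 4)"
proof -
  have "integrable lborel (\<lambda>x::'a. (1 / \<epsilon> ^ k) * cutoff R V (norm x))" for k :: nat
    using V_integrable[OF dim] by simp
  note i = this
  have b: "cutoff R V r / r ^ k \<le> (1 / \<epsilon> ^ k) * cutoff R V r" if "r > \<epsilon>" for k :: nat and r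
  proof -
    have "\<epsilon> ^ k \<le> r ^ k" using \<epsilon> that by (intro power_mono) auto
    then have "cutoff R V r / r ^ k \<le> cutoff R V r / \<epsilon> ^ k"
      using \<epsilon> that cutoff_V_nonneg by (intro divide_left_mono) auto
    then show ?thesis by simp
  qed
  show "integrable lborel (\<lambda>x::'a. wtc \<epsilon> (norm x))"
  proof (rule Bochner_Integration.integrable_bound[OF i[of 4]])
    show "AE x::'a in lborel. norm (wtc \<epsilon> (norm x)) \<le> norm ((1 / \<epsilon> ^ 4) * cutoff R V (norm x))"
    proof (intro AE_I2)
      fix x :: 'a
      show "norm (wtc \<epsilon> (norm x)) \<le> norm ((1 / \<epsilon> ^ 4) * cutoff R V (norm x))"
        using b[of "norm x" 4] wt_nonneg[of "norm x"] cutoff_V_nonneg[of "norm x"] \<epsilon>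
        by (auto simp: wtc_def wt_def)
    qed
  qed measurable
  show "integrable lborel (\<lambda>x::'a. wtc \<epsilon> (norm x) / norm x ^ 4)"
  proof (rule Bochner_Integration.integrable_bound[OF i[of 8]])
    show "AE x::'a in lborel. norm (wtc \<epsilon> (norm x) / norm x ^ 4) \<le> norm ((1 / \<epsilon> ^ 8) * cutoff R V (norm x))"
    proof (intro AE_I2)
      fix x :: 'a
      have "cutoff R V (norm x) / norm x ^ 4 / norm x ^ 4 = cutoff R V (norm x) / norm x ^ 8"
        by (simp flip: power_add)
      then show "norm (wtc \<epsilon> (norm x) / norm x ^ 4) \<le> norm ((1 / \<epsilon> ^ 8) * cutoff R V (norm x))"
        using b[of "norm x" 8] cutoff_V_nonneg[of "norm x"] \<epsilon> by (auto simp: wtc_def wt_def)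
    qed
  qed measurable
qed

lemma wtc_tendsto:
  fixes H :: "'a::euclidean_space \<Rightarrow> real"
  assumes i: "integrable lborel (\<lambda>x. wt (norm x) * H x)" and [measurable]: "H \<in> borel_measurable borel"
  shows "(\<lambda>k. \<integral>x. wtc (1 / real (Suc k)) (norm x) * H x \<partial>lborel) \<longlonglongrightarrow> (\<integral>x. wt (norm x) * H x \<partial>lborel)"
proof (rule integral_dominated_convergence[where w = "\<lambda>x. norm (wt (norm x) * H x)"])
  show "integrable lborel (\<lambda>x. norm (wt (norm x) * H x))" by (rule integrable_norm[OF i])
  show "AE x in lborel. (\<lambda>k. wtc (1 / real (Suc k)) (norm x) * H x) \<longlonglongrightarrow> wt (norm x) * H x"
  proof (intro AE_I2)
    fix x :: 'a
    show "(\<lambda>k. wtc (1 / real (Suc k)) (norm x) * H x) \<longlonglongrightarrow> wt (norm x) * H x"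
    proof (cases "x = 0")
      case True
      then show ?thesis by (simp add: wtc_def wt_def cutoff_def)
    next
      case False
      have "(\<lambda>k. 1 / real (Suc k)) \<longlonglongrightarrow> 0"
        using LIMSEQ_inverse_real_of_nat by (simp add: inverse_eq_divide)
      then have "\<forall>\<^sub>F k in sequentially. 1 / real (Suc k) < norm x"
        using False by (intro order_tendstoD(2)) auto
      then have "\<forall>\<^sub>F k in sequentially. wtc (1 / real (Suc k)) (norm x) * H x = wt (norm x) * H x"
        by eventually_elim (simp add: wtc_def)
      then show ?thesis by (rule tendsto_eventually)
    qed
  qed
  show "AE x in lborel. norm (wtc (1 / real (Suc k)) (norm x) * H x) \<le> norm (wt (norm x) * H x)" for k
    by (intro AE_I2) (auto simp: wtc_def)
qed measurable

text \<open>The cutoff of the weight at a small radius is radial and invisible to rotations, so no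
  boundary term arises there and the radius can be sent to 0.\<close>

lemma rot_by_parts:
  fixes F G :: "'a::euclidean_space \<Rightarrow> real"
  assumes dim: "DIM('a) = n" and F: "vanishing \<rho> F" and G: "vanishing \<rho> G" and bc: "b \<in> Basis" "c \<in> Basis"
  shows "(\<integral>x. wt (norm x) * (rot b c F x * G x) \<partial>lborel) = - (\<integral>x. wt (norm x) * (F x * rot b c G x) \<partial>lborel)"
proof (rule LIMSEQ_unique)
  note v = vanishing_smooth[OF F] vanishing_supp[OF F] vanishing_smooth[OF G] vanishing_supp[OF G]
  have rF: "vanishing \<rho> (rot b c F)" and rG: "vanishing \<rho> (rot b c G)"
    using v bc by (auto intro: vanishing_rot)
  show "(\<lambda>k. \<integral>x. wtc (1 / real (Suc k)) (norm x) * (rot b c F x * G x) \<partial>lborel) \<longlonglongrightarrow> (\<integral>x. wt (norm x) * (rot b c F x * G x) \<partial>lborel)"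
    by (intro wtc_tendsto wt_integrable[OF dim rF G] smooth_measurable smooth_mult smooth_rot v bc)
  have "(\<lambda>k. \<integral>x. wtc (1 / real (Suc k)) (norm x) * (F x * rot b c G x) \<partial>lborel) \<longlonglongrightarrow> (\<integral>x. wt (norm x) * (F x * rot b c G x) \<partial>lborel)"
    by (intro wtc_tendsto wt_integrable[OF dim F rG] smooth_measurable smooth_mult smooth_rot v bc)
  from tendsto_minus[OF this]
  show "(\<lambda>k. \<integral>x. wtc (1 / real (Suc k)) (norm x) * (rot b c F x * G x) \<partial>lborel) \<longlonglongrightarrow> - (\<integral>x. wt (norm x) * (F x * rot b c G x) \<partial>lborel)"
    using integral_rot_by_parts[OF wtc_measurable wtc_integrable(1)[OF dim] v(1,2,3) bc] by simp
qed

lemma sph_lap_gap: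
  fixes u :: "'a::euclidean_space \<Rightarrow> real"
  assumes dim: "DIM('a) = n" and u: "smooth u" "supp_in \<rho> u"
  shows "(real n - 1) * (\<Sum>b\<in>Basis. \<Sum>c\<in>Basis. \<integral>x. wt (norm x) * (rot b c u x * rot b c u x) \<partial>lborel) / 2
     \<le> (\<integral>x. wt (norm x) * (sph_lap u x * sph_lap u x) \<partial>lborel)"
proof -
  let ?Q = "\<lambda>x. (\<Sum>b\<in>Basis. \<Sum>c\<in>Basis. (rot b c u x)\<^sup>2) / 2"
  have vr: "vanishing \<rho> (rot b c u)" if "b \<in> Basis" "c \<in> Basis" for b c
    using u that by (rule vanishing_rot)
  have ir: "integrable lborel (\<lambda>x. wt (norm x) * (rot b c u x * rot b c u x))" if "b \<in> Basis" "c \<in> Basis" for b c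
    by (rule wt_integrable[OF dim vr[OF that] vr[OF that]])
  have Qe: "wt (norm x) * ?Q x = (\<Sum>b\<in>Basis. \<Sum>c\<in>Basis. wt (norm x) * (rot b c u x * rot b c u x)) / 2" for x
    by (simp add: sum_distrib_left power2_eq_square)
  have Qi: "integrable lborel (\<lambda>x. wt (norm x) * ?Q x)" unfolding Qe using ir by simp
  have Qs: "(\<integral>x. wt (norm x) * ?Q x \<partial>lborel) = (\<Sum>b\<in>Basis. \<Sum>c\<in>Basis. \<integral>x. wt (norm x) * (rot b c u x * rot b c u x) \<partial>lborel) / 2"
    unfolding Qe using ir by (simp add: Bochner_Integration.integral_sum)
  have Qm: "?Q \<in> borel_measurable borel"
    by (intro borel_measurable_divide borel_measurable_sum borel_measurable_power smooth_measurable smooth_rot u borel_measurable_const) auto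
  have vs: "vanishing \<rho> (sph_lap u)" using u by (rule vanishing_sph_lap)
  have l1: "(\<lambda>k. \<integral>x. wtc (1 / real (Suc k)) (norm x) * (sph_lap u x)\<^sup>2 \<partial>lborel) \<longlonglongrightarrow> (\<integral>x. wt (norm x) * (sph_lap u x)\<^sup>2 \<partial>lborel)"
    unfolding power2_eq_square
    by (intro wtc_tendsto wt_integrable[OF dim vs vs] smooth_measurable smooth_mult vanishing_smooth[OF vs])
  have l2: "(\<lambda>k. (real n - 1) * (\<integral>x. wtc (1 / real (Suc k)) (norm x) * ?Q x \<partial>lborel)) \<longlonglongrightarrow> (real n - 1) * (\<integral>x. wt (norm x) * ?Q x \<partial>lborel)"
    by (intro tendsto_intros wtc_tendsto Qi Qm)
  have "(real n - 1) * (\<integral>x. wtc (1 / real (Suc k)) (norm x) * ?Q x \<partial>lborel) \<le> (\<integral>x. wtc (1 / real (Suc k)) (norm x) * (sph_lap u x)\<^sup>2 \<partial>lborel)" for k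
    unfolding dim[symmetric]
    by (rule sphere_gap[OF wtc_measurable wtc_nonneg wtc_integrable(1)[OF dim] wtc_integrable(2)[OF dim] u]) auto
  then have "(real n - 1) * (\<integral>x. wt (norm x) * ?Q x \<partial>lborel) \<le> (\<integral>x. wt (norm x) * (sph_lap u x)\<^sup>2 \<partial>lborel)"
    by (intro LIMSEQ_le[OF l2 l1]) auto
  then show ?thesis unfolding Qs power2_eq_square[of "sph_lap u _"] by simp
qed

section \<open>The gradient term without the derivative of V\<close>

definition grad_sq :: "('a::euclidean_space \<Rightarrow> real) \<Rightarrow> 'a \<Rightarrow> real" where
  "grad_sq u x = (\<Sum>b\<in>Basis. partial b u x * partial b u x)"

lemma grad_sq: "(norm (grad u x))\<^sup>2 = grad_sq u x"
  by (simp only: norm_grad_sq grad_sq_def) (simp only: power2_eq_square)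

lemma smooth_grad_sq: "smooth u \<Longrightarrow> smooth (grad_sq u)"
  unfolding grad_sq_def[abs_def] by (intro smooth_sum smooth_mult smooth_partial)

lemma supp_in_grad_sq: "supp_in \<rho> u \<Longrightarrow> supp_in \<rho> (grad_sq u)"
  using supp_in_partial[of \<rho> u] by (auto simp: supp_in_def grad_sq_def intro!: sum.neutral)

text \<open>Integrating \<open>(r\<^sup>n\<^sup>-\<^sup>2 V |\<nabla>u|\<^sup>2)'\<close> along the rays removes the derivative of \<open>V\<close>; what remains converges
  absolutely.\<close>

lemma improper_gradient_integral:
  fixes u :: "'a::euclidean_space \<Rightarrow> real"
  assumes dim: "DIM('a) = n" and u: "smooth u" "supp_in \<rho> u" and \<rho>: "0 < \<rho>" "\<rho> < R"
  defines "H \<equiv> \<lambda>x. cutoff R V (norm x) / (norm x)\<^sup>2 * ((real n - 1) * grad_sq u x + euler (grad_sq u) x)"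
  shows "integrable lborel H"
    and "has_improper_integral (\<lambda>x. (V (norm x) / (norm x)\<^sup>2 - deriv V (norm x) / norm x) * (norm (grad u x))\<^sup>2)
       (\<integral>x. H x \<partial>lborel) (ball 0 R)"
proof -
  define G where "G = grad_sq u"
  have G: "smooth G" "supp_in \<rho> G" using u by (auto simp: G_def intro: smooth_grad_sq supp_in_grad_sq)
  have E: "smooth (euler G)" "supp_in \<rho> (euler G)" using G by (auto intro: smooth_euler supp_in_euler)
  have Hs: "smooth (\<lambda>x. (real n - 1) * G x + euler G x)" "supp_in \<rho> (\<lambda>x. (real n - 1) * G x + euler G x)"
    using G E by (auto intro!: smooth_intros simp: supp_in_def)
  have [measurable]: "G \<in> borel_measurable borel" "euler G \<in> borel_measurable borel"
    by (intro smooth_measurable G E)+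
  obtain Cg where Cg: "Cg \<ge> 0" "\<And>x. \<bar>G x\<bar> \<le> Cg" using smooth_supp_bounded[OF G] by blast
  have Vm: "(\<lambda>x::'a. cutoff R V (norm x) / (norm x)\<^sup>2) \<in> borel_measurable borel" by measurable
  have Hm [measurable]: "H \<in> borel_measurable borel"
    unfolding H_def G_def[symmetric] by measurable
  show Hi: "integrable lborel H"
  proof -
    obtain D where D: "\<And>x. \<bar>(real n - 1) * G x + euler G x\<bar> \<le> D" using smooth_supp_bounded[OF Hs] by blast
    have "integrable lborel (\<lambda>x::'a. D * (cutoff R V (norm x) / (norm x)\<^sup>2))"
      by (intro integrable_mult_right V_inverse_square_integrable dim)
    then show ?thesis
    proof (rule Bochner_Integration.integrable_bound)
      show "AE x in lborel. norm (H x) \<le> norm (D * (cutoff R V (norm x) / (norm x)\<^sup>2))"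
      proof (intro AE_I2)
        fix x :: 'a
        have "\<bar>cutoff R V (norm x) / (norm x)\<^sup>2\<bar> * \<bar>(real n - 1) * G x + euler G x\<bar> \<le> \<bar>cutoff R V (norm x) / (norm x)\<^sup>2\<bar> * \<bar>D\<bar>"
          using D[of x] by (intro mult_left_mono) auto
        then show "norm (H x) \<le> norm (D * (cutoff R V (norm x) / (norm x)\<^sup>2))"
          by (simp only: H_def G_def real_norm_def abs_mult mult.commute)
      qed
    qed simp
  qed
  define f where "f x = (V (norm x) / (norm x)\<^sup>2 - deriv V (norm x) / norm x) * (norm (grad u x))\<^sup>2" for x :: 'a
  define S where "S \<epsilon> = ball (0::'a) R - cball 0 \<epsilon>" for \<epsilon>
  define \<rho>' where "\<rho>' = (\<rho> + R) / 2"
  have \<rho>': "\<rho> < \<rho>'" "\<rho>' < R" "0 < \<rho>'" using \<rho> by (auto simp: \<rho>'_def)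
  \<comment> \<open>The integrand outside the ball of radius \<open>\<epsilon>\<close>, written with
    the extended profiles so that it is measurable on the whole space.\<close>
  define Fe where "Fe \<epsilon> x = indicator (S \<epsilon>) x * ((cutoff R V (norm x) / (norm x)\<^sup>2 - cutoff R (deriv V) (norm x) / norm x) * G x)" for \<epsilon> x
  have Sm [measurable]: "S \<epsilon> \<in> sets borel" for \<epsilon> by (auto simp: S_def)
  have Fm [measurable]: "Fe \<epsilon> \<in> borel_measurable borel" for \<epsilon> unfolding Fe_def by measurable
  have fF: "indicator (S \<epsilon>) x *\<^sub>R f x = Fe \<epsilon> x" if "\<epsilon> > 0" for \<epsilon> x
    using that by (auto simp: f_def Fe_def S_def indicator_def cutoff_def grad_sq G_def)
  have Fi: "integrable lborel (Fe \<epsilon>)" if \<epsilon>: "\<epsilon> > 0" for \<epsilon>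
  proof -
    have sub: "{\<epsilon>..\<rho>'} \<subseteq> {0<..<R}" using \<epsilon> \<rho>' by auto
    have "continuous_on {\<epsilon>..\<rho>'} (\<lambda>r. V r / r\<^sup>2 - deriv V r / r)"
      using \<epsilon> by (intro continuous_intros continuous_on_subset[OF V_cont sub] continuous_on_subset[OF dV_cont sub]) auto
    then have "bounded ((\<lambda>r. V r / r\<^sup>2 - deriv V r / r) ` {\<epsilon>..\<rho>'})"
      by (intro compact_imp_bounded compact_continuous_image) auto
    then obtain K where K: "\<And>y. y \<in> (\<lambda>r. V r / r\<^sup>2 - deriv V r / r) ` {\<epsilon>..\<rho>'} \<Longrightarrow> norm y \<le> K"
      unfolding bounded_iff by blast
    have "integrable lborel (\<lambda>x::'a. indicator (ball 0 R) x * (\<bar>K\<bar> * Cg))"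
      using emeasure_lborel_ball_finite[of "0::'a" R] by (intro integrable_mult_left) auto
    then show ?thesis
    proof (rule Bochner_Integration.integrable_bound)
      show "AE x in lborel. norm (Fe \<epsilon> x) \<le> norm (indicator (ball 0 R) x * (\<bar>K\<bar> * Cg))"
      proof (intro AE_I2)
        fix x :: 'a
        show "norm (Fe \<epsilon> x) \<le> norm (indicator (ball 0 R) x * (\<bar>K\<bar> * Cg))"
        proof (cases "\<epsilon> < norm x \<and> norm x \<le> \<rho>'")
          case True
          then have "\<bar>V (norm x) / (norm x)\<^sup>2 - deriv V (norm x) / norm x\<bar> \<le> \<bar>K\<bar>"
            using K[OF imageI, of "norm x"] by auto
          then have "\<bar>V (norm x) / (norm x)\<^sup>2 - deriv V (norm x) / norm x\<bar> * \<bar>G x\<bar> \<le> \<bar>K\<bar> * Cg"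
            using Cg by (intro mult_mono) auto
          then show ?thesis using True \<epsilon> \<rho>' Cg by (simp add: Fe_def S_def cutoff_def abs_mult)
        next
          case False
          then have "x \<notin> S \<epsilon> \<or> G x = 0" using G(2) \<rho>' by (auto simp: S_def supp_in_def)
          then show ?thesis by (auto simp: Fe_def)
        qed
      qed
    qed simp
  qed
  define He where "He \<epsilon> x = indicator (- cball 0 \<epsilon>) x * H x" for \<epsilon> x
  have Hei: "integrable lborel (He \<epsilon>)" for \<epsilon>
  proof -
    have "- cball (0::'a) \<epsilon> \<in> sets lborel" by auto
    from integrable_mult_indicator[OF this Hi] show ?thesis by (simp add: He_def[abs_def])
  qed
  \<comment> \<open>Outside the small ball, \<open>k \<epsilon>\<close> along a ray, multiplied by
    r^(n - 1), is minus the derivative of r^(n - 2) V |grad u|^2, so it integrates to the boundary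
    value at \<open>\<epsilon>\<close>.\<close>
  define k where "k \<epsilon> x = Fe \<epsilon> x - He \<epsilon> x" for \<epsilon> x
  have ki: "integrable lborel (k \<epsilon>)" if "\<epsilon> > 0" for \<epsilon>
    unfolding k_def[abs_def] using Fi[OF that] Hei by (rule Bochner_Integration.integrable_diff)
  have ray: "(\<integral>r. k \<epsilon> (r *\<^sub>R \<theta>) \<partial>radial_measure n) = \<epsilon> ^ (n - 1) * V \<epsilon> / \<epsilon> * G (\<epsilon> *\<^sub>R \<theta>)"
    if \<epsilon>: "0 < \<epsilon>" "\<epsilon> < \<rho>" and \<theta>: "norm \<theta> = 1" for \<epsilon> and \<theta> :: 'a
  proof -
    have "\<theta> \<noteq> 0" using \<theta> by auto
    define \<Phi> where "\<Phi> r = r ^ (n - 1) * 1 * (V r / r * G (r *\<^sub>R \<theta>))" for r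
    define \<Phi>1 where "\<Phi>1 r = r ^ (n - 1) * ((deriv V r / r + (real n - 2) * V r / r\<^sup>2) * G (r *\<^sub>R \<theta>) + V r / r\<^sup>2 * euler G (r *\<^sub>R \<theta>))" for r
    have km [measurable]: "k \<epsilon> \<in> borel_measurable borel" using ki[OF \<epsilon>(1)] borel_measurable_integrable by force
    have "(\<integral>r. k \<epsilon> (r *\<^sub>R \<theta>) \<partial>radial_measure n) = (\<integral>r. indicator {0<..} r * r ^ (n - 1) * k \<epsilon> (r *\<^sub>R \<theta>) \<partial>lborel)"
      by (rule integral_radial_measure) measurable
    also have "\<dots> = (\<integral>r. - (indicator {\<epsilon>..\<rho>'} r *\<^sub>R \<Phi>1 r) \<partial>lborel)"
    proof (rule integral_cong_AE)
      show "(\<lambda>r. - (indicator {\<epsilon>..\<rho>'} r *\<^sub>R \<Phi>1 r)) \<in> borel_measurable lborel"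
      proof -
        have sub: "{\<epsilon>..\<rho>'} \<subseteq> {0<..<R}" using \<epsilon> \<rho>' by auto
        have "continuous_on {\<epsilon>..\<rho>'} \<Phi>1"
          unfolding \<Phi>1_def using \<epsilon>
          by (intro continuous_intros continuous_on_subset[OF V_cont sub] continuous_on_subset[OF dV_cont sub]
              ray_continuous smooth_continuous_on G E) auto
        then have "(\<lambda>r. indicator {\<epsilon>..\<rho>'} r *\<^sub>R \<Phi>1 r) \<in> borel_measurable borel"
          by (intro borel_measurable_continuous_on_indicator) auto
        then show ?thesis by simp
      qed
      show "AE r in lborel. indicator {0<..} r * r ^ (n - 1) * k \<epsilon> (r *\<^sub>R \<theta>) = - (indicator {\<epsilon>..\<rho>'} r *\<^sub>R \<Phi>1 r)"
        using AE_lborel_singleton[of \<epsilon>]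
      proof eventually_elim
        case (elim r)
        consider "r < \<epsilon>" | "\<epsilon> < r" "r \<le> \<rho>'" | "r > \<rho>'" using elim by linarith
        then show ?case
        proof cases
          case 1
          have "k \<epsilon> (r *\<^sub>R \<theta>) = 0" if "r > 0" using that 1 \<theta> by (simp add: k_def Fe_def He_def S_def)
          then show ?thesis using 1 by (cases "r > 0") auto
        next
          case 2
          then have r: "0 < r" "r < R" using \<epsilon> \<rho>' by auto
          have "k \<epsilon> (r *\<^sub>R \<theta>) = (V r / r\<^sup>2 - deriv V r / r) * G (r *\<^sub>R \<theta>) - V r / r\<^sup>2 * ((real n - 1) * G (r *\<^sub>R \<theta>) + euler G (r *\<^sub>R \<theta>))"
            using 2 r \<theta> \<open>\<theta> \<noteq> 0\<close> by (simp add: k_def Fe_def He_def S_def H_def G_def[symmetric] cutoff_def)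
          then have "r ^ (n - 1) * k \<epsilon> (r *\<^sub>R \<theta>) = - \<Phi>1 r"
          proof -
            assume e: "k \<epsilon> (r *\<^sub>R \<theta>) = (V r / r\<^sup>2 - deriv V r / r) * G (r *\<^sub>R \<theta>) - V r / r\<^sup>2 * ((real n - 1) * G (r *\<^sub>R \<theta>) + euler G (r *\<^sub>R \<theta>))"
            have gen: "(a - d) * g - a * ((m - 1) * g + z) = - ((d + (m - 2) * a) * g + a * z)" for a d g m z :: real
              by (simp add: algebra_simps)
            show ?thesis unfolding e gen \<Phi>1_def by (simp only: times_divide_eq_right mult_minus_right)
          qed
          then show ?thesis using 2 r by simp
        next
          case 3
          then have "r > 0" "norm (r *\<^sub>R \<theta>) > \<rho>" using \<theta> \<rho>' by auto
          then have "G (r *\<^sub>R \<theta>) = 0" "euler G (r *\<^sub>R \<theta>) = 0" using G(2) E(2) by (auto simp: supp_in_def)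
          then show ?thesis using 3 by (simp add: k_def Fe_def He_def H_def G_def[symmetric])
        qed
      qed
    qed measurable
    also have "\<dots> = - (\<integral>r. indicator {\<epsilon>..\<rho>'} r *\<^sub>R \<Phi>1 r \<partial>lborel)" by simp
    also have "(\<integral>r. indicator {\<epsilon>..\<rho>'} r *\<^sub>R \<Phi>1 r \<partial>lborel) = \<Phi> \<rho>' - \<Phi> \<epsilon>"
    proof (rule integral_FTC_atLeastAtMost)
      show "\<epsilon> \<le> \<rho>'" using \<epsilon> \<rho>' by simp
      have sub: "{\<epsilon>..\<rho>'} \<subseteq> {0<..<R}" using \<epsilon> \<rho>' by auto
      show "continuous_on {\<epsilon>..\<rho>'} \<Phi>1"
        unfolding \<Phi>1_def using \<epsilon>
        by (intro continuous_intros continuous_on_subset[OF V_cont sub] continuous_on_subset[OF dV_cont sub]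
            ray_continuous smooth_continuous_on G E) auto
      fix r assume "\<epsilon> \<le> r" "r \<le> \<rho>'"
      then have r: "r \<in> {0<..<R}" "r > 0" using \<epsilon> \<rho>' by auto
      have "((\<lambda>r. V r / r * G (r *\<^sub>R \<theta>)) has_real_derivative
          (deriv V r * r - V r * 1) / (r * r) * G (r *\<^sub>R \<theta>) + euler G (r *\<^sub>R \<theta>) / r * (V r / r)) (at r)"
        using r by (intro DERIV_mult DERIV_divide V_deriv DERIV_ident DERIV_along_ray G) auto
      from DERIV_weighted_flux[OF n r(2) DERIV_const[of 1] this]
      have "(\<Phi> has_real_derivative r ^ (n - 1) * 1 * ((deriv V r * r - V r * 1) / (r * r) * G (r *\<^sub>R \<theta>) + euler G (r *\<^sub>R \<theta>) / r * (V r / r)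
          + ((real n - 1) / r + 0 / 1) * (V r / r * G (r *\<^sub>R \<theta>)))) (at r)"
        unfolding \<Phi>_def[abs_def] by simp
      also have "r ^ (n - 1) * 1 * ((deriv V r * r - V r * 1) / (r * r) * G (r *\<^sub>R \<theta>) + euler G (r *\<^sub>R \<theta>) / r * (V r / r)
          + ((real n - 1) / r + 0 / 1) * (V r / r * G (r *\<^sub>R \<theta>))) = \<Phi>1 r"
        using r(2) by (simp add: \<Phi>1_def field_simps power2_eq_square)
      finally have "(\<Phi> has_real_derivative \<Phi>1 r) (at r within {\<epsilon>..\<rho>'})" by (rule has_field_derivative_at_within)
      then show "(\<Phi> has_vector_derivative \<Phi>1 r) (at r within {\<epsilon>..\<rho>'})"
        by (simp add: has_real_derivative_iff_has_vector_derivative)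
    qed
    also have "\<Phi> \<rho>' = 0"
    proof -
      have "norm (\<rho>' *\<^sub>R \<theta>) > \<rho>" using \<theta> \<rho>' by simp
      then show ?thesis using G(2) by (auto simp: \<Phi>_def supp_in_def)
    qed
    finally show ?thesis by (simp add: \<Phi>_def)
  qed
  let ?P = "measure (polar_measure :: 'a measure) UNIV"
  interpret P: finite_measure "polar_measure :: 'a measure" by (rule finite_polar_measure)
  have kb: "\<bar>\<integral>x. k \<epsilon> x \<partial>lborel\<bar> \<le> \<epsilon> ^ (n - 1) * V \<epsilon> / \<epsilon> * (Cg * ?P)" if \<epsilon>: "0 < \<epsilon>" "\<epsilon> < \<rho>" for \<epsilon>
  proof -
    have V\<epsilon>: "V \<epsilon> > 0" using \<epsilon> \<rho> by (intro V_pos) auto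
    note pol = integral_polar[OF ki[OF \<epsilon>(1)], unfolded dim]
    have "\<bar>\<integral>x. k \<epsilon> x \<partial>lborel\<bar> = norm (\<integral>y. \<integral>r. k \<epsilon> (r *\<^sub>R sgn y) \<partial>radial_measure n \<partial>(polar_measure :: 'a measure))"
      unfolding pol(2) by simp
    also have "\<dots> \<le> (\<integral>y. norm (\<integral>r. k \<epsilon> (r *\<^sub>R sgn y) \<partial>radial_measure n) \<partial>(polar_measure :: 'a measure))"
      by (rule integral_norm_bound)
    also have "\<dots> \<le> (\<integral>y. \<epsilon> ^ (n - 1) * V \<epsilon> / \<epsilon> * Cg \<partial>(polar_measure :: 'a measure))"
    proof (rule integral_mono_AE)
      show "integrable polar_measure (\<lambda>y::'a. norm (\<integral>r. k \<epsilon> (r *\<^sub>R sgn y) \<partial>radial_measure n))"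
        by (rule integrable_norm[OF pol(1)])
      show "AE y in (polar_measure :: 'a measure). norm (\<integral>r. k \<epsilon> (r *\<^sub>R sgn y) \<partial>radial_measure n) \<le> \<epsilon> ^ (n - 1) * V \<epsilon> / \<epsilon> * Cg"
        using AE_polar_nonzero
      proof eventually_elim
        case (elim y)
        have "(\<epsilon> ^ (n - 1) * V \<epsilon> / \<epsilon>) * \<bar>G (\<epsilon> *\<^sub>R sgn y)\<bar> \<le> (\<epsilon> ^ (n - 1) * V \<epsilon> / \<epsilon>) * Cg"
          using Cg(2) V\<epsilon> \<epsilon> by (intro mult_left_mono) auto
        then show ?case using ray[OF \<epsilon>, of "sgn y"] elim V\<epsilon> \<epsilon> by (simp add: norm_sgn abs_mult)
      qed
    qed simp
    also have "\<dots> = \<epsilon> ^ (n - 1) * V \<epsilon> / \<epsilon> * (Cg * ?P)" by (simp add: mult_ac)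
    finally show ?thesis .
  qed
  have split: "(LINT x:S \<epsilon>|lborel. f x) = (\<integral>x. He \<epsilon> x \<partial>lborel) + (\<integral>x. k \<epsilon> x \<partial>lborel)" if "\<epsilon> > 0" for \<epsilon>
  proof -
    have "(LINT x:S \<epsilon>|lborel. f x) = (\<integral>x. Fe \<epsilon> x \<partial>lborel)"
      unfolding set_lebesgue_integral_def using fF[OF that] by simp
    also have "\<dots> = (\<integral>x. He \<epsilon> x + k \<epsilon> x \<partial>lborel)" by (simp add: k_def)
    also have "\<dots> = (\<integral>x. He \<epsilon> x \<partial>lborel) + (\<integral>x. k \<epsilon> x \<partial>lborel)"
      by (rule Bochner_Integration.integral_add[OF Hei ki[OF that]])
    finally show ?thesis .
  qed
  have "((\<lambda>\<epsilon>. LINT x:S \<epsilon>|lborel. f x) \<longlongrightarrow> (\<integral>x. H x \<partial>lborel)) (at_right 0)"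
  proof (rule tendsto_at_right_sequentially[OF \<rho>(1)])
    fix e :: "nat \<Rightarrow> real"
    assume e: "\<And>j. 0 < e j" "\<And>j. e j < \<rho>" "decseq e" "e \<longlonglongrightarrow> 0"
    have er: "filterlim e (at_right 0) sequentially"
    proof -
      have "e j \<noteq> 0" for j using e(1)[of j] by simp
      then show ?thesis using e(4,1) by (auto simp: filterlim_at)
    qed
    have l1: "(\<lambda>j. \<integral>x. He (e j) x \<partial>lborel) \<longlonglongrightarrow> (\<integral>x. H x \<partial>lborel)"
    proof (rule integral_dominated_convergence[where w = "\<lambda>x. norm (H x)"])
      show "integrable lborel (\<lambda>x. norm (H x))" by (rule integrable_norm[OF Hi])
      show "AE x in lborel. (\<lambda>j. He (e j) x) \<longlonglongrightarrow> H x"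
        using AE_lborel_singleton[of "0::'a"]
      proof eventually_elim
        case (elim x)
        have "\<forall>\<^sub>F j in sequentially. e j < norm x" using elim by (intro order_tendstoD(2)[OF e(4)]) simp
        then have "\<forall>\<^sub>F j in sequentially. He (e j) x = H x" by eventually_elim (simp add: He_def)
        then show ?case by (rule tendsto_eventually)
      qed
      show "AE x in lborel. norm (He (e j) x) \<le> norm (H x)" for j
        by (intro AE_I2) (auto simp: He_def indicator_def)
      show "He (e j) \<in> borel_measurable lborel" for j using Hei by (rule borel_measurable_integrable)
    qed simp
    have l2: "(\<lambda>j. \<integral>x. k (e j) x \<partial>lborel) \<longlonglongrightarrow> 0"
    proof (rule tendsto_rabs_zero_cancel, rule real_tendsto_sandwich[OF _ _ tendsto_const])
      show "(\<lambda>j. e j ^ (n - 1) * V (e j) / e j * (Cg * ?P)) \<longlonglongrightarrow> 0"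
        using tendsto_mult_left_zero[OF filterlim_compose[OF lim0 er], of "Cg * ?P"] .
      show "\<forall>\<^sub>F j in sequentially. \<bar>\<integral>x. k (e j) x \<partial>lborel\<bar> \<le> e j ^ (n - 1) * V (e j) / e j * (Cg * ?P)"
        using kb e by (intro always_eventually) auto
    qed simp
    from tendsto_add[OF l1 l2] show "(\<lambda>j. LINT x:S (e j)|lborel. f x) \<longlonglongrightarrow> (\<integral>x. H x \<partial>lborel)"
      using split e(1) by simp
  qed
  moreover have "set_integrable lborel (S \<epsilon>) f" if "\<epsilon> > 0" for \<epsilon>
    unfolding set_integrable_def
  proof -
    have "(\<lambda>x. indicator (S \<epsilon>) x *\<^sub>R f x) = Fe \<epsilon>" using fF[OF that] by (rule ext)
    then show "integrable lborel (\<lambda>x. indicator (S \<epsilon>) x *\<^sub>R f x)" using Fi[OF that] by (simp only:)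
  qed
  ultimately show "has_improper_integral (\<lambda>x. (V (norm x) / (norm x)\<^sup>2 - deriv V (norm x) / norm x) * (norm (grad u x))\<^sup>2)
       (\<integral>x. H x \<partial>lborel) (ball 0 R)"
    unfolding has_improper_integral_def S_def f_def[abs_def] by blast
qed

end

section \<open>Splitting into radial and tangential energy\<close>

lemma euler_add:
  assumes "smooth F" "smooth G"
  shows "euler (\<lambda>x. F x + G x) x = euler F x + euler G x"
  unfolding euler_def sum.distrib[symmetric]
  by (intro sum.cong refl) (simp add: partial_add assms smooth_differentiable algebra_simps)

lemma euler_sum:
  assumes "\<And>i. i \<in> I \<Longrightarrow> smooth (f i)"
  shows "euler (\<lambda>x. \<Sum>i\<in>I. f i x) x = (\<Sum>i\<in>I. euler (f i) x)"
  unfolding euler_def using assms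
  by (subst sum.swap) (simp add: partial_sum smooth_differentiable sum_distrib_left)

lemma smooth_laplacian: "smooth u \<Longrightarrow> smooth (laplacian u)"
  unfolding laplacian_def[abs_def] by (intro smooth_sum smooth_partial)

lemma supp_in_laplacian: "supp_in \<rho> u \<Longrightarrow> supp_in \<rho> (laplacian u)"
  using supp_in_partial[OF supp_in_partial[of \<rho> u]] by (auto simp: supp_in_def laplacian_def intro!: sum.neutral)

definition rot_sq :: "('a::euclidean_space \<Rightarrow> real) \<Rightarrow> 'a \<Rightarrow> real" where
  "rot_sq u x = (\<Sum>b\<in>Basis. \<Sum>c\<in>Basis. rot b c u x * rot b c u x) / 2"

text \<open>This is \<open>euler\<close> applied to \<open>rot_sq u\<close>; the factor 2 of the
  product rule cancels the half.\<close>

definition rot_euler :: "('a::euclidean_space \<Rightarrow> real) \<Rightarrow> 'a \<Rightarrow> real" where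
  "rot_euler u x = (\<Sum>b\<in>Basis. \<Sum>c\<in>Basis. rot b c u x * euler (rot b c u) x)"

lemma euler_rot_sq:
  assumes u: "smooth u"
  shows "smooth (rot_sq u)" "euler (rot_sq u) x = rot_euler u x"
proof -
  have e: "rot_sq u = (\<lambda>x. \<Sum>b\<in>Basis. \<Sum>c\<in>Basis. (1 / 2) * (rot b c u x * rot b c u x))"
    by (simp add: rot_sq_def fun_eq_iff sum_divide_distrib)
  have s: "smooth (\<lambda>x. (1 / 2) * (rot b c u x * rot b c u x))" if "b \<in> Basis" "c \<in> Basis" for b c
    by (intro smooth_mult smooth_const smooth_rot u that)
  show "smooth (rot_sq u)" unfolding e by (intro smooth_sum s)
  have k0: "euler (\<lambda>x. 1 / 2) x = 0" for x :: 'a by (simp add: euler_def)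
  have "euler (rot_sq u) x = (\<Sum>b\<in>Basis. \<Sum>c\<in>Basis. euler (\<lambda>x. (1 / 2) * (rot b c u x * rot b c u x)) x)"
    unfolding e
    by (subst euler_sum, intro smooth_sum s, assumption+)
      (intro sum.cong refl euler_sum s; assumption)
  also have "\<dots> = rot_euler u x"
    unfolding rot_euler_def
  proof (intro sum.cong refl)
    fix b c :: 'a assume bc: "b \<in> Basis" "c \<in> Basis"
    have r: "smooth (rot b c u)" using u bc by (rule smooth_rot)
    show "euler (\<lambda>x. (1 / 2) * (rot b c u x * rot b c u x)) x = rot b c u x * euler (rot b c u) x"
      unfolding euler_mult[OF smooth_const smooth_mult[OF r r]] euler_mult[OF r r] k0 by simp
  qed
  finally show "euler (rot_sq u) x = rot_euler u x" .
qed

lemma radial_rot: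
  assumes u: "smooth u" "radial u" and bc: "b \<in> Basis" "c \<in> Basis"
  shows "rot b c u x = 0"
proof (cases "b = c")
  case True
  then show ?thesis by (simp add: rot_def)
next
  case False
  have "u (plane_rot b c t x) = u x" for t
    using u(2) norm_plane_rot[OF bc False, of t x] unfolding radial_def by blast
  then have "((\<lambda>t. u x) has_real_derivative rot b c u (plane_rot b c 0 x)) (at 0)"
    using DERIV_plane_rot[OF bc False u(1), of x 0] by simp
  then show ?thesis using DERIV_unique[OF _ DERIV_const] plane_rot_0[OF bc False] by metis
qed

context rellich_pair
begin

text \<open>After multiplication by |x|^4 only E u, E^2 u and tangential quantities remain; E
  applied to Lagrange's identity supplies the radial derivative of |grad u|^2. With e = E u and d =
  E^2 u the purely radial terms collapse to a square: (d + (n - 2) e)^2 - (n - 1) (2 e d + (n - 3)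
  e^2) = (d - e)^2.\<close>

lemma rellich_pointwise:
  fixes u :: "'a::euclidean_space \<Rightarrow> real"
  assumes dim: "DIM('a) = n" and u: "smooth u" and x: "x \<noteq> 0"
  shows "cutoff R V (norm x) * (laplacian u x * laplacian u x)
     - (real n - 1) * (cutoff R V (norm x) / (norm x)\<^sup>2 * ((real n - 1) * grad_sq u x + euler (grad_sq u) x))
   = wt (norm x) * ((euler (euler u) x - euler u x) * (euler (euler u) x - euler u x))
     + wt (norm x) * (2 * (rad_lap u x * sph_lap u x) + sph_lap u x * sph_lap u x
       - (real n - 1) * ((real n - 3) * rot_sq u x + rot_euler u x))"
proof -
  define s where "s = x \<bullet> x"
  have s: "s > 0" "(norm x)\<^sup>2 = s" "norm x ^ 4 = s * s"
    using x by (auto simp: s_def power2_norm_eq_inner[symmetric] eval_nat_numeral)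
  define e where "e = euler u x"
  define ee where "ee = euler (euler u) x"
  define L where "L = rad_lap u x"
  define S where "S = sph_lap u x"
  define Q where "Q = rot_sq u x"
  define P where "P = rot_euler u x"
  define G where "G = grad_sq u x"
  define EG where "EG = euler (grad_sq u) x"
  define D where "D = laplacian u x"
  define m where "m = real n"
  define c where "c = cutoff R V (norm x)"
  have L: "L = ee + (m - 2) * e" by (simp add: L_def rad_lap_def dim ee_def e_def m_def)
  have sD: "s * D = L + S" unfolding s_def D_def L_def S_def by (rule sph_lap_eq[OF u])
  have sGx: "(x \<bullet> x) * grad_sq u x = euler u x * euler u x + rot_sq u x" for x
    using lagrange_rot[of x u] unfolding grad_sq rot_sq_def by (simp add: power2_eq_square)
  have sG: "s * G = e * e + Q" unfolding s_def G_def e_def Q_def by (rule sGx)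
  have gs: "smooth (grad_sq u)" by (rule smooth_grad_sq[OF u])
  have es: "smooth (euler u)" by (rule smooth_euler[OF u])
  have "euler (\<lambda>x. (x \<bullet> x) * grad_sq u x) x = 2 * s * G + s * EG"
    by (simp add: euler_mult[OF smooth_inner_self gs] euler_inner_self s_def G_def EG_def)
  moreover have "euler (\<lambda>x. euler u x * euler u x + rot_sq u x) x = 2 * e * ee + P"
    by (simp add: euler_add[OF smooth_mult[OF es es] euler_rot_sq(1)[OF u]] euler_mult[OF es es] euler_rot_sq(2)[OF u]
        e_def ee_def P_def)
  ultimately have sEG: "s * EG = 2 * e * ee + P - 2 * (e * e + Q)"
    unfolding sGx using sG by simp
  have K: "(ee - e) * (ee - e) + (2 * (L * S) + S * S - (m - 1) * ((m - 3) * Q + P))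
     = (s * D) * (s * D) - (m - 1) * ((m - 1) * (s * G) + s * EG)"
    unfolding sD sG sEG L by (simp add: algebra_simps)
  have "c * (D * D) - (m - 1) * (c / s * ((m - 1) * G + EG)) = c / (s * s) * ((s * D) * (s * D) - (m - 1) * ((m - 1) * (s * G) + s * EG))"
    using s(1) by (simp add: field_simps)
  also have "\<dots> = c / (s * s) * ((ee - e) * (ee - e)) + c / (s * s) * (2 * (L * S) + S * S - (m - 1) * ((m - 3) * Q + P))"
    unfolding K[symmetric] by (simp only: distrib_left)
  finally show ?thesis
    unfolding wt_def s(2,3) e_def[symmetric] ee_def[symmetric] L_def[symmetric] S_def[symmetric] Q_def[symmetric]
      P_def[symmetric] G_def[symmetric] EG_def[symmetric] D_def[symmetric] m_def[symmetric] c_def[symmetric] .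
qed

lemma vanishing_radial_part:
  assumes "smooth u" "supp_in \<rho> u"
  shows "vanishing \<rho> (\<lambda>x. euler (euler u) x - euler u x)"
proof -
  have "vanishing \<rho> (\<lambda>x. euler (euler u) x + (-1) * euler u x)"
    by (intro vanishing_add vanishing_cmult vanishing_euler smooth_euler supp_in_euler assms)
  then show ?thesis by simp
qed

lemma rot_sq_integrable:
  fixes u :: "'a::euclidean_space \<Rightarrow> real"
  assumes dim: "DIM('a) = n" and u: "smooth u" "supp_in \<rho> u"
  shows "integrable lborel (\<lambda>x. wt (norm x) * rot_sq u x)"
    and "(\<integral>x. wt (norm x) * rot_sq u x \<partial>lborel) = (\<Sum>b\<in>Basis. \<Sum>c\<in>Basis. \<integral>x. wt (norm x) * (rot b c u x * rot b c u x) \<partial>lborel) / 2"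
proof -
  have i: "integrable lborel (\<lambda>x. wt (norm x) * (rot b c u x * rot b c u x))" if "b \<in> Basis" "c \<in> Basis" for b c
    by (rule wt_integrable[OF dim vanishing_rot[OF u that] vanishing_rot[OF u that]])
  have e: "wt (norm x) * rot_sq u x = (\<Sum>b\<in>Basis. \<Sum>c\<in>Basis. wt (norm x) * (rot b c u x * rot b c u x)) / 2" for x
    by (simp add: rot_sq_def sum_distrib_left)
  show "integrable lborel (\<lambda>x. wt (norm x) * rot_sq u x)" unfolding e using i by simp
  show "(\<integral>x. wt (norm x) * rot_sq u x \<partial>lborel) = (\<Sum>b\<in>Basis. \<Sum>c\<in>Basis. \<integral>x. wt (norm x) * (rot b c u x * rot b c u x) \<partial>lborel) / 2"
    unfolding e using i by (simp add: Bochner_Integration.integral_sum)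
qed

lemma rot_euler_integrable:
  fixes u :: "'a::euclidean_space \<Rightarrow> real"
  assumes dim: "DIM('a) = n" and u: "smooth u" "supp_in \<rho> u"
  shows "integrable lborel (\<lambda>x. wt (norm x) * rot_euler u x)"
    and "(\<integral>x. wt (norm x) * rot_euler u x \<partial>lborel) = (\<Sum>b\<in>Basis. \<Sum>c\<in>Basis. \<integral>x. wt (norm x) * (rot b c u x * euler (rot b c u) x) \<partial>lborel)"
proof -
  have i: "integrable lborel (\<lambda>x. wt (norm x) * (rot b c u x * euler (rot b c u) x))" if "b \<in> Basis" "c \<in> Basis" for b c
    by (rule wt_integrable[OF dim vanishing_rot[OF u that] vanishing_euler[OF smooth_rot[OF u(1) that] supp_in_rot[OF u(2)]]])
  have e: "wt (norm x) * rot_euler u x = (\<Sum>b\<in>Basis. \<Sum>c\<in>Basis. wt (norm x) * (rot b c u x * euler (rot b c u) x))" for x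
    by (simp add: rot_euler_def sum_distrib_left)
  show "integrable lborel (\<lambda>x. wt (norm x) * rot_euler u x)" unfolding e using i by simp
  show "(\<integral>x. wt (norm x) * rot_euler u x \<partial>lborel) = (\<Sum>b\<in>Basis. \<Sum>c\<in>Basis. \<integral>x. wt (norm x) * (rot b c u x * euler (rot b c u) x) \<partial>lborel)"
    unfolding e using i by (simp add: Bochner_Integration.integral_sum)
qed

definition radial_energy :: "('a::euclidean_space \<Rightarrow> real) \<Rightarrow> real" where
  "radial_energy u = (\<integral>x. wt (norm x) * ((euler (euler u) x - euler u x) * (euler (euler u) x - euler u x)) \<partial>lborel)"

definition tangential_energy :: "('a::euclidean_space \<Rightarrow> real) \<Rightarrow> real" where
  "tangential_energy u = (\<integral>x. wt (norm x) * (2 * (rad_lap u x * sph_lap u x) + sph_lap u x * sph_lap u x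
       - (real n - 1) * ((real n - 3) * rot_sq u x + rot_euler u x)) \<partial>lborel)"

lemma radial_energy_integrable:
  fixes u :: "'a::euclidean_space \<Rightarrow> real"
  assumes "DIM('a) = n" "smooth u" "supp_in \<rho> u"
  shows "integrable lborel (\<lambda>x. wt (norm x) * ((euler (euler u) x - euler u x) * (euler (euler u) x - euler u x)))"
  by (rule wt_integrable[OF assms(1) vanishing_radial_part[OF assms(2,3)] vanishing_radial_part[OF assms(2,3)]])

lemma radial_energy_nonneg: "radial_energy u \<ge> 0"
  unfolding radial_energy_def by (intro Bochner_Integration.integral_nonneg mult_nonneg_nonneg[OF wt_nonneg zero_le_square])

lemma tangential_energy_integrable:
  fixes u :: "'a::euclidean_space \<Rightarrow> real"
  assumes dim: "DIM('a) = n" and u: "smooth u" "supp_in \<rho> u"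
  shows "integrable lborel (\<lambda>x. wt (norm x) * (2 * (rad_lap u x * sph_lap u x) + sph_lap u x * sph_lap u x
       - (real n - 1) * ((real n - 3) * rot_sq u x + rot_euler u x)))"
    and "tangential_energy u = 2 * (\<integral>x. wt (norm x) * (rad_lap u x * sph_lap u x) \<partial>lborel)
       + (\<integral>x. wt (norm x) * (sph_lap u x * sph_lap u x) \<partial>lborel)
       - (real n - 1) * ((real n - 3) * (\<integral>x. wt (norm x) * rot_sq u x \<partial>lborel) + (\<integral>x. wt (norm x) * rot_euler u x \<partial>lborel))"
proof -
  have L: "vanishing \<rho> (rad_lap u)" and S: "vanishing \<rho> (sph_lap u)"
    using u by (auto intro: vanishing_rad_lap vanishing_sph_lap)
  note i = wt_integrable[OF dim L S] wt_integrable[OF dim S S] rot_sq_integrable(1)[OF dim u] rot_euler_integrable(1)[OF dim u]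
  have e: "wt (norm x) * (2 * (rad_lap u x * sph_lap u x) + sph_lap u x * sph_lap u x
       - (real n - 1) * ((real n - 3) * rot_sq u x + rot_euler u x))
    = 2 * (wt (norm x) * (rad_lap u x * sph_lap u x)) + wt (norm x) * (sph_lap u x * sph_lap u x)
       - (real n - 1) * ((real n - 3) * (wt (norm x) * rot_sq u x) + wt (norm x) * rot_euler u x)" for x
    by (simp add: algebra_simps)
  show "integrable lborel (\<lambda>x. wt (norm x) * (2 * (rad_lap u x * sph_lap u x) + sph_lap u x * sph_lap u x
       - (real n - 1) * ((real n - 3) * rot_sq u x + rot_euler u x)))"
    unfolding e by (intro Bochner_Integration.integrable_diff Bochner_Integration.integrable_add integrable_mult_right i)
  show "tangential_energy u = 2 * (\<integral>x. wt (norm x) * (rad_lap u x * sph_lap u x) \<partial>lborel)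
       + (\<integral>x. wt (norm x) * (sph_lap u x * sph_lap u x) \<partial>lborel)
       - (real n - 1) * ((real n - 3) * (\<integral>x. wt (norm x) * rot_sq u x \<partial>lborel) + (\<integral>x. wt (norm x) * rot_euler u x \<partial>lborel))"
    unfolding tangential_energy_def e using i by simp
qed

text \<open>The integral with the Laplacian is finite and the improper integral, being a limit, is
  unique, so the extended inequality can be rearranged. Nonnegativity of the energies matters
  because \<open>ennreal\<close> cuts negative numbers off at 0.\<close>

lemma hardy_rellich_iff:
  fixes u :: "'a::euclidean_space \<Rightarrow> real"
  assumes dim: "DIM('a) = n" and u: "smooth u" "supp_in \<rho> u" and \<rho>: "0 < \<rho>" "\<rho> < R"
    and nn: "radial_energy u + tangential_energy u \<ge> 0"
  shows "hardy_rellich (ball 0 R) V W u \<longleftrightarrow>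
     (\<integral>\<^sup>+x. ennreal (cutoff R W (norm x) * (norm (grad u x))\<^sup>2) \<partial>lborel) \<le> ennreal (radial_energy u + tangential_energy u)"
proof -
  define I where "I = (\<integral>x. cutoff R V (norm x) / (norm x)\<^sup>2 * ((real n - 1) * grad_sq u x + euler (grad_sq u) x) \<partial>lborel)"
  note imp = improper_gradient_integral[OF dim u \<rho>]
  have Iuniq: "I' = I" if "has_improper_integral (\<lambda>x. (V (norm x) / (norm x)\<^sup>2 - deriv V (norm x) / norm x) * (norm (grad u x))\<^sup>2) I' (ball 0 R)" for I'
    using that imp(2) unfolding has_improper_integral_def I_def
    by (intro tendsto_unique[OF trivial_limit_at_right_real]) auto
  define A where "A = (\<integral>x. cutoff R V (norm x) * (laplacian u x * laplacian u x) \<partial>lborel)"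
  have Ai: "integrable lborel (\<lambda>x. cutoff R V (norm x) * (laplacian u x * laplacian u x))"
    by (rule weight_integrable[OF cutoff_V_measurable V_integrable[OF dim] smooth_mult[OF smooth_laplacian[OF u(1)] smooth_laplacian[OF u(1)]]
          supp_in_mult_left[OF supp_in_laplacian[OF u(2)]]])
  have Ann: "(\<integral>\<^sup>+x. ennreal (cutoff R V (norm x) * (laplacian u x)\<^sup>2) \<partial>lborel) = ennreal A"
    unfolding A_def power2_eq_square
    by (rule nn_integral_eq_integral[OF Ai]) (intro AE_I2 mult_nonneg_nonneg[OF cutoff_V_nonneg zero_le_square])
  have A0: "A \<ge> 0" unfolding A_def by (intro Bochner_Integration.integral_nonneg mult_nonneg_nonneg[OF cutoff_V_nonneg zero_le_square])
  define X where "X = (\<integral>\<^sup>+x. ennreal (cutoff R W (norm x) * (norm (grad u x))\<^sup>2) \<partial>lborel)"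
  have AI: "A - (real n - 1) * I = radial_energy u + tangential_energy u"
  proof -
    have "A - (real n - 1) * I = (\<integral>x. cutoff R V (norm x) * (laplacian u x * laplacian u x)
       - (real n - 1) * (cutoff R V (norm x) / (norm x)\<^sup>2 * ((real n - 1) * grad_sq u x + euler (grad_sq u) x)) \<partial>lborel)"
      unfolding A_def I_def
      by (simp only: Bochner_Integration.integral_diff[OF Ai integrable_mult_right[OF imp(1)]] integral_mult_right_zero)
    also have "\<dots> = (\<integral>x. wt (norm x) * ((euler (euler u) x - euler u x) * (euler (euler u) x - euler u x))
     + wt (norm x) * (2 * (rad_lap u x * sph_lap u x) + sph_lap u x * sph_lap u x
       - (real n - 1) * ((real n - 3) * rot_sq u x + rot_euler u x)) \<partial>lborel)"
    proof (rule integral_cong_AE)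
      show "AE x in lborel. cutoff R V (norm x) * (laplacian u x * laplacian u x)
       - (real n - 1) * (cutoff R V (norm x) / (norm x)\<^sup>2 * ((real n - 1) * grad_sq u x + euler (grad_sq u) x))
       = wt (norm x) * ((euler (euler u) x - euler u x) * (euler (euler u) x - euler u x))
     + wt (norm x) * (2 * (rad_lap u x * sph_lap u x) + sph_lap u x * sph_lap u x
       - (real n - 1) * ((real n - 3) * rot_sq u x + rot_euler u x))"
        using AE_lborel_singleton[of "0::'a"] by eventually_elim (rule rellich_pointwise[OF dim u(1)])
    next
      show "(\<lambda>x. cutoff R V (norm x) * (laplacian u x * laplacian u x)
       - (real n - 1) * (cutoff R V (norm x) / (norm x)\<^sup>2 * ((real n - 1) * grad_sq u x + euler (grad_sq u) x))) \<in> borel_measurable lborel"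
        using Ai imp(1) by (intro borel_measurable_diff borel_measurable_times borel_measurable_const borel_measurable_integrable)
      show "(\<lambda>x. wt (norm x) * ((euler (euler u) x - euler u x) * (euler (euler u) x - euler u x))
     + wt (norm x) * (2 * (rad_lap u x * sph_lap u x) + sph_lap u x * sph_lap u x
       - (real n - 1) * ((real n - 3) * rot_sq u x + rot_euler u x))) \<in> borel_measurable lborel"
        by (intro borel_measurable_add borel_measurable_integrable radial_energy_integrable[OF dim u] tangential_energy_integrable(1)[OF dim u])
    qed
    also have "\<dots> = radial_energy u + tangential_energy u"
      unfolding radial_energy_def tangential_energy_def
      by (rule Bochner_Integration.integral_add[OF radial_energy_integrable[OF dim u] tangential_energy_integrable(1)[OF dim u]])
    finally show ?thesis .
  qed
  have "hardy_rellich (ball 0 R) V W u \<longleftrightarrow> enn2ereal X + ereal ((real n - 1) * I) \<le> enn2ereal (ennreal A)"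
    unfolding hardy_rellich_def dim nn_integral_ball_cutoff[of V "\<lambda>x. (laplacian u x)\<^sup>2" R]
      nn_integral_ball_cutoff[of W "\<lambda>x. (norm (grad u x))\<^sup>2" R] Ann X_def[symmetric]
    using Iuniq imp(2)[folded I_def] by blast
  \<comment> \<open>If \<open>X\<close> is infinite, both sides are false.\<close>
  also have "\<dots> \<longleftrightarrow> X \<le> ennreal (A - (real n - 1) * I)"
  proof (cases X)
    case (real a)
    have "A - (real n - 1) * I \<ge> 0" using nn AI by simp
    then show ?thesis using real A0 by (simp add: enn2ereal_ennreal ennreal_le_iff le_diff_eq)
  qed (simp add: enn2ereal_ennreal A0 top_unique)
  finally show ?thesis unfolding AI X_def .
qed

lemma euler_radial_nn:
  fixes u :: "'a::euclidean_space \<Rightarrow> real"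
  assumes dim: "DIM('a) = n" and u: "smooth u" "supp_in \<rho> u"
  shows "(\<integral>\<^sup>+x. ennreal (cutoff R V (norm x) * ((euler (euler u) x - euler u x) / (norm x)\<^sup>2)\<^sup>2) \<partial>lborel) = ennreal (radial_energy u)"
proof -
  have "(\<integral>\<^sup>+x. ennreal (cutoff R V (norm x) * ((euler (euler u) x - euler u x) / (norm x)\<^sup>2)\<^sup>2) \<partial>lborel)
    = (\<integral>\<^sup>+x. ennreal (wt (norm x) * ((euler (euler u) x - euler u x) * (euler (euler u) x - euler u x))) \<partial>lborel)"
  proof (intro nn_integral_cong)
    fix x :: 'a
    have "c * (d / s)\<^sup>2 = c / s\<^sup>2 * (d * d)" for c d s :: real by (simp add: power_divide power2_eq_square)
    note this[of "cutoff R V (norm x)" "euler (euler u) x - euler u x" "(norm x)\<^sup>2"]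
    moreover have "((norm x)\<^sup>2)\<^sup>2 = norm x ^ 4" by (simp flip: power_mult)
    ultimately show "ennreal (cutoff R V (norm x) * ((euler (euler u) x - euler u x) / (norm x)\<^sup>2)\<^sup>2)
      = ennreal (wt (norm x) * ((euler (euler u) x - euler u x) * (euler (euler u) x - euler u x)))"
      by (simp only: wt_def)
  qed
  also have "\<dots> = ennreal (radial_energy u)"
    unfolding radial_energy_def
    by (rule nn_integral_eq_integral[OF radial_energy_integrable[OF dim u]]) (intro AE_I2 mult_nonneg_nonneg[OF wt_nonneg zero_le_square])
  finally show ?thesis .
qed

text \<open>All rotations of a radial u vanish, and what is left is Hardy's inequality for the
  profile u_r with derivative u_rr.\<close>

lemma radial_hardy_rellich_iff:
  fixes u :: "'a::euclidean_space \<Rightarrow> real"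
  assumes dim: "DIM('a) = n" and u: "smooth u" "supp_in \<rho> u" and \<rho>: "0 < \<rho>" "\<rho> < R" and rad: "radial u"
  shows "hardy_rellich (ball 0 R) V W u \<longleftrightarrow>
     (\<integral>\<^sup>+x. ennreal (cutoff R W (norm x) * (euler u x / norm x)\<^sup>2) \<partial>lborel)
       \<le> (\<integral>\<^sup>+x. ennreal (cutoff R V (norm x) * ((euler (euler u) x - euler u x) / (norm x)\<^sup>2)\<^sup>2) \<partial>lborel)"
proof -
  have r0: "rot b c u = (\<lambda>x. 0)" if "b \<in> Basis" "c \<in> Basis" for b c
    using radial_rot[OF u(1) rad that] by auto
  have rr0: "rot b c (\<lambda>x. 0) x = 0" for b c x :: 'a by (simp add: rot_def)
  have "sph_lap u x = 0" "rot_sq u x = 0" "rot_euler u x = 0" for x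
    by (simp_all add: sph_lap_def rot_sq_def rot_euler_def rr0 r0)
  then have t0: "tangential_energy u = 0" by (simp add: tangential_energy_def)
  have "(norm (grad u x))\<^sup>2 = (euler u x / norm x)\<^sup>2" if "x \<noteq> 0" for x
    using lagrange_rot[of x u] that by (simp add: r0 power2_norm_eq_inner[symmetric] power_divide field_simps)
  then have "(\<integral>\<^sup>+x. ennreal (cutoff R W (norm x) * (norm (grad u x))\<^sup>2) \<partial>lborel) = (\<integral>\<^sup>+x. ennreal (cutoff R W (norm x) * (euler u x / norm x)\<^sup>2) \<partial>lborel)"
    using AE_lborel_singleton[of "0::'a"] by (intro nn_integral_cong_AE) (auto elim!: eventually_mono)
  then show ?thesis
    using hardy_rellich_iff[OF dim u \<rho>] t0 radial_energy_nonneg[of u] euler_radial_nn[OF dim u] by simp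
qed

text \<open>Hardy's inequality on each ray for u_r, which for nonradial u need not vanish at the
  origin.\<close>

lemma radial_part_hardy:
  fixes u :: "'a::euclidean_space \<Rightarrow> real"
  assumes dim: "DIM('a) = n" and u: "smooth u" "supp_in \<rho> u" and \<rho>: "0 < \<rho>" "\<rho> < R" and H: "ray_hardy n R V W"
  shows "(\<integral>\<^sup>+x. ennreal (cutoff R W (norm x) * (euler u x / norm x)\<^sup>2) \<partial>lborel)
       \<le> (\<integral>\<^sup>+x. ennreal (cutoff R V (norm x) * ((euler (euler u) x - euler u x) / (norm x)\<^sup>2)\<^sup>2) \<partial>lborel)"
proof (rule nn_integral_ray_mono[OF dim])
  have s: "smooth (euler u)" "smooth (euler (euler u))" using u by (auto intro: smooth_euler)
  have [measurable]: "euler u \<in> borel_measurable borel" "euler (euler u) \<in> borel_measurable borel"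
    by (intro smooth_measurable s)+
  show "(\<lambda>x. euler u x / norm x) \<in> borel_measurable borel" "(\<lambda>x. (euler (euler u) x - euler u x) / (norm x)\<^sup>2) \<in> borel_measurable borel"
    by measurable
  define \<rho>' where "\<rho>' = (\<rho> + R) / 2"
  have \<rho>': "0 < \<rho>'" "\<rho>' < R" "\<rho> < \<rho>'" using \<rho> by (auto simp: \<rho>'_def)
  fix \<theta> :: 'a assume \<theta>: "norm \<theta> = 1"
  have "(\<integral>\<^sup>+r\<in>{0<..<R}. ennreal (r ^ (n - 1) * W r * (euler u (r *\<^sub>R \<theta>) / norm (r *\<^sub>R \<theta>))\<^sup>2) \<partial>lborel)
     = (\<integral>\<^sup>+r\<in>{0<..<R}. ennreal (r ^ (n - 1) * W r * (euler u (r *\<^sub>R \<theta>) / r)\<^sup>2) \<partial>lborel)"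
    using \<theta> by (intro nn_integral_cong) (auto simp: indicator_def)
  also have "\<dots> \<le> (\<integral>\<^sup>+r\<in>{0<..<R}. ennreal (r ^ (n - 1) * V r * ((euler (euler u) (r *\<^sub>R \<theta>) - euler u (r *\<^sub>R \<theta>)) / r\<^sup>2)\<^sup>2) \<partial>lborel)"
  proof (rule ray_hardyD[OF H _ _ \<rho>'(1,2)])
    show "((\<lambda>r. euler u (r *\<^sub>R \<theta>) / r) has_real_derivative (euler (euler u) (r *\<^sub>R \<theta>) - euler u (r *\<^sub>R \<theta>)) / r\<^sup>2) (at r)"
      if "r \<in> {0<..<R}" for r
    proof -
      have "((\<lambda>r. euler u (r *\<^sub>R \<theta>) / r) has_real_derivative (euler (euler u) (r *\<^sub>R \<theta>) / r * r - euler u (r *\<^sub>R \<theta>) * 1) / (r * r)) (at r)"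
        using that by (intro DERIV_divide DERIV_ident DERIV_along_ray s) auto
      then show ?thesis using that by (simp add: power2_eq_square)
    qed
    show "continuous_on {0<..<R} (\<lambda>r. (euler (euler u) (r *\<^sub>R \<theta>) - euler u (r *\<^sub>R \<theta>)) / r\<^sup>2)"
      by (intro continuous_intros ray_continuous smooth_continuous_on s) auto
    show "euler u (r *\<^sub>R \<theta>) / r = 0" if "\<rho>' \<le> r" for r
      using supp_in_euler[OF u(2)] \<rho>(1) \<rho>' that \<theta> unfolding supp_in_def by auto
  qed
  also have "\<dots> = (\<integral>\<^sup>+r\<in>{0<..<R}. ennreal (r ^ (n - 1) * V r * ((euler (euler u) (r *\<^sub>R \<theta>) - euler u (r *\<^sub>R \<theta>)) / (norm (r *\<^sub>R \<theta>))\<^sup>2)\<^sup>2) \<partial>lborel)"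
    using \<theta> by (intro nn_integral_cong) (auto simp: indicator_def)
  finally show "(\<integral>\<^sup>+r\<in>{0<..<R}. ennreal (r ^ (n - 1) * W r * (euler u (r *\<^sub>R \<theta>) / norm (r *\<^sub>R \<theta>))\<^sup>2) \<partial>lborel)
     \<le> (\<integral>\<^sup>+r\<in>{0<..<R}. ennreal (r ^ (n - 1) * V r * ((euler (euler u) (r *\<^sub>R \<theta>) - euler u (r *\<^sub>R \<theta>)) / (norm (r *\<^sub>R \<theta>))\<^sup>2)\<^sup>2) \<partial>lborel)" .
qed

lemma segment_hardy_of_rellich:
  assumes dim: "DIM('a::euclidean_space) = n"
    and H: "\<forall>u\<in>test_functions (ball (0::'a) R). radial u \<longrightarrow> hardy_rellich (ball 0 R) V W u"
  shows "segment_hardy n R V W"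
proof (rule segment_hardyI[where m = 1, OF dim])
  fix a b and h h1 :: "real \<Rightarrow> real"
  assume ab: "0 < a" "a < b" "b < R" and h: "smooth h" "\<And>s. (h has_real_derivative h1 s) (at s)"
    and hz: "\<And>s. s < a\<^sup>2 \<or> b\<^sup>2 < s \<Longrightarrow> h s = 0"
  obtain G where G: "\<And>s. (G has_real_derivative h s) (at s)"
    using antiderivative_exists[OF smooth_continuous_on[OF h(1)]] by blast
  \<comment> \<open>The half absorbs the 2 r of the chain rule, so that u = k(r^2) has u_r = r
    h(r^2). The constant makes \<open>k\<close> vanish from b^2 on; for r < a the function u is
    constant, in general not zero.\<close>
  define k where "k s = (G s - G (b\<^sup>2)) / 2" for s
  have k: "(k has_real_derivative h s / 2) (at s)" for s
    using DERIV_cdivide[OF DERIV_diff[OF G DERIV_const]] by (simp add: k_def[abs_def])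
  have "smooth (\<lambda>s. (1 / 2) * h s)" by (intro smooth_mult smooth_const h)
  then have ks: "smooth k" by (intro smooth_real_antiderivative[OF k]) simp
  have kz: "k s = 0" if s: "b\<^sup>2 < s" for s
  proof -
    obtain t where t: "b\<^sup>2 < t" "k s - k (b\<^sup>2) = (s - b\<^sup>2) * (h t / 2)"
      using MVT2[OF s k] by blast
    then show ?thesis using hz[of t] by (simp add: k_def)
  qed
  define u where "u x = k (x \<bullet> x)" for x :: 'a
  have su: "smooth u" unfolding u_def[abs_def] by (rule smooth_compose[OF ks smooth_inner_self])
  have ur: "radial u" by (simp add: radial_def u_def power2_norm_eq_inner[symmetric])
  have uz: "u x = 0" if "norm x > b" for x
    using that ab power2_strict_mono[of b "norm x"] unfolding u_def by (intro kz) (simp add: power2_norm_eq_inner)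
  have "u \<in> test_functions (ball 0 R)" by (rule test_functionI[OF su uz ab(3)])
  then have hr: "hardy_rellich (ball 0 R) V W u" using H ur by blast
  have ub: "supp_in b u" using uz by (simp add: supp_in_def)
  have b0: "0 < b" using ab by simp
  have hs: "smooth (\<lambda>x::'a. h (x \<bullet> x))" by (rule smooth_compose[OF h(1) smooth_inner_self])
  have ec: "euler (\<lambda>x. f (x \<bullet> x)) x = f1 (x \<bullet> x) * (2 * (x \<bullet> x))"
    if "smooth f" "\<And>s. (f has_real_derivative f1 s) (at s)" for f f1 and x :: 'a
    unfolding euler_inner_self[symmetric, of x] euler_def sum_distrib_left
    by (intro sum.cong refl) (simp add: grad_compose_sq[OF that])
  have eu: "euler u = (\<lambda>x. h (x \<bullet> x) * (x \<bullet> x))"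
    unfolding u_def[abs_def] by (rule ext) (simp add: ec[OF ks k])
  have eux: "euler u x = h (x \<bullet> x) * (x \<bullet> x)" for x by (simp only: eu)
  have eeu: "euler (euler u) x = h1 (x \<bullet> x) * (2 * (x \<bullet> x)) * (x \<bullet> x) + h (x \<bullet> x) * (2 * (x \<bullet> x))" for x
    unfolding eu euler_mult[OF hs smooth_inner_self] ec[OF h] euler_inner_self ..
  have n0: "(t ^ 1 * H)\<^sup>2 = (H * t\<^sup>2 / t)\<^sup>2"
    "(real 1 * t ^ (1 - 1) * H + 2 * t ^ (1 + 1) * H1)\<^sup>2 = ((H1 * (2 * t\<^sup>2) * t\<^sup>2 + H * (2 * t\<^sup>2) - H * t\<^sup>2) / t\<^sup>2)\<^sup>2"
    if "t \<noteq> 0" for t H H1 :: real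
    using that by (simp_all add: field_simps power2_eq_square)
  have nx: "(norm x ^ 1 * h ((norm x)\<^sup>2))\<^sup>2 = (euler u x / norm x)\<^sup>2"
    "(real 1 * norm x ^ (1 - 1) * h ((norm x)\<^sup>2) + 2 * norm x ^ (1 + 1) * h1 ((norm x)\<^sup>2))\<^sup>2
       = ((euler (euler u) x - euler u x) / (norm x)\<^sup>2)\<^sup>2"
    if "x \<noteq> 0" for x
    unfolding eeu eux power2_norm_eq_inner[of x, symmetric] by (rule n0; use that in simp)+
  have "(\<integral>\<^sup>+x. ennreal (cutoff R W (norm x) * (norm (x::'a) ^ 1 * h ((norm x)\<^sup>2))\<^sup>2) \<partial>lborel)
      = (\<integral>\<^sup>+x. ennreal (cutoff R W (norm x) * (euler u x / norm x)\<^sup>2) \<partial>lborel)"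
    by (rule nn_integral_cong_AE, use AE_lborel_singleton[of "0::'a"] in eventually_elim) (subst nx(1), assumption, rule refl)
  also have "\<dots> \<le> (\<integral>\<^sup>+x. ennreal (cutoff R V (norm x) * ((euler (euler u) x - euler u x) / (norm x)\<^sup>2)\<^sup>2) \<partial>lborel)"
    using hr unfolding radial_hardy_rellich_iff[OF dim su ub b0 ab(3) ur] .
  also have "\<dots> = (\<integral>\<^sup>+x. ennreal (cutoff R V (norm x) * (real 1 * norm (x::'a) ^ (1 - 1) * h ((norm x)\<^sup>2) + 2 * norm x ^ (1 + 1) * h1 ((norm x)\<^sup>2))\<^sup>2) \<partial>lborel)"
    by (rule nn_integral_cong_AE, use AE_lborel_singleton[of "0::'a"] in eventually_elim) (subst nx(2), assumption, rule refl)
  finally show "(\<integral>\<^sup>+x. ennreal (cutoff R W (norm x) * (norm (x::'a) ^ 1 * h ((norm x)\<^sup>2))\<^sup>2) \<partial>lborel)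
      \<le> (\<integral>\<^sup>+x. ennreal (cutoff R V (norm x) * (real 1 * norm (x::'a) ^ (1 - 1) * h ((norm x)\<^sup>2) + 2 * norm x ^ (1 + 1) * h1 ((norm x)\<^sup>2))\<^sup>2) \<partial>lborel)" .
qed

end

text \<open>Linear coefficients are eigenfunctions of E with eigenvalue 1, so E - 1 acts on the
  combination as E acts on \<open>p\<close> and \<open>q\<close>. Iterated, (E - 1)(E - 2) becomes
  E^2 - E.\<close>

lemma euler_twist:
  assumes "smooth p" "smooth q"
  shows "euler (\<lambda>x. (x \<bullet> b) * q x - (x \<bullet> c) * p x) x =
    (x \<bullet> b) * q x - (x \<bullet> c) * p x + ((x \<bullet> b) * euler q x - (x \<bullet> c) * euler p x)"
  by (simp add: euler_diff smooth_mult smooth_inner euler_mult euler_inner assms)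

lemma twist_bound:
  fixes x :: "'a::euclidean_space"
  assumes bc: "b \<in> Basis" "c \<in> Basis" and "\<bar>p\<bar> \<le> A" "\<bar>q\<bar> \<le> B"
  shows "\<bar>(x \<bullet> b) * q - (x \<bullet> c) * p\<bar> \<le> norm x * (A + B)"
proof -
  have "\<bar>(x \<bullet> b) * q\<bar> \<le> norm x * B" "\<bar>(x \<bullet> c) * p\<bar> \<le> norm x * A"
    unfolding abs_mult using assms Basis_le_norm[of b x] Basis_le_norm[of c x] by (auto intro!: mult_mono)
  then show ?thesis using abs_triangle_ineq4[of "(x \<bullet> b) * q" "(x \<bullet> c) * p"] by (simp add: distrib_left)
qed

text \<open>E^2 - E is the sum of the operators (x . d) E partial_d: one factor |x| is explicit, and
  \<open>euler_bound\<close> supplies the second.\<close>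

lemma euler_euler_bound:
  fixes F :: "'a::euclidean_space \<Rightarrow> real"
  assumes F: "smooth F" "supp_in \<rho> F"
  obtains C where "C \<ge> 0" "\<And>x. \<bar>euler (euler F) x - euler F x\<bar> \<le> C * (norm x)\<^sup>2"
proof -
  have "\<forall>d\<in>Basis. \<exists>C\<ge>0. \<forall>x. \<bar>euler (partial d F) x\<bar> \<le> C * norm x"
  proof
    fix d :: 'a assume d: "d \<in> Basis"
    show "\<exists>C\<ge>0. \<forall>x. \<bar>euler (partial d F) x\<bar> \<le> C * norm x"
      using euler_bound[OF smooth_partial[OF F(1) d] supp_in_partial[OF F(2)]] by metis
  qed
  from bchoice[OF this] obtain C where C: "\<And>d. d \<in> Basis \<Longrightarrow> C d \<ge> 0"
    "\<And>d x. d \<in> Basis \<Longrightarrow> \<bar>euler (partial d F) x\<bar> \<le> C d * norm x" by metis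
  have "\<bar>euler (euler F) x - euler F x\<bar> \<le> (\<Sum>d\<in>Basis. C d) * (norm x)\<^sup>2" for x
  proof -
    have "\<bar>euler (euler F) x - euler F x\<bar> \<le> (\<Sum>d\<in>Basis. \<bar>(x \<bullet> d) * euler (partial d F) x\<bar>)"
      unfolding euler_euler[OF F(1)] using sum_abs[of "\<lambda>d. (x \<bullet> d) * euler (partial d F) x" Basis] by simp
    also have "\<dots> \<le> (\<Sum>d\<in>Basis. norm x * (C d * norm x))"
      unfolding abs_mult using C Basis_le_norm[of _ x] by (intro sum_mono mult_mono) auto
    also have "\<dots> = (\<Sum>d\<in>Basis. C d) * (norm x)\<^sup>2"
      unfolding sum_distrib_right by (intro sum.cong refl) (simp add: power2_eq_square)
    finally show ?thesis .
  qed
  moreover have "(\<Sum>d\<in>Basis. C d) \<ge> 0" using C by (intro sum_nonneg)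
  ultimately show ?thesis using that by blast
qed

text \<open>Divided by \<open>r\<close>, \<open>r\<^sup>2\<close> and \<open>r\<^sup>3\<close>, these are \<open>g\<close>, \<open>g'\<close> and \<open>g''\<close> for \<open>g(r) = f(r\<theta>)/r\<close> with \<open>f = rot b c u\<close>. Since \<open>f\<close>
  vanishes at the origin, \<open>g\<close> is \<open>C\<^sup>2\<close> up to \<open>r = 0\<close>.\<close>

lemma rot_ray_bounds:
  fixes u :: "'a::euclidean_space \<Rightarrow> real"
  assumes u: "smooth u" "supp_in \<rho> u" and bc: "b \<in> Basis" "c \<in> Basis"
  defines "f \<equiv> rot b c u"
  obtains C where "C \<ge> 0" "\<And>x. \<bar>f x\<bar> \<le> C * norm x" "\<And>x. \<bar>euler f x - f x\<bar> \<le> C * norm x ^ 2"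
    "\<And>x. \<bar>euler (euler f) x - 3 * euler f x + 2 * f x\<bar> \<le> C * norm x ^ 3"
proof -
  define p where "p = partial b u"
  define q where "q = partial c u"
  have p: "smooth p" "supp_in \<rho> p" and q: "smooth q" "supp_in \<rho> q"
    using u bc by (auto simp: p_def q_def intro: smooth_partial supp_in_partial)
  have f: "f = (\<lambda>x. (x \<bullet> b) * q x - (x \<bullet> c) * p x)" by (simp add: f_def rot_def[abs_def] p_def q_def)
  have sf: "smooth f" unfolding f_def by (rule smooth_rot[OF u(1) bc])
  have k: "euler f x - f x = (x \<bullet> b) * euler q x - (x \<bullet> c) * euler p x" for x
    unfolding f by (subst euler_twist[OF p(1) q(1)]) simp
  have "euler (\<lambda>x. euler f x - f x) x = euler (euler f) x - euler f x" for x
    by (rule euler_diff[OF smooth_euler[OF sf] sf])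
  moreover have "euler (\<lambda>x. euler f x - f x) x = (euler f x - f x) + ((x \<bullet> b) * euler (euler q) x - (x \<bullet> c) * euler (euler p) x)" for x
    unfolding k by (rule euler_twist[OF smooth_euler[OF p(1)] smooth_euler[OF q(1)]])
  ultimately have "euler (euler f) x - euler f x = (euler f x - f x) + ((x \<bullet> b) * euler (euler q) x - (x \<bullet> c) * euler (euler p) x)" for x
    by simp
  note kE = this
  have kk: "euler (euler f) x - 3 * euler f x + 2 * f x =
      (x \<bullet> b) * (euler (euler q) x - euler q x) - (x \<bullet> c) * (euler (euler p) x - euler p x)" for x
    unfolding right_diff_distrib using k[of x] kE[of x] by linarith
  obtain C1 where C1: "C1 \<ge> 0" "\<And>x. \<bar>f x\<bar> \<le> C1 * norm x" using rot_bound[OF u bc] unfolding f_def by blast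
  obtain P Q where P: "P \<ge> 0" "\<And>x. \<bar>euler p x\<bar> \<le> P * norm x" and Q: "Q \<ge> 0" "\<And>x. \<bar>euler q x\<bar> \<le> Q * norm x"
    using euler_bound[OF p] euler_bound[OF q] by metis
  obtain P2 Q2 where P2: "P2 \<ge> 0" "\<And>x. \<bar>euler (euler p) x - euler p x\<bar> \<le> P2 * (norm x)\<^sup>2"
    and Q2: "Q2 \<ge> 0" "\<And>x. \<bar>euler (euler q) x - euler q x\<bar> \<le> Q2 * (norm x)\<^sup>2"
    using euler_euler_bound[OF p] euler_euler_bound[OF q] by metis
  define C where "C = C1 + (P + Q) + (P2 + Q2)"
  have C: "C1 \<le> C" "P + Q \<le> C" "P2 + Q2 \<le> C" "C \<ge> 0" using C1 P Q P2 Q2 by (auto simp: C_def)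
  show ?thesis
  proof (rule that[OF C(4)])
    fix x :: 'a
    show "\<bar>f x\<bar> \<le> C * norm x" using C1(2)[of x] mult_right_mono[OF C(1) norm_ge_zero[of x]] by linarith
    have "\<bar>euler f x - f x\<bar> \<le> (P + Q) * norm x ^ 2"
      unfolding k using twist_bound[OF bc P(2)[of x] Q(2)[of x], of x] by (simp add: algebra_simps power2_eq_square)
    then show "\<bar>euler f x - f x\<bar> \<le> C * norm x ^ 2"
      using mult_right_mono[OF C(2) zero_le_power[OF norm_ge_zero[of x], of 2]] by linarith
    have "\<bar>euler (euler f) x - 3 * euler f x + 2 * f x\<bar> \<le> (P2 + Q2) * norm x ^ 3"
      unfolding kk using twist_bound[OF bc P2(2)[of x] Q2(2)[of x], of x]
      by (simp add: algebra_simps power2_eq_square power3_eq_cube)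
    then show "\<bar>euler (euler f) x - 3 * euler f x + 2 * f x\<bar> \<le> C * norm x ^ 3"
      using mult_right_mono[OF C(3) zero_le_power[OF norm_ge_zero[of x], of 3]] by linarith
  qed
qed

section \<open>Lower bound for the tangential energy\<close>

context rellich_pair
begin

text \<open>The integrand of \<open>ray_second_order\<close> for g = f / r, without the factor r^(n
  - 1) and rewritten in E. The coefficients come from g' = (E f - f) / r^2 and g'' = (E^2 f - 3 E f
  + 2 f) / r^3.\<close>

definition rot_energy :: "('a::euclidean_space \<Rightarrow> real) \<Rightarrow> 'a \<Rightarrow> real" where
  "rot_energy f x = wt (norm x) * (f x * (- 2 * euler (euler f) x + (- (4 * real n - 6) * euler f x + - ((real n - 1) * (real n - 4)) * f x)))"

lemma rot_energy_integrable:
  fixes f :: "'a::euclidean_space \<Rightarrow> real"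
  assumes dim: "DIM('a) = n" and f: "vanishing \<rho> f"
  shows "integrable lborel (rot_energy f)"
    and "(\<integral>x. rot_energy f x \<partial>lborel) = - 2 * (\<integral>x. wt (norm x) * (f x * euler (euler f) x) \<partial>lborel)
      - (4 * real n - 6) * (\<integral>x. wt (norm x) * (f x * euler f x) \<partial>lborel)
      - (real n - 1) * (real n - 4) * (\<integral>x. wt (norm x) * (f x * f x) \<partial>lborel)"
proof -
  note v = vanishing_smooth[OF f] vanishing_supp[OF f]
  have e: "vanishing \<rho> (euler f)" "vanishing \<rho> (euler (euler f))"
    using v by (auto intro: vanishing_euler smooth_euler supp_in_euler)
  note i = wt_integrable[OF dim f e(2)] wt_integrable[OF dim f e(1)] wt_integrable[OF dim f f]
  have r: "rot_energy f = (\<lambda>x. - 2 * (wt (norm x) * (f x * euler (euler f) x)) - (4 * real n - 6) * (wt (norm x) * (f x * euler f x))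
      - (real n - 1) * (real n - 4) * (wt (norm x) * (f x * f x)))"
    by (simp add: fun_eq_iff rot_energy_def algebra_simps)
  show "integrable lborel (rot_energy f)"
    unfolding r by (intro Bochner_Integration.integrable_diff integrable_mult_right i)
  show "(\<integral>x. rot_energy f x \<partial>lborel) = - 2 * (\<integral>x. wt (norm x) * (f x * euler (euler f) x) \<partial>lborel)
      - (4 * real n - 6) * (\<integral>x. wt (norm x) * (f x * euler f x) \<partial>lborel)
      - (real n - 1) * (real n - 4) * (\<integral>x. wt (norm x) * (f x * f x) \<partial>lborel)"
    unfolding r
    by (simp only: Bochner_Integration.integral_diff Bochner_Integration.integrable_diff integrable_mult_right i integral_mult_right_zero)
qed

end

locale rellich_convex_pair = rellich_pair +
  fixes V2 :: "real \<Rightarrow> real"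
  assumes V2: "\<And>r. r \<in> {0<..<R} \<Longrightarrow> (deriv V has_real_derivative V2 r) (at r)"
    and V2_le: "\<And>r. r \<in> {0<..<R} \<Longrightarrow> W r - 2 * V r / r\<^sup>2 + 2 * deriv V r / r - V2 r \<ge> 0"
    and hardy: "ray_hardy n R V W"
begin

text \<open>An instance of \<open>ray_second_order\<close> with g = f / r: by
  \<open>rot_ray_bounds\<close> this g and its two derivatives stay bounded at the origin, and
  \<open>V2_le\<close> divided by r is the bound on (V / r)''.\<close>

lemma rot_energy_ray:
  fixes u :: "'a::euclidean_space \<Rightarrow> real"
  assumes u: "smooth u" "supp_in \<rho> u" and \<rho>: "0 < \<rho>" "\<rho> < R"
    and bc: "b \<in> Basis" "c \<in> Basis" and \<theta>: "norm \<theta> = 1"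
  defines "f \<equiv> rot b c u"
  shows "0 \<le> (\<integral>r. rot_energy f (r *\<^sub>R \<theta>) \<partial>radial_measure n)"
    and "(\<integral>\<^sup>+r\<in>{0<..<R}. ennreal (r ^ (n - 1) * W r * (f (r *\<^sub>R \<theta>) / r)\<^sup>2) \<partial>lborel) \<le> ennreal (\<integral>r. rot_energy f (r *\<^sub>R \<theta>) \<partial>radial_measure n)"
proof -
  have f: "smooth f" "supp_in \<rho> f" using u bc by (auto simp: f_def intro: smooth_rot supp_in_rot)
  have s: "smooth (euler f)" "smooth (euler (euler f))" using f by (auto intro: smooth_euler)
  have se: "supp_in \<rho> (euler f)" using f by (auto intro: supp_in_euler)
  define g where "g r = f (r *\<^sub>R \<theta>) / r" for r
  define g1 where "g1 r = (euler f (r *\<^sub>R \<theta>) - f (r *\<^sub>R \<theta>)) / r\<^sup>2" for r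
  define g2 where "g2 r = (euler (euler f) (r *\<^sub>R \<theta>) - 3 * euler f (r *\<^sub>R \<theta>) + 2 * f (r *\<^sub>R \<theta>)) / r ^ 3" for r
  define X1 where "X1 r = deriv V r / r - V r / r\<^sup>2" for r
  define X2 where "X2 r = V2 r / r - 2 * deriv V r / r\<^sup>2 + 2 * V r / r ^ 3" for r
  define \<rho>' where "\<rho>' = (\<rho> + R) / 2"
  have \<rho>': "0 < \<rho>'" "\<rho>' < R" "\<rho> < \<rho>'" using \<rho> by (auto simp: \<rho>'_def)
  obtain C where C: "C \<ge> 0" "\<And>x. \<bar>f x\<bar> \<le> C * norm x" "\<And>x. \<bar>euler f x - f x\<bar> \<le> C * norm x ^ 2"
    "\<And>x. \<bar>euler (euler f) x - 3 * euler f x + 2 * f x\<bar> \<le> C * norm x ^ 3"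
    using rot_ray_bounds[OF u bc] unfolding f_def by metis
  have dg: "(g has_real_derivative g1 r) (at r)" if "r \<in> {0<..<R}" for r
  proof -
    have "(g has_real_derivative (euler f (r *\<^sub>R \<theta>) / r * r - f (r *\<^sub>R \<theta>) * 1) / (r * r)) (at r)"
      unfolding g_def[abs_def] using that by (intro DERIV_divide DERIV_ident DERIV_along_ray f) auto
    then show ?thesis using that by (simp add: power2_eq_square g1_def)
  qed
  have dg1: "(g1 has_real_derivative g2 r) (at r)" if "r \<in> {0<..<R}" for r
  proof -
    have r: "r \<noteq> 0" using that by simp
    have "((\<lambda>r. euler f (r *\<^sub>R \<theta>) - f (r *\<^sub>R \<theta>)) has_real_derivative
        euler (euler f) (r *\<^sub>R \<theta>) / r - euler f (r *\<^sub>R \<theta>) / r) (at r)"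
      using r by (intro DERIV_diff DERIV_along_ray f s)
    moreover have "((\<lambda>r::real. r\<^sup>2) has_real_derivative 2 * r) (at r)"
      using DERIV_pow[of 2 r] by simp
    ultimately have "(g1 has_real_derivative ((euler (euler f) (r *\<^sub>R \<theta>) / r - euler f (r *\<^sub>R \<theta>) / r) * r\<^sup>2
       - (euler f (r *\<^sub>R \<theta>) - f (r *\<^sub>R \<theta>)) * (2 * r)) / (r\<^sup>2 * r\<^sup>2)) (at r)"
      unfolding g1_def[abs_def] using r by (intro DERIV_divide) auto
    moreover have "((EE / r - E / r) * r\<^sup>2 - (E - F) * (2 * r)) / (r\<^sup>2 * r\<^sup>2) = (EE - 3 * E + 2 * F) / r ^ 3" for EE E F
      using r by (simp add: field_simps power2_eq_square power3_eq_cube)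
    ultimately show ?thesis unfolding g2_def by (simp only:)
  qed
  have g2c: "continuous_on {0<..<R} g2"
    unfolding g2_def[abs_def] by (intro continuous_intros ray_continuous smooth_continuous_on s f) auto
  have z: "g r = 0" "g1 r = 0" if "\<rho>' \<le> r" for r
  proof -
    have "norm (r *\<^sub>R \<theta>) > \<rho>" using that \<rho>' \<theta> by simp
    then have "f (r *\<^sub>R \<theta>) = 0" "euler f (r *\<^sub>R \<theta>) = 0" using f(2) se unfolding supp_in_def by auto
    then show "g r = 0" "g1 r = 0" by (simp_all add: g_def g1_def)
  qed
  have dX: "((\<lambda>r. V r / r) has_real_derivative X1 r) (at r)" if "r \<in> {0<..<R}" for r
  proof -
    have r: "r \<noteq> 0" using that by simp
    have "((\<lambda>r. V r / r) has_real_derivative (deriv V r * r - V r * 1) / (r * r)) (at r)"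
      using r by (intro DERIV_divide DERIV_ident V_deriv[OF that])
    moreover have "(deriv V r * r - V r * 1) / (r * r) = X1 r"
      using r by (simp add: X1_def diff_divide_distrib power2_eq_square)
    ultimately show ?thesis by (simp only:)
  qed
  have dX1: "(X1 has_real_derivative X2 r) (at r)" if "r \<in> {0<..<R}" for r
  proof -
    have r: "r \<noteq> 0" using that by simp
    have "((\<lambda>r::real. r\<^sup>2) has_real_derivative 2 * r) (at r)"
      using DERIV_pow[of 2 r] by simp
    then have "(X1 has_real_derivative (V2 r * r - deriv V r * 1) / (r * r) - (deriv V r * r\<^sup>2 - V r * (2 * r)) / (r\<^sup>2 * r\<^sup>2)) (at r)"
      unfolding X1_def[abs_def] using r by (intro DERIV_diff DERIV_divide DERIV_ident V_deriv[OF that] V2[OF that]) auto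
    moreover have "(v2 * r - v1 * 1) / (r * r) - (v1 * r\<^sup>2 - v * (2 * r)) / (r\<^sup>2 * r\<^sup>2) = v2 / r - 2 * v1 / r\<^sup>2 + 2 * v / r ^ 3" for v v1 v2
      using r by (simp add: field_simps power2_eq_square power3_eq_cube)
    ultimately show ?thesis unfolding X2_def by (simp only:)
  qed
  have X2le: "X2 r \<le> W r / r" if "r \<in> {0<..<R}" for r
  proof -
    have r: "r > 0" using that by simp
    have "v2 / r - 2 * v1 / r\<^sup>2 + 2 * v / r ^ 3 = w / r - (w - 2 * v / r\<^sup>2 + 2 * v1 / r - v2) / r" for v v1 v2 w
      using r by (simp add: field_simps power2_eq_square power3_eq_cube)
    from this[of "V2 r" "deriv V r" "V r" "W r"] show ?thesis
      using V2_le[OF that] r unfolding X2_def by simp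
  qed
  have bd: "\<bar>x / r ^ k\<bar> \<le> C" if "0 < r" "\<bar>x\<bar> \<le> C * norm (r *\<^sub>R \<theta>) ^ k" for x r and k :: nat
    using that \<theta> by (simp add: abs_div power_abs pos_divide_le_eq)
  have b0: "\<bar>g r\<bar> \<le> C" "\<bar>g1 r\<bar> \<le> C" "\<bar>g2 r\<bar> \<le> C" if "r \<in> {0<..<R}" for r
  proof -
    have "\<bar>f x\<bar> \<le> C * norm x ^ 1" for x using C(2) by simp
    note b = bd[OF _ this] bd[OF _ C(3)] bd[OF _ C(4)]
    have r: "0 < r" using that by simp
    show "\<bar>g r\<bar> \<le> C" using b(1)[OF r] by (simp add: g_def)
    show "\<bar>g1 r\<bar> \<le> C" unfolding g1_def by (rule b(2)[OF r])
    show "\<bar>g2 r\<bar> \<le> C" unfolding g2_def by (rule b(3)[OF r])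
  qed
  define F where "F r = r ^ (n - 1) * V r * (- 2 * g r * g2 r - 4 * real n * g r * g1 r / r - real n * (real n - 1) * (g r)\<^sup>2 / r\<^sup>2)" for r
  have hy: "(\<integral>\<^sup>+r\<in>{0<..<R}. ennreal (r ^ (n - 1) * W r * (g r)\<^sup>2) \<partial>lborel)
      \<le> (\<integral>\<^sup>+r\<in>{0<..<R}. ennreal (r ^ (n - 1) * V r * (g1 r)\<^sup>2) \<partial>lborel)"
  proof (rule ray_hardyD[OF hardy dg _ \<rho>'(1,2) z(1)])
    show "continuous_on {0<..<R} g1" using dg1 by (meson DERIV_isCont continuous_at_imp_continuous_on)
  qed
  note rso = ray_second_order[OF n V_pos W_pos V_cont W_cont dX dX1 X2le hy J lim0 dg dg1 g2c b0 \<rho>'(1,2) z, folded F_def]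
  have "indicator {0<..} r * r ^ (n - 1) * rot_energy f (r *\<^sub>R \<theta>) = indicator {0<..<R} r *\<^sub>R F r" for r
  proof (cases "0 < r \<and> r < R")
    case True
    have "r ^ (n - 1) * (v / r ^ 4 * (f * (- 2 * ee + (- (4 * m - 6) * e + - ((m - 1) * (m - 4)) * f))))
      = r ^ (n - 1) * v * (- 2 * (f / r) * ((ee - 3 * e + 2 * f) / r ^ 3) - 4 * m * (f / r) * ((e - f) / r\<^sup>2) / r - m * (m - 1) * (f / r)\<^sup>2 / r\<^sup>2)"
      for f e ee m v
      using True by (simp add: divide_simps eval_nat_numeral) (simp add: algebra_simps)
    from this[of "V r" "f (r *\<^sub>R \<theta>)"] True show ?thesis
      unfolding F_def g_def g1_def g2_def rot_energy_def wt_def using \<theta> by (simp add: cutoff_def)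
  next
    case False
    then show ?thesis using \<theta> by (auto simp: rot_energy_def wt_def cutoff_def indicator_def)
  qed
  moreover have "(\<lambda>r. rot_energy f (r *\<^sub>R \<theta>)) \<in> borel_measurable borel"
    unfolding rot_energy_def
    by (intro borel_measurable_times borel_measurable_add borel_measurable_const measurable_compose[OF _ wt_measurable]
        borel_measurable_continuous_onI ray_continuous smooth_continuous_on f s continuous_intros)
  ultimately have "(\<integral>r. rot_energy f (r *\<^sub>R \<theta>) \<partial>radial_measure n) = (LINT r:{0<..<R}|lborel. F r)"
    using integral_radial_measure[of "\<lambda>r. rot_energy f (r *\<^sub>R \<theta>)" n] by (simp add: set_lebesgue_integral_def)
  then show "0 \<le> (\<integral>r. rot_energy f (r *\<^sub>R \<theta>) \<partial>radial_measure n)"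
    "(\<integral>\<^sup>+r\<in>{0<..<R}. ennreal (r ^ (n - 1) * W r * (f (r *\<^sub>R \<theta>) / r)\<^sup>2) \<partial>lborel) \<le> ennreal (\<integral>r. rot_energy f (r *\<^sub>R \<theta>) \<partial>radial_measure n)"
    using rso(2,3) by (simp_all add: g_def)
qed

lemma rot_energy_hardy:
  fixes u :: "'a::euclidean_space \<Rightarrow> real"
  assumes dim: "DIM('a) = n" and u: "smooth u" "supp_in \<rho> u" and \<rho>: "0 < \<rho>" "\<rho> < R"
    and bc: "b \<in> Basis" "c \<in> Basis"
  defines "f \<equiv> rot b c u"
  shows "0 \<le> (\<integral>x. rot_energy f x \<partial>lborel)"
    and "(\<integral>\<^sup>+x. ennreal (cutoff R W (norm x) * (f x / norm x)\<^sup>2) \<partial>lborel) \<le> ennreal (\<integral>x. rot_energy f x \<partial>lborel)"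
proof -
  have v: "vanishing \<rho> f" unfolding f_def by (rule vanishing_rot[OF u bc])
  have fm [measurable]: "f \<in> borel_measurable borel" by (rule smooth_measurable[OF vanishing_smooth[OF v]])
  define \<phi> where "\<phi> y = (\<integral>r. rot_energy f (r *\<^sub>R sgn y) \<partial>radial_measure n)" for y :: 'a
  note p = integral_polar[OF rot_energy_integrable(1)[OF dim v], unfolded dim, folded \<phi>_def]
  have ray: "0 \<le> \<phi> y" "(\<integral>\<^sup>+r. ennreal (cutoff R W (norm (r *\<^sub>R sgn y)) * (f (r *\<^sub>R sgn y) / norm (r *\<^sub>R sgn y))\<^sup>2) \<partial>radial_measure n) \<le> ennreal (\<phi> y)"
    if "y \<noteq> 0" for y
  proof -
    have y: "norm (sgn y) = 1" using that by (simp add: norm_sgn)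
    note r = rot_energy_ray[OF u \<rho> bc y, folded f_def]
    show "0 \<le> \<phi> y" unfolding \<phi>_def by (rule r(1))
    have "(\<integral>\<^sup>+r. ennreal (cutoff R W (norm (r *\<^sub>R sgn y)) * (f (r *\<^sub>R sgn y) / norm (r *\<^sub>R sgn y))\<^sup>2) \<partial>radial_measure n)
      = (\<integral>\<^sup>+r\<in>{0<..<R}. ennreal (r ^ (n - 1) * W r * (f (r *\<^sub>R sgn y) / norm (r *\<^sub>R sgn y))\<^sup>2) \<partial>lborel)"
      by (rule nn_integral_ray[of "\<lambda>x. (f x / norm x)\<^sup>2" W, OF _ _ y]) simp_all
    also have "\<dots> = (\<integral>\<^sup>+r\<in>{0<..<R}. ennreal (r ^ (n - 1) * W r * (f (r *\<^sub>R sgn y) / r)\<^sup>2) \<partial>lborel)"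
      using y by (intro nn_integral_cong) (auto simp: indicator_def)
    also have "\<dots> \<le> ennreal (\<phi> y)" unfolding \<phi>_def by (rule r(2))
    finally show "(\<integral>\<^sup>+r. ennreal (cutoff R W (norm (r *\<^sub>R sgn y)) * (f (r *\<^sub>R sgn y) / norm (r *\<^sub>R sgn y))\<^sup>2) \<partial>radial_measure n) \<le> ennreal (\<phi> y)" .
  qed
  have nn: "AE y in polar_measure. 0 \<le> \<phi> y" using AE_polar_nonzero[where 'a='a] by eventually_elim (rule ray(1))
  show "0 \<le> (\<integral>x. rot_energy f x \<partial>lborel)" unfolding p(2) by (rule integral_nonneg_AE[OF nn])
  have "(\<integral>\<^sup>+x. ennreal (cutoff R W (norm x) * (f x / norm x)\<^sup>2) \<partial>lborel)
    = (\<integral>\<^sup>+y. \<integral>\<^sup>+r. ennreal (cutoff R W (norm (r *\<^sub>R sgn y)) * (f (r *\<^sub>R sgn y) / norm (r *\<^sub>R sgn y))\<^sup>2) \<partial>radial_measure n \<partial>(polar_measure :: 'a measure))"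
    unfolding dim[symmetric] by (rule nn_integral_polar') simp
  also have "\<dots> \<le> (\<integral>\<^sup>+y. ennreal (\<phi> y) \<partial>polar_measure)"
    by (rule nn_integral_mono_AE, use AE_polar_nonzero[where 'a='a] in eventually_elim) (rule ray(2))
  also have "\<dots> = ennreal (\<integral>x. rot_energy f x \<partial>lborel)"
    unfolding p(2) by (rule nn_integral_eq_integral[OF p(1) nn])
  finally show "(\<integral>\<^sup>+x. ennreal (cutoff R W (norm x) * (f x / norm x)\<^sup>2) \<partial>lborel) \<le> ennreal (\<integral>x. rot_energy f x \<partial>lborel)" .
qed

text \<open>One rotation of \<open>sph_lap u\<close> is moved onto \<open>rad_lap u\<close>, where
  it commutes with E. Apart from the integral of the square of \<open>sph_lap u\<close>, all terms
  are then quadratic in the single functions f = \<open>rot b c u\<close>, and the spectral gap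
  bounds that square below by terms of the same kind. The resulting lower bound is half the sum of
  the integrals of \<open>rot_energy f\<close>.\<close>

lemma tangential_energy_hardy:
  fixes u :: "'a::euclidean_space \<Rightarrow> real"
  assumes dim: "DIM('a) = n" and u: "smooth u" "supp_in \<rho> u" and \<rho>: "0 < \<rho>" "\<rho> < R"
  shows "0 \<le> tangential_energy u"
    and "(\<integral>\<^sup>+x. ennreal (cutoff R W (norm x) * (rot_sq u x / (norm x)\<^sup>2)) \<partial>lborel) \<le> ennreal (tangential_energy u)"
proof -
  let ?A = "\<lambda>b c. \<integral>x. wt (norm x) * (rot b c u x * rot b c u x) \<partial>lborel"
  let ?B = "\<lambda>b c. \<integral>x. wt (norm x) * (rot b c u x * euler (rot b c u) x) \<partial>lborel"
  let ?C = "\<lambda>b c. \<integral>x. wt (norm x) * (rot b c u x * euler (euler (rot b c u)) x) \<partial>lborel"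
  define e where "e b c = (\<integral>x. rot_energy (rot b c u) x \<partial>lborel)" for b c
  have v: "vanishing \<rho> (rot b c u)" if "b \<in> Basis" "c \<in> Basis" for b c by (rule vanishing_rot[OF u that])
  have vL: "vanishing \<rho> (rad_lap u)" by (rule vanishing_rad_lap[OF u])
  have cross: "integrable lborel (\<lambda>x. wt (norm x) * (rad_lap u x * rot b c (rot b c u) x))"
    "(\<integral>x. wt (norm x) * (rad_lap u x * rot b c (rot b c u) x) \<partial>lborel) = - (?C b c + (real n - 2) * ?B b c)"
    if bc: "b \<in> Basis" "c \<in> Basis" for b c
  proof -
    let ?f = "rot b c u"
    note f = vanishing_smooth[OF v[OF bc]] vanishing_supp[OF v[OF bc]]
    have vf: "vanishing \<rho> (euler ?f)" "vanishing \<rho> (euler (euler ?f))"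
      using f by (auto intro: vanishing_euler smooth_euler supp_in_euler)
    show "integrable lborel (\<lambda>x. wt (norm x) * (rad_lap u x * rot b c ?f x))"
      by (rule wt_integrable[OF dim vL vanishing_rot[OF f bc]])
    have cE: "rot b c (euler u) = euler ?f" using rot_euler_commute[OF u(1) bc] by (rule ext)
    have cEE: "rot b c (euler (euler u)) = euler (euler ?f)"
      using rot_euler_commute[OF smooth_euler[OF u(1)] bc] unfolding cE by (rule ext)
    have s: "smooth (euler u)" "smooth (euler (euler u))" using u by (auto intro: smooth_euler)
    have "rot b c (rad_lap u) x = rot b c (euler (euler u)) x + (real n - 2) * rot b c (euler u) x" for x
    proof -
      have pL: "partial d (rad_lap u) x = partial d (euler (euler u)) x + (real n - 2) * partial d (euler u) x" for d
        unfolding rad_lap_def[abs_def] dim using s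
        by (simp add: partial_add partial_mult smooth_differentiable smooth_mult)
      show ?thesis unfolding rot_def pL by (simp add: algebra_simps)
    qed
    then have rL: "rot b c (rad_lap u) x = euler (euler ?f) x + (real n - 2) * euler ?f x" for x
      by (simp add: cE cEE)
    have "(\<integral>x. wt (norm x) * (rad_lap u x * rot b c ?f x) \<partial>lborel) = - (\<integral>x. wt (norm x) * (rot b c (rad_lap u) x * ?f x) \<partial>lborel)"
      using rot_by_parts[OF dim vL v[OF bc] bc] by simp
    also have "(\<integral>x. wt (norm x) * (rot b c (rad_lap u) x * ?f x) \<partial>lborel)
      = (\<integral>x. wt (norm x) * (?f x * euler (euler ?f) x) + (real n - 2) * (wt (norm x) * (?f x * euler ?f x)) \<partial>lborel)"
      by (intro Bochner_Integration.integral_cong refl) (simp add: rL algebra_simps)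
    also have "\<dots> = ?C b c + (real n - 2) * ?B b c"
      using wt_integrable[OF dim v[OF bc] vf(1)] wt_integrable[OF dim v[OF bc] vf(2)] by simp
    finally show "(\<integral>x. wt (norm x) * (rad_lap u x * rot b c ?f x) \<partial>lborel) = - (?C b c + (real n - 2) * ?B b c)" .
  qed
  have "(\<integral>x. wt (norm x) * (rad_lap u x * sph_lap u x) \<partial>lborel)
    = (\<integral>x. (\<Sum>b\<in>Basis. \<Sum>c\<in>Basis. wt (norm x) * (rad_lap u x * rot b c (rot b c u) x)) / 2 \<partial>lborel)"
    by (intro Bochner_Integration.integral_cong refl) (simp add: sph_lap_def sum_distrib_left)
  also have "\<dots> = (\<Sum>b\<in>Basis. \<Sum>c\<in>Basis. - (?C b c + (real n - 2) * ?B b c)) / 2"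
    using cross by (simp add: Bochner_Integration.integral_sum)
  finally have LS: "2 * (\<integral>x. wt (norm x) * (rad_lap u x * sph_lap u x) \<partial>lborel)
    = - (\<Sum>b\<in>Basis. \<Sum>c\<in>Basis. ?C b c) - (real n - 2) * (\<Sum>b\<in>Basis. \<Sum>c\<in>Basis. ?B b c)"
    by (simp add: sum.distrib sum_negf sum_distrib_left sum_subtractf)
  have "(\<Sum>b\<in>Basis. \<Sum>c\<in>Basis. e b c) = (\<Sum>b\<in>Basis. \<Sum>c\<in>Basis. - 2 * ?C b c - (4 * real n - 6) * ?B b c - (real n - 1) * (real n - 4) * ?A b c)"
    unfolding e_def by (intro sum.cong refl rot_energy_integrable(2)[OF dim v])
  also have "\<dots> = - 2 * (\<Sum>b\<in>Basis. \<Sum>c\<in>Basis. ?C b c) - (4 * real n - 6) * (\<Sum>b\<in>Basis. \<Sum>c\<in>Basis. ?B b c)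
      - (real n - 1) * (real n - 4) * (\<Sum>b\<in>Basis. \<Sum>c\<in>Basis. ?A b c)"
    by (simp only: sum_subtractf sum_distrib_left)
  finally have E: "(\<Sum>b\<in>Basis. \<Sum>c\<in>Basis. e b c) = \<dots>" .
  \<comment> \<open>X, Y, Z stand for the sums of \<open>?C\<close>, \<open>?B\<close>,
    \<open>?A\<close>, and S for the integral of the squared \<open>sph_lap u\<close>. In 2 t the
    gap contributes (m - 1) Z, which turns the coefficient - (m - 1) (m - 3) of Z into - (m - 1) (m
    - 4).\<close>
  have "2 * t \<ge> - 2 * X - (4 * m - 6) * Y - (m - 1) * (m - 4) * Z"
    if "t = - X - (m - 2) * Y + S - (m - 1) * ((m - 3) * (Z / 2) + Y)" "(m - 1) * Z / 2 \<le> S" for t X Y Z S m :: real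
    using that by (simp add: field_simps)
  from this[OF tangential_energy_integrable(2)[OF dim u, unfolded LS rot_sq_integrable(2)[OF dim u] rot_euler_integrable(2)[OF dim u]]
      sph_lap_gap[OF dim u]]
  have "(\<Sum>b\<in>Basis. \<Sum>c\<in>Basis. e b c) \<le> 2 * tangential_energy u" unfolding E .
  then have T: "(\<Sum>b\<in>Basis. \<Sum>c\<in>Basis. e b c) / 2 \<le> tangential_energy u" by simp
  have e0: "0 \<le> e b c" if "b \<in> Basis" "c \<in> Basis" for b c
    unfolding e_def by (rule rot_energy_hardy(1)[OF dim u \<rho> that])
  then have "0 \<le> (\<Sum>b\<in>Basis. \<Sum>c\<in>Basis. e b c)" by (intro sum_nonneg)
  then show "0 \<le> tangential_energy u" using T by linarith
  have [measurable]: "rot b c u \<in> borel_measurable borel" if "b \<in> Basis" "c \<in> Basis" for b c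
    by (rule smooth_measurable[OF smooth_rot[OF u(1) that]])
  have meas: "(\<lambda>x. ennreal (cutoff R W (norm x) * (rot b c u x / norm x)\<^sup>2)) \<in> borel_measurable lborel" if "b \<in> Basis" "c \<in> Basis" for b c
    using that by measurable
  have "(\<integral>\<^sup>+x. ennreal (cutoff R W (norm x) * (rot_sq u x / (norm x)\<^sup>2)) \<partial>lborel)
    = (\<integral>\<^sup>+x. ennreal (1 / 2) * (\<Sum>b\<in>Basis. \<Sum>c\<in>Basis. ennreal (cutoff R W (norm x) * (rot b c u x / norm x)\<^sup>2)) \<partial>lborel)"
  proof (rule nn_integral_cong)
    fix x :: 'a
    have s0: "0 \<le> cutoff R W (norm x) * (rot b c u x / norm x)\<^sup>2" for b c by (intro mult_nonneg_nonneg cutoff_W_nonneg zero_le_power2)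
    have "cutoff R W (norm x) * (rot_sq u x / (norm x)\<^sup>2) = (1 / 2) * (\<Sum>b\<in>Basis. \<Sum>c\<in>Basis. cutoff R W (norm x) * (rot b c u x / norm x)\<^sup>2)"
      by (simp add: rot_sq_def sum_distrib_left sum_divide_distrib power_divide power2_eq_square)
    also have "ennreal \<dots> = ennreal (1 / 2) * ennreal (\<Sum>b\<in>Basis. \<Sum>c\<in>Basis. cutoff R W (norm x) * (rot b c u x / norm x)\<^sup>2)"
      by (intro ennreal_mult sum_nonneg s0) simp
    also have "ennreal (\<Sum>b\<in>Basis. \<Sum>c\<in>Basis. cutoff R W (norm x) * (rot b c u x / norm x)\<^sup>2)
      = (\<Sum>b\<in>Basis. \<Sum>c\<in>Basis. ennreal (cutoff R W (norm x) * (rot b c u x / norm x)\<^sup>2))"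
      by (simp only: sum_ennreal[symmetric] sum_nonneg s0)
    finally show "ennreal (cutoff R W (norm x) * (rot_sq u x / (norm x)\<^sup>2)) =
       ennreal (1 / 2) * (\<Sum>b\<in>Basis. \<Sum>c\<in>Basis. ennreal (cutoff R W (norm x) * (rot b c u x / norm x)\<^sup>2))" .
  qed
  also have "\<dots> = ennreal (1 / 2) * (\<Sum>b\<in>Basis. \<Sum>c\<in>Basis. \<integral>\<^sup>+x. ennreal (cutoff R W (norm x) * (rot b c u x / norm x)\<^sup>2) \<partial>lborel)"
  proof -
    have "(\<integral>\<^sup>+x. (\<Sum>b\<in>Basis. \<Sum>c\<in>Basis. ennreal (cutoff R W (norm x) * (rot b c u x / norm x)\<^sup>2)) \<partial>lborel)
      = (\<Sum>b\<in>Basis. \<integral>\<^sup>+x. (\<Sum>c\<in>Basis. ennreal (cutoff R W (norm x) * (rot b c u x / norm x)\<^sup>2)) \<partial>lborel)"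
      by (intro nn_integral_sum borel_measurable_sum meas)
    also have "\<dots> = (\<Sum>b\<in>Basis. \<Sum>c\<in>Basis. \<integral>\<^sup>+x. ennreal (cutoff R W (norm x) * (rot b c u x / norm x)\<^sup>2) \<partial>lborel)"
      by (intro sum.cong refl nn_integral_sum meas)
    finally show ?thesis
      by (subst nn_integral_cmult) (auto intro!: borel_measurable_sum meas)
  qed
  also have "\<dots> \<le> ennreal (1 / 2) * (\<Sum>b\<in>Basis. \<Sum>c\<in>Basis. ennreal (e b c))"
    unfolding e_def by (intro mult_left_mono sum_mono rot_energy_hardy(2)[OF dim u \<rho>]) auto
  also have "\<dots> = ennreal (1 / 2) * ennreal (\<Sum>b\<in>Basis. \<Sum>c\<in>Basis. e b c)"
  proof -
    have "(\<Sum>b\<in>Basis. \<Sum>c\<in>Basis. ennreal (e b c)) = (\<Sum>b\<in>Basis. ennreal (\<Sum>c\<in>Basis. e b c))"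
      by (intro sum.cong refl sum_ennreal e0)
    also have "\<dots> = ennreal (\<Sum>b\<in>Basis. \<Sum>c\<in>Basis. e b c)" by (intro sum_ennreal sum_nonneg e0)
    finally show ?thesis by simp
  qed
  also have "\<dots> = ennreal ((\<Sum>b\<in>Basis. \<Sum>c\<in>Basis. e b c) / 2)"
    using \<open>0 \<le> (\<Sum>b\<in>Basis. \<Sum>c\<in>Basis. e b c)\<close> by (subst ennreal_mult[symmetric]) auto
  also have "\<dots> \<le> ennreal (tangential_energy u)" by (rule ennreal_leI[OF T])
  finally show "(\<integral>\<^sup>+x. ennreal (cutoff R W (norm x) * (rot_sq u x / (norm x)\<^sup>2)) \<partial>lborel) \<le> ennreal (tangential_energy u)" .
qed

lemma hardy_rellich_all:
  fixes u :: "'a::euclidean_space \<Rightarrow> real"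
  assumes dim: "DIM('a) = n" and ut: "u \<in> test_functions (ball 0 R)"
  shows "hardy_rellich (ball 0 R) V W u"
proof -
  have u1: "smooth u" using test_functionD(1)[OF ut R] .
  obtain \<rho> where \<rho>: "0 < \<rho>" "\<rho> < R" and u2: "supp_in \<rho> u" using test_functionD(2)[OF ut R] by blast
  note u = u1 u2
  note T = tangential_energy_hardy[OF dim u \<rho>]
  have nn: "0 \<le> radial_energy u + tangential_energy u" using T(1) radial_energy_nonneg[of u] by linarith
  have [measurable]: "euler u \<in> borel_measurable borel" "rot_sq u \<in> borel_measurable borel"
    by (intro smooth_measurable smooth_euler u euler_rot_sq(1))+
  have g: "(norm (grad u x))\<^sup>2 = (euler u x / norm x)\<^sup>2 + rot_sq u x / (norm x)\<^sup>2" if "x \<noteq> 0" for x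
  proof -
    have "(norm x)\<^sup>2 * (norm (grad u x))\<^sup>2 = (euler u x)\<^sup>2 + rot_sq u x"
      using lagrange_rot[of x u] unfolding power2_norm_eq_inner[of x] rot_sq_def by (simp only: power2_eq_square)
    then have "(norm (grad u x))\<^sup>2 = ((euler u x)\<^sup>2 + rot_sq u x) / (norm x)\<^sup>2" using that by (simp add: field_simps)
    then show ?thesis by (simp add: add_divide_distrib power_divide)
  qed
  have q0: "0 \<le> rot_sq u x" for x by (simp add: rot_sq_def sum_nonneg)
  have "(\<integral>\<^sup>+x. ennreal (cutoff R W (norm x) * (norm (grad u x))\<^sup>2) \<partial>lborel)
    = (\<integral>\<^sup>+x. ennreal (cutoff R W (norm x) * (euler u x / norm x)\<^sup>2) + ennreal (cutoff R W (norm x) * (rot_sq u x / (norm x)\<^sup>2)) \<partial>lborel)"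
  proof (rule nn_integral_cong_AE, use AE_lborel_singleton[of "0::'a"] in eventually_elim)
    fix x :: 'a assume "x \<noteq> 0"
    show "ennreal (cutoff R W (norm x) * (norm (grad u x))\<^sup>2) =
      ennreal (cutoff R W (norm x) * (euler u x / norm x)\<^sup>2) + ennreal (cutoff R W (norm x) * (rot_sq u x / (norm x)\<^sup>2))"
      unfolding g[OF \<open>x \<noteq> 0\<close>] distrib_left
      by (intro ennreal_plus mult_nonneg_nonneg cutoff_W_nonneg zero_le_power2 divide_nonneg_nonneg q0)
  qed
  also have "\<dots> = (\<integral>\<^sup>+x. ennreal (cutoff R W (norm x) * (euler u x / norm x)\<^sup>2) \<partial>lborel)
     + (\<integral>\<^sup>+x. ennreal (cutoff R W (norm x) * (rot_sq u x / (norm x)\<^sup>2)) \<partial>lborel)"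
    by (rule nn_integral_add) measurable
  also have "\<dots> \<le> ennreal (radial_energy u) + ennreal (tangential_energy u)"
    using radial_part_hardy[OF dim u \<rho> hardy] T(2) unfolding euler_radial_nn[OF dim u] by (rule add_mono)
  also have "\<dots> = ennreal (radial_energy u + tangential_energy u)"
    using T(1) radial_energy_nonneg[of u] by simp
  finally show ?thesis unfolding hardy_rellich_iff[OF dim u \<rho> nn] .
qed

end

text \<open>With \<beta> = n - 3 - \<alpha> > -1, the function r^(n - 3) V is at most r^\<beta> near
  0, hence integrable there, and away from 0 it is at most a constant times r^(n - 1) V. The
  boundary weight r^(n - 2) V equals r^(\<beta> + 1) times r^\<alpha> V.\<close>

lemma (in weight_pair) rellich_pairI:
  assumes \<alpha>: "\<alpha> < real n - 2" and lim: "((\<lambda>r. r powr \<alpha> * V r) \<longlongrightarrow> 0) (at_right 0)"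
  shows "rellich_pair n R V W"
proof
  define \<beta> where "\<beta> = real n - 3 - \<alpha>"
  have \<beta>: "\<beta> > -1" using \<alpha> by (simp add: \<beta>_def)
  have e1: "r ^ (n - 1) * V r / r = r powr (\<beta> + 1) * (r powr \<alpha> * V r)" if "r > 0" for r
  proof -
    have "r ^ (n - 1) = r powr (real n - 1)" using that n by (simp add: powr_realpow[symmetric] of_nat_diff)
    also have "\<dots> = r powr (\<beta> + 1) * r powr \<alpha> * r powr 1" unfolding powr_add[symmetric] by (simp add: \<beta>_def)
    finally show ?thesis using that by simp
  qed
  have p0: "((\<lambda>r. r powr (\<beta> + 1)) \<longlongrightarrow> 0) (at_right (0::real))"
    using \<beta> by (intro tendsto_zero_powrI[where b = "\<beta> + 1"] tendsto_ident_at tendsto_const) (auto simp: eventually_at_filter)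
  have "((\<lambda>r. r powr (\<beta> + 1) * (r powr \<alpha> * V r)) \<longlongrightarrow> 0 * 0) (at_right 0)" by (rule tendsto_mult[OF p0 lim])
  moreover have "\<forall>\<^sub>F r in at_right 0. r powr (\<beta> + 1) * (r powr \<alpha> * V r) = r ^ (n - 1) * V r / r"
    using eventually_at_right_less[of 0] by eventually_elim (rule e1[symmetric])
  ultimately show "((\<lambda>r. r ^ (n - 1) * V r / r) \<longlongrightarrow> 0) (at_right 0)"
    using Lim_transform_eventually by fastforce
  have "\<forall>\<^sub>F r in at_right 0. r powr \<alpha> * V r < 1" by (rule order_tendstoD(2)[OF lim]) simp
  then obtain d where d: "d > 0" "\<And>r. 0 < r \<Longrightarrow> r < d \<Longrightarrow> r powr \<alpha> * V r < 1"
    unfolding eventually_at_right_field by auto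
  define \<delta> where "\<delta> = min d R / 2"
  have \<delta>: "\<delta> > 0" "\<delta> < d" "\<delta> < R" using d R by (auto simp: \<delta>_def)
  define j where "j r = r ^ (n - 1) * V r / r\<^sup>2" for r
  have jc: "continuous_on {0<..<R} j" unfolding j_def[abs_def] by (intro continuous_intros V_cont) auto
  have jm: "(\<lambda>r. indicator {0<..<R} r *\<^sub>R j r) \<in> borel_measurable borel"
    by (intro borel_measurable_continuous_on_indicator jc) auto
  have j0: "0 \<le> j r" if "r \<in> {0<..<R}" for r using V_pos[OF that] that by (simp add: j_def)
  have near: "j r \<le> r powr \<beta>" if "0 < r" "r \<le> \<delta>" for r
  proof -
    have "j r = r powr \<beta> * (r powr \<alpha> * V r)"
      using e1[OF that(1)] that(1) by (simp add: j_def power2_eq_square powr_add field_simps)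
    also have "\<dots> \<le> r powr \<beta> * 1" using d(2)[of r] that \<delta> by (intro mult_left_mono) auto
    finally show ?thesis by simp
  qed
  have "(\<integral>\<^sup>+r\<in>{0<..\<delta>}. ennreal (r powr \<beta>) \<partial>lborel) \<le> ennreal (\<delta> powr (\<beta> + 1) / (\<beta> + 1))"
  proof (rule nn_integral_Ioc_le)
    show "(\<lambda>r. ennreal (r powr \<beta>) * indicator {0<..\<delta>} r) \<in> borel_measurable borel" by measurable
    fix \<epsilon> assume \<epsilon>: "0 < \<epsilon>" "\<epsilon> < \<delta>"
    have "(\<integral>\<^sup>+r. ennreal (r powr \<beta>) * indicator {\<epsilon>..\<delta>} r \<partial>lborel) = ennreal (\<delta> powr (\<beta> + 1) / (\<beta> + 1) - \<epsilon> powr (\<beta> + 1) / (\<beta> + 1))"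
    proof (rule nn_integral_FTC_Icc[where F = "\<lambda>r. r powr (\<beta> + 1) / (\<beta> + 1)"])
      show "((\<lambda>r. r powr (\<beta> + 1) / (\<beta> + 1)) has_real_derivative r powr \<beta>) (at r)" if "r \<in> {\<epsilon>..\<delta>}" for r
      proof -
        have "((\<lambda>r. r powr (\<beta> + 1) / (\<beta> + 1)) has_real_derivative (\<beta> + 1) * r powr (\<beta> + 1 - 1) / (\<beta> + 1)) (at r)"
          using that \<epsilon> by (intro DERIV_cdivide has_real_derivative_powr) auto
        moreover have "(\<beta> + 1) * r powr (\<beta> + 1 - 1) / (\<beta> + 1) = r powr \<beta>" using \<beta> by simp
        ultimately show ?thesis by (simp only:)
      qed
    qed (use \<epsilon> in auto)
    also have "\<dots> \<le> ennreal (\<delta> powr (\<beta> + 1) / (\<beta> + 1))" using \<beta> by (intro ennreal_leI) simp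
    finally show "(\<integral>\<^sup>+r\<in>{\<epsilon>..\<delta>}. ennreal (r powr \<beta>) \<partial>lborel) \<le> ennreal (\<delta> powr (\<beta> + 1) / (\<beta> + 1))" .
  qed (rule \<delta>)
  then have f1: "(\<integral>\<^sup>+r\<in>{0<..\<delta>}. ennreal (r powr \<beta>) \<partial>lborel) < \<infinity>" by (rule le_less_trans) simp
  have far: "j r \<le> (1 / \<delta>\<^sup>2) * (r ^ (n - 1) * V r)" if "\<delta> < r" "r < R" for r
  proof -
    have "\<delta>\<^sup>2 \<le> r\<^sup>2" using that \<delta> by (intro power_mono) auto
    moreover have "0 \<le> r ^ (n - 1) * V r" using V_pos[of r] that \<delta> by simp
    ultimately have "j r \<le> (r ^ (n - 1) * V r) / \<delta>\<^sup>2" unfolding j_def using \<delta> that by (intro divide_left_mono) auto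
    then show ?thesis by simp
  qed
  have vm: "(\<lambda>r. ennreal (r ^ (n - 1) * V r) * indicator {0<..<R} r) \<in> borel_measurable borel"
  proof -
    have "(\<lambda>r. ennreal (indicator {0<..<R} r *\<^sub>R (r ^ (n - 1) * V r))) \<in> borel_measurable borel"
      by (intro measurable_compose[OF _ measurable_ennreal] borel_measurable_continuous_on_indicator continuous_intros V_cont) auto
    moreover have "(\<lambda>r. ennreal (indicator {0<..<R} r *\<^sub>R (r ^ (n - 1) * V r))) = (\<lambda>r. ennreal (r ^ (n - 1) * V r) * indicator {0<..<R} r)"
      by (auto simp: fun_eq_iff indicator_def)
    ultimately show ?thesis by simp
  qed
  have "(\<integral>\<^sup>+r. ennreal (norm (indicator {0<..<R} r *\<^sub>R j r)) \<partial>lborel)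
    \<le> (\<integral>\<^sup>+r. ennreal (r powr \<beta>) * indicator {0<..\<delta>} r + ennreal (1 / \<delta>\<^sup>2) * (ennreal (r ^ (n - 1) * V r) * indicator {0<..<R} r) \<partial>lborel)"
  proof (rule nn_integral_mono)
    fix r :: real
    consider "0 < r" "r \<le> \<delta>" | "\<delta> < r" "r < R" | "r \<le> 0 \<or> R \<le> r" using \<delta> by linarith
    then show "ennreal (norm (indicator {0<..<R} r *\<^sub>R j r))
      \<le> ennreal (r powr \<beta>) * indicator {0<..\<delta>} r + ennreal (1 / \<delta>\<^sup>2) * (ennreal (r ^ (n - 1) * V r) * indicator {0<..<R} r)"
    proof cases
      case 1
      then have "ennreal (norm (indicator {0<..<R} r *\<^sub>R j r)) \<le> ennreal (r powr \<beta>)"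
        using near[of r] j0[of r] \<delta> by (intro ennreal_leI) simp
      also have "\<dots> = ennreal (r powr \<beta>) * indicator {0<..\<delta>} r" using 1 by simp
      finally show ?thesis by (rule order_trans) simp
    next
      case 2
      then have "ennreal (norm (indicator {0<..<R} r *\<^sub>R j r)) \<le> ennreal ((1 / \<delta>\<^sup>2) * (r ^ (n - 1) * V r))"
        using far[of r] j0[of r] \<delta> by (intro ennreal_leI) simp
      also have "\<dots> = ennreal (1 / \<delta>\<^sup>2) * (ennreal (r ^ (n - 1) * V r) * indicator {0<..<R} r)"
        using 2 \<delta> by (subst ennreal_mult') auto
      finally show ?thesis by (rule order_trans) simp
    qed auto
  qed
  also have "\<dots> = (\<integral>\<^sup>+r\<in>{0<..\<delta>}. ennreal (r powr \<beta>) \<partial>lborel) + ennreal (1 / \<delta>\<^sup>2) * (\<integral>\<^sup>+r\<in>{0<..<R}. ennreal (r ^ (n - 1) * V r) \<partial>lborel)"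
    using vm by (subst nn_integral_add) (auto simp: nn_integral_cmult)
  also have "\<dots> < \<infinity>" using f1 V_fin by (simp add: ennreal_mult_less_top)
  finally show "set_integrable lborel {0<..<R} (\<lambda>r. r ^ (n - 1) * V r / r\<^sup>2)"
    unfolding set_integrable_def integrable_iff_bounded j_def[symmetric] using jm by simp
qed

theorem theorem1p1:
  fixes B :: "(real ^ 'n) set" and n :: nat and R :: real and V W :: "real \<Rightarrow> real"
  assumes n: "n = CARD('n)"
    and R: "R > 0" and B: "B = ball 0 R"
    and V_pos: "\<forall>r\<in>{0<..<R}. V r > 0" and W_pos: "\<forall>r\<in>{0<..<R}. W r > 0"
    and V_C1: "V C1_differentiable_on {0<..<R}" and W_C1: "W C1_differentiable_on {0<..<R}"
    and div: "diverges_at_zero R (\<lambda>r. 1 / (r ^ (n - 1) * V r))"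
    and fin: "(\<integral>\<^sup>+r\<in>{0<..<R}. ennreal (r ^ (n - 1) * V r) \<partial>lborel) < \<infinity>"
  shows
    "((bessel_pair n R V W \<and> bessel_weight n R V W \<ge> 1)
        \<longleftrightarrow> (\<forall>u\<in>test_functions B. hardy B V W u))
     \<and>
     ((\<exists>\<alpha> < real n - 2. ((\<lambda>r. r powr \<alpha> * V r) \<longlongrightarrow> 0) (at_right 0)) \<longrightarrow>
        ((bessel_pair n R V W \<and> bessel_weight n R V W \<ge> 1)
           \<longleftrightarrow> (\<forall>u\<in>test_functions B. hardy B V W u)) \<and>
        ((\<forall>u\<in>test_functions B. hardy B V W u)
           \<longleftrightarrow> (\<forall>u\<in>test_functions B. radial u \<longrightarrow> hardy_rellich B V W u)))
     \<and>
     ((\<exists>\<alpha> < real n - 2. ((\<lambda>r. r powr \<alpha> * V r) \<longlongrightarrow> 0) (at_right 0)) \<and>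
        (\<forall>r\<in>{0<..<R}. deriv V differentiable at r) \<and>
        (\<forall>r\<in>{0<..<R}. W r - 2 * V r / r\<^sup>2 + 2 * deriv V r / r - deriv (deriv V) r \<ge> 0) \<longrightarrow>
        ((bessel_pair n R V W \<and> bessel_weight n R V W \<ge> 1)
           \<longleftrightarrow> (\<forall>u\<in>test_functions B. hardy B V W u)) \<and>
        ((\<forall>u\<in>test_functions B. hardy B V W u)
           \<longleftrightarrow> (\<forall>u\<in>test_functions B. radial u \<longrightarrow> hardy_rellich B V W u)) \<and>
        ((\<forall>u\<in>test_functions B. radial u \<longrightarrow> hardy_rellich B V W u)
           \<longleftrightarrow> (\<forall>u\<in>test_functions B. hardy_rellich B V W u)))"
    (is "(?P1 \<longleftrightarrow> ?P2) \<and> (?b \<longrightarrow> (?P1 \<longleftrightarrow> ?P2) \<and> (?P2 \<longleftrightarrow> ?P3)) \<and> (?b \<and> ?d \<and> ?c \<longrightarrow> (?P1 \<longleftrightarrow> ?P2) \<and> (?P2 \<longleftrightarrow> ?P3) \<and> (?P3 \<longleftrightarrow> ?P4))")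
proof -
  have dim: "DIM(real ^ 'n) = n" using n by simp
  obtain D where D: "\<And>r. r \<in> {0<..<R} \<Longrightarrow> (V has_vector_derivative D r) (at r)" "continuous_on {0<..<R} D"
    using V_C1 unfolding C1_differentiable_on_def by blast
  have dV: "deriv V r = D r" "(V has_real_derivative deriv V r) (at r)" if "r \<in> {0<..<R}" for r
    using D(1)[OF that] DERIV_imp_deriv[of V "D r" r] by (simp_all add: has_real_derivative_iff_has_vector_derivative)
  interpret weight_pair n R V W
  proof
    show "n \<ge> 1" using n by simp
    show "R > 0" by (rule R)
    show "V r > 0" "W r > 0" if "r \<in> {0<..<R}" for r using V_pos W_pos that by auto
    show "(V has_real_derivative deriv V r) (at r)" if "r \<in> {0<..<R}" for r by (rule dV(2)[OF that])
    have "continuous_on {0<..<R} (deriv V) \<longleftrightarrow> continuous_on {0<..<R} D" by (intro continuous_on_cong refl dV(1))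
    then show "continuous_on {0<..<R} (deriv V)" using D(2) by simp
    show "continuous_on {0<..<R} W" by (rule C1_differentiable_imp_continuous_on[OF W_C1])
  qed (rule div fin)+
  have P12: "?P1 \<longleftrightarrow> ?P2"
  proof
    assume ?P1
    then show ?P2 unfolding B using hardy_of_ray_hardy[OF dim ray_hardy_of_bessel] by blast
  next
    assume ?P2
    then show ?P1 unfolding B by (rule bessel_of_segment_hardy[OF segment_hardy_of_hardy[OF dim]])
  qed
  \<comment> \<open>Statement (3) is compared with (1) rather than directly with (2), so that both
    implications pass through the one-dimensional inequalities.\<close>
  have P23: "?P2 \<longleftrightarrow> ?P3" if b: ?b
  proof -
    obtain \<alpha> where "\<alpha> < real n - 2" "((\<lambda>r. r powr \<alpha> * V r) \<longlongrightarrow> 0) (at_right 0)" using b by blast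
    then interpret rellich_pair n R V W by (rule rellich_pairI)
    have "?P3" if ?P1
    proof (intro ballI impI)
      fix u :: "real ^ 'n \<Rightarrow> real" assume u: "u \<in> test_functions B" "radial u"
      have H: "ray_hardy n R V W" using that ray_hardy_of_bessel by blast
      have su: "smooth u" using test_functionD(1)[of u R] u(1) R B by simp
      obtain \<rho> where \<rho>: "0 < \<rho>" "\<rho> < R" "supp_in \<rho> u" using test_functionD(2)[of u R] u(1) R B by blast
      show "hardy_rellich B V W u"
        unfolding B radial_hardy_rellich_iff[OF dim su \<rho>(3,1,2) u(2)] by (rule radial_part_hardy[OF dim su \<rho>(3,1,2) H])
    qed
    moreover have "?P1" if ?P3
      using that unfolding B by (intro bessel_of_segment_hardy segment_hardy_of_rellich[OF dim])
    ultimately show ?thesis using P12 by blast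
  qed
  \<comment> \<open>The content lies in the implication from (3) to (4), which returns to (1) in
    order to have Hardy's inequality on rays; the converse is a restriction to radial
    functions.\<close>
  have P34: "?P3 \<longleftrightarrow> ?P4" if b: ?b and d: ?d and c: ?c
  proof
    assume ?P3
    then have H: "ray_hardy n R V W" using P12 P23[OF b] ray_hardy_of_bessel by blast
    obtain \<alpha> where "\<alpha> < real n - 2" "((\<lambda>r. r powr \<alpha> * V r) \<longlongrightarrow> 0) (at_right 0)" using b by blast
    then interpret rellich_pair n R V W by (rule rellich_pairI)
    interpret rellich_convex_pair n R V W "deriv (deriv V)"
    proof
      show "(deriv V has_real_derivative deriv (deriv V) r) (at r)" if "r \<in> {0<..<R}" for r
        using d that DERIV_deriv_iff_real_differentiable by blast
      show "W r - 2 * V r / r\<^sup>2 + 2 * deriv V r / r - deriv (deriv V) r \<ge> 0" if "r \<in> {0<..<R}" for r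
        using c that by blast
      show "ray_hardy n R V W" by (rule H)
    qed
    show ?P4 unfolding B using hardy_rellich_all[OF dim] by blast
  qed blast
  show ?thesis using P12 P23 P34 by blast
qed

end
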